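(* Let $\mathcal C$ be a dg category over a field. Let $G_1\boxtimes G_2$ and $G_1'\boxtimes G_2'$ be product bimodules in $\mathcal C^{op}\otimes\mathcal C$, and let $\phi_i:G_i\to G_i'$ be morphisms for $i=1,2$. Then $\mathrm{cone}(\phi_1\boxtimes\phi_2)$ is a weakly product bimodule.
   Context: All functors are derived. For a dg category $\mathcal C$ over a field $\mathbf k$, $\mathrm{Perf}(\mathcal C)$ is the idempotent-completed pre-triangulated closure of $\mathcal C$; we do not distinguish between $\mathcal C$ and $\mathrm{Perf}(\mathcal C)$, nor between $\mathcal C^{op}\otimes\mathcal C$ and $\mathrm{Perf}(\mathcal C^{op}\otimes\mathcal C)$, when speaking of objects. For $K\in\mathcal C^{op}\otimes\mathcal C$ the convolution functor is $\Phi_K(F)=K\otimes_{\mathcal C}F$, with values in $\mathcal C$-modules. A product bimodule is an exterior product $G_1\boxtimes G_2\in\mathcal C^{op}\otimes\mathcal C$, where the first factor is regarded as an object of $\mathcal C^{op}$ and the second as an object of $\mathcal C$; its convolution is $\Phi_{G_1\boxtimes G_2}(F)\cong H^\bullet(G_1\otimes F)\otimes G_2$, where $G_1\otimes F=G_1\otimes_{\mathcal C}F$ is a complex of $\mathbf k$-vector spaces. Morphisms $\phi_1$ and $\phi_2$ are (degree zero, closed) morphisms between the objects so regarded, and $\phi_1\boxtimes\phi_2:G_1\boxtimes G_2\to G_1'\boxtimes G_2'$ is the induced morphism. For an object $G$, $\mathrm{ads}(G)$ is the smallest full subcategory (of the derived category of $\mathcal C$-modules) containing $G$ and closed under (possibly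 infinite) direct sums, direct summands and shifts. An object $G_{12}\in\mathcal C^{op}\otimes\mathcal C$ is a weakly product bimodule if there exists an object $G_2\in\mathcal C$ such that $\Phi_{G_{12}}(F)\in\mathrm{ads}(G_2)$ for all $F\in\mathcal C$. *)

theory Defs
  imports
    Complex_Main
    "HOL-Library.Poly_Mapping"
    "HOL-Library.Function_Algebras"
    "HOL-Library.Product_Plus"
    "HOL-Library.Equipollence"
begin

text \<open>
  Conventions: cohomological grading (differentials have degree 1), Koszul signs, and
  \<open>\<C>\<close>-modules are right modules, i.e. contravariant, so that the Yoneda embedding
  \<open>x \<mapsto> Hom(-, x)\<close> is covariant.
\<close>

section \<open>Complexes of vector spaces\<close>

text \<open>
  The graded pieces are subspaces of one ambient vector space. They need not be independent of each
  other, so operations on elements of a piece carry the degree as an explicit argument.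
\<close>

record ('k, 'v) cpx =
  piece :: "int \<Rightarrow> 'v set"
  scl :: "'k \<Rightarrow> 'v \<Rightarrow> 'v"
  dif :: "int \<Rightarrow> 'v \<Rightarrow> 'v"

definition cochain_complex :: "('k::field, 'v::ab_group_add) cpx \<Rightarrow> bool" where
  "cochain_complex V \<longleftrightarrow>
     vector_space (scl V) \<and>
     (\<forall>n. module.subspace (scl V) (piece V n)) \<and>
     (\<forall>n. \<forall>v\<in>piece V n. dif V n v \<in> piece V (n + 1) \<and> dif V (n + 1) (dif V n v) = 0) \<and>
     (\<forall>n. \<forall>v\<in>piece V n. \<forall>w\<in>piece V n. dif V n (v + w) = dif V n v + dif V n w) \<and>
     (\<forall>n c. \<forall>v\<in>piece V n. dif V n (scl V c v) = scl V c (dif V n v))"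

definition koszul :: "int \<Rightarrow> 'v::ab_group_add \<Rightarrow> 'v" where
  "koszul p v = (if even p then v else - v)"

definition shift_cpx :: "int \<Rightarrow> ('k, 'v::ab_group_add) cpx \<Rightarrow> ('k, 'v) cpx" where
  "shift_cpx k V = \<lparr>piece = (\<lambda>n. piece V (n + k)), scl = scl V,
     dif = (\<lambda>n v. koszul k (dif V (n + k) v))\<rparr>"

definition cone_cpx ::
  "('k, 'v::ab_group_add) cpx \<Rightarrow> ('k, 'w::ab_group_add) cpx \<Rightarrow> (int \<Rightarrow> 'v \<Rightarrow> 'w) \<Rightarrow> ('k, 'w \<times> 'v) cpx" where
  "cone_cpx V W f = \<lparr>piece = (\<lambda>n. piece W n \<times> piece V (n + 1)),
     scl = (\<lambda>c (w, v). (scl W c w, scl V c v)),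
     dif = (\<lambda>n (w, v). (dif W n w + f (n + 1) v, - dif V (n + 1) v))\<rparr>"

definition dsum_cpx :: "('j \<Rightarrow> ('k, 'v::ab_group_add) cpx) \<Rightarrow> ('k, 'j \<Rightarrow> 'v) cpx" where
  "dsum_cpx V = \<lparr>piece = (\<lambda>n. {s. (\<forall>j. s j \<in> piece (V j) n) \<and> finite {j. s j \<noteq> 0}}),
     scl = (\<lambda>c s j. scl (V j) c (s j)),
     dif = (\<lambda>n s j. dif (V j) n (s j))\<rparr>"

section \<open>Tensor products\<close>

definition fscale :: "'k::field \<Rightarrow> ('g \<Rightarrow>\<^sub>0 'k) \<Rightarrow> ('g \<Rightarrow>\<^sub>0 'k)" where
  "fscale c = Poly_Mapping.map ((*) c)"

lemma lookup_fscale: "Poly_Mapping.lookup (fscale c p) g = c * Poly_Mapping.lookup p g"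
  by (simp add: fscale_def Poly_Mapping.map.rep_eq when_def)

lemma vector_space_fscale: "vector_space (fscale :: 'k::field \<Rightarrow> ('g \<Rightarrow>\<^sub>0 'k) \<Rightarrow> _)"
  by unfold_locales
    (simp_all add: poly_mapping_eq_iff fun_eq_iff lookup_fscale lookup_add algebra_simps)

text \<open>
  The quotient of a free vector space by a subspace \<open>R\<close> is realised as the image of a chosen
  linear projection with kernel \<open>R\<close>, which plays the role of the quotient map.
\<close>

definition quot_proj :: "('g \<Rightarrow>\<^sub>0 'k::field) set \<Rightarrow> ('g \<Rightarrow>\<^sub>0 'k) \<Rightarrow> ('g \<Rightarrow>\<^sub>0 'k)" where
  "quot_proj R = (SOME \<pi>. Vector_Spaces.linear fscale fscale \<pi> \<and> (\<forall>v. \<pi> (\<pi> v) = \<pi> v) \<and> {v. \<pi> v = 0} = R)"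

lemma quot_proj_ex:
  assumes "module.subspace fscale (R :: ('g \<Rightarrow>\<^sub>0 'k::field) set)"
  shows "\<exists>\<pi>. Vector_Spaces.linear fscale fscale \<pi> \<and> (\<forall>v. \<pi> (\<pi> v) = \<pi> v) \<and> {v. \<pi> v = 0} = R"
proof -
  interpret vs: vector_space "fscale :: 'k \<Rightarrow> ('g \<Rightarrow>\<^sub>0 'k) \<Rightarrow> _" by (rule vector_space_fscale)
  interpret vp: vector_space_pair "fscale :: 'k \<Rightarrow> ('g \<Rightarrow>\<^sub>0 'k) \<Rightarrow> _" "fscale :: 'k \<Rightarrow> ('g \<Rightarrow>\<^sub>0 'k) \<Rightarrow> _" by unfold_locales
  obtain B where B: "B \<subseteq> R" "vs.independent B" "R \<subseteq> vs.span B" using vs.maximal_independent_subset by blast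
  have sB: "vs.span B = R" using B assms vs.span_minimal by blast
  let ?E = "vs.extend_basis B"
  define \<pi> where "\<pi> = vp.construct ?E (\<lambda>b. if b \<in> B then 0 else b)"
  have iE: "vs.independent ?E" and sE: "vs.span ?E = UNIV" and BE: "B \<subseteq> ?E"
    using vs.independent_extend_basis vs.span_extend_basis vs.extend_basis_superset B by blast+
  have lin: "Vector_Spaces.linear fscale fscale \<pi>" unfolding \<pi>_def by (rule vp.linear_construct[OF iE])
  interpret l: Vector_Spaces.linear "fscale :: 'k \<Rightarrow> ('g \<Rightarrow>\<^sub>0 'k) \<Rightarrow> _" "fscale :: 'k \<Rightarrow> ('g \<Rightarrow>\<^sub>0 'k) \<Rightarrow> _" \<pi> by (rule lin)
  have b: "b \<in> ?E \<Longrightarrow> \<pi> b = (if b \<in> B then 0 else b)" for b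
    unfolding \<pi>_def by (rule vp.construct_basis[OF iE])
  have P: "v - \<pi> v \<in> R \<and> \<pi> (v - \<pi> v) = 0" for v
  proof -
    have "v \<in> vs.span ?E" using sE by simp
    then show ?thesis
    proof (induction rule: vs.span_induct_alt)
      case base then show ?case using assms vs.subspace_0 by (simp add: l.zero)
    next
      case (step c x y)
      have e: "fscale c x + y - \<pi> (fscale c x + y) = fscale c (x - \<pi> x) + (y - \<pi> y)"
        by (simp add: l.add l.scale vs.scale_right_diff_distrib)
      have "x - \<pi> x \<in> R" "\<pi> (x - \<pi> x) = 0" using b[OF step(1)] B vs.subspace_0[OF assms] by (auto simp: l.zero)
      then show ?case unfolding e using step vs.subspace_add vs.subspace_scale assms
        by (auto simp: l.add l.scale)
    qed
  qed
  have k: "\<pi> v = 0" if "v \<in> R" for v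
  proof -
    have "v \<in> vs.span B" using that sB by simp
    then show ?thesis by (induction rule: vs.span_induct_alt) (use b BE in \<open>auto simp: l.add l.scale l.zero\<close>)
  qed
  show ?thesis
  proof (rule exI[of _ \<pi>], intro conjI)
    show "Vector_Spaces.linear fscale fscale \<pi>" by (rule lin)
    show "\<forall>v. \<pi> (\<pi> v) = \<pi> v" using P by (metis l.diff right_minus_eq)
    show "{v. \<pi> v = 0} = R" using P k by (metis (mono_tags, lifting) Collect_cong Collect_mem_eq diff_zero)
  qed
qed

lemma quot_proj:
  assumes "module.subspace fscale R"
  shows "Vector_Spaces.linear fscale fscale (quot_proj R)" "quot_proj R (quot_proj R v) = quot_proj R v"
    "quot_proj R v = 0 \<longleftrightarrow> v \<in> R"
  using someI_ex[OF quot_proj_ex[OF assms]] unfolding quot_proj_def by blast+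

text \<open>
  \<open>gen i p q v w\<close> stands for \<open>v \<otimes> w\<close> with \<open>v\<close> of degree \<open>p\<close> in \<open>V i\<close> and \<open>w\<close> of degree \<open>q\<close>
  in \<open>W i\<close>. \<open>tensor_family I V W E\<close> is the quotient of \<open>\<Oplus>\<^sub>i V i \<otimes> W i\<close> (over the ground field,
  \<open>i\<close> ranging over \<open>I\<close>) by the span of a set \<open>E\<close> of further relations.
\<close>

type_synonym ('i, 'v, 'w, 'k) formal = "('i \<times> int \<times> int \<times> 'v \<times> 'w) \<Rightarrow>\<^sub>0 'k"

definition gen :: "'i \<Rightarrow> int \<Rightarrow> int \<Rightarrow> 'v \<Rightarrow> 'w \<Rightarrow> ('i, 'v, 'w, 'k::field) formal" where
  "gen i p q v w = Poly_Mapping.single (i, p, q, v, w) 1"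

definition lext :: "('g \<Rightarrow> ('h \<Rightarrow>\<^sub>0 'k)) \<Rightarrow> ('g \<Rightarrow>\<^sub>0 'k::field) \<Rightarrow> ('h \<Rightarrow>\<^sub>0 'k)" where
  "lext b t = (\<Sum>g\<in>Poly_Mapping.keys t. fscale (Poly_Mapping.lookup t g) (b g))"

definition lext2 ::
  "('g \<Rightarrow> 'g' \<Rightarrow> ('h \<Rightarrow>\<^sub>0 'k)) \<Rightarrow> ('g \<Rightarrow>\<^sub>0 'k::field) \<Rightarrow> ('g' \<Rightarrow>\<^sub>0 'k) \<Rightarrow> ('h \<Rightarrow>\<^sub>0 'k)" where
  "lext2 b s t = lext (\<lambda>g. lext (b g) t) s"

definition bilinear_rels ::
  "'i set \<Rightarrow> ('i \<Rightarrow> ('k::field, 'v::ab_group_add) cpx) \<Rightarrow> ('i \<Rightarrow> ('k, 'w::ab_group_add) cpx)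
   \<Rightarrow> ('i, 'v, 'w, 'k) formal set" where
  "bilinear_rels I V W =
     {gen i p q (v + v') w - gen i p q v w - gen i p q v' w | i p q v v' w.
        i \<in> I \<and> v \<in> piece (V i) p \<and> v' \<in> piece (V i) p \<and> w \<in> piece (W i) q} \<union>
     {gen i p q v (w + w') - gen i p q v w - gen i p q v w' | i p q v w w'.
        i \<in> I \<and> v \<in> piece (V i) p \<and> w \<in> piece (W i) q \<and> w' \<in> piece (W i) q} \<union>
     {gen i p q (scl (V i) c v) w - fscale c (gen i p q v w) | i p q c v w.
        i \<in> I \<and> v \<in> piece (V i) p \<and> w \<in> piece (W i) q} \<union>
     {gen i p q v (scl (W i) c w) - fscale c (gen i p q v w) | i p q c v w.
        i \<in> I \<and> v \<in> piece (V i) p \<and> w \<in> piece (W i) q}"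

definition tensor_proj ::
  "'i set \<Rightarrow> ('i \<Rightarrow> ('k::field, 'v::ab_group_add) cpx) \<Rightarrow> ('i \<Rightarrow> ('k, 'w::ab_group_add) cpx)
   \<Rightarrow> ('i, 'v, 'w, 'k) formal set \<Rightarrow> ('i, 'v, 'w, 'k) formal \<Rightarrow> ('i, 'v, 'w, 'k) formal" where
  "tensor_proj I V W E = quot_proj (module.span fscale (bilinear_rels I V W \<union> E))"

definition tensor_family ::
  "'i set \<Rightarrow> ('i \<Rightarrow> ('k::field, 'v::ab_group_add) cpx) \<Rightarrow> ('i \<Rightarrow> ('k, 'w::ab_group_add) cpx)
   \<Rightarrow> ('i, 'v, 'w, 'k) formal set \<Rightarrow> ('k, ('i, 'v, 'w, 'k) formal) cpx" where
  "tensor_family I V W E = \<lparr>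
     piece = (\<lambda>n. tensor_proj I V W E ` module.span fscale
        {gen i p q v w | i p q v w. i \<in> I \<and> p + q = n \<and> v \<in> piece (V i) p \<and> w \<in> piece (W i) q}),
     scl = fscale,
     dif = (\<lambda>n t. tensor_proj I V W E (lext (\<lambda>(i, p, q, v, w).
        gen i (p + 1) q (dif (V i) p v) w + koszul p (gen i p (q + 1) v (dif (W i) q w))) t))\<rparr>"

abbreviation tensor_cpx ::
  "('k::field, 'v::ab_group_add) cpx \<Rightarrow> ('k, 'w::ab_group_add) cpx \<Rightarrow> ('k, (unit, 'v, 'w, 'k) formal) cpx" where
  "tensor_cpx V W \<equiv> tensor_family UNIV (\<lambda>_. V) (\<lambda>_. W) {}"

abbreviation tproj ::
  "('k::field, 'v::ab_group_add) cpx \<Rightarrow> ('k, 'w::ab_group_add) cpx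
   \<Rightarrow> (unit, 'v, 'w, 'k) formal \<Rightarrow> (unit, 'v, 'w, 'k) formal" where
  "tproj V W \<equiv> tensor_proj UNIV (\<lambda>_. V) (\<lambda>_. W) {}"

section \<open>Dg categories\<close>

text \<open>
  \<open>cmp C x y z m n g f\<close> is \<open>g \<circ> f\<close> for \<open>g \<in> Hom(y, z)\<close> of degree \<open>m\<close> and \<open>f \<in> Hom(x, y)\<close> of
  degree \<open>n\<close>.
\<close>

record ('o, 'k, 'h) dgcat =
  Obj :: "'o set"
  Hom :: "'o \<Rightarrow> 'o \<Rightarrow> ('k, 'h) cpx"
  cmp :: "'o \<Rightarrow> 'o \<Rightarrow> 'o \<Rightarrow> int \<Rightarrow> int \<Rightarrow> 'h \<Rightarrow> 'h \<Rightarrow> 'h"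
  idt :: "'o \<Rightarrow> 'h"

definition bilinear_pairing ::
  "('k::field, 'u::ab_group_add) cpx \<Rightarrow> ('k, 'v::ab_group_add) cpx \<Rightarrow> ('k, 'w::ab_group_add) cpx
   \<Rightarrow> (int \<Rightarrow> int \<Rightarrow> 'u \<Rightarrow> 'v \<Rightarrow> 'w) \<Rightarrow> bool" where
  \<comment> \<open>equivalently, a chain map \<open>U \<otimes> V \<rightarrow> W\<close>\<close>
  "bilinear_pairing U V W b \<longleftrightarrow>
     (\<forall>m n. \<forall>u\<in>piece U m. \<forall>v\<in>piece V n.
        b m n u v \<in> piece W (m + n) \<and>
        (\<forall>u'\<in>piece U m. b m n (u + u') v = b m n u v + b m n u' v) \<and>
        (\<forall>v'\<in>piece V n. b m n u (v + v') = b m n u v + b m n u v') \<and>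
        (\<forall>c. b m n (scl U c u) v = scl W c (b m n u v)) \<and>
        (\<forall>c. b m n u (scl V c v) = scl W c (b m n u v)) \<and>
        dif W (m + n) (b m n u v) =
          b (m + 1) n (dif U m u) v + koszul m (b m (n + 1) u (dif V n v)))"

definition dg_category :: "('o, 'k::field, 'h::ab_group_add) dgcat \<Rightarrow> bool" where
  "dg_category C \<longleftrightarrow>
     (\<forall>x\<in>Obj C. \<forall>y\<in>Obj C. cochain_complex (Hom C x y)) \<and>
     (\<forall>x\<in>Obj C. \<forall>y\<in>Obj C. \<forall>z\<in>Obj C.
        bilinear_pairing (Hom C y z) (Hom C x y) (Hom C x z) (cmp C x y z)) \<and>
     (\<forall>w\<in>Obj C. \<forall>x\<in>Obj C. \<forall>y\<in>Obj C. \<forall>z\<in>Obj C. \<forall>l m n.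
        \<forall>h\<in>piece (Hom C y z) l. \<forall>g\<in>piece (Hom C x y) m. \<forall>f\<in>piece (Hom C w x) n.
        cmp C w x z (l + m) n (cmp C x y z l m h g) f = cmp C w y z l (m + n) h (cmp C w x y m n g f)) \<and>
     (\<forall>x\<in>Obj C. idt C x \<in> piece (Hom C x x) 0 \<and> dif (Hom C x x) 0 (idt C x) = 0) \<and>
     (\<forall>x\<in>Obj C. \<forall>y\<in>Obj C. \<forall>n. \<forall>f\<in>piece (Hom C x y) n.
        cmp C x y y 0 n (idt C y) f = f \<and> cmp C x x y n 0 f (idt C x) = f)"

definition op_cat :: "('o, 'k, 'h::ab_group_add) dgcat \<Rightarrow> ('o, 'k, 'h) dgcat" where
  "op_cat C = \<lparr>Obj = Obj C, Hom = (\<lambda>x y. Hom C y x),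
     cmp = (\<lambda>x y z m n g f. koszul (m * n) (cmp C z y x n m f g)), idt = idt C\<rparr>"

definition tensor_cat ::
  "('o, 'k::field, 'h::ab_group_add) dgcat \<Rightarrow> ('p, 'k, 'i::ab_group_add) dgcat
   \<Rightarrow> ('o \<times> 'p, 'k, (unit, 'h, 'i, 'k) formal) dgcat" where
  "tensor_cat A B = \<lparr>
     Obj = Obj A \<times> Obj B,
     Hom = (\<lambda>(x, x') (y, y'). tensor_cpx (Hom A x y) (Hom B x' y')),
     cmp = (\<lambda>(x, x') (y, y') (z, z') m n. \<lambda>s t. tproj (Hom A x z) (Hom B x' z')
        (lext2 (\<lambda>(_, p, q, g, g') (_, r, s, f, f').
           koszul (q * r) (gen () (p + r) (q + s) (cmp A x y z p r g f) (cmp B x' y' z' q s g' f'))) s t)),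
     idt = (\<lambda>(x, x'). tproj (Hom A x x) (Hom B x' x') (gen () 0 0 (idt A x) (idt B x')))\<rparr>"

section \<open>Dg modules\<close>

text \<open>
  \<open>act M x y m n v a\<close> is \<open>v \<cdot> a\<close>, of degree \<open>m + n\<close> in \<open>M x\<close>, for \<open>v \<in> M y\<close> of degree \<open>m\<close> and
  \<open>a \<in> Hom(x, y)\<close> of degree \<open>n\<close>.
\<close>

record ('o, 'k, 'h, 'm) dgmod =
  sp :: "'o \<Rightarrow> ('k, 'm) cpx"
  act :: "'o \<Rightarrow> 'o \<Rightarrow> int \<Rightarrow> int \<Rightarrow> 'm \<Rightarrow> 'h \<Rightarrow> 'm"

definition dg_module ::
  "('o, 'k::field, 'h::ab_group_add) dgcat \<Rightarrow> ('o, 'k, 'h, 'm::ab_group_add) dgmod \<Rightarrow> bool" where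
  "dg_module C M \<longleftrightarrow>
     (\<forall>x\<in>Obj C. cochain_complex (sp M x)) \<and>
     (\<forall>x\<in>Obj C. \<forall>y\<in>Obj C. bilinear_pairing (sp M y) (Hom C x y) (sp M x) (act M x y)) \<and>
     (\<forall>x\<in>Obj C. \<forall>y\<in>Obj C. \<forall>z\<in>Obj C. \<forall>l m n.
        \<forall>v\<in>piece (sp M z) l. \<forall>g\<in>piece (Hom C y z) m. \<forall>f\<in>piece (Hom C x y) n.
        act M x y (l + m) n (act M y z l m v g) f = act M x z l (m + n) v (cmp C x y z m n g f)) \<and>
     (\<forall>x\<in>Obj C. \<forall>n. \<forall>v\<in>piece (sp M x) n. act M x x n 0 v (idt C x) = v)"

definition graded_map ::
  "('o, 'k::field, 'h) dgcat \<Rightarrow> ('o, 'k, 'h, 'm::ab_group_add) dgmod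
   \<Rightarrow> ('o, 'k, 'h, 'n::ab_group_add) dgmod \<Rightarrow> int \<Rightarrow> ('o \<Rightarrow> int \<Rightarrow> 'm \<Rightarrow> 'n) \<Rightarrow> bool" where
  "graded_map C M N p f \<longleftrightarrow>
     (\<forall>x\<in>Obj C. \<forall>n. \<forall>v\<in>piece (sp M x) n.
        f x n v \<in> piece (sp N x) (n + p) \<and>
        (\<forall>w\<in>piece (sp M x) n. f x n (v + w) = f x n v + f x n w) \<and>
        (\<forall>c. f x n (scl (sp M x) c v) = scl (sp N x) c (f x n v))) \<and>
     (\<forall>x\<in>Obj C. \<forall>y\<in>Obj C. \<forall>m n. \<forall>v\<in>piece (sp M y) m. \<forall>a\<in>piece (Hom C x y) n.
        f x (m + n) (act M x y m n v a) = act N x y (m + p) n (f y m v) a)"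

definition closed_morphism ::
  "('o, 'k::field, 'h) dgcat \<Rightarrow> ('o, 'k, 'h, 'm::ab_group_add) dgmod
   \<Rightarrow> ('o, 'k, 'h, 'n::ab_group_add) dgmod \<Rightarrow> ('o \<Rightarrow> int \<Rightarrow> 'm \<Rightarrow> 'n) \<Rightarrow> bool" where
  "closed_morphism C M N f \<longleftrightarrow> graded_map C M N 0 f \<and>
     (\<forall>x\<in>Obj C. \<forall>n. \<forall>v\<in>piece (sp M x) n. f x (n + 1) (dif (sp M x) n v) = dif (sp N x) n (f x n v))"

definition homotopic ::
  "('o, 'k::field, 'h) dgcat \<Rightarrow> ('o, 'k, 'h, 'm::ab_group_add) dgmod
   \<Rightarrow> ('o, 'k, 'h, 'n::ab_group_add) dgmod
   \<Rightarrow> ('o \<Rightarrow> int \<Rightarrow> 'm \<Rightarrow> 'n) \<Rightarrow> ('o \<Rightarrow> int \<Rightarrow> 'm \<Rightarrow> 'n) \<Rightarrow> bool" where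
  "homotopic C M N f g \<longleftrightarrow> (\<exists>h. graded_map C M N (-1) h \<and>
     (\<forall>x\<in>Obj C. \<forall>n. \<forall>v\<in>piece (sp M x) n.
        f x n v - g x n v = dif (sp N x) (n - 1) (h x n v) + h x (n + 1) (dif (sp M x) n v)))"

definition homotopy_retract ::
  "('o, 'k::field, 'h::ab_group_add) dgcat \<Rightarrow> ('o, 'k, 'h, 'm::ab_group_add) dgmod
   \<Rightarrow> ('o, 'k, 'h, 'n::ab_group_add) dgmod \<Rightarrow> bool" where
  "homotopy_retract C N M \<longleftrightarrow> dg_module C N \<and> dg_module C M \<and>
     (\<exists>i p. closed_morphism C N M i \<and> closed_morphism C M N p \<and>
        homotopic C N N (\<lambda>x n v. p x n (i x n v)) (\<lambda>x n v. v))"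

definition homotopy_equivalent ::
  "('o, 'k::field, 'h::ab_group_add) dgcat \<Rightarrow> ('o, 'k, 'h, 'm::ab_group_add) dgmod
   \<Rightarrow> ('o, 'k, 'h, 'n::ab_group_add) dgmod \<Rightarrow> bool" where
  "homotopy_equivalent C M N \<longleftrightarrow> dg_module C M \<and> dg_module C N \<and>
     (\<exists>f g. closed_morphism C M N f \<and> closed_morphism C N M g \<and>
        homotopic C M M (\<lambda>x n v. g x n (f x n v)) (\<lambda>x n v. v) \<and>
        homotopic C N N (\<lambda>x n v. f x n (g x n v)) (\<lambda>x n v. v))"

definition representable :: "('o, 'k, 'h) dgcat \<Rightarrow> 'o \<Rightarrow> ('o, 'k, 'h, 'h) dgmod" where
  "representable C z = \<lparr>sp = (\<lambda>x. Hom C x z), act = (\<lambda>x y. cmp C x y z)\<rparr>"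

definition shift_mod :: "int \<Rightarrow> ('o, 'k, 'h, 'm::ab_group_add) dgmod \<Rightarrow> ('o, 'k, 'h, 'm) dgmod" where
  "shift_mod k M = \<lparr>sp = (\<lambda>x. shift_cpx k (sp M x)), act = (\<lambda>x y m n. act M x y (m + k) n)\<rparr>"

definition cone ::
  "('o, 'k, 'h, 'm::ab_group_add) dgmod \<Rightarrow> ('o, 'k, 'h, 'n::ab_group_add) dgmod
   \<Rightarrow> ('o \<Rightarrow> int \<Rightarrow> 'm \<Rightarrow> 'n) \<Rightarrow> ('o, 'k, 'h, 'n \<times> 'm) dgmod" where
  "cone M N f = \<lparr>sp = (\<lambda>x. cone_cpx (sp M x) (sp N x) (f x)),
     act = (\<lambda>x y m n (w, v) a. (act N x y m n w a, act M x y (m + 1) n v a))\<rparr>"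

definition dsum_mod :: "('j \<Rightarrow> ('o, 'k, 'h, 'm::ab_group_add) dgmod) \<Rightarrow> ('o, 'k, 'h, 'j \<Rightarrow> 'm) dgmod" where
  "dsum_mod M = \<lparr>sp = (\<lambda>x. dsum_cpx (\<lambda>j. sp (M j) x)),
     act = (\<lambda>x y m n s a j. act (M j) x y m n (s j) a)\<rparr>"

section \<open>The derived category and perfect modules\<close>

text \<open>
  The type \<open>'b\<close> fixes a universe: every vector space of dimension at most the cardinality of \<open>'b\<close> is
  isomorphic to a subspace of \<open>'b \<Rightarrow>\<^sub>0 'k\<close>, and modules are small if their values are such subspaces.
  The derived category is modelled by the homotopy category of small h-projective modules.
\<close>

definition small_module ::
  "('o, 'k::field, 'h::ab_group_add) dgcat \<Rightarrow> ('o, 'k, 'h, 'b \<Rightarrow>\<^sub>0 'k) dgmod \<Rightarrow> bool" where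
  "small_module C M \<longleftrightarrow> dg_module C M \<and> (\<forall>x\<in>Obj C. scl (sp M x) = fscale)"

definition acyclic_module ::
  "('o, 'k, 'h) dgcat \<Rightarrow> ('o, 'k, 'h, 'm::ab_group_add) dgmod \<Rightarrow> bool" where
  "acyclic_module C M \<longleftrightarrow> (\<forall>x\<in>Obj C. \<forall>n. \<forall>v\<in>piece (sp M x) n.
     dif (sp M x) n v = 0 \<longrightarrow> (\<exists>u\<in>piece (sp M x) (n - 1). dif (sp M x) (n - 1) u = v))"

definition derived_object ::
  "('o, 'k::field, 'h::ab_group_add) dgcat \<Rightarrow> ('o, 'k, 'h, 'b \<Rightarrow>\<^sub>0 'k) dgmod \<Rightarrow> bool" where
  "derived_object C P \<longleftrightarrow> small_module C P \<and>
     (\<forall>N :: ('o, 'k, 'h, 'b \<Rightarrow>\<^sub>0 'k) dgmod. small_module C N \<and> acyclic_module C N \<longrightarrow>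
        (\<forall>f. closed_morphism C P N f \<longrightarrow> homotopic C P N f (\<lambda>x n v. 0)))"

text \<open>
  Representables are h-projective, and h-projectivity is preserved by shifts, cones and homotopy
  retracts; so the members of \<open>perf C\<close> are automatically objects of the derived category.
  Homotopy invariance is the special case of retracts given by homotopy equivalences.
  The clause for the zero module matters only if \<open>C\<close> has no objects.
\<close>

inductive_set perf ::
  "('o, 'k::field, 'h::ab_group_add) dgcat \<Rightarrow> ('o, 'k, 'h, 'b \<Rightarrow>\<^sub>0 'k) dgmod set"
  for C :: "('o, 'k, 'h) dgcat" where
  zero: "small_module C M \<Longrightarrow> (\<And>x n. x \<in> Obj C \<Longrightarrow> piece (sp M x) n = {0}) \<Longrightarrow> M \<in> perf C"
| repr: "x \<in> Obj C \<Longrightarrow> small_module C M \<Longrightarrow> homotopy_equivalent C M (representable C x) \<Longrightarrow> M \<in> perf C"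
| shift: "M \<in> perf C \<Longrightarrow> shift_mod k M \<in> perf C"
| cone: "M \<in> perf C \<Longrightarrow> N \<in> perf C \<Longrightarrow> closed_morphism C M N f \<Longrightarrow> small_module C Z \<Longrightarrow>
     homotopy_equivalent C Z (cone M N f) \<Longrightarrow> Z \<in> perf C"
| retract: "M \<in> perf C \<Longrightarrow> small_module C N \<Longrightarrow> homotopy_retract C N M \<Longrightarrow> N \<in> perf C"

text \<open>
  Direct sums in the derived category are computed by direct sums of modules. They are indexed by
  the whole type \<open>'b\<close>; smaller families are padded with zero modules, which are retracts of any
  module. A small module has, up to isomorphism, no direct sum decomposition with more than
  \<open>'b\<close>-many nonzero summands as long as \<open>C\<close> has at most \<open>'b\<close>-many objects and \<open>'b\<close> is infinite.
\<close>

inductive_set ads ::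
  "('o, 'k::field, 'h::ab_group_add) dgcat \<Rightarrow> ('o, 'k, 'h, 'b \<Rightarrow>\<^sub>0 'k) dgmod
   \<Rightarrow> ('o, 'k, 'h, 'b \<Rightarrow>\<^sub>0 'k) dgmod set"
  for C :: "('o, 'k, 'h) dgcat" and G :: "('o, 'k, 'h, 'b \<Rightarrow>\<^sub>0 'k) dgmod" where
  self: "derived_object C G \<Longrightarrow> G \<in> ads C G"
| shift: "M \<in> ads C G \<Longrightarrow> shift_mod k M \<in> ads C G"
| summand: "M \<in> ads C G \<Longrightarrow> derived_object C N \<Longrightarrow> homotopy_retract C N M \<Longrightarrow> N \<in> ads C G"
| dsum: "(\<And>j :: 'b. M j \<in> ads C G) \<Longrightarrow> derived_object C N \<Longrightarrow>
     homotopy_equivalent C N (dsum_mod M) \<Longrightarrow> N \<in> ads C G"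

section \<open>Bimodules and convolution\<close>

type_synonym ('o, 'k, 'h, 'm) dgbimod = "('o \<times> 'o, 'k, (unit, 'h, 'h, 'k) formal, 'm) dgmod"

abbreviation env_cat ::
  "('o, 'k::field, 'h::ab_group_add) dgcat \<Rightarrow> ('o \<times> 'o, 'k, (unit, 'h, 'h, 'k) formal) dgcat" where
  "env_cat C \<equiv> tensor_cat (op_cat C) C"

text \<open>\<open>ext_prod A B M N\<close> has the action \<open>(v \<otimes> w) \<cdot> (a \<otimes> b) = (-1)\<^bsup>|w||a|\<^esup> va \<otimes> wb\<close>.\<close>

definition ext_prod ::
  "('o, 'k::field, 'h, 'm::ab_group_add) dgmod \<Rightarrow> ('p, 'k, 'i, 'n::ab_group_add) dgmod
   \<Rightarrow> ('o \<times> 'p, 'k, (unit, 'h, 'i, 'k) formal, (unit, 'm, 'n, 'k) formal) dgmod" where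
  "ext_prod M N = \<lparr>
     sp = (\<lambda>(x, x'). tensor_cpx (sp M x) (sp N x')),
     act = (\<lambda>(x, x') (y, y') m n. \<lambda>t a. tproj (sp M x) (sp N x')
        (lext2 (\<lambda>(_, p, q, v, w) (_, r, s, f, g).
           koszul (q * r) (gen () (p + r) (q + s) (act M x y p r v f) (act N x' y' q s w g))) t a))\<rparr>"

definition ext_prod_map ::
  "('o, 'k::field, 'h, 'm'::ab_group_add) dgmod \<Rightarrow> ('p, 'k, 'i, 'n'::ab_group_add) dgmod
   \<Rightarrow> ('o \<Rightarrow> int \<Rightarrow> 'm \<Rightarrow> 'm') \<Rightarrow> ('p \<Rightarrow> int \<Rightarrow> 'n \<Rightarrow> 'n')
   \<Rightarrow> 'o \<times> 'p \<Rightarrow> int \<Rightarrow> (unit, 'm, 'n, 'k) formal \<Rightarrow> (unit, 'm', 'n', 'k) formal" where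
  \<comment> \<open>\<open>M'\<close> and \<open>N'\<close> are the targets of \<open>\<phi>\<close> and \<open>\<psi>\<close>\<close>
  "ext_prod_map M' N' \<phi> \<psi> = (\<lambda>(x, x') n t. tproj (sp M' x) (sp N' x')
     (lext (\<lambda>(_, p, q, v, w). gen () p q (\<phi> x p v) (\<psi> x' q w)) t))"

text \<open>
  \<open>K \<otimes>\<^sub>C F\<close> at \<open>y\<close> is the quotient of \<open>\<Oplus>\<^sub>x K(x, y) \<otimes> F(x)\<close> by
  \<open>k \<otimes> f\<cdot>a = (-1)\<^bsup>|a||f|\<^esup> k\<cdot>(a \<otimes> id) \<otimes> f\<close>, where \<open>a : x \<rightarrow> x'\<close> in \<open>C\<close> is regarded as a morphism
  \<open>x' \<rightarrow> x\<close> of the opposite category. The remaining action is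
  \<open>(k \<otimes> f)\<cdot>b = (-1)\<^bsup>|f||b|\<^esup> k\<cdot>(id \<otimes> b) \<otimes> f\<close>. For h-projective \<open>F\<close> this is the derived tensor product.
\<close>

definition balanced_rels ::
  "('o, 'k::field, 'h::ab_group_add) dgcat \<Rightarrow> ('o, 'k, 'h, 'm::ab_group_add) dgbimod
   \<Rightarrow> ('o, 'k, 'h, 'n::ab_group_add) dgmod \<Rightarrow> 'o \<Rightarrow> ('o, 'm, 'n, 'k) formal set" where
  "balanced_rels C K F y =
     {gen x p (q + s) k (act F x x' q s f a)
        - koszul (s * q) (gen x' (p + s) q
            (act K (x', y) (x, y) p s k (tproj (Hom C x x') (Hom C y y) (gen () s 0 a (idt C y)))) f)
      | x x' p q s k f a. x \<in> Obj C \<and> x' \<in> Obj C \<and>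
          k \<in> piece (sp K (x, y)) p \<and> f \<in> piece (sp F x') q \<and> a \<in> piece (Hom C x x') s}"

definition convolution ::
  "('o, 'k::field, 'h::ab_group_add) dgcat \<Rightarrow> ('o, 'k, 'h, 'm::ab_group_add) dgbimod
   \<Rightarrow> ('o, 'k, 'h, 'n::ab_group_add) dgmod \<Rightarrow> ('o, 'k, 'h, ('o, 'm, 'n, 'k) formal) dgmod" where
  "convolution C K F = \<lparr>
     sp = (\<lambda>y. tensor_family (Obj C) (\<lambda>x. sp K (x, y)) (sp F) (balanced_rels C K F y)),
     act = (\<lambda>z y n r t b. tensor_proj (Obj C) (\<lambda>x. sp K (x, z)) (sp F) (balanced_rels C K F z)
        (lext (\<lambda>(x, p, q, k, f). koszul (q * r) (gen x (p + r) q
           (act K (x, z) (x, y) p r k (tproj (Hom C x x) (Hom C z y) (gen () 0 r (idt C x) b))) f)) t))\<rparr>"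

text \<open>
  The argument \<open>TYPE('b)\<close> names the universe. Since constructions on modules change the carrier type,
  membership in \<open>perf\<close> and \<open>ads\<close> is expressed up to homotopy equivalence.
\<close>

definition weakly_product_bimodule ::
  "'b itself \<Rightarrow> ('o, 'k::field, 'h::ab_group_add) dgcat
   \<Rightarrow> ('o, 'k, 'h, 'm::ab_group_add) dgbimod \<Rightarrow> bool" where
  "weakly_product_bimodule U C K \<longleftrightarrow>
     (\<exists>K' :: ('o, 'k, 'h, 'b \<Rightarrow>\<^sub>0 'k) dgbimod. K' \<in> perf (env_cat C) \<and> homotopy_equivalent (env_cat C) K K') \<and>
     (\<exists>G :: ('o, 'k, 'h, 'b \<Rightarrow>\<^sub>0 'k) dgmod. G \<in> perf C \<and>
        (\<forall>F :: ('o, 'k, 'h, 'b \<Rightarrow>\<^sub>0 'k) dgmod. F \<in> perf C \<longrightarrow>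
           (\<exists>N \<in> ads C G. homotopy_equivalent C (convolution C K F) N)))"

text \<open>The universe \<open>'b\<close> is infinite and large enough to contain the dg category \<open>C\<close>.\<close>

definition universe_for :: "'b itself \<Rightarrow> ('o, 'k, 'h) dgcat \<Rightarrow> bool" where
  "universe_for U C \<longleftrightarrow> infinite (UNIV :: 'b set) \<and> Obj C \<lesssim> (UNIV :: 'b set) \<and>
     (\<forall>x\<in>Obj C. \<forall>y\<in>Obj C. \<forall>n. piece (Hom C x y) n \<lesssim> (UNIV :: 'b set))"

end

theory Submission
  imports Defs
begin

text \<open>
  Convolution with a product bimodule is \<open>F \<mapsto> (G1 \<otimes>\<^sub>C F) \<otimes> G2\<close>. So convolution with the cone of
  \<open>\<phi>1 \<box> \<phi>2\<close> is the cone of \<open>\<alpha> \<otimes> \<phi>2 : V \<otimes> G2 \<rightarrow> V' \<otimes> G2'\<close>, where \<open>\<alpha> : V \<rightarrow> V'\<close> is the map of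
  complexes \<open>G1 \<otimes>\<^sub>C F \<rightarrow> G1' \<otimes>\<^sub>C F\<close>. Over a field, contractions of \<open>V\<close> and \<open>V'\<close> allow us to
  replace \<open>\<alpha>\<close> by a map of graded vector spaces, and a generalized inverse splits such a map into
  an isomorphism and zero maps. Hence the cone is a retract of a direct sum of shifts of the cone
  of \<open>\<phi>2\<close>, of \<open>G2\<close>, and of \<open>G2'\<close>, and the sum of these three is a perfect module that does not
  depend on \<open>F\<close>.
\<close>

section \<open>Graded linear algebra\<close>

text \<open>\<open>perf\<close> and \<open>ads\<close> only contain modules with values in
  \<open>'b \<Rightarrow>\<^sub>0 'k\<close>, whereas cones, exterior products and convolutions
  change the carrier type. So every construction comes with a bound on dimensions, which yields an
  isomorphic module with the right carrier. Retracts up to homotopy can take the place of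
  equivalences: \<open>perf\<close>, \<open>ads\<close> and h-projectivity are all closed under
  them. Hence V is not replaced by its cohomology, nor \<alpha> decomposed into kernel, image and
  cokernel. V keeps its pieces and loses its differential, and a map \<beta> with
  \<alpha>\<beta>\<alpha> = \<alpha> is enough to embed the cone into (V' \<oplus> V) \<otimes> G,
  where G is the sum of the three modules. As the contractions of V and V' are chosen independently
  of \<alpha>, they are compatible with it only up to homotopy, and correction terms enter the maps
  of cones. The cone must also be perfect as a bimodule; this is a separate induction over
  \<open>perf\<close> in each factor.\<close>

lemma koszul_0 [simp]: "koszul p 0 = 0"
  by (simp add: koszul_def)

lemma koszul_zero_deg [simp]: "koszul 0 v = v"
  by (simp add: koszul_def)

lemma koszul_add: "koszul p (v + w) = koszul p v + koszul p w"
  by (simp add: koszul_def)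

lemma koszul_koszul: "koszul p (koszul q v) = koszul (p + q) v"
  by (auto simp: koszul_def)

lemma fscale_add: "fscale c (t + u) = fscale c t + fscale c u"
  and fscale_neg: "fscale c (- t) = - fscale c t"
proof -
  interpret vector_space fscale by (rule vector_space_fscale)
  show "fscale c (t + u) = fscale c t + fscale c u" "fscale c (- t) = - fscale c t"
    by (simp_all add: scale_right_distrib)
qed

lemma fscale_koszul: "fscale c (koszul p t) = koszul p (fscale c t)"
  by (simp add: koszul_def fscale_neg)

lemma subspace_iff:
  assumes "vector_space s"
  shows "module.subspace s S \<longleftrightarrow> 0 \<in> S \<and> (\<forall>x\<in>S. \<forall>y\<in>S. x + y \<in> S) \<and> (\<forall>c. \<forall>x\<in>S. s c x \<in> S)"
  using assms by (simp add: module.subspace_def module_iff_vector_space)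

lemma cochain_complexI:
  assumes "vector_space (scl V)"
    and "\<And>n. 0 \<in> piece V n"
    and "\<And>n v w. v \<in> piece V n \<Longrightarrow> w \<in> piece V n \<Longrightarrow> v + w \<in> piece V n"
    and "\<And>n v c. v \<in> piece V n \<Longrightarrow> scl V c v \<in> piece V n"
    and "\<And>n v. v \<in> piece V n \<Longrightarrow> dif V n v \<in> piece V (n + 1)"
    and "\<And>n v. v \<in> piece V n \<Longrightarrow> dif V (n + 1) (dif V n v) = 0"
    and "\<And>n v w. v \<in> piece V n \<Longrightarrow> w \<in> piece V n \<Longrightarrow> dif V n (v + w) = dif V n v + dif V n w"
    and "\<And>n v c. v \<in> piece V n \<Longrightarrow> dif V n (scl V c v) = scl V c (dif V n v)"
  shows "cochain_complex V"
  using assms unfolding cochain_complex_def by (simp add: subspace_iff)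

context
  fixes V :: "('k::field, 'v::ab_group_add) cpx"
  assumes V: "cochain_complex V"
begin

lemma cc_vector_space: "vector_space (scl V)"
  using V by (simp add: cochain_complex_def)

lemma cc_subspace: "module.subspace (scl V) (piece V n)"
  using V by (simp add: cochain_complex_def)

lemma cc_zero: "0 \<in> piece V n"
  using cc_subspace[of n] by (simp add: subspace_iff[OF cc_vector_space])

lemma cc_add: "v \<in> piece V n \<Longrightarrow> w \<in> piece V n \<Longrightarrow> v + w \<in> piece V n"
  using cc_subspace[of n] by (simp add: subspace_iff[OF cc_vector_space])

lemma cc_scl: "v \<in> piece V n \<Longrightarrow> scl V c v \<in> piece V n"
  using cc_subspace[of n] by (simp add: subspace_iff[OF cc_vector_space])

lemma scl_minus_one: "scl V (- 1) v = - v"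
proof -
  interpret vector_space "scl V" by (rule cc_vector_space)
  show ?thesis by simp
qed

lemma cc_neg: "v \<in> piece V n \<Longrightarrow> - v \<in> piece V n"
  using cc_scl[of v n "- 1"] by (simp add: scl_minus_one)

lemma cc_diff: "v \<in> piece V n \<Longrightarrow> w \<in> piece V n \<Longrightarrow> v - w \<in> piece V n"
  using cc_add[of v n "- w"] cc_neg[of w n] by simp

lemma cc_koszul: "v \<in> piece V n \<Longrightarrow> koszul p v \<in> piece V n"
  using cc_neg[of v n] by (simp add: koszul_def)

lemma cc_dif: "v \<in> piece V n \<Longrightarrow> m = n + 1 \<Longrightarrow> dif V n v \<in> piece V m"
  using V by (simp add: cochain_complex_def)

lemma dif_dif: "v \<in> piece V n \<Longrightarrow> m = n + 1 \<Longrightarrow> dif V m (dif V n v) = 0"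
  using V by (simp add: cochain_complex_def)

lemma dif_add: "v \<in> piece V n \<Longrightarrow> w \<in> piece V n \<Longrightarrow> dif V n (v + w) = dif V n v + dif V n w"
  using V by (simp add: cochain_complex_def)

lemma dif_scl: "v \<in> piece V n \<Longrightarrow> dif V n (scl V c v) = scl V c (dif V n v)"
  using V by (simp add: cochain_complex_def)

lemma dif_zero: "dif V n 0 = 0"
  using dif_add[OF cc_zero cc_zero, of n] by simp

lemma dif_neg: "v \<in> piece V n \<Longrightarrow> dif V n (- v) = - dif V n v"
  using dif_scl[of v n "- 1"] by (simp add: scl_minus_one)

lemma dif_diff: "v \<in> piece V n \<Longrightarrow> w \<in> piece V n \<Longrightarrow> dif V n (v - w) = dif V n v - dif V n w"
  using dif_add[of v n "- w"] cc_neg[of w n] dif_neg[of w n] by simp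

lemma dif_koszul: "v \<in> piece V n \<Longrightarrow> dif V n (koszul p v) = koszul p (dif V n v)"
  by (simp add: koszul_def dif_neg)

end

lemmas cc_rules = cc_zero cc_add cc_scl cc_neg cc_diff cc_koszul cc_dif
lemmas dif_rules = dif_add dif_scl dif_zero dif_neg dif_diff dif_koszul dif_dif

text \<open>Maps carry the degree as an argument and are constrained on the pieces only, since the
  pieces of a complex may overlap; values elsewhere are arbitrary.\<close>

definition graded_linear ::
  "('k::field, 'v::ab_group_add) cpx \<Rightarrow> ('k, 'w::ab_group_add) cpx \<Rightarrow> int \<Rightarrow> (int \<Rightarrow> 'v \<Rightarrow> 'w) \<Rightarrow> bool" where
  "graded_linear V W p f \<longleftrightarrow> (\<forall>n. \<forall>v\<in>piece V n. f n v \<in> piece W (n + p) \<and>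
     (\<forall>w\<in>piece V n. f n (v + w) = f n v + f n w) \<and>
     (\<forall>c. f n (scl V c v) = scl W c (f n v)))"

lemma graded_linearI:
  assumes "\<And>n v. v \<in> piece V n \<Longrightarrow> f n v \<in> piece W (n + p)"
    and "\<And>n v w. v \<in> piece V n \<Longrightarrow> w \<in> piece V n \<Longrightarrow> f n (v + w) = f n v + f n w"
    and "\<And>n v c. v \<in> piece V n \<Longrightarrow> f n (scl V c v) = scl W c (f n v)"
  shows "graded_linear V W p f"
  using assms by (simp add: graded_linear_def)

lemma gl_in: "graded_linear V W p f \<Longrightarrow> v \<in> piece V n \<Longrightarrow> m = n + p \<Longrightarrow> f n v \<in> piece W m"
  by (simp add: graded_linear_def)

lemma gl_add: "graded_linear V W p f \<Longrightarrow> v \<in> piece V n \<Longrightarrow> w \<in> piece V n \<Longrightarrow> f n (v + w) = f n v + f n w"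
  by (simp add: graded_linear_def)

lemma gl_scl: "graded_linear V W p f \<Longrightarrow> v \<in> piece V n \<Longrightarrow> f n (scl V c v) = scl W c (f n v)"
  by (simp add: graded_linear_def)

lemma gl_zero:
  assumes "graded_linear V W p f" "cochain_complex V"
  shows "f n 0 = 0"
  using gl_add[OF assms(1) cc_zero[OF assms(2)] cc_zero[OF assms(2)], of n] by simp

lemma gl_neg:
  assumes "graded_linear V W p f" "cochain_complex V" "v \<in> piece V n"
  shows "f n (- v) = - f n v"
  using gl_add[OF assms(1,3) cc_neg[OF assms(2,3)]] gl_zero[OF assms(1,2)]
  by (simp add: eq_neg_iff_add_eq_0 add.commute)

lemma gl_diff:
  assumes "graded_linear V W p f" "cochain_complex V" "v \<in> piece V n" "w \<in> piece V n"
  shows "f n (v - w) = f n v - f n w"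
  using gl_add[OF assms(1,3) cc_neg[OF assms(2,4)]] gl_neg[OF assms(1,2,4)] by simp

lemma gl_koszul:
  assumes "graded_linear V W p f" "cochain_complex V" "v \<in> piece V n"
  shows "f n (koszul q v) = koszul q (f n v)"
  using gl_neg[OF assms] by (simp add: koszul_def)

lemma gl_dif: "cochain_complex V \<Longrightarrow> graded_linear V V 1 (dif V)"
  by (rule graded_linearI) (simp_all add: cc_dif dif_add dif_scl)

lemmas gl_rules = gl_zero gl_add gl_scl gl_neg gl_diff gl_koszul

section \<open>Universal property of the tensor construction\<close>

text \<open>Unlike for \<open>lext\<close>, the target is any vector space: besides maps between
  formal sums this covers maps from a tensor product to the values of a module, such as contraction
  with a functional.\<close>

definition lin_ext :: "('k::field \<Rightarrow> 'z::ab_group_add \<Rightarrow> 'z) \<Rightarrow> ('g \<Rightarrow> 'z) \<Rightarrow> ('g \<Rightarrow>\<^sub>0 'k) \<Rightarrow> 'z" where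
  "lin_ext s b t = (\<Sum>g\<in>Poly_Mapping.keys t. s (Poly_Mapping.lookup t g) (b g))"

lemma lext_eq_lin_ext: "lext b = lin_ext fscale b"
  by (simp add: fun_eq_iff lext_def lin_ext_def)

context
  fixes s :: "'k::field \<Rightarrow> 'z::ab_group_add \<Rightarrow> 'z"
  assumes s: "vector_space s"
begin

interpretation vector_space s by (rule s)

lemma lin_ext_superset:
  assumes "finite K" "Poly_Mapping.keys t \<subseteq> K"
  shows "lin_ext s b t = (\<Sum>g\<in>K. s (Poly_Mapping.lookup t g) (b g))"
  unfolding lin_ext_def
  by (rule sum.mono_neutral_left) (use assms in \<open>auto simp: in_keys_iff\<close>)

lemma linear_lin_ext: "Vector_Spaces.linear fscale s (lin_ext s b)"
proof -
  interpret f: vector_space "fscale :: 'k \<Rightarrow> ('g \<Rightarrow>\<^sub>0 'k) \<Rightarrow> _" by (rule vector_space_fscale)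
  have add: "lin_ext s b (t + u) = lin_ext s b t + lin_ext s b u" for t u
  proof -
    let ?K = "Poly_Mapping.keys t \<union> Poly_Mapping.keys u"
    have "Poly_Mapping.keys (t + u) \<subseteq> ?K" by (rule Poly_Mapping.keys_add)
    then show ?thesis
      by (simp add: lin_ext_superset[of ?K] lookup_add scale_left_distrib sum.distrib)
  qed
  have scale: "lin_ext s b (fscale c t) = s c (lin_ext s b t)" for c t
  proof -
    have "Poly_Mapping.keys (fscale c t) \<subseteq> Poly_Mapping.keys t"
      by (auto simp: in_keys_iff lookup_fscale)
    then show ?thesis
      by (simp add: lin_ext_superset[of "Poly_Mapping.keys t"] lookup_fscale scale_sum_right)
  qed
  show ?thesis
    by (unfold_locales) (simp_all add: add scale)
qed

lemma lin_ext_add: "lin_ext s b (t + u) = lin_ext s b t + lin_ext s b u"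
  and lin_ext_diff: "lin_ext s b (t - u) = lin_ext s b t - lin_ext s b u"
  and lin_ext_neg: "lin_ext s b (- t) = - lin_ext s b t"
  and lin_ext_zero: "lin_ext s b 0 = 0"
  and lin_ext_fscale: "lin_ext s b (fscale c t) = s c (lin_ext s b t)"
proof -
  interpret l: Vector_Spaces.linear fscale s "lin_ext s b" by (rule linear_lin_ext)
  show "lin_ext s b (t + u) = lin_ext s b t + lin_ext s b u"
    "lin_ext s b (t - u) = lin_ext s b t - lin_ext s b u"
    "lin_ext s b (- t) = - lin_ext s b t"
    "lin_ext s b 0 = 0"
    "lin_ext s b (fscale c t) = s c (lin_ext s b t)"
    by (simp_all add: l.add l.diff l.neg l.scale l.zero)
qed

lemma lin_ext_koszul: "lin_ext s b (koszul p t) = koszul p (lin_ext s b t)"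
  by (simp add: koszul_def lin_ext_neg)

lemma lin_ext_gen [simp]: "lin_ext s b (gen i p q v w) = b (i, p, q, v, w)"
  by (simp add: lin_ext_def gen_def)

text \<open>Moves a quotient projection inside a map given on generators, so that a projection
  applied after \<open>lext\<close> becomes the linear extension of a formula in pure
  tensors.\<close>

lemma linear_comp_lin_ext:
  assumes "Vector_Spaces.linear s s' f"
  shows "f (lin_ext s b t) = lin_ext s' (\<lambda>g. f (b g)) t"
proof -
  interpret l: Vector_Spaces.linear s s' f by (rule assms)
  show ?thesis by (simp add: lin_ext_def l.sum l.scale)
qed

end

lemmas lin_ext_rules = lin_ext_add lin_ext_diff lin_ext_neg lin_ext_zero lin_ext_fscale lin_ext_koszul

definition bilinear_on ::
  "'i set \<Rightarrow> ('i \<Rightarrow> ('k::field, 'v::ab_group_add) cpx) \<Rightarrow> ('i \<Rightarrow> ('k, 'w::ab_group_add) cpx)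
   \<Rightarrow> ('k \<Rightarrow> 'z::ab_group_add \<Rightarrow> 'z) \<Rightarrow> ('i \<Rightarrow> int \<Rightarrow> int \<Rightarrow> 'v \<Rightarrow> 'w \<Rightarrow> 'z) \<Rightarrow> bool" where
  "bilinear_on I V W s b \<longleftrightarrow> (\<forall>i\<in>I. \<forall>p q. \<forall>v\<in>piece (V i) p. \<forall>w\<in>piece (W i) q.
     (\<forall>v'\<in>piece (V i) p. b i p q (v + v') w = b i p q v w + b i p q v' w) \<and>
     (\<forall>w'\<in>piece (W i) q. b i p q v (w + w') = b i p q v w + b i p q v w') \<and>
     (\<forall>c. b i p q (scl (V i) c v) w = s c (b i p q v w)) \<and>
     (\<forall>c. b i p q v (scl (W i) c w) = s c (b i p q v w)))"

lemma bilinear_onI: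
  assumes "\<And>i p q v v' w. i \<in> I \<Longrightarrow> v \<in> piece (V i) p \<Longrightarrow> v' \<in> piece (V i) p \<Longrightarrow> w \<in> piece (W i) q \<Longrightarrow>
      b i p q (v + v') w = b i p q v w + b i p q v' w"
    and "\<And>i p q v w w'. i \<in> I \<Longrightarrow> v \<in> piece (V i) p \<Longrightarrow> w \<in> piece (W i) q \<Longrightarrow> w' \<in> piece (W i) q \<Longrightarrow>
      b i p q v (w + w') = b i p q v w + b i p q v w'"
    and "\<And>i p q v w c. i \<in> I \<Longrightarrow> v \<in> piece (V i) p \<Longrightarrow> w \<in> piece (W i) q \<Longrightarrow>
      b i p q (scl (V i) c v) w = s c (b i p q v w)"
    and "\<And>i p q v w c. i \<in> I \<Longrightarrow> v \<in> piece (V i) p \<Longrightarrow> w \<in> piece (W i) q \<Longrightarrow>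
      b i p q v (scl (W i) c w) = s c (b i p q v w)"
  shows "bilinear_on I V W s b"
  using assms by (simp add: bilinear_on_def)

definition ten ::
  "'i set \<Rightarrow> ('i \<Rightarrow> ('k::field, 'v::ab_group_add) cpx) \<Rightarrow> ('i \<Rightarrow> ('k, 'w::ab_group_add) cpx)
   \<Rightarrow> ('i, 'v, 'w, 'k) formal set \<Rightarrow> 'i \<Rightarrow> int \<Rightarrow> int \<Rightarrow> 'v \<Rightarrow> 'w \<Rightarrow> ('i, 'v, 'w, 'k) formal" where
  "ten I V W E i p q v w = tensor_proj I V W E (gen i p q v w)"

text \<open>The differential on formal sums, before the final projection. Whether it is well defined
  modulo the relations is the subject of \<open>tensor_complex\<close>.\<close>

definition tensor_dif ::
  "('i \<Rightarrow> ('k::field, 'v::ab_group_add) cpx) \<Rightarrow> ('i \<Rightarrow> ('k, 'w::ab_group_add) cpx)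
   \<Rightarrow> ('i, 'v, 'w, 'k) formal \<Rightarrow> ('i, 'v, 'w, 'k) formal" where
  "tensor_dif V W = lext (\<lambda>(i, p, q, v, w).
     gen i (p + 1) q (dif (V i) p v) w + koszul p (gen i p (q + 1) v (dif (W i) q w)))"

locale tensor_data =
  fixes I :: "'i set" and V :: "'i \<Rightarrow> ('k::field, 'v::ab_group_add) cpx"
    and W :: "'i \<Rightarrow> ('k, 'w::ab_group_add) cpx" and E :: "('i, 'v, 'w, 'k) formal set"
  assumes V: "\<And>i. i \<in> I \<Longrightarrow> cochain_complex (V i)" and W: "\<And>i. i \<in> I \<Longrightarrow> cochain_complex (W i)"
begin

abbreviation "pr \<equiv> tensor_proj I V W E"
abbreviation "tn \<equiv> ten I V W E"
abbreviation "T \<equiv> tensor_family I V W E"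

interpretation fs: vector_space "fscale :: 'k \<Rightarrow> ('i, 'v, 'w, 'k) formal \<Rightarrow> _" by (rule vector_space_fscale)

lemma linear_pr: "Vector_Spaces.linear fscale fscale pr"
  unfolding tensor_proj_def by (rule quot_proj) simp

interpretation pr: Vector_Spaces.linear "fscale :: 'k \<Rightarrow> ('i, 'v, 'w, 'k) formal \<Rightarrow> _"
  "fscale :: 'k \<Rightarrow> ('i, 'v, 'w, 'k) formal \<Rightarrow> _" pr by (rule linear_pr)

lemma pr_pr [simp]: "pr (pr t) = pr t"
  unfolding tensor_proj_def by (rule quot_proj) simp

lemma pr_eq_0_iff: "pr t = 0 \<longleftrightarrow> t \<in> fs.span (bilinear_rels I V W \<union> E)"
  unfolding tensor_proj_def by (rule quot_proj) simp

lemma pr_rel: "t \<in> bilinear_rels I V W \<union> E \<Longrightarrow> pr t = 0"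
  by (simp add: pr_eq_0_iff fs.span_base)

lemma pr_koszul: "pr (koszul p t) = koszul p (pr t)"
  by (simp add: koszul_def pr.neg)

lemma pr_fscale: "pr (fscale c t) = fscale c (pr t)"
  by (rule pr.scale)

lemmas pr_simps = pr.add pr.diff pr.neg pr.zero pr_koszul pr_fscale

text \<open>The difference t - pr t lies in the span of the relations. A linear extension of a
  bilinear map kills the bilinear relations, and it kills \<open>E\<close> by hypothesis, so it
  cannot distinguish t from its representative. This is the universal property in the form used
  below.\<close>

lemma lift_pr:
  assumes s: "vector_space s"
    and b: "bilinear_on I V W s b"
    and E: "\<And>e. e \<in> E \<Longrightarrow> lin_ext s (\<lambda>(i, p, q, v, w). b i p q v w) e = 0"
  shows "lin_ext s (\<lambda>(i, p, q, v, w). b i p q v w) (pr t) = lin_ext s (\<lambda>(i, p, q, v, w). b i p q v w) t"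
proof -
  let ?l = "lin_ext s (\<lambda>(i, p, q, v, w). b i p q v w)"
  interpret l: Vector_Spaces.linear fscale s ?l by (rule linear_lin_ext[OF s])
  have "t - pr t \<in> fs.span (bilinear_rels I V W \<union> E)"
    by (simp add: pr_eq_0_iff[symmetric] pr.diff)
  moreover have "?l r = 0" if "r \<in> bilinear_rels I V W \<union> E" for r
    using that
  proof
    assume "r \<in> bilinear_rels I V W"
    then show ?thesis
      unfolding bilinear_rels_def using b
      by (auto simp: l.diff l.scale lin_ext_gen[OF s] bilinear_on_def)
  qed (rule E)
  ultimately have "?l (t - pr t) = 0"
    by (rule l.eq_0_on_span[rotated])
  then show ?thesis by (simp add: l.diff)
qed

text \<open>Maps out of tensor products are given by formulas on generators, while
  \<open>ten\<close> is a chosen representative and not the generator itself; this allows the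
  formula to be evaluated on a pure tensor.\<close>

lemma lift_ten:
  assumes s: "vector_space s"
    and b: "bilinear_on I V W s b"
    and E: "\<And>e. e \<in> E \<Longrightarrow> lin_ext s (\<lambda>(i, p, q, v, w). b i p q v w) e = 0"
  shows "lin_ext s (\<lambda>(i, p, q, v, w). b i p q v w) (tn i p q v w) = b i p q v w"
  using lift_pr[OF s b E, of "gen i p q v w"] by (simp add: ten_def lin_ext_gen[OF s])

context
  fixes i assumes i: "i \<in> I"
begin

lemma ten_add_left:
  assumes "v \<in> piece (V i) p" "v' \<in> piece (V i) p" "w \<in> piece (W i) q"
  shows "tn i p q (v + v') w = tn i p q v w + tn i p q v' w"
proof -
  have "pr (gen i p q (v + v') w - gen i p q v w - gen i p q v' w) = 0"
    by (rule pr_rel, rule UnI1, unfold bilinear_rels_def, rule UnI1, rule UnI1, rule UnI1,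
      rule CollectI, rule exI[of _ i], rule exI[of _ p], rule exI[of _ q], rule exI[of _ v], rule exI[of _ "v'"], rule exI[of _ w]) (use i assms in simp)
  then show ?thesis by (simp add: ten_def pr_simps algebra_simps)
qed

lemma ten_add_right:
  assumes "v \<in> piece (V i) p" "w \<in> piece (W i) q" "w' \<in> piece (W i) q"
  shows "tn i p q v (w + w') = tn i p q v w + tn i p q v w'"
proof -
  have "pr (gen i p q v (w + w') - gen i p q v w - gen i p q v w') = 0"
    by (rule pr_rel, rule UnI1, unfold bilinear_rels_def, rule UnI1, rule UnI1, rule UnI2,
      rule CollectI, rule exI[of _ i], rule exI[of _ p], rule exI[of _ q], rule exI[of _ v], rule exI[of _ w], rule exI[of _ "w'"]) (use i assms in simp)
  then show ?thesis by (simp add: ten_def pr_simps algebra_simps)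
qed

lemma ten_scl_left:
  assumes "v \<in> piece (V i) p" "w \<in> piece (W i) q"
  shows "tn i p q (scl (V i) c v) w = fscale c (tn i p q v w)"
proof -
  have "pr (gen i p q (scl (V i) c v) w - fscale c (gen i p q v w)) = 0"
    by (rule pr_rel, rule UnI1, unfold bilinear_rels_def, rule UnI1, rule UnI2,
      rule CollectI, rule exI[of _ i], rule exI[of _ p], rule exI[of _ q], rule exI[of _ c], rule exI[of _ v], rule exI[of _ w]) (use i assms in simp)
  then show ?thesis by (simp add: ten_def pr_simps algebra_simps)
qed

lemma ten_scl_right:
  assumes "v \<in> piece (V i) p" "w \<in> piece (W i) q"
  shows "tn i p q v (scl (W i) c w) = fscale c (tn i p q v w)"
proof -
  have "pr (gen i p q v (scl (W i) c w) - fscale c (gen i p q v w)) = 0"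
    by (rule pr_rel, rule UnI1, unfold bilinear_rels_def, rule UnI2,
      rule CollectI, rule exI[of _ i], rule exI[of _ p], rule exI[of _ q], rule exI[of _ c], rule exI[of _ v], rule exI[of _ w]) (use i assms in simp)
  then show ?thesis by (simp add: ten_def pr_simps algebra_simps)
qed

lemma ten_neg_left: "v \<in> piece (V i) p \<Longrightarrow> w \<in> piece (W i) q \<Longrightarrow> tn i p q (- v) w = - tn i p q v w"
  using ten_scl_left[of v p w q "- 1"] by (simp add: scl_minus_one[OF V[OF i]])

lemma ten_neg_right: "v \<in> piece (V i) p \<Longrightarrow> w \<in> piece (W i) q \<Longrightarrow> tn i p q v (- w) = - tn i p q v w"
  using ten_scl_right[of v p w q "- 1"] by (simp add: scl_minus_one[OF W[OF i]])

lemma ten_zero_left: "w \<in> piece (W i) q \<Longrightarrow> tn i p q 0 w = 0"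
  using ten_add_left[OF cc_zero[OF V[OF i]] cc_zero[OF V[OF i]], of w q p] by simp

lemma ten_zero_right: "v \<in> piece (V i) p \<Longrightarrow> tn i p q v 0 = 0"
  using ten_add_right[OF _ cc_zero[OF W[OF i]] cc_zero[OF W[OF i]], of v p q] by simp

lemma ten_diff_left: "v \<in> piece (V i) p \<Longrightarrow> v' \<in> piece (V i) p \<Longrightarrow> w \<in> piece (W i) q \<Longrightarrow>
    tn i p q (v - v') w = tn i p q v w - tn i p q v' w"
  using ten_add_left[of v p "- v'" w q] ten_neg_left[of v' p w q] cc_neg[OF V[OF i]] by simp

lemma ten_diff_right: "v \<in> piece (V i) p \<Longrightarrow> w \<in> piece (W i) q \<Longrightarrow> w' \<in> piece (W i) q \<Longrightarrow>
    tn i p q v (w - w') = tn i p q v w - tn i p q v w'"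
  using ten_add_right[of v p w q "- w'"] ten_neg_right[of v p w' q] cc_neg[OF W[OF i]] by simp

lemma ten_koszul_left: "v \<in> piece (V i) p \<Longrightarrow> w \<in> piece (W i) q \<Longrightarrow> tn i p q (koszul k v) w = koszul k (tn i p q v w)"
  by (simp add: koszul_def ten_neg_left)

lemma ten_koszul_right: "v \<in> piece (V i) p \<Longrightarrow> w \<in> piece (W i) q \<Longrightarrow> tn i p q v (koszul k w) = koszul k (tn i p q v w)"
  by (simp add: koszul_def ten_neg_right)

end

lemmas ten_rules = ten_add_left ten_add_right ten_scl_left ten_scl_right ten_neg_left ten_neg_right
  ten_zero_left ten_zero_right ten_diff_left ten_diff_right ten_koszul_left ten_koszul_right

lemma piece_eq: "piece T n =
    fs.span {tn i p q v w | i p q v w. i \<in> I \<and> p + q = n \<and> v \<in> piece (V i) p \<and> w \<in> piece (W i) q}"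
proof -
  have "{tn i p q v w | i p q v w. i \<in> I \<and> p + q = n \<and> v \<in> piece (V i) p \<and> w \<in> piece (W i) q}
    = pr ` {gen i p q v w | i p q v w. i \<in> I \<and> p + q = n \<and> v \<in> piece (V i) p \<and> w \<in> piece (W i) q}"
    unfolding ten_def by blast
  then show ?thesis by (simp add: tensor_family_def pr.span_image)
qed

lemma ten_in:
  assumes "i \<in> I" "v \<in> piece (V i) p" "w \<in> piece (W i) q" "n = p + q"
  shows "tn i p q v w \<in> piece T n"
  unfolding piece_eq by (rule fs.span_base) (use assms in blast)

lemma scl_T [simp]: "scl T = fscale"
  by (simp add: tensor_family_def)

lemma subspace_T: "fs.subspace (piece T n)"
  by (simp add: piece_eq)

text \<open>A scalar multiple of a pure tensor is again a pure tensor, the scalar being absorbed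
  into the left factor, so induction over a piece has no case for scalars.\<close>

lemma piece_induct [consumes 1, case_names ten zero add]:
  assumes "t \<in> piece T n"
    and ten: "\<And>i p q v w. i \<in> I \<Longrightarrow> n = p + q \<Longrightarrow> v \<in> piece (V i) p \<Longrightarrow> w \<in> piece (W i) q \<Longrightarrow> P (tn i p q v w)"
    and zero: "P 0"
    and add: "\<And>s t. s \<in> piece T n \<Longrightarrow> t \<in> piece T n \<Longrightarrow> P s \<Longrightarrow> P t \<Longrightarrow> P (s + t)"
  shows "P t"
proof -
  have "t \<in> fs.span {tn i p q v w | i p q v w. i \<in> I \<and> p + q = n \<and> v \<in> piece (V i) p \<and> w \<in> piece (W i) q}"
    using assms(1) by (simp add: piece_eq)
  \<comment> \<open>Membership is carried along because the hypothesis on sums asks for it.\<close>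
  then have "P t \<and> t \<in> piece T n"
  proof (induction rule: fs.span_induct_alt)
    case base then show ?case using zero fs.subspace_0[OF subspace_T] by simp
  next
    case (step c x y)
    then obtain i p q v w where x: "x = tn i p q v w" "i \<in> I" "p + q = n" "v \<in> piece (V i) p" "w \<in> piece (W i) q"
      by blast
    have e: "fscale c x = tn i p q (scl (V i) c v) w" using x by (simp add: ten_scl_left)
    have m: "scl (V i) c v \<in> piece (V i) p" using x cc_scl[OF V] by blast
    have t: "tn i p q (scl (V i) c v) w \<in> piece T n" using x m by (simp add: ten_in)
    have "P (tn i p q (scl (V i) c v) w)" using ten[OF x(2) _ m x(5)] x(3) by simp
    then show ?case unfolding e
      using step.IH t add fs.subspace_add[OF subspace_T t] by blast
  qed
  then show ?thesis ..
qed

lemma proj_tensor_dif_ten: "pr (tensor_dif V W (gen i p q v w))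
    = tn i (p + 1) q (dif (V i) p v) w + koszul p (tn i p (q + 1) v (dif (W i) q w))"
  by (simp add: tensor_dif_def lext_eq_lin_ext lin_ext_gen[OF vector_space_fscale] pr_simps ten_def)

text \<open>Linearity holds on all formal sums and not merely on a piece, the differential being a
  linear extension followed by the projection.\<close>

lemma linear_dif: "Vector_Spaces.linear fscale fscale (dif T n)"
proof -
  have "dif T n = pr \<circ> tensor_dif V W"
    by (simp add: tensor_family_def fun_eq_iff tensor_dif_def)
  moreover have "Vector_Spaces.linear fscale fscale (pr \<circ> tensor_dif V W)"
    unfolding tensor_dif_def lext_eq_lin_ext
    by (rule Vector_Spaces.linear_compose[OF linear_lin_ext[OF vector_space_fscale] linear_pr])
  ultimately show ?thesis by simp
qed

end

text \<open>The bilinear relations are respected by the differential in any case, so the condition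
  concerns the extra relations \<open>E\<close>: the raw differential of each lies in the span of
  all relations.\<close>

locale tensor_complex = tensor_data +
  assumes E_dif: "\<And>e. e \<in> E \<Longrightarrow> pr (tensor_dif V W e) = 0"
begin

text \<open>\<open>dif\<close> applies the raw formula to a representative of the pure tensor. After
  projection the formula is bilinear and vanishes on \<open>E\<close>, so it may be evaluated on the
  generator instead.\<close>

lemma dif_ten:
  assumes "i \<in> I" "v \<in> piece (V i) p" "w \<in> piece (W i) q"
  shows "dif T n (tn i p q v w)
    = tn i (p + 1) q (dif (V i) p v) w + koszul p (tn i p (q + 1) v (dif (W i) q w))"
proof -
  let ?b = "\<lambda>i p q v w. tn i (p + 1) q (dif (V i) p v) w + koszul p (tn i p (q + 1) v (dif (W i) q w))"
  have e: "pr (tensor_dif V W t) = lin_ext fscale (\<lambda>(i, p, q, v, w). ?b i p q v w) t" for t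
    unfolding tensor_dif_def lext_eq_lin_ext linear_comp_lin_ext[OF vector_space_fscale linear_pr]
    by (rule arg_cong[where f="\<lambda>b. lin_ext fscale b t"])
       (auto simp: fun_eq_iff pr_simps ten_def)
  have "bilinear_on I V W fscale ?b"
    by (rule bilinear_onI)
      (simp_all add: ten_rules cc_rules[OF V] cc_rules[OF W] dif_rules[OF V] dif_rules[OF W] koszul_add algebra_simps
        fscale_add fscale_koszul)
  then have "lin_ext fscale (\<lambda>(i, p, q, v, w). ?b i p q v w) (tn i p q v w) = ?b i p q v w"
    by (rule lift_ten[OF vector_space_fscale]) (metis E_dif e)
  then show ?thesis
    using e by (simp add: tensor_family_def tensor_dif_def)
qed

lemma cochain_complex_T: "cochain_complex T"
proof (rule cochain_complexI)
  interpret fs: vector_space "fscale :: 'b \<Rightarrow> ('a, 'c, 'd, 'b) formal \<Rightarrow> _" by (rule vector_space_fscale)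
  show "vector_space (scl T)" by (simp add: vector_space_fscale)
  fix n
  interpret l: Vector_Spaces.linear "fscale :: 'b \<Rightarrow> ('a, 'c, 'd, 'b) formal \<Rightarrow> _" fscale "dif T n" by (rule linear_dif)
  interpret l1: Vector_Spaces.linear "fscale :: 'b \<Rightarrow> ('a, 'c, 'd, 'b) formal \<Rightarrow> _" fscale "dif T (n + 1)" by (rule linear_dif)
  show "0 \<in> piece T n" using fs.subspace_0[OF subspace_T] .
  fix v
  assume v: "v \<in> piece T n"
  show "w \<in> piece T n \<Longrightarrow> v + w \<in> piece T n" for w using v fs.subspace_add[OF subspace_T] by blast
  show "scl T c v \<in> piece T n" for c using v fs.subspace_scale[OF subspace_T] by simp
  show "dif T n (v + w) = dif T n v + dif T n w" for w by (rule l.add)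
  show "dif T n (scl T c v) = scl T c (dif T n v)" for c by (simp add: l.scale)
  show "dif T n v \<in> piece T (n + 1)"
    using v
  proof (induction rule: piece_induct)
    case (ten i p q v w)
    have "koszul p (tn i p (q + 1) v (dif (W i) q w)) \<in> piece T (n + 1)"
      unfolding koszul_def using ten fs.subspace_neg[OF subspace_T] by (simp add: ten_in cc_dif[OF W])
    then show ?case using ten
      by (simp add: dif_ten ten_in cc_dif[OF V] fs.subspace_add[OF subspace_T])
  qed (simp_all add: l.zero l.add fs.subspace_0[OF subspace_T] fs.subspace_add[OF subspace_T])
  show "dif T (n + 1) (dif T n v) = 0"
    using v
  proof (induction rule: piece_induct)
    \<comment> \<open>The mixed terms dv \<otimes> dw occur with the signs of p and p + 1 and
      cancel.\<close>
    case (ten i p q v w)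
    from ten(1,3,4) show ?case
      by (auto simp add: dif_ten l1.diff l1.add l1.neg koszul_def cc_dif[OF V] cc_dif[OF W] dif_dif[OF V] dif_dif[OF W] ten_rules)
  qed (simp_all add: l.zero l.add l1.zero l1.add)
qed

end

section \<open>Modules, morphisms and homotopy retracts\<close>

lemma bilinear_pairingI:
  assumes "\<And>m n u v. u \<in> piece U m \<Longrightarrow> v \<in> piece V n \<Longrightarrow> b m n u v \<in> piece W (m + n)"
    and "\<And>m n u u' v. u \<in> piece U m \<Longrightarrow> u' \<in> piece U m \<Longrightarrow> v \<in> piece V n \<Longrightarrow> b m n (u + u') v = b m n u v + b m n u' v"
    and "\<And>m n u v v'. u \<in> piece U m \<Longrightarrow> v \<in> piece V n \<Longrightarrow> v' \<in> piece V n \<Longrightarrow> b m n u (v + v') = b m n u v + b m n u v'"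
    and "\<And>m n u v c. u \<in> piece U m \<Longrightarrow> v \<in> piece V n \<Longrightarrow> b m n (scl U c u) v = scl W c (b m n u v)"
    and "\<And>m n u v c. u \<in> piece U m \<Longrightarrow> v \<in> piece V n \<Longrightarrow> b m n u (scl V c v) = scl W c (b m n u v)"
    and "\<And>m n u v. u \<in> piece U m \<Longrightarrow> v \<in> piece V n \<Longrightarrow> dif W (m + n) (b m n u v) =
          b (m + 1) n (dif U m u) v + koszul m (b m (n + 1) u (dif V n v))"
  shows "bilinear_pairing U V W b"
  using assms unfolding bilinear_pairing_def by simp

context
  fixes U :: "('k::field, 'u::ab_group_add) cpx" and V :: "('k, 'v::ab_group_add) cpx"
    and W :: "('k, 'w::ab_group_add) cpx" and b
  assumes b: "bilinear_pairing U V W b"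
begin

lemma bp_in: "u \<in> piece U m \<Longrightarrow> v \<in> piece V n \<Longrightarrow> k = m + n \<Longrightarrow> b m n u v \<in> piece W k"
  using b by (simp add: bilinear_pairing_def)

lemma bp_add_left: "u \<in> piece U m \<Longrightarrow> u' \<in> piece U m \<Longrightarrow> v \<in> piece V n \<Longrightarrow> b m n (u + u') v = b m n u v + b m n u' v"
  using b by (simp add: bilinear_pairing_def)

lemma bp_add_right: "u \<in> piece U m \<Longrightarrow> v \<in> piece V n \<Longrightarrow> v' \<in> piece V n \<Longrightarrow> b m n u (v + v') = b m n u v + b m n u v'"
  using b by (simp add: bilinear_pairing_def)

lemma bp_scl_left: "u \<in> piece U m \<Longrightarrow> v \<in> piece V n \<Longrightarrow> b m n (scl U c u) v = scl W c (b m n u v)"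
  using b by (simp add: bilinear_pairing_def)

lemma bp_scl_right: "u \<in> piece U m \<Longrightarrow> v \<in> piece V n \<Longrightarrow> b m n u (scl V c v) = scl W c (b m n u v)"
  using b by (simp add: bilinear_pairing_def)

lemma bp_dif: "u \<in> piece U m \<Longrightarrow> v \<in> piece V n \<Longrightarrow> k = m + n \<Longrightarrow>
    dif W k (b m n u v) = b (m + 1) n (dif U m u) v + koszul m (b m (n + 1) u (dif V n v))"
  using b by (simp add: bilinear_pairing_def)

lemma bp_zero_left:
  assumes "cochain_complex U" "v \<in> piece V n"
  shows "b m n 0 v = 0"
  using bp_add_left[OF cc_zero cc_zero assms(2)] assms(1) by simp

lemma bp_zero_right:
  assumes "cochain_complex V" "u \<in> piece U m"
  shows "b m n u 0 = 0"
  using bp_add_right[OF assms(2) cc_zero cc_zero] assms(1) by simp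

lemma bp_neg_left:
  assumes "cochain_complex U" "u \<in> piece U m" "v \<in> piece V n"
  shows "b m n (- u) v = - b m n u v"
  using bp_add_left[OF assms(2) cc_neg[OF assms(1,2)] assms(3)] bp_zero_left[OF assms(1,3)]
  by (simp add: eq_neg_iff_add_eq_0 add.commute)

lemma bp_neg_right:
  assumes "cochain_complex V" "u \<in> piece U m" "v \<in> piece V n"
  shows "b m n u (- v) = - b m n u v"
  using bp_add_right[OF assms(2,3) cc_neg[OF assms(1,3)]] bp_zero_right[OF assms(1,2)]
  by (simp add: eq_neg_iff_add_eq_0 add.commute)

lemma bp_diff_left:
  assumes "cochain_complex U" "u \<in> piece U m" "u' \<in> piece U m" "v \<in> piece V n"
  shows "b m n (u - u') v = b m n u v - b m n u' v"
  using bp_add_left[OF assms(2) cc_neg[OF assms(1,3)] assms(4)] bp_neg_left[OF assms(1,3,4)] by simp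

lemma bp_diff_right:
  assumes "cochain_complex V" "u \<in> piece U m" "v \<in> piece V n" "v' \<in> piece V n"
  shows "b m n u (v - v') = b m n u v - b m n u v'"
  using bp_add_right[OF assms(2,3) cc_neg[OF assms(1,4)]] bp_neg_right[OF assms(1,2,4)] by simp

lemma bp_koszul_left:
  assumes "cochain_complex U" "u \<in> piece U m" "v \<in> piece V n"
  shows "b m n (koszul k u) v = koszul k (b m n u v)"
  using bp_neg_left[OF assms] by (simp add: koszul_def)

lemma bp_koszul_right:
  assumes "cochain_complex V" "u \<in> piece U m" "v \<in> piece V n"
  shows "b m n u (koszul k v) = koszul k (b m n u v)"
  using bp_neg_right[OF assms] by (simp add: koszul_def)

end

lemmas bp_left_rules = bp_add_left bp_scl_left bp_zero_left bp_neg_left bp_diff_left bp_koszul_left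
lemmas bp_right_rules = bp_add_right bp_scl_right bp_zero_right bp_neg_right bp_diff_right bp_koszul_right

text \<open>The part of the dg category axioms on which shifts, cones, sums and homotopies of
  modules rest. For a tensor product of dg categories, this is the part that gets
  established.\<close>

definition hom_complexes :: "('o, 'k::field, 'h::ab_group_add) dgcat \<Rightarrow> bool" where
  "hom_complexes C \<longleftrightarrow> (\<forall>x\<in>Obj C. \<forall>y\<in>Obj C. cochain_complex (Hom C x y))"

lemma hom_cc: "hom_complexes C \<Longrightarrow> x \<in> Obj C \<Longrightarrow> y \<in> Obj C \<Longrightarrow> cochain_complex (Hom C x y)"
  by (simp add: hom_complexes_def)

context
  fixes C :: "('o, 'k::field, 'h::ab_group_add) dgcat"
  assumes C: "dg_category C"
begin

lemma dg_category_hom_complexes: "hom_complexes C"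
  using C by (simp add: dg_category_def hom_complexes_def)

lemma cmp_pairing: "x \<in> Obj C \<Longrightarrow> y \<in> Obj C \<Longrightarrow> z \<in> Obj C \<Longrightarrow>
    bilinear_pairing (Hom C y z) (Hom C x y) (Hom C x z) (cmp C x y z)"
  using C by (simp add: dg_category_def)

lemma cmp_assoc: "w \<in> Obj C \<Longrightarrow> x \<in> Obj C \<Longrightarrow> y \<in> Obj C \<Longrightarrow> z \<in> Obj C \<Longrightarrow>
    h \<in> piece (Hom C y z) l \<Longrightarrow> g \<in> piece (Hom C x y) m \<Longrightarrow> f \<in> piece (Hom C w x) n \<Longrightarrow> k = l + m \<Longrightarrow>
    cmp C w x z k n (cmp C x y z l m h g) f = cmp C w y z l (m + n) h (cmp C w x y m n g f)"
  using C by (simp add: dg_category_def)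

lemma idt_in: "x \<in> Obj C \<Longrightarrow> idt C x \<in> piece (Hom C x x) 0"
  using C by (simp add: dg_category_def)

lemma dif_idt: "x \<in> Obj C \<Longrightarrow> dif (Hom C x x) 0 (idt C x) = 0"
  using C by (simp add: dg_category_def)

lemma cmp_idt_left: "x \<in> Obj C \<Longrightarrow> y \<in> Obj C \<Longrightarrow> f \<in> piece (Hom C x y) n \<Longrightarrow> cmp C x y y 0 n (idt C y) f = f"
  using C by (simp add: dg_category_def)

lemma cmp_idt_right: "x \<in> Obj C \<Longrightarrow> y \<in> Obj C \<Longrightarrow> f \<in> piece (Hom C x y) n \<Longrightarrow> cmp C x x y n 0 f (idt C x) = f"
  using C by (simp add: dg_category_def)

end

lemma dg_moduleI:
  assumes "\<And>x. x \<in> Obj C \<Longrightarrow> cochain_complex (sp M x)"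
    and "\<And>x y. x \<in> Obj C \<Longrightarrow> y \<in> Obj C \<Longrightarrow> bilinear_pairing (sp M y) (Hom C x y) (sp M x) (act M x y)"
    and "\<And>x y z l m n v g f. x \<in> Obj C \<Longrightarrow> y \<in> Obj C \<Longrightarrow> z \<in> Obj C \<Longrightarrow>
        v \<in> piece (sp M z) l \<Longrightarrow> g \<in> piece (Hom C y z) m \<Longrightarrow> f \<in> piece (Hom C x y) n \<Longrightarrow>
        act M x y (l + m) n (act M y z l m v g) f = act M x z l (m + n) v (cmp C x y z m n g f)"
    and "\<And>x n v. x \<in> Obj C \<Longrightarrow> v \<in> piece (sp M x) n \<Longrightarrow> act M x x n 0 v (idt C x) = v"
  shows "dg_module C M"
  using assms by (simp add: dg_module_def)

context
  fixes C :: "('o, 'k::field, 'h::ab_group_add) dgcat" and M :: "('o, 'k, 'h, 'm::ab_group_add) dgmod"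
  assumes M: "dg_module C M"
begin

lemma mod_cc: "x \<in> Obj C \<Longrightarrow> cochain_complex (sp M x)"
  using M by (simp add: dg_module_def)

lemma act_pairing: "x \<in> Obj C \<Longrightarrow> y \<in> Obj C \<Longrightarrow> bilinear_pairing (sp M y) (Hom C x y) (sp M x) (act M x y)"
  using M by (simp add: dg_module_def)

lemma act_act: "x \<in> Obj C \<Longrightarrow> y \<in> Obj C \<Longrightarrow> z \<in> Obj C \<Longrightarrow>
    v \<in> piece (sp M z) l \<Longrightarrow> g \<in> piece (Hom C y z) m \<Longrightarrow> f \<in> piece (Hom C x y) n \<Longrightarrow> k = l + m \<Longrightarrow>
    act M x y k n (act M y z l m v g) f = act M x z l (m + n) v (cmp C x y z m n g f)"
  using M by (simp add: dg_module_def)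

lemma act_idt: "x \<in> Obj C \<Longrightarrow> v \<in> piece (sp M x) n \<Longrightarrow> act M x x n 0 v (idt C x) = v"
  using M by (simp add: dg_module_def)

lemmas act_in = bp_in[OF act_pairing]
lemmas act_left_rules = bp_add_left[OF act_pairing] bp_scl_left[OF act_pairing]
  bp_zero_left[OF act_pairing mod_cc] bp_neg_left[OF act_pairing mod_cc]
  bp_diff_left[OF act_pairing mod_cc] bp_koszul_left[OF act_pairing mod_cc]
lemmas act_dif = bp_dif[OF act_pairing]
lemmas mod_cc_rules = cc_rules[OF mod_cc]
lemmas mod_dif_rules = dif_rules[OF mod_cc]

end

context
  fixes C :: "('o, 'k::field, 'h::ab_group_add) dgcat" and M :: "('o, 'k, 'h, 'm::ab_group_add) dgmod"
  assumes M: "dg_module C M" and C: "hom_complexes C"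
begin

lemmas act_right_rules = bp_add_right[OF act_pairing[OF M]] bp_scl_right[OF act_pairing[OF M]]
  bp_zero_right[OF act_pairing[OF M] hom_cc[OF C]] bp_neg_right[OF act_pairing[OF M] hom_cc[OF C]]
  bp_diff_right[OF act_pairing[OF M] hom_cc[OF C]] bp_koszul_right[OF act_pairing[OF M] hom_cc[OF C]]

end

lemma graded_map_iff: "graded_map C M N p f \<longleftrightarrow>
    (\<forall>x\<in>Obj C. graded_linear (sp M x) (sp N x) p (f x)) \<and>
    (\<forall>x\<in>Obj C. \<forall>y\<in>Obj C. \<forall>m n. \<forall>v\<in>piece (sp M y) m. \<forall>a\<in>piece (Hom C x y) n.
       f x (m + n) (act M x y m n v a) = act N x y (m + p) n (f y m v) a)"
  unfolding graded_map_def graded_linear_def by blast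

lemma graded_mapI:
  assumes "\<And>x. x \<in> Obj C \<Longrightarrow> graded_linear (sp M x) (sp N x) p (f x)"
    and "\<And>x y m n v a. x \<in> Obj C \<Longrightarrow> y \<in> Obj C \<Longrightarrow> v \<in> piece (sp M y) m \<Longrightarrow> a \<in> piece (Hom C x y) n \<Longrightarrow>
       f x (m + n) (act M x y m n v a) = act N x y (m + p) n (f y m v) a"
  shows "graded_map C M N p f"
  using assms by (simp add: graded_map_iff)

lemma gm_gl: "graded_map C M N p f \<Longrightarrow> x \<in> Obj C \<Longrightarrow> graded_linear (sp M x) (sp N x) p (f x)"
  by (simp add: graded_map_iff)

lemma gm_act: "graded_map C M N p f \<Longrightarrow> x \<in> Obj C \<Longrightarrow> y \<in> Obj C \<Longrightarrow> v \<in> piece (sp M y) m \<Longrightarrow>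
    a \<in> piece (Hom C x y) n \<Longrightarrow> k = m + n \<Longrightarrow> f x k (act M x y m n v a) = act N x y (m + p) n (f y m v) a"
  by (simp add: graded_map_iff)

lemmas gm_in = gl_in[OF gm_gl]
lemmas gm_add = gl_add[OF gm_gl]
lemmas gm_scl = gl_scl[OF gm_gl]

lemma closed_graded: "closed_morphism C M N f \<Longrightarrow> graded_map C M N 0 f"
  by (simp add: closed_morphism_def)

lemma closed_dif: "closed_morphism C M N f \<Longrightarrow> x \<in> Obj C \<Longrightarrow> v \<in> piece (sp M x) n \<Longrightarrow> m = n + 1 \<Longrightarrow>
    f x m (dif (sp M x) n v) = dif (sp N x) n (f x n v)"
  by (simp add: closed_morphism_def)

lemma closed_morphismI:
  assumes "graded_map C M N 0 f"
    and "\<And>x n v. x \<in> Obj C \<Longrightarrow> v \<in> piece (sp M x) n \<Longrightarrow> f x (n + 1) (dif (sp M x) n v) = dif (sp N x) n (f x n v)"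
  shows "closed_morphism C M N f"
  using assms by (simp add: closed_morphism_def)

lemma closed_in: "closed_morphism C M N f \<Longrightarrow> x \<in> Obj C \<Longrightarrow> v \<in> piece (sp M x) n \<Longrightarrow> f x n v \<in> piece (sp N x) n"
  using gm_in[OF closed_graded, of C M N f x v n n] by simp

lemmas closed_gl = gm_gl[OF closed_graded]
lemmas closed_add = gm_add[OF closed_graded]
lemmas closed_scl = gm_scl[OF closed_graded]

lemma closed_act: "closed_morphism C M N f \<Longrightarrow> x \<in> Obj C \<Longrightarrow> y \<in> Obj C \<Longrightarrow> v \<in> piece (sp M y) m \<Longrightarrow>
    a \<in> piece (Hom C x y) n \<Longrightarrow> k = m + n \<Longrightarrow> f x k (act M x y m n v a) = act N x y m n (f y m v) a"
  using gm_act[OF closed_graded] by simp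

lemma graded_map_comp:
  assumes "graded_map C M N p f" "graded_map C N L q g" "r = p + q"
  shows "graded_map C M L r (\<lambda>x n v. g x (n + p) (f x n v))"
proof (rule graded_mapI)
  fix x assume x: "x \<in> Obj C"
  show "graded_linear (sp M x) (sp L x) r (\<lambda>n v. g x (n + p) (f x n v))"
    by (rule graded_linearI)
      (use x assms in \<open>simp_all add: gm_in[OF assms(1)] gm_in[OF assms(2)] gm_add[OF assms(1)] gm_add[OF assms(2)]
        gm_scl[OF assms(1)] gm_scl[OF assms(2)]\<close>)
next
  fix x y m n v a
  assume "x \<in> Obj C" "y \<in> Obj C" "v \<in> piece (sp M y) m" "a \<in> piece (Hom C x y) n"
  then show "g x (m + n + p) (f x (m + n) (act M x y m n v a)) = act L x y (m + r) n (g y (m + p) (f y m v)) a"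
    using assms(3) by (simp add: gm_act[OF assms(1)] gm_act[OF assms(2)] gm_in[OF assms(1)] algebra_simps)
qed

lemma closed_comp:
  assumes "closed_morphism C M N f" "closed_morphism C N L g"
  shows "closed_morphism C M L (\<lambda>x n v. g x n (f x n v))"
proof (rule closed_morphismI)
  show "graded_map C M L 0 (\<lambda>x n v. g x n (f x n v))"
    using graded_map_comp[OF closed_graded[OF assms(1)] closed_graded[OF assms(2)], of 0] by simp
qed (simp add: closed_dif[OF assms(1)] closed_dif[OF assms(2)] closed_in[OF assms(1)])

lemma closed_id: "closed_morphism C M M (\<lambda>x n v. v)"
  by (rule closed_morphismI, rule graded_mapI, rule graded_linearI) simp_all

lemma graded_zero:
  assumes "dg_module C N" "hom_complexes C"
  shows "graded_map C M N p (\<lambda>x n v. 0)"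
proof (rule graded_mapI, rule graded_linearI)
  fix x c assume x: "x \<in> Obj C"
  show "0 = scl (sp N x) c 0"
  proof -
    interpret vector_space "scl (sp N x)" by (rule cc_vector_space[OF mod_cc[OF assms(1) x]])
    show ?thesis by simp
  qed
qed (simp_all add: mod_cc_rules[OF assms(1)] act_left_rules[OF assms(1)])

lemma graded_add:
  assumes N: "dg_module C N" and f: "graded_map C M N p f" and g: "graded_map C M N p g"
  shows "graded_map C M N p (\<lambda>x n v. f x n v + g x n v)"
proof (rule graded_mapI, rule graded_linearI)
  fix x n v c assume x: "x \<in> Obj C" and v: "v \<in> piece (sp M x) n"
  interpret vector_space "scl (sp N x)" by (rule cc_vector_space[OF mod_cc[OF N x]])
  show "f x n (scl (sp M x) c v) + g x n (scl (sp M x) c v) = scl (sp N x) c (f x n v + g x n v)"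
    using x v by (simp add: gm_scl[OF f] gm_scl[OF g] scale_right_distrib)
qed (simp_all add: gm_in[OF f] gm_in[OF g] gm_add[OF f] gm_add[OF g] mod_cc_rules[OF N]
    gm_act[OF f] gm_act[OF g] act_left_rules[OF N])

section \<open>Strict isomorphisms and homotopy retracts\<close>

definition dg_iso ::
  "('o, 'k::field, 'h::ab_group_add) dgcat \<Rightarrow> ('o, 'k, 'h, 'm::ab_group_add) dgmod
   \<Rightarrow> ('o, 'k, 'h, 'n::ab_group_add) dgmod \<Rightarrow> ('o \<Rightarrow> int \<Rightarrow> 'm \<Rightarrow> 'n) \<Rightarrow> ('o \<Rightarrow> int \<Rightarrow> 'n \<Rightarrow> 'm) \<Rightarrow> bool" where
  "dg_iso C M N f g \<longleftrightarrow> dg_module C M \<and> dg_module C N \<and> closed_morphism C M N f \<and> closed_morphism C N M g \<and>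
     (\<forall>x\<in>Obj C. \<forall>n. \<forall>v\<in>piece (sp M x) n. g x n (f x n v) = v) \<and>
     (\<forall>x\<in>Obj C. \<forall>n. \<forall>w\<in>piece (sp N x) n. f x n (g x n w) = w)"

lemma dg_isoD:
  assumes "dg_iso C M N f g"
  shows "dg_module C M" "dg_module C N" "closed_morphism C M N f" "closed_morphism C N M g"
    "\<And>x n v. x \<in> Obj C \<Longrightarrow> v \<in> piece (sp M x) n \<Longrightarrow> g x n (f x n v) = v"
    "\<And>x n w. x \<in> Obj C \<Longrightarrow> w \<in> piece (sp N x) n \<Longrightarrow> f x n (g x n w) = w"
  using assms by (simp_all add: dg_iso_def)

text \<open>Only \<open>f\<close> has to be checked. Linearity, compatibility with the action and
  closedness of \<open>g\<close> follow by writing its arguments as values of \<open>f\<close> and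
  cancelling.\<close>

lemma dg_isoI:
  assumes M: "dg_module C M" and N: "dg_module C N" and f: "closed_morphism C M N f"
    and g: "\<And>x n w. x \<in> Obj C \<Longrightarrow> w \<in> piece (sp N x) n \<Longrightarrow> g x n w \<in> piece (sp M x) n"
    and gf: "\<And>x n v. x \<in> Obj C \<Longrightarrow> v \<in> piece (sp M x) n \<Longrightarrow> g x n (f x n v) = v"
    and fg: "\<And>x n w. x \<in> Obj C \<Longrightarrow> w \<in> piece (sp N x) n \<Longrightarrow> f x n (g x n w) = w"
  shows "dg_iso C M N f g"
proof -
  have "closed_morphism C N M g"
  proof (rule closed_morphismI, rule graded_mapI, rule graded_linearI)
    fix x n v w c assume x: "x \<in> Obj C" and v: "v \<in> piece (sp N x) n"
    note vx = v g[OF x v]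
    show "g x n v \<in> piece (sp M x) (n + 0)" using vx by simp
    show "g x n (v + w) = g x n v + g x n w" if w: "w \<in> piece (sp N x) n"
      using gf[OF x cc_add[OF mod_cc[OF M x] g[OF x v] g[OF x w]]] x v w
      by (simp add: closed_add[OF f] fg g)
    show "g x n (scl (sp N x) c v) = scl (sp M x) c (g x n v)"
      using gf[OF x cc_scl[OF mod_cc[OF M x] g[OF x v]], of c] x v
      by (simp add: closed_scl[OF f] fg g)
    show "g x (n + 1) (dif (sp N x) n v) = dif (sp M x) n (g x n v)"
      using gf[OF x cc_dif[OF mod_cc[OF M x] g[OF x v]], of "n + 1"] x v
      by (simp add: closed_dif[OF f] fg g)
  next
    fix x y m n v a
    assume *: "x \<in> Obj C" "y \<in> Obj C" "v \<in> piece (sp N y) m" "a \<in> piece (Hom C x y) n"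
    have "act M x y m n (g y m v) a \<in> piece (sp M x) (m + n)"
      using * by (simp add: act_in[OF M] g)
    then show "g x (m + n) (act N x y m n v a) = act M x y (m + 0) n (g y m v) a"
      using gf[of x "act M x y m n (g y m v) a" "m + n"] *
      by (simp add: closed_act[OF f] fg g)
  qed
  then show ?thesis using assms by (simp add: dg_iso_def)
qed

lemma dg_iso_sym: "dg_iso C M N f g \<Longrightarrow> dg_iso C N M g f"
  by (auto simp: dg_iso_def)

lemma dg_iso_trans:
  assumes "dg_iso C M N f g" "dg_iso C N L f' g'"
  shows "dg_iso C M L (\<lambda>x n v. f' x n (f x n v)) (\<lambda>x n v. g x n (g' x n v))"
  using assms unfolding dg_iso_def by (auto intro: closed_comp simp: closed_in)

lemma homotopicI:
  assumes "graded_map C M N (-1) h"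
    and "\<And>x n v. x \<in> Obj C \<Longrightarrow> v \<in> piece (sp M x) n \<Longrightarrow>
      f x n v - g x n v = dif (sp N x) (n - 1) (h x n v) + h x (n + 1) (dif (sp M x) n v)"
  shows "homotopic C M N f g"
  using assms by (auto simp: homotopic_def)

lemma homotopic_eq:
  assumes "dg_module C N" "hom_complexes C"
    and "\<And>x n v. x \<in> Obj C \<Longrightarrow> v \<in> piece (sp M x) n \<Longrightarrow> f x n v = g x n v"
  shows "homotopic C M N f g"
  by (rule homotopicI[OF graded_zero[OF assms(1,2)]])
    (simp add: assms(3) mod_dif_rules[OF assms(1)])

lemma homotopy_retractI:
  assumes "dg_module C N" "dg_module C M" "closed_morphism C N M i" "closed_morphism C M N p"
    "homotopic C N N (\<lambda>x n v. p x n (i x n v)) (\<lambda>x n v. v)"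
  shows "homotopy_retract C N M"
  unfolding homotopy_retract_def using assms by blast

lemma strict_retract:
  assumes "hom_complexes C" "dg_module C N" "dg_module C M" "closed_morphism C N M i" "closed_morphism C M N p"
    "\<And>x n v. x \<in> Obj C \<Longrightarrow> v \<in> piece (sp N x) n \<Longrightarrow> p x n (i x n v) = v"
  shows "homotopy_retract C N M"
  by (rule homotopy_retractI[OF assms(2-5)], rule homotopic_eq[OF assms(2,1,6)])

lemma iso_retract: "hom_complexes C \<Longrightarrow> dg_iso C N M f g \<Longrightarrow> homotopy_retract C N M"
  unfolding dg_iso_def by (rule strict_retract) auto

lemma iso_equivalent: "hom_complexes C \<Longrightarrow> dg_iso C N M f g \<Longrightarrow> homotopy_equivalent C N M"
  unfolding dg_iso_def homotopy_equivalent_def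
  by (intro conjI exI[of _ f] exI[of _ g] homotopic_eq) auto

lemma equivalent_retract: "homotopy_equivalent C N M \<Longrightarrow> homotopy_retract C N M"
  unfolding homotopy_retract_def homotopy_equivalent_def by blast

lemma retract_trans:
  assumes "homotopy_retract C A B" "homotopy_retract C B D"
  shows "homotopy_retract C A D"
proof -
  from assms obtain i p h i' p' h' where A: "dg_module C A" and B: "dg_module C B" and D: "dg_module C D"
    and i: "closed_morphism C A B i" and p: "closed_morphism C B A p"
    and i': "closed_morphism C B D i'" and p': "closed_morphism C D B p'"
    and h: "graded_map C A A (-1) h" and h': "graded_map C B B (-1) h'"
    and ih: "\<And>x n v. x \<in> Obj C \<Longrightarrow> v \<in> piece (sp A x) n \<Longrightarrow>
      p x n (i x n v) - v = dif (sp A x) (n - 1) (h x n v) + h x (n + 1) (dif (sp A x) n v)"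
    and ih': "\<And>x n v. x \<in> Obj C \<Longrightarrow> v \<in> piece (sp B x) n \<Longrightarrow>
      p' x n (i' x n v) - v = dif (sp B x) (n - 1) (h' x n v) + h' x (n + 1) (dif (sp B x) n v)"
    unfolding homotopy_retract_def homotopic_def by metis
  \<comment> \<open>The defect p (p' i' - 1) i of the inner retraction is the boundary of p h' i;
    adding h accounts for the remaining p i - 1.\<close>
  let ?k = "\<lambda>x n v. p x (n - 1) (h' x n (i x n v))"
  have k: "graded_map C A A (-1) ?k"
    using graded_map_comp[OF graded_map_comp[OF closed_graded[OF i] h' refl] closed_graded[OF p], of "-1"]
    by simp
  show ?thesis
  proof (rule homotopy_retractI[OF A D closed_comp[OF i i'] closed_comp[OF p' p]], rule homotopicI[OF graded_add[OF A h k]])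
    fix x n v assume x: "x \<in> Obj C" and v: "v \<in> piece (sp A x) n"
    have iv: "i x n v \<in> piece (sp B x) n" using closed_in[OF i x v] .
    have "p x n (p' x n (i' x n (i x n v)) - i x n v) = p x n (dif (sp B x) (n - 1) (h' x n (i x n v)) + h' x (n + 1) (dif (sp B x) n (i x n v)))"
      using ih'[OF x iv] by simp
    moreover have "h' x n (i x n v) \<in> piece (sp B x) (n - 1)" using gm_in[OF h' x iv] by simp
    moreover have "h' x (n + 1) (dif (sp B x) n (i x n v)) \<in> piece (sp B x) n"
      using x iv by (intro gm_in[OF h']) (auto intro: mod_cc_rules(7)[OF B])
    ultimately have "p x n (p' x n (i' x n (i x n v))) - p x n (i x n v) =
        dif (sp A x) (n - 1) (?k x n v) + ?k x (n + 1) (dif (sp A x) n v)"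
      using x v iv closed_in[OF i' x iv]
      by (simp add: gl_diff[OF closed_gl[OF p x] mod_cc[OF B x]] closed_add[OF p] mod_cc_rules[OF B] closed_in[OF p'] closed_in[OF i']
          closed_dif[OF p] closed_dif[OF i])
    moreover have "h x n v \<in> piece (sp A x) (n - 1)" "?k x n v \<in> piece (sp A x) (n - 1)"
      using gm_in[OF h x v] gm_in[OF k x v] by simp_all
    ultimately show "p x n (p' x n (i' x n (i x n v))) - v =
        dif (sp A x) (n - 1) (h x n v + ?k x n v) + (h x (n + 1) (dif (sp A x) n v) + ?k x (n + 1) (dif (sp A x) n v))"
      using ih[OF x v] x by (simp add: mod_dif_rules[OF A] algebra_simps)
  qed
qed

section \<open>Shifts, cones and direct sums\<close>

lemma shift_cpx_simps [simp]:
  "piece (shift_cpx k V) n = piece V (n + k)" "scl (shift_cpx k V) = scl V"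
  "dif (shift_cpx k V) n v = koszul k (dif V (n + k) v)"
  by (simp_all add: shift_cpx_def)

lemma shift_mod_simps [simp]:
  "sp (shift_mod k M) x = shift_cpx k (sp M x)" "act (shift_mod k M) x y m n = act M x y (m + k) n"
  by (simp_all add: shift_mod_def)

lemma koszul_scl: "vector_space s \<Longrightarrow> s c (koszul k v) = koszul k (s c v)"
proof -
  assume "vector_space s"
  then interpret vector_space s .
  show ?thesis by (simp add: koszul_def)
qed

lemma cochain_complex_shift:
  assumes V: "cochain_complex V"
  shows "cochain_complex (shift_cpx k V)"
  by (rule cochain_complexI)
    (simp_all add: cc_vector_space[OF V] cc_rules[OF V] dif_rules[OF V] dif_dif[OF V] koszul_add
      koszul_scl[OF cc_vector_space[OF V]])

lemma dg_module_shift: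
  assumes M: "dg_module C M" "hom_complexes C"
  shows "dg_module C (shift_mod k M)"
proof (rule dg_moduleI, goal_cases)
  case (1 x)
  then show ?case by (simp add: cochain_complex_shift mod_cc[OF M(1)])
next
  case (2 x y)
  show ?case
  proof (rule bilinear_pairingI, goal_cases)
    case (6 m n u v)
    then show ?case using 2
      by (simp add: act_dif[OF M(1)] act_left_rules[OF M(1)] mod_cc_rules[OF M(1)] koszul_def ac_simps)
  qed (use 2 in \<open>simp_all add: act_in[OF M(1)] act_left_rules[OF M(1)] act_right_rules[OF M]\<close>)
qed (simp_all add: act_act[OF M(1)] act_idt[OF M(1)])

lemma cone_cpx_simps [simp]:
  "piece (cone_cpx V W f) n = piece W n \<times> piece V (n + 1)"
  "scl (cone_cpx V W f) c u = (scl W c (fst u), scl V c (snd u))"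
  "dif (cone_cpx V W f) n u = (dif W n (fst u) + f (n + 1) (snd u), - dif V (n + 1) (snd u))"
  by (simp_all add: cone_cpx_def case_prod_beta)

lemma cone_simps [simp]:
  "sp (cone M N f) x = cone_cpx (sp M x) (sp N x) (f x)"
  "act (cone M N f) x y m n u a = (act N x y m n (fst u) a, act M x y (m + 1) n (snd u) a)"
  by (simp_all add: cone_def case_prod_beta)

lemma vector_space_pair: 
  assumes "vector_space s" "vector_space t"
  shows "vector_space (\<lambda>c u. (s c (fst u), t c (snd u)))"
proof -
  interpret s: vector_space s by fact
  interpret t: vector_space t by fact
  show ?thesis
    by unfold_locales (simp_all add: s.scale_right_distrib t.scale_right_distrib s.scale_left_distrib t.scale_left_distrib)
qed

lemma scl_cone: "scl (cone_cpx V W f) = (\<lambda>c u. (scl W c (fst u), scl V c (snd u)))"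
  by (simp add: fun_eq_iff)

lemma scl_add: "cochain_complex V \<Longrightarrow> scl V c (v + w) = scl V c v + scl V c w"
proof -
  assume V: "cochain_complex V"
  interpret vector_space "scl V" by (rule cc_vector_space[OF V])
  show ?thesis by (rule scale_right_distrib)
qed

lemma scl_neg: "cochain_complex V \<Longrightarrow> scl V c (- v) = - scl V c v"
proof -
  assume V: "cochain_complex V"
  interpret vector_space "scl V" by (rule cc_vector_space[OF V])
  show ?thesis by simp
qed

lemma cochain_complex_cone:
  assumes V: "cochain_complex V" and W: "cochain_complex W" and f: "graded_linear V W 0 f"
    and fd: "\<And>n m v. v \<in> piece V n \<Longrightarrow> m = n + 1 \<Longrightarrow> f m (dif V n v) = dif W n (f n v)"
  shows "cochain_complex (cone_cpx V W f)"
proof (rule cochain_complexI, goal_cases)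
  case 1
  then show ?case unfolding scl_cone by (rule vector_space_pair[OF cc_vector_space[OF W] cc_vector_space[OF V]])
qed (auto simp: cc_rules[OF V] cc_rules[OF W] dif_rules[OF V] dif_rules[OF W] dif_dif[OF V] dif_dif[OF W]
    gl_rules[OF f] gl_neg[OF f V] gl_zero[OF f V] gl_in[OF f] fd scl_add[OF W] scl_neg[OF V] zero_prod_def)

lemma dg_module_cone:
  assumes M: "dg_module C M" and N: "dg_module C N" and f: "closed_morphism C M N f" and C: "hom_complexes C"
  shows "dg_module C (cone M N f)"
proof (rule dg_moduleI, goal_cases)
  case (1 x)
  then show ?case
    by (simp add: cochain_complex_cone mod_cc[OF M] mod_cc[OF N] closed_gl[OF f] closed_dif[OF f])
next
  case (2 x y)
  show ?case
  proof (rule bilinear_pairingI, goal_cases)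
    case (6 m n u v)
    \<comment> \<open>The second component has degree m + 1, so its Leibniz sign is opposite to that
      of the first; this is compensated by the negated differential on the source.\<close>
    have "koszul (m + 1) w = - koszul m w" for w :: 'd by (simp add: koszul_def)
    moreover have "koszul m (w, w') = (koszul m w, koszul m w')" for w :: 'e and w' :: 'd by (simp add: koszul_def)
    ultimately show ?case using 2 6
      by (auto simp: act_dif[OF M] act_dif[OF N] act_left_rules[OF M] act_left_rules[OF N] mod_cc_rules[OF M] mod_cc_rules[OF N]
          closed_act[OF f] closed_in[OF f] koszul_add koszul_koszul algebra_simps)
  qed (use 2 in \<open>auto simp: act_in[OF M] act_left_rules[OF M] act_right_rules[OF M C]
     act_in[OF N] act_left_rules[OF N] act_right_rules[OF N C]\<close>)
qed (auto simp: act_act[OF M] act_idt[OF M] act_act[OF N] act_idt[OF N])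

lemma dsum_cpx_simps [simp]:
  "s \<in> piece (dsum_cpx V) n \<longleftrightarrow> (\<forall>j. s j \<in> piece (V j) n) \<and> finite {j. s j \<noteq> 0}"
  "scl (dsum_cpx V) c s = (\<lambda>j. scl (V j) c (s j))"
  "dif (dsum_cpx V) n s = (\<lambda>j. dif (V j) n (s j))"
  by (simp_all add: dsum_cpx_def)

lemma dsum_mod_simps [simp]:
  "sp (dsum_mod M) x = dsum_cpx (\<lambda>j. sp (M j) x)"
  "act (dsum_mod M) x y m n s a = (\<lambda>j. act (M j) x y m n (s j) a)"
  by (simp_all add: dsum_mod_def)

lemma finite_support_mono:
  assumes "finite {j. s j \<noteq> 0}" "\<And>j. s j = 0 \<Longrightarrow> t j = 0"
  shows "finite {j. t j \<noteq> 0}"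
  by (rule finite_subset[OF _ assms(1)]) (use assms(2) in auto)

lemma finite_support_add:
  fixes s t :: "'j \<Rightarrow> 'v::ab_group_add"
  assumes "finite {j. s j \<noteq> 0}" "finite {j. t j \<noteq> 0}"
  shows "finite {j. s j + t j \<noteq> 0}"
  by (rule finite_subset[OF _ finite_UnI[OF assms]]) auto

lemma vector_space_fun:
  assumes "\<And>j. vector_space (s j)"
  shows "vector_space (\<lambda>c v j. s j c (v j))"
proof -
  interpret s: vector_space "s j" for j by fact
  show ?thesis
    by unfold_locales (simp_all add: fun_eq_iff s.scale_right_distrib s.scale_left_distrib)
qed

lemma scl_dsum: "scl (dsum_cpx V) = (\<lambda>c s j. scl (V j) c (s j))"
  by (simp add: fun_eq_iff)

lemma cochain_complex_dsum:
  assumes V: "\<And>j. cochain_complex (V j)"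
  shows "cochain_complex (dsum_cpx V)"
proof (rule cochain_complexI, goal_cases)
  case 1
  then show ?case unfolding scl_dsum by (rule vector_space_fun[OF cc_vector_space[OF V]])
next
  case (3 n v w)
  then show ?case by (simp add: cc_rules[OF V] finite_support_add)
next
  case (4 n v c)
  have "scl (V j) c 0 = 0" for j using scl_add[OF V, of j c 0 0] by simp
  then show ?case using 4
    by (auto simp: cc_rules[OF V] intro: finite_support_mono[of v])
next
  case (5 n v)
  then show ?case by (auto simp: cc_rules[OF V] dif_rules[OF V] intro: finite_support_mono[of v])
qed (simp_all add: cc_rules[OF V] dif_rules[OF V] dif_dif[OF V] fun_eq_iff)

lemma dg_module_dsum:
  assumes M: "\<And>j. dg_module C (M j)" and C: "hom_complexes C"
  shows "dg_module C (dsum_mod M)"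
proof (rule dg_moduleI, goal_cases)
  case (1 x)
  then show ?case by (simp add: cochain_complex_dsum mod_cc[OF M])
next
  case (2 x y)
  show ?case
  proof (rule bilinear_pairingI, goal_cases)
    case (1 m n u v)
    then show ?case using 2
      by (auto simp: act_in[OF M] act_left_rules[OF M] intro: finite_support_mono[of u])
  next
    case (6 m n u v)
    then show ?case using 2
      by (auto simp: act_dif[OF M] koszul_def fun_eq_iff)
  qed (use 2 in \<open>auto simp: act_left_rules[OF M] act_right_rules[OF M C] fun_eq_iff\<close>)
qed (auto simp: act_act[OF M] act_idt[OF M] fun_eq_iff)

section \<open>Tensor products of two complexes\<close>

abbreviation tns ::
  "('k::field, 'v::ab_group_add) cpx \<Rightarrow> ('k, 'w::ab_group_add) cpx \<Rightarrow> int \<Rightarrow> int \<Rightarrow> 'v \<Rightarrow> 'w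
   \<Rightarrow> (unit, 'v, 'w, 'k) formal" where
  "tns V W p q v w \<equiv> ten UNIV (\<lambda>_. V) (\<lambda>_. W) {} () p q v w"

abbreviation bilin ::
  "('k::field, 'v::ab_group_add) cpx \<Rightarrow> ('k, 'w::ab_group_add) cpx \<Rightarrow> ('k \<Rightarrow> 'z::ab_group_add \<Rightarrow> 'z)
   \<Rightarrow> (int \<Rightarrow> int \<Rightarrow> 'v \<Rightarrow> 'w \<Rightarrow> 'z) \<Rightarrow> bool" where
  "bilin V W s b \<equiv> bilinear_on (UNIV :: unit set) (\<lambda>_. V) (\<lambda>_. W) s (\<lambda>_. b)"

lemma linear_tproj: "Vector_Spaces.linear fscale fscale (tproj V W)"
  unfolding tensor_proj_def
proof (rule quot_proj)
  interpret vector_space fscale by (rule vector_space_fscale)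
  show "module.subspace fscale (span (bilinear_rels UNIV (\<lambda>_. V) (\<lambda>_. W) \<union> {}))" by simp
qed

lemma tproj_koszul: "tproj V W (koszul k t) = koszul k (tproj V W t)"
proof -
  interpret l: Vector_Spaces.linear fscale fscale "tproj V W" by (rule linear_tproj)
  show ?thesis by (simp add: koszul_def l.neg)
qed

lemma tproj_gen: "tproj V W (gen () p q v w) = tns V W p q v w"
  by (simp add: ten_def)

context
  fixes V :: "('k::field, 'v::ab_group_add) cpx" and W :: "('k, 'w::ab_group_add) cpx"
  assumes V: "cochain_complex V" and W: "cochain_complex W"
begin

interpretation tensor_complex "UNIV :: unit set" "\<lambda>_. V" "\<lambda>_. W" "{}"
  by unfold_locales (simp_all add: V W)

lemmas tns_rules = ten_rules[where i="()", simplified]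
lemmas tns_in = ten_in[where i="()", simplified]
lemmas tns_dif = dif_ten[where i="()", simplified]
lemmas cochain_complex_tensor = cochain_complex_T

lemma tns_lift:
  assumes "vector_space s" "bilin V W s b"
  shows "lin_ext s (\<lambda>(_, p, q, v, w). b p q v w) (tns V W p q v w) = b p q v w"
  using lift_ten[OF assms] by simp

lemma tensor_dif_add: "dif (tensor_cpx V W) n (s + t) = dif (tensor_cpx V W) n s + dif (tensor_cpx V W) n t"
  and tensor_dif_zero: "dif (tensor_cpx V W) n 0 = 0"
  and tensor_dif_neg: "dif (tensor_cpx V W) n (- s) = - dif (tensor_cpx V W) n s"
  and tensor_dif_diff: "dif (tensor_cpx V W) n (s - t) = dif (tensor_cpx V W) n s - dif (tensor_cpx V W) n t"
proof -
  interpret l: Vector_Spaces.linear fscale fscale "dif (tensor_cpx V W) n" by (rule linear_dif)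
  show "dif (tensor_cpx V W) n (s + t) = dif (tensor_cpx V W) n s + dif (tensor_cpx V W) n t"
    "dif (tensor_cpx V W) n 0 = 0" "dif (tensor_cpx V W) n (- s) = - dif (tensor_cpx V W) n s"
    "dif (tensor_cpx V W) n (s - t) = dif (tensor_cpx V W) n s - dif (tensor_cpx V W) n t"
    by (simp_all add: l.add l.zero l.neg l.diff)
qed

end

lemma tensor_induct [consumes 3, case_names ten zero add]:
  assumes V: "cochain_complex V" and W: "cochain_complex W" and t: "t \<in> piece (tensor_cpx V W) n"
    and ten: "\<And>p q v w. n = p + q \<Longrightarrow> v \<in> piece V p \<Longrightarrow> w \<in> piece W q \<Longrightarrow> P (tns V W p q v w)"
    and zero: "P 0"
    and add: "\<And>s t. s \<in> piece (tensor_cpx V W) n \<Longrightarrow> t \<in> piece (tensor_cpx V W) n \<Longrightarrow> P s \<Longrightarrow> P t \<Longrightarrow> P (s + t)"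
  shows "P t"
proof -
  interpret tensor_complex "UNIV :: unit set" "\<lambda>_. V" "\<lambda>_. W" "{}"
    by unfold_locales (simp_all add: V W)
  show ?thesis using t by (rule piece_induct) (use ten zero add in auto)
qed

text \<open>Additivity of both maps suffices because pure tensors generate a piece already as an
  abelian group.\<close>

lemma tensor_eqI [consumes 3, case_names ten left right]:
  assumes "cochain_complex V" "cochain_complex W" "t \<in> piece (tensor_cpx V W) n"
    and "\<And>p q v w. n = p + q \<Longrightarrow> v \<in> piece V p \<Longrightarrow> w \<in> piece W q \<Longrightarrow> f (tns V W p q v w) = g (tns V W p q v w)"
    and f: "\<And>s t. s \<in> piece (tensor_cpx V W) n \<Longrightarrow> t \<in> piece (tensor_cpx V W) n \<Longrightarrow> f (s + t) = f s + f t"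
    and g: "\<And>s t. s \<in> piece (tensor_cpx V W) n \<Longrightarrow> t \<in> piece (tensor_cpx V W) n \<Longrightarrow> g (s + t) = g s + g t"
  shows "f t = (g t :: 'z::ab_group_add)"
  using assms(1-3)
proof (induction rule: tensor_induct)
  case zero
  note z = cc_zero[OF cochain_complex_tensor[OF assms(1,2)], of n]
  show ?case using f[OF z z] g[OF z z] by simp
qed (use assms in simp_all)

lemmas tensor_dif_rules = tensor_dif_add tensor_dif_zero tensor_dif_neg tensor_dif_diff

lemma scl_tensor [simp]: "scl (tensor_family I V W E) = fscale"
  by (simp add: tensor_family_def)

text \<open>No Koszul sign is built in. \<open>ext_map\<close> and \<open>vmap\<close> put it into
  the left map; the sign-free form is the right one for the action on \<open>vtens\<close>, where
  the acting element stands to the right of both factors.\<close>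

definition tensor_map ::
  "('k::field, 'v'::ab_group_add) cpx \<Rightarrow> ('k, 'w'::ab_group_add) cpx \<Rightarrow> int \<Rightarrow> int
   \<Rightarrow> (int \<Rightarrow> 'v \<Rightarrow> 'v') \<Rightarrow> (int \<Rightarrow> 'w \<Rightarrow> 'w') \<Rightarrow> (unit, 'v, 'w, 'k) formal \<Rightarrow> (unit, 'v', 'w', 'k) formal" where
  "tensor_map V' W' a b \<phi> \<psi> t = tproj V' W' (lext (\<lambda>(_, p, q, v, w). gen () (p + a) (q + b) (\<phi> p v) (\<psi> q w)) t)"

lemma tensor_map_eq: "tensor_map V' W' a b \<phi> \<psi> t
    = lin_ext fscale (\<lambda>(_, p, q, v, w). tns V' W' (p + a) (q + b) (\<phi> p v) (\<psi> q w)) t"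
  by (simp add: tensor_map_def lext_eq_lin_ext linear_comp_lin_ext[OF vector_space_fscale linear_tproj]
      case_prod_unfold tproj_gen)

lemma tensor_map_add: "tensor_map V' W' a b \<phi> \<psi> (s + t) = tensor_map V' W' a b \<phi> \<psi> s + tensor_map V' W' a b \<phi> \<psi> t"
  and tensor_map_zero: "tensor_map V' W' a b \<phi> \<psi> 0 = 0"
  and tensor_map_neg: "tensor_map V' W' a b \<phi> \<psi> (- t) = - tensor_map V' W' a b \<phi> \<psi> t"
  and tensor_map_diff: "tensor_map V' W' a b \<phi> \<psi> (s - t) = tensor_map V' W' a b \<phi> \<psi> s - tensor_map V' W' a b \<phi> \<psi> t"
  and tensor_map_koszul: "tensor_map V' W' a b \<phi> \<psi> (koszul k t) = koszul k (tensor_map V' W' a b \<phi> \<psi> t)"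
  and tensor_map_scl: "tensor_map V' W' a b \<phi> \<psi> (fscale c t) = fscale c (tensor_map V' W' a b \<phi> \<psi> t)"
  by (simp_all add: tensor_map_eq lin_ext_rules[OF vector_space_fscale])

lemmas tensor_map_rules = tensor_map_add tensor_map_zero tensor_map_neg tensor_map_diff tensor_map_koszul

context
  fixes V :: "('k::field, 'v::ab_group_add) cpx" and W :: "('k, 'w::ab_group_add) cpx"
    and V' :: "('k::field, 'v'::ab_group_add) cpx" and W' :: "('k, 'w'::ab_group_add) cpx"
    and a b :: int and \<phi> \<psi>
  assumes V: "cochain_complex V" and W: "cochain_complex W"
    and V': "cochain_complex V'" and W': "cochain_complex W'"
    and \<phi>: "graded_linear V V' a \<phi>" and \<psi>: "graded_linear W W' b \<psi>"
begin

lemma tensor_map_tns: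
  assumes "v \<in> piece V p" "w \<in> piece W q"
  shows "tensor_map V' W' a b \<phi> \<psi> (tns V W p q v w) = tns V' W' (p + a) (q + b) (\<phi> p v) (\<psi> q w)"
  unfolding tensor_map_eq
  by (rule tns_lift[OF V W vector_space_fscale], rule bilinear_onI)
    (simp_all add: gl_rules[OF \<phi>] gl_rules[OF \<psi>] gl_in[OF \<phi>] gl_in[OF \<psi>] tns_rules[OF V' W'])

lemma tensor_map_in:
  assumes "t \<in> piece (tensor_cpx V W) n" "m = n + a + b"
  shows "tensor_map V' W' a b \<phi> \<psi> t \<in> piece (tensor_cpx V' W') m"
  using V W assms(1)
proof (induction rule: tensor_induct)
  case (ten p q v w)
  then show ?case using assms(2)
    by (simp add: tensor_map_tns tns_in[OF V' W'] gl_in[OF \<phi>] gl_in[OF \<psi>])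
qed (simp_all add: tensor_map_rules cc_rules[OF cochain_complex_tensor[OF V' W']])

lemma tensor_map_gl: "c = a + b \<Longrightarrow> graded_linear (tensor_cpx V W) (tensor_cpx V' W') c (\<lambda>n. tensor_map V' W' a b \<phi> \<psi>)"
  by (rule graded_linearI) (simp_all add: tensor_map_in tensor_map_rules tensor_map_scl)

end

text \<open>The rule (v \<otimes> w)(f \<otimes> g) = (-1)^(|w||f|) vf \<otimes> wg, isolated
  because it is both the composition of a tensor product of categories and the action on an exterior
  product.\<close>

definition tensor_pair ::
  "('k::field, 'u::ab_group_add) cpx \<Rightarrow> ('k, 'v::ab_group_add) cpx
   \<Rightarrow> (int \<Rightarrow> int \<Rightarrow> 'u1 \<Rightarrow> 'h1 \<Rightarrow> 'u) \<Rightarrow> (int \<Rightarrow> int \<Rightarrow> 'u2 \<Rightarrow> 'h2 \<Rightarrow> 'v)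
   \<Rightarrow> (unit, 'u1, 'u2, 'k) formal \<Rightarrow> (unit, 'h1, 'h2, 'k) formal \<Rightarrow> (unit, 'u, 'v, 'k) formal" where
  "tensor_pair Z1 Z2 \<beta>1 \<beta>2 s t = tproj Z1 Z2
     (lext2 (\<lambda>(_, p, q, v, w) (_, r, s, f, g). koszul (q * r) (gen () (p + r) (q + s) (\<beta>1 p r v f) (\<beta>2 q s w g))) s t)"

lemma tensor_pair_eq: "tensor_pair Z1 Z2 \<beta>1 \<beta>2 s t =
   lin_ext fscale (\<lambda>(_, p, q, v, w). lin_ext fscale
     (\<lambda>(_, r, s, f, g). koszul (q * r) (tns Z1 Z2 (p + r) (q + s) (\<beta>1 p r v f) (\<beta>2 q s w g))) t) s"
  by (simp add: tensor_pair_def lext2_def lext_eq_lin_ext linear_comp_lin_ext[OF vector_space_fscale linear_tproj]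
      case_prod_unfold tproj_gen tproj_koszul)

lemma lin_ext_fun_add:
  assumes "vector_space s"
  shows "lin_ext s (\<lambda>g. b g + b' g) t = lin_ext s b t + lin_ext s b' t"
proof -
  interpret vector_space s by fact
  show ?thesis by (simp add: lin_ext_def scale_right_distrib sum.distrib)
qed

lemma lin_ext_fun_zero:
  assumes "vector_space s"
  shows "lin_ext s (\<lambda>g. 0) t = 0"
proof -
  interpret vector_space s by fact
  show ?thesis by (simp add: lin_ext_def)
qed

lemma lin_ext_fun_scl:
  assumes "vector_space s"
  shows "lin_ext s (\<lambda>g. s c (b g)) t = s c (lin_ext s b t)"
proof -
  interpret vector_space s by fact
  show ?thesis by (simp add: lin_ext_def scale_sum_right mult.commute)
qed

lemma tensor_pair_add_left: "tensor_pair Z1 Z2 \<beta>1 \<beta>2 (s + s') t = tensor_pair Z1 Z2 \<beta>1 \<beta>2 s t + tensor_pair Z1 Z2 \<beta>1 \<beta>2 s' t"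
  and tensor_pair_zero_left: "tensor_pair Z1 Z2 \<beta>1 \<beta>2 0 t = 0"
  and tensor_pair_neg_left: "tensor_pair Z1 Z2 \<beta>1 \<beta>2 (- s) t = - tensor_pair Z1 Z2 \<beta>1 \<beta>2 s t"
  and tensor_pair_scl_left: "tensor_pair Z1 Z2 \<beta>1 \<beta>2 (fscale c s) t = fscale c (tensor_pair Z1 Z2 \<beta>1 \<beta>2 s t)"
  by (simp_all add: tensor_pair_eq lin_ext_rules[OF vector_space_fscale])

lemma tensor_pair_add_right: "tensor_pair Z1 Z2 \<beta>1 \<beta>2 s (t + t') = tensor_pair Z1 Z2 \<beta>1 \<beta>2 s t + tensor_pair Z1 Z2 \<beta>1 \<beta>2 s t'"
  and tensor_pair_zero_right: "tensor_pair Z1 Z2 \<beta>1 \<beta>2 s 0 = 0"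
  and tensor_pair_scl_right: "tensor_pair Z1 Z2 \<beta>1 \<beta>2 s (fscale c t) = fscale c (tensor_pair Z1 Z2 \<beta>1 \<beta>2 s t)"
  by (simp_all add: tensor_pair_eq lin_ext_rules[OF vector_space_fscale] case_prod_unfold
     lin_ext_fun_add[OF vector_space_fscale] lin_ext_fun_zero[OF vector_space_fscale] lin_ext_fun_scl[OF vector_space_fscale])

lemma tensor_pair_neg_right: "tensor_pair Z1 Z2 \<beta>1 \<beta>2 s (- t) = - tensor_pair Z1 Z2 \<beta>1 \<beta>2 s t"
  using tensor_pair_add_right[of Z1 Z2 \<beta>1 \<beta>2 s t "- t"]
  by (simp add: tensor_pair_zero_right eq_neg_iff_add_eq_0 add.commute)

lemma tensor_pair_koszul_left: "tensor_pair Z1 Z2 \<beta>1 \<beta>2 (koszul k s) t = koszul k (tensor_pair Z1 Z2 \<beta>1 \<beta>2 s t)"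
  and tensor_pair_koszul_right: "tensor_pair Z1 Z2 \<beta>1 \<beta>2 s (koszul k t) = koszul k (tensor_pair Z1 Z2 \<beta>1 \<beta>2 s t)"
  by (simp_all add: koszul_def tensor_pair_neg_left tensor_pair_neg_right)

lemma tensor_pair_diff_left: "tensor_pair Z1 Z2 \<beta>1 \<beta>2 (s - s') t = tensor_pair Z1 Z2 \<beta>1 \<beta>2 s t - tensor_pair Z1 Z2 \<beta>1 \<beta>2 s' t"
  using tensor_pair_add_left[of Z1 Z2 \<beta>1 \<beta>2 s "- s'" t] by (simp add: tensor_pair_neg_left)

lemma tensor_pair_diff_right: "tensor_pair Z1 Z2 \<beta>1 \<beta>2 s (t - t') = tensor_pair Z1 Z2 \<beta>1 \<beta>2 s t - tensor_pair Z1 Z2 \<beta>1 \<beta>2 s t'"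
  using tensor_pair_add_right[of Z1 Z2 \<beta>1 \<beta>2 s t "- t'"] by (simp add: tensor_pair_neg_right)

lemmas tensor_pair_rules = tensor_pair_diff_left tensor_pair_diff_right tensor_pair_add_left tensor_pair_zero_left tensor_pair_neg_left tensor_pair_scl_left
  tensor_pair_add_right tensor_pair_zero_right tensor_pair_neg_right tensor_pair_scl_right
  tensor_pair_koszul_left tensor_pair_koszul_right

context
  fixes U1 :: "('k::field, 'u1::ab_group_add) cpx" and U2 :: "('k, 'u2::ab_group_add) cpx"
    and H1 :: "('k::field, 'h1::ab_group_add) cpx" and H2 :: "('k, 'h2::ab_group_add) cpx"
    and Z1 :: "('k::field, 'z1::ab_group_add) cpx" and Z2 :: "('k, 'z2::ab_group_add) cpx"
    and \<beta>1 \<beta>2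
  assumes U1: "cochain_complex U1" and U2: "cochain_complex U2"
    and H1: "cochain_complex H1" and H2: "cochain_complex H2"
    and Z1: "cochain_complex Z1" and Z2: "cochain_complex Z2"
    and b1: "bilinear_pairing U1 H1 Z1 \<beta>1" and b2: "bilinear_pairing U2 H2 Z2 \<beta>2"
begin

lemma tensor_pair_tns:
  assumes v: "v \<in> piece U1 p" and w: "w \<in> piece U2 q" and f: "f \<in> piece H1 r" and g: "g \<in> piece H2 s"
  shows "tensor_pair Z1 Z2 \<beta>1 \<beta>2 (tns U1 U2 p q v w) (tns H1 H2 r s f g)
    = koszul (q * r) (tns Z1 Z2 (p + r) (q + s) (\<beta>1 p r v f) (\<beta>2 q s w g))"
proof -
  \<comment> \<open>For a fixed left argument the formula is lifted in the right variable. Only with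
    this value known can bilinearity in the left variable be checked.\<close>
  have inner: "lin_ext fscale
     (\<lambda>(_, r, s, f, g). koszul (q * r) (tns Z1 Z2 (p + r) (q + s) (\<beta>1 p r v f) (\<beta>2 q s w g))) (tns H1 H2 r s f g)
     = koszul (q * r) (tns Z1 Z2 (p + r) (q + s) (\<beta>1 p r v f) (\<beta>2 q s w g))"
    if "v \<in> piece U1 p" "w \<in> piece U2 q" for p q v w
    using that by (intro tns_lift[OF H1 H2 vector_space_fscale] bilinear_onI)
      (simp_all add: bp_right_rules[OF b1] bp_right_rules[OF b2] bp_in[OF b1] bp_in[OF b2]
        tns_rules[OF Z1 Z2] koszul_add fscale_koszul)
  have "bilin U1 U2 fscale (\<lambda>p q v w. lin_ext fscale (\<lambda>(_, r, s, f, g). koszul (q * r)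
      (tns Z1 Z2 (p + r) (q + s) (\<beta>1 p r v f) (\<beta>2 q s w g))) (tns H1 H2 r s f g))"
    by (rule bilinear_onI)
      (use f g in \<open>simp_all add: inner cc_rules[OF U1] cc_rules[OF U2]
        bp_left_rules[OF b1] bp_left_rules[OF b2] bp_in[OF b1] bp_in[OF b2]
        tns_rules[OF Z1 Z2] koszul_add fscale_koszul\<close>)
  note tns_lift[OF U1 U2 vector_space_fscale this, of p q v w]
  then show ?thesis unfolding tensor_pair_eq using inner[OF v w] by simp
qed

lemma tensor_pairing:
  "bilinear_pairing (tensor_cpx U1 U2) (tensor_cpx H1 H2) (tensor_cpx Z1 Z2) (\<lambda>m n. tensor_pair Z1 Z2 \<beta>1 \<beta>2)"
proof (rule bilinear_pairingI, goal_cases)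
  note U = cochain_complex_tensor[OF U1 U2] and H = cochain_complex_tensor[OF H1 H2] and Z = cochain_complex_tensor[OF Z1 Z2]
  case (1 m n u v)
  from U1 U2 \<open>u \<in> _\<close> show ?case
  proof (induction rule: tensor_induct)
    case u: (ten p q v1 w1)
    from H1 H2 \<open>v \<in> _\<close> show ?case
    proof (induction rule: tensor_induct)
      case (ten r s f g)
      then show ?case using u
        by (simp add: tensor_pair_tns cc_rules[OF Z] tns_in[OF Z1 Z2] bp_in[OF b1] bp_in[OF b2])
    qed (simp_all add: tensor_pair_rules cc_rules[OF Z])
  qed (simp_all add: tensor_pair_rules cc_rules[OF Z])
next
  note U = cochain_complex_tensor[OF U1 U2] and H = cochain_complex_tensor[OF H1 H2] and Z = cochain_complex_tensor[OF Z1 Z2]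
  case (6 m n u v)
  from U1 U2 \<open>u \<in> _\<close> show ?case
  proof (induction rule: tensor_induct)
    case u: (ten p q v1 w1)
    from H1 H2 \<open>v \<in> _\<close> show ?case
    proof (induction rule: tensor_induct)
      case (ten r s f g)
      note u = u(2,3) and f = ten(2,3)
      \<comment> \<open>All signs depend only on the parities of the four degrees; in each of the
        sixteen cases the terms match.\<close>
      show ?case using u f \<open>m = p + q\<close>
        by (cases "even p"; cases "even q"; cases "even r"; cases "even s")
          (simp_all add: tensor_pair_tns tensor_dif_rules[OF Z1 Z2] tns_dif[OF U1 U2] tns_dif[OF H1 H2] tns_dif[OF Z1 Z2] koszul_def
            tensor_pair_rules bp_in[OF b1] bp_in[OF b2] bp_dif[OF b1] bp_dif[OF b2]
            cc_rules[OF U1] cc_rules[OF U2] cc_rules[OF H1] cc_rules[OF H2] cc_rules[OF Z1] cc_rules[OF Z2]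
            tns_rules[OF Z1 Z2] algebra_simps)
    qed (simp_all add: tensor_pair_rules tensor_dif_rules[OF H1 H2] tensor_dif_rules[OF Z1 Z2]
        koszul_add algebra_simps)
  qed (simp_all add: tensor_pair_rules tensor_dif_rules[OF U1 U2] tensor_dif_rules[OF Z1 Z2]
        koszul_add algebra_simps)
qed (simp_all add: tensor_pair_rules)

end

section \<open>Exterior products\<close>

lemma op_cat_simps [simp]:
  "Obj (op_cat C) = Obj C" "Hom (op_cat C) x y = Hom C y x" "idt (op_cat C) x = idt C x"
  "cmp (op_cat C) x y z m n g f = koszul (m * n) (cmp C z y x n m f g)"
  by (simp_all add: op_cat_def)

text \<open>The sign of the reversed composition restores the Leibniz rule after the factors are
  exchanged. In associativity both sides collect the sign of lm + ln + mn.\<close>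

lemma dg_category_op:
  assumes C: "dg_category C"
  shows "dg_category (op_cat C)"
  unfolding dg_category_def op_cat_simps
proof (intro conjI ballI allI, goal_cases)
  case (1 x y)
  then show ?case using hom_cc[OF dg_category_hom_complexes[OF C]] by blast
next
  case (2 x y z)
  note b = cmp_pairing[OF C 2(3,2,1)] and
    cc = hom_cc[OF dg_category_hom_complexes[OF C] 2(3,1)] hom_cc[OF dg_category_hom_complexes[OF C] 2(3,2)]
      hom_cc[OF dg_category_hom_complexes[OF C] 2(2,1)]
  show ?case
  proof (rule bilinear_pairingI, goal_cases)
    case (6 m n u v)
    then show ?case
      by (cases "even m"; cases "even n") (simp_all add: koszul_def op_cat_def bp_dif[OF b] bp_in[OF b] dif_neg[OF cc(1)])
  qed (simp_all add: op_cat_def bp_in[OF b] cc_rules[OF cc(1)] bp_left_rules[OF b] bp_right_rules[OF b] koszul_add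
      koszul_scl[OF cc_vector_space[OF cc(1)]] algebra_simps)
next
  case (3 w x y z l m n h g f)
  note bp = bp_koszul_left[OF cmp_pairing[OF C] hom_cc[OF dg_category_hom_complexes[OF C]]]
    bp_koszul_right[OF cmp_pairing[OF C] hom_cc[OF dg_category_hom_complexes[OF C]]]
  show ?case using 3
    by (simp add: bp bp_in[OF cmp_pairing[OF C]] cmp_assoc[OF C] koszul_koszul algebra_simps)
qed (simp_all add: idt_in[OF C] dif_idt[OF C] cmp_idt_left[OF C] cmp_idt_right[OF C])

lemma tensor_cat_simps [simp]:
  "Obj (tensor_cat A B) = Obj A \<times> Obj B"
  "Hom (tensor_cat A B) z w = tensor_cpx (Hom A (fst z) (fst w)) (Hom B (snd z) (snd w))"
  "cmp (tensor_cat A B) x y z m n s t = tensor_pair (Hom A (fst x) (fst z)) (Hom B (snd x) (snd z))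
     (cmp A (fst x) (fst y) (fst z)) (cmp B (snd x) (snd y) (snd z)) s t"
  "idt (tensor_cat A B) x = tns (Hom A (fst x) (fst x)) (Hom B (snd x) (snd x)) 0 0 (idt A (fst x)) (idt B (snd x))"
  by (simp_all add: tensor_cat_def tensor_pair_def case_prod_beta' tproj_gen)

lemma ext_prod_simps [simp]:
  "sp (ext_prod M N) x = tensor_cpx (sp M (fst x)) (sp N (snd x))"
  "act (ext_prod M N) x y m n s t = tensor_pair (sp M (fst x)) (sp N (snd x)) (act M (fst x) (fst y)) (act N (snd x) (snd y)) s t"
  by (simp_all add: ext_prod_def tensor_pair_def case_prod_beta')

lemma hom_complexes_tensor:
  assumes A: "hom_complexes A" and B: "hom_complexes B"
  shows "hom_complexes (tensor_cat A B)"
  unfolding hom_complexes_def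
  by (auto intro!: cochain_complex_tensor hom_cc[OF A] hom_cc[OF B])

context
  fixes A :: "('o, 'k::field, 'h::ab_group_add) dgcat" and B :: "('p, 'k, 'i::ab_group_add) dgcat"
    and M :: "('o, 'k, 'h, 'm::ab_group_add) dgmod" and N :: "('p, 'k, 'i, 'n::ab_group_add) dgmod"
  assumes A: "dg_category A" and B: "dg_category B" and M: "dg_module A M" and N: "dg_module B N"
begin

lemma ext_prod_act_tns:
  assumes "x \<in> Obj A" "y \<in> Obj A" "x' \<in> Obj B" "y' \<in> Obj B"
    and "v \<in> piece (sp M y) p" "w \<in> piece (sp N y') q" "f \<in> piece (Hom A x y) r" "g \<in> piece (Hom B x' y') s"
  shows "act (ext_prod M N) (x, x') (y, y') m n (tns (sp M y) (sp N y') p q v w) (tns (Hom A x y) (Hom B x' y') r s f g)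
     = koszul (q * r) (tns (sp M x) (sp N x') (p + r) (q + s) (act M x y p r v f) (act N x' y' q s w g))"
  using assms hom_cc[OF dg_category_hom_complexes[OF A]] hom_cc[OF dg_category_hom_complexes[OF B]]
  by (simp add: tensor_pair_tns mod_cc[OF M] mod_cc[OF N] act_pairing[OF M] act_pairing[OF N])

text \<open>The pairing axiom is an instance of \<open>tensor_pairing\<close>. The others are
  additive in every argument, which reduces them to pure tensors, where the axioms of the two
  factors and a comparison of signs remain.\<close>

lemma dg_module_ext_prod: "dg_module (tensor_cat A B) (ext_prod M N)"
proof (rule dg_moduleI, goal_cases)
  case (1 x)
  then show ?case by (auto intro!: cochain_complex_tensor mod_cc[OF M] mod_cc[OF N])
next
  case (2 x y)
  moreover obtain x1 x2 y1 y2 where xy: "x = (x1, x2)" "y = (y1, y2)" by (metis surj_pair)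
  moreover have "act (ext_prod M N) x y = (\<lambda>m n. tensor_pair (sp M x1) (sp N x2) (act M x1 y1) (act N x2 y2))"
    by (simp add: fun_eq_iff xy)
  ultimately show ?case
    using hom_cc[OF dg_category_hom_complexes[OF A]] hom_cc[OF dg_category_hom_complexes[OF B]]
    by (simp add: tensor_pairing mod_cc[OF M] mod_cc[OF N] act_pairing[OF M] act_pairing[OF N])
next
  case (3 x y z l m n v g f)
  obtain x1 x2 y1 y2 z1 z2 where xyz: "x = (x1, x2)" "y = (y1, y2)" "z = (z1, z2)" by (metis surj_pair)
  note o = 3(1-3)[unfolded xyz, simplified]
  note HA = hom_cc[OF dg_category_hom_complexes[OF A]] and HB = hom_cc[OF dg_category_hom_complexes[OF B]]
  note cM = mod_cc[OF M] and cN = mod_cc[OF N]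
  note pA = cmp_pairing[OF A] and pB = cmp_pairing[OF B] and pM = act_pairing[OF M] and pN = act_pairing[OF N]
  from 3(4-6) show ?case unfolding xyz ext_prod_simps tensor_cat_simps fst_conv snd_conv
  proof -
    assume v: "v \<in> piece (tensor_cpx (sp M z1) (sp N z2)) l"
      and g: "g \<in> piece (tensor_cpx (Hom A y1 z1) (Hom B y2 z2)) m"
      and f: "f \<in> piece (tensor_cpx (Hom A x1 y1) (Hom B x2 y2)) n"
    show "tensor_pair (sp M x1) (sp N x2) (act M x1 y1) (act N x2 y2)
        (tensor_pair (sp M y1) (sp N y2) (act M y1 z1) (act N y2 z2) v g) f =
      tensor_pair (sp M x1) (sp N x2) (act M x1 z1) (act N x2 z2) v
        (tensor_pair (Hom A x1 z1) (Hom B x2 z2) (cmp A x1 y1 z1) (cmp B x2 y2 z2) g f)"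
    proof -
    have cc: "cochain_complex (sp M z1)" "cochain_complex (sp N z2)" 
      "cochain_complex (Hom A y1 z1)" "cochain_complex (Hom B y2 z2)"
      "cochain_complex (Hom A x1 y1)" "cochain_complex (Hom B x2 y2)"
      using o by (simp_all add: cM cN HA HB)
    from cc(1,2) v show ?thesis
    proof (induction rule: tensor_induct)
      case v: (ten p q v w)
      from cc(3,4) g show ?case
      proof (induction rule: tensor_induct)
        case g: (ten p' q' v' w')
        from cc(5,6) f show ?case
        proof (induction rule: tensor_induct)
          case f: (ten p'' q'' v'' w'')
          show ?case using o v g f
            by (simp add: tensor_pair_tns cM cN HA HB pA pB pM pN tensor_pair_rules bp_in[OF pM] bp_in[OF pN] bp_in[OF pA] bp_in[OF pB]
              koszul_koszul act_act[OF M] act_act[OF N] algebra_simps)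
        qed (use o in \<open>simp_all add: tensor_pair_rules\<close>)
      qed (use o in \<open>simp_all add: tensor_pair_rules\<close>)
    qed (use o in \<open>simp_all add: tensor_pair_rules\<close>)
    qed
  qed
next
  case (4 x n v)
  obtain x1 x2 where x: "x = (x1, x2)" by (metis surj_pair)
  note o = 4(1)[unfolded x, simplified]
  note HA = hom_cc[OF dg_category_hom_complexes[OF A]] and HB = hom_cc[OF dg_category_hom_complexes[OF B]]
  have "v \<in> piece (tensor_cpx (sp M x1) (sp N x2)) n" using 4 x by simp
  moreover have "cochain_complex (sp M x1)" "cochain_complex (sp N x2)"
    using o by (simp_all add: mod_cc[OF M] mod_cc[OF N])
  ultimately have "v \<in> piece (tensor_cpx (sp M x1) (sp N x2)) n"
    and cc: "cochain_complex (sp M x1)" "cochain_complex (sp N x2)" by blast+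
  from cc this(1) show ?case
    unfolding x ext_prod_simps tensor_cat_simps fst_conv snd_conv
  proof (induction rule: tensor_induct)
    case (ten p q v w)
    then show ?case using o
      by (simp add: tensor_pair_tns mod_cc[OF M] mod_cc[OF N] HA HB act_pairing[OF M] act_pairing[OF N] idt_in[OF A] idt_in[OF B]
        act_idt[OF M] act_idt[OF N])
  qed (use o in \<open>simp_all add: tensor_pair_rules\<close>)
qed

end

section \<open>Small models\<close>

lemma lepoll_ordLeq: "A \<lesssim> B \<longleftrightarrow> ordLeq3 (card_of A) (card_of B)"
  by (simp add: lepoll_def card_of_ordLeq)

lemma lepoll_UNIV_times:
  assumes "infinite (UNIV :: 'b set)" "A \<lesssim> (UNIV :: 'b set)" "B \<lesssim> (UNIV :: 'b set)"
  shows "A \<times> B \<lesssim> (UNIV :: 'b set)"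
proof -
  have "(UNIV :: 'b set) \<times> (UNIV :: 'b set) \<approx> (UNIV :: 'b set)"
    using card_of_Times_same_infinite[OF assms(1)] by (simp add: eqpoll_iff_card_of_ordIso)
  then show ?thesis
    using times_lepoll_mono[OF assms(2,3)] lepoll_trans2 by blast
qed

lemma lepoll_UNIV_UN:
  assumes "infinite (UNIV :: 'b set)" "A \<lesssim> (UNIV :: 'b set)" "\<And>a. a \<in> A \<Longrightarrow> F a \<lesssim> (UNIV :: 'b set)"
  shows "(\<Union>a\<in>A. F a) \<lesssim> (UNIV :: 'b set)"
  using assms card_of_UNION_ordLeq_infinite unfolding lepoll_ordLeq by blast

lemma lepoll_UNIV_finite: "infinite (UNIV :: 'b set) \<Longrightarrow> finite A \<Longrightarrow> A \<lesssim> (UNIV :: 'b set)"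
  by (rule finite_lepoll_infinite)

lemma lepoll_UNIV_int: "infinite (UNIV :: 'b set) \<Longrightarrow> (A :: int set) \<lesssim> (UNIV :: 'b set)"
proof -
  assume "infinite (UNIV :: 'b set)"
  then have "(UNIV :: nat set) \<lesssim> (UNIV :: 'b set)" by (simp add: infinite_le_lepoll)
  moreover have "A \<lesssim> (UNIV :: nat set)"
    unfolding lepoll_def by (rule exI[of _ to_nat]) simp
  ultimately show ?thesis by (rule lepoll_trans[rotated])
qed

lemma lepoll_image: "A \<lesssim> B \<Longrightarrow> f ` A \<lesssim> B"
  using image_lepoll lepoll_trans by blast

text \<open>Extend B to a basis. Each unit vector of \<open>'b \<Rightarrow>\<^sub>0 'k\<close> lies
  in the span of finitely many basis elements, and the union of these finite sets spans everything,
  hence is the whole basis. A union of finite sets indexed by the infinite type \<open>'b\<close> is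
  no larger than \<open>'b\<close>.\<close>

lemma independent_lepoll:
  fixes B :: "('b \<Rightarrow>\<^sub>0 'k::field) set"
  assumes inf: "infinite (UNIV :: 'b set)" and B: "\<not> module.dependent fscale B"
  shows "B \<lesssim> (UNIV :: 'b set)"
proof -
  interpret vs: vector_space "fscale :: 'k \<Rightarrow> ('b \<Rightarrow>\<^sub>0 'k) \<Rightarrow> _" by (rule vector_space_fscale)
  let ?E = "vs.extend_basis B"
  have iE: "vs.independent ?E" and sE: "vs.span ?E = UNIV" and BE: "B \<subseteq> ?E"
    using vs.independent_extend_basis vs.span_extend_basis vs.extend_basis_superset B by blast+
  have "\<exists>F. finite F \<and> F \<subseteq> ?E \<and> Poly_Mapping.single b (1::'k) \<in> vs.span F" for b
  proof -
    have "Poly_Mapping.single b (1::'k) \<in> vs.span ?E" using sE by simp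
    then obtain F r where F: "finite F" "F \<subseteq> ?E" "Poly_Mapping.single b (1::'k) = (\<Sum>a\<in>F. fscale (r a) a)"
      unfolding vs.span_explicit by blast
    have "(\<Sum>a\<in>F. fscale (r a) a) \<in> vs.span F"
      by (intro vs.span_sum vs.span_scale vs.span_base)
    then show ?thesis using F by metis
  qed
  then obtain F where F: "\<And>b. finite (F b)" "\<And>b. F b \<subseteq> ?E" "\<And>b. Poly_Mapping.single b (1::'k) \<in> vs.span (F b)"
    by metis
  let ?U = "\<Union>b. F b"
  have single: "Poly_Mapping.single b (1::'k) \<in> vs.span ?U" for b
    using F(3)[of b] vs.span_mono[of "F b" ?U] by blast
  have "t \<in> vs.span ?U" for t :: "'b \<Rightarrow>\<^sub>0 'k"
  proof -
    have "(\<Sum>b\<in>Poly_Mapping.keys t. fscale (Poly_Mapping.lookup t b) (Poly_Mapping.single b 1)) \<in> vs.span ?U"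
      by (intro vs.span_sum vs.span_scale single)
    moreover have "(\<Sum>b\<in>Poly_Mapping.keys t. fscale (Poly_Mapping.lookup t b) (Poly_Mapping.single b 1)) = t"
      by (rule poly_mapping_eqI) (auto simp: lookup_sum lookup_fscale lookup_single when_def in_keys_iff sum.delta' if_distrib cong: if_cong)
    ultimately show ?thesis by simp
  qed
  then have "vs.span ?U = UNIV" by blast
  then have "?E \<subseteq> ?U"
    using vs.spanning_subset_independent[of ?U ?E] F(2) iE by blast
  moreover have "?U \<lesssim> (UNIV :: 'b set)"
    by (rule lepoll_UNIV_UN[OF inf lepoll_refl lepoll_UNIV_finite[OF inf F(1)]])
  ultimately show ?thesis
    using BE subset_imp_lepoll lepoll_trans by (metis order_trans)
qed

text \<open>Dimension at most \<open>'b\<close> in every degree, phrased by generating sets: these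
  are easy to give for cones, sums and tensor products, and a basis can be extracted where one is
  wanted.\<close>

definition small_dim :: "'b itself \<Rightarrow> ('k::field, 'v::ab_group_add) cpx \<Rightarrow> bool" where
  "small_dim U V \<longleftrightarrow> (\<forall>n. \<exists>S\<subseteq>piece V n. S \<lesssim> (UNIV :: 'b set) \<and> piece V n \<subseteq> module.span (scl V) S)"

lemma small_dim_basis:
  assumes V: "cochain_complex V" and s: "small_dim TYPE('b) V"
  obtains B where "\<And>n. B n \<subseteq> piece V n" "\<And>n. \<not> module.dependent (scl V) (B n)"
    "\<And>n. module.span (scl V) (B n) = piece V n" "\<And>n. B n \<lesssim> (UNIV :: 'b set)"
proof -
  interpret vs: vector_space "scl V" by (rule cc_vector_space[OF V])
  have "\<exists>B. B \<subseteq> piece V n \<and> vs.independent B \<and> vs.span B = piece V n \<and> B \<lesssim> (UNIV :: 'b set)" for n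
  proof -
    obtain S where S: "S \<subseteq> piece V n" "S \<lesssim> (UNIV :: 'b set)" "piece V n \<subseteq> vs.span S"
      using s unfolding small_dim_def by blast
    obtain B where B: "B \<subseteq> S" "vs.independent B" "S \<subseteq> vs.span B"
      using vs.maximal_independent_subset by blast
    have "vs.span S \<subseteq> vs.span B" using B(3) vs.span_minimal vs.subspace_span by blast
    moreover have "vs.span B \<subseteq> piece V n"
      using B(1) S(1) vs.span_minimal[OF _ cc_subspace[OF V]] by blast
    moreover have "B \<lesssim> (UNIV :: 'b set)" using B(1) S(2) subset_imp_lepoll lepoll_trans by blast
    ultimately show ?thesis using B S by (intro exI[of _ B]) blast
  qed
  then show ?thesis using that by metis
qed

lemma small_module_dim:
  fixes M :: "('o, 'k::field, 'h::ab_group_add, 'b \<Rightarrow>\<^sub>0 'k) dgmod"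
  assumes "infinite (UNIV :: 'b set)" "small_module C M" "x \<in> Obj C"
  shows "small_dim TYPE('b) (sp M x)"
  unfolding small_dim_def
proof
  fix n
  interpret vs: vector_space "fscale :: 'k \<Rightarrow> ('b \<Rightarrow>\<^sub>0 'k) \<Rightarrow> _" by (rule vector_space_fscale)
  obtain B where B: "B \<subseteq> piece (sp M x) n" "vs.independent B" "piece (sp M x) n \<subseteq> vs.span B"
    using vs.maximal_independent_subset by blast
  moreover have "scl (sp M x) = fscale" using assms by (simp add: small_module_def)
  ultimately show "\<exists>S\<subseteq>piece (sp M x) n. S \<lesssim> (UNIV :: 'b set) \<and> piece (sp M x) n \<subseteq> module.span (scl (sp M x)) S"
    using independent_lepoll[OF assms(1) B(2)] by (intro exI[of _ B]) simp
qed

text \<open>A basis of each piece is sent injectively to unit vectors. The embedding may differ from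
  degree to degree, as operations on elements know their degree.\<close>

lemma small_dim_embed:
  fixes V :: "('k::field, 'v::ab_group_add) cpx"
  assumes V: "cochain_complex V" and s: "small_dim TYPE('b) V"
  obtains j :: "int \<Rightarrow> 'v \<Rightarrow> ('b \<Rightarrow>\<^sub>0 'k)" where "\<And>n. Vector_Spaces.linear (scl V) fscale (j n)"
    "\<And>n. inj_on (j n) (piece V n)"
proof -
  interpret vs: vector_space "scl V" by (rule cc_vector_space[OF V])
  interpret f: vector_space "fscale :: 'k \<Rightarrow> ('b \<Rightarrow>\<^sub>0 'k) \<Rightarrow> _" by (rule vector_space_fscale)
  interpret vp: vector_space_pair "scl V" "fscale :: 'k \<Rightarrow> ('b \<Rightarrow>\<^sub>0 'k) \<Rightarrow> _" by unfold_locales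
  obtain B where B: "\<And>n. B n \<subseteq> piece V n" "\<And>n. vs.independent (B n)"
    "\<And>n. vs.span (B n) = piece V n" "\<And>n. B n \<lesssim> (UNIV :: 'b set)"
    using small_dim_basis[OF V s] by blast
  obtain e :: "int \<Rightarrow> 'v \<Rightarrow> 'b" where e: "\<And>n. inj_on (e n) (B n)"
    using B(4) unfolding lepoll_def by metis
  define j where "j n = vp.construct (B n) (\<lambda>v. Poly_Mapping.single (e n v) (1::'k))" for n
  have lin: "Vector_Spaces.linear (scl V) fscale (j n)" for n
    unfolding j_def by (rule vp.linear_construct[OF B(2)])
  have "inj_on (j n) (piece V n)" for n
  proof -
    interpret l: Vector_Spaces.linear "scl V" fscale "j n" by (rule lin)
    have jB: "j n v = Poly_Mapping.single (e n v) 1" if "v \<in> B n" for v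
      unfolding j_def using vp.construct_basis[OF B(2) that] .
    have "v = 0" if v: "v \<in> piece V n" and 0: "j n v = 0" for v
    proof -
      let ?r = "vs.representation (B n) v"
      let ?S = "{b. ?r b \<noteq> 0}"
      have vs: "v \<in> vs.span (B n)" using B(3) v by blast
      have v_eq: "v = (\<Sum>b\<in>?S. scl V (?r b) b)"
        using vs.sum_nonzero_representation_eq[OF B(2) vs] by simp
      have S: "?S \<subseteq> B n" "finite ?S"
        using vs.representation_ne_zero vs.finite_representation by blast+
      have "?r b = 0" if b: "b \<in> ?S" for b
      proof -
        \<comment> \<open>Since \<open>e n\<close> is injective on the basis, the entry of
          \<open>j n v\<close> at the index of b is exactly the coordinate of v at b.\<close>
        have "0 = Poly_Mapping.lookup (j n (\<Sum>b\<in>?S. scl V (?r b) b)) (e n b)"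
          using 0 v_eq by simp
        also have "\<dots> = (\<Sum>b'\<in>?S. ?r b' * (if b' = b then 1 else 0))"
          unfolding l.sum lookup_sum
        proof (rule sum.cong[OF refl])
          fix b' assume "b' \<in> ?S"
          then have "b' \<in> B n" "b \<in> B n" using S b by blast+
          then show "Poly_Mapping.lookup (j n (scl V (?r b') b')) (e n b) = ?r b' * (if b' = b then 1 else 0)"
            using inj_onD[OF e[of n]] by (auto simp: l.scale jB lookup_fscale lookup_single when_def)
        qed
        also have "\<dots> = ?r b" using b S(2) by (simp add: sum.delta if_distrib cong: if_cong)
        finally show ?thesis by simp
      qed
      then have "(\<Sum>b\<in>?S. scl V (?r b) b) = 0" by (intro sum.neutral) auto
      then show "v = 0" by (rule trans[OF v_eq])
    qed
    then show ?thesis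
      using l.inj_on_iff_eq_0[OF cc_subspace[OF V]] by blast
  qed
  then show ?thesis using that lin by blast
qed

section \<open>Transport of structure along embeddings into the universe\<close>

definition transport_cpx :: "('k, 'v::ab_group_add) cpx \<Rightarrow> (int \<Rightarrow> 'v \<Rightarrow> ('b \<Rightarrow>\<^sub>0 'k)) \<Rightarrow> ('k::field, 'b \<Rightarrow>\<^sub>0 'k) cpx" where
  "transport_cpx V j = \<lparr>piece = (\<lambda>n. j n ` piece V n), scl = fscale,
     dif = (\<lambda>n w. j (n + 1) (dif V n (inv_into (piece V n) (j n) w)))\<rparr>"

definition transport_mod ::
  "('o, 'k::field, 'h, 'm::ab_group_add) dgmod \<Rightarrow> ('o \<Rightarrow> int \<Rightarrow> 'm \<Rightarrow> ('b \<Rightarrow>\<^sub>0 'k)) \<Rightarrow> ('o, 'k, 'h, 'b \<Rightarrow>\<^sub>0 'k) dgmod" where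
  "transport_mod M j = \<lparr>sp = (\<lambda>x. transport_cpx (sp M x) (j x)),
     act = (\<lambda>x y m n w a. j x (m + n) (act M x y m n (inv_into (piece (sp M y) m) (j y m) w) a))\<rparr>"

lemma transport_simps [simp]:
  "piece (transport_cpx V j) n = j n ` piece V n" "scl (transport_cpx V j) = fscale"
  "sp (transport_mod M i) x = transport_cpx (sp M x) (i x)"
  by (simp_all add: transport_cpx_def transport_mod_def)

lemma transport_dif: "inj_on (j n) (piece V n) \<Longrightarrow> v \<in> piece V n \<Longrightarrow>
    dif (transport_cpx V j) n (j n v) = j (n + 1) (dif V n v)"
  by (simp add: transport_cpx_def)

lemma transport_act: "inj_on (j y m) (piece (sp M y) m) \<Longrightarrow> v \<in> piece (sp M y) m \<Longrightarrow>
    act (transport_mod M j) x y m n (j y m v) a = j x (m + n) (act M x y m n v a)"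
  by (simp add: transport_mod_def)

lemma cochain_complex_transport:
  assumes V: "cochain_complex V" and lin: "\<And>n. Vector_Spaces.linear (scl V) fscale (j n)"
    and inj: "\<And>n. inj_on (j n) (piece V n)"
  shows "cochain_complex (transport_cpx V j)"
proof -
  have l: "j n (v + w) = j n v + j n w" "j n (scl V c v) = fscale c (j n v)" "j n 0 = 0" for n v w c
  proof -
    interpret l: Vector_Spaces.linear "scl V" fscale "j n" by (rule lin)
    show "j n (v + w) = j n v + j n w" "j n (scl V c v) = fscale c (j n v)" "j n 0 = 0"
      by (simp_all add: l.add l.scale l.zero)
  qed
  note td = transport_dif[where j = j, OF inj]
  show ?thesis
  proof (rule cochain_complexI, goal_cases)
    case 1 show ?case by (simp add: vector_space_fscale)
  next
    case (2 n) show ?case using l(3) cc_zero[OF V] by (simp, metis imageI)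
  next
    case (3 n v w) then show ?case by (auto simp: l[symmetric] cc_rules[OF V])
  next
    case (4 n v c) then show ?case by (auto simp: l[symmetric] cc_rules[OF V])
  next
    case (5 n v) then show ?case by (auto simp: td cc_rules[OF V])
  next
    case (6 n v) then show ?case by (auto simp: td cc_rules[OF V] dif_dif[OF V] l)
  next
    case (7 n v w) then show ?case by (auto simp: l[symmetric] td cc_rules[OF V] dif_rules[OF V])
  next
    case (8 n v c) then show ?case by (auto simp: l[symmetric] td cc_rules[OF V] dif_rules[OF V])
  qed
qed

lemma transport_iso:
  assumes M: "dg_module C M" and C: "hom_complexes C"
    and lin: "\<And>x n. x \<in> Obj C \<Longrightarrow> Vector_Spaces.linear (scl (sp M x)) fscale (j x n)"
    and inj: "\<And>x n. x \<in> Obj C \<Longrightarrow> inj_on (j x n) (piece (sp M x) n)"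
  shows "small_module C (transport_mod M j)" "dg_iso C M (transport_mod M j) j (\<lambda>x n. inv_into (piece (sp M x) n) (j x n))"
proof -
  have l: "j x n (v + w) = j x n v + j x n w" "j x n (scl (sp M x) c v) = fscale c (j x n v)"
    "j x n (- v) = - j x n v" if "x \<in> Obj C" for x n v w c
  proof -
    interpret l: Vector_Spaces.linear "scl (sp M x)" fscale "j x n" by (rule lin[OF that])
    show "j x n (v + w) = j x n v + j x n w" "j x n (scl (sp M x) c v) = fscale c (j x n v)" "j x n (- v) = - j x n v"
      by (simp_all add: l.add l.scale l.neg)
  qed
  have lk: "j x n (koszul k v) = koszul k (j x n v)" if "x \<in> Obj C" for x n v k
    using that by (simp add: koszul_def l)
  have td: "dif (transport_cpx (sp M x) (j x)) n (j x n v) = j x (n + 1) (dif (sp M x) n v)"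
    if "x \<in> Obj C" "v \<in> piece (sp M x) n" for x n v
    using transport_dif[of "j x", OF inj] that by blast
  have ta: "act (transport_mod M j) x y m n (j y m v) a = j x (m + n) (act M x y m n v a)"
    if "y \<in> Obj C" "v \<in> piece (sp M y) m" for x y m n v a
    using transport_act[of j, OF inj] that by blast
  note mr = act_in[OF M] mod_cc_rules[OF M] mod_dif_rules[OF M]
  have N: "dg_module C (transport_mod M j)"
  proof (rule dg_moduleI, goal_cases)
    case (1 x)
    then show ?case by (simp add: cochain_complex_transport mod_cc[OF M] lin inj)
  next
    case (2 x y)
    show ?case
    proof (rule bilinear_pairingI, goal_cases)
      case (1 m n u v) then show ?case using 2 by (auto simp: ta mr)
    next
      case (2 m n u u' v)
      then show ?case using \<open>x \<in> Obj C\<close> \<open>y \<in> Obj C\<close> by (auto simp: l[symmetric] ta mr act_left_rules[OF M])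
    next
      case (3 m n u v v')
      then show ?case using \<open>x \<in> Obj C\<close> \<open>y \<in> Obj C\<close> by (auto simp: l[symmetric] ta mr act_right_rules[OF M C])
    next
      case (4 m n u v c)
      then show ?case using \<open>x \<in> Obj C\<close> \<open>y \<in> Obj C\<close> by (auto simp: l[symmetric] ta mr act_left_rules[OF M])
    next
      case (5 m n u v c)
      then show ?case using \<open>x \<in> Obj C\<close> \<open>y \<in> Obj C\<close> by (auto simp: l[symmetric] ta mr act_right_rules[OF M C])
    next
      case (6 m n u v)
      then obtain u' where u': "u = j y m u'" "u' \<in> piece (sp M y) m" by auto
      have "act M x y m n u' v \<in> piece (sp M x) (m + n)" "dif (sp M y) m u' \<in> piece (sp M y) (m + 1)"
        using u' 6 2 by (simp_all add: mr)
      then show ?case using u' 6(2) 2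
        by (simp add: td ta mr act_dif[OF M] l lk algebra_simps)
    qed
  next
    case (3 x y z l m n v g f)
    then obtain v' where v': "v = j z l v'" "v' \<in> piece (sp M z) l" by auto
    have "act M y z l m v' g \<in> piece (sp M y) (l + m)" using v' 3 by (simp add: mr)
    then show ?case using v' 3 by (simp add: ta mr act_act[OF M] algebra_simps)
  next
    case (4 x n v)
    then show ?case by (auto simp: ta act_idt[OF M])
  qed
  then show "small_module C (transport_mod M j)" by (simp add: small_module_def)
  show "dg_iso C M (transport_mod M j) j (\<lambda>x n. inv_into (piece (sp M x) n) (j x n))"
  proof (rule dg_isoI[OF M N])
    show "closed_morphism C M (transport_mod M j) j"
      by (rule closed_morphismI, rule graded_mapI, rule graded_linearI) (simp_all add: l ta td inj)
  qed (auto simp: inj inv_into_into)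
qed

text \<open>The bridge to \<open>perf\<close> and \<open>ads\<close>: whatever the carrier of a
  module, bounded dimension of its values provides an isomorphic module with values in
  \<open>'b \<Rightarrow>\<^sub>0 'k\<close>.\<close>

lemma small_model:
  fixes M :: "('o, 'k::field, 'h::ab_group_add, 'm::ab_group_add) dgmod"
  assumes M: "dg_module C M" and C: "hom_complexes C" and s: "\<And>x. x \<in> Obj C \<Longrightarrow> small_dim TYPE('b) (sp M x)"
  obtains N :: "('o, 'k, 'h, 'b \<Rightarrow>\<^sub>0 'k) dgmod" and f g where "small_module C N" "dg_iso C N M f g"
proof -
  have "\<exists>j :: int \<Rightarrow> 'm \<Rightarrow> ('b \<Rightarrow>\<^sub>0 'k). x \<in> Obj C \<longrightarrow>
    (\<forall>n. Vector_Spaces.linear (scl (sp M x)) fscale (j n) \<and> inj_on (j n) (piece (sp M x) n))" for x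
  proof (cases "x \<in> Obj C")
    case True
    then show ?thesis using small_dim_embed[OF mod_cc[OF M True] s[OF True]] by metis
  qed simp
  then obtain j :: "'o \<Rightarrow> int \<Rightarrow> 'm \<Rightarrow> ('b \<Rightarrow>\<^sub>0 'k)" where
    "\<And>x n. x \<in> Obj C \<Longrightarrow> Vector_Spaces.linear (scl (sp M x)) fscale (j x n)"
    "\<And>x n. x \<in> Obj C \<Longrightarrow> inj_on (j x n) (piece (sp M x) n)" by metis
  from transport_iso[OF M C this] that dg_iso_sym show ?thesis by blast
qed

section \<open>Dimension bounds for the constructions\<close>

lemma small_dim_shift: "small_dim U V \<Longrightarrow> small_dim U (shift_cpx k V)"
  by (simp add: small_dim_def)

lemma small_dim_cone:
  assumes inf: "infinite (UNIV :: 'b set)" and V: "cochain_complex V" and W: "cochain_complex W"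
    and sV: "small_dim TYPE('b) V" and sW: "small_dim TYPE('b) W"
  shows "small_dim TYPE('b) (cone_cpx V W f)"
  unfolding small_dim_def
proof
  fix n
  interpret V: vector_space "scl V" by (rule cc_vector_space[OF V])
  interpret W: vector_space "scl W" by (rule cc_vector_space[OF W])
  interpret P: vector_space "scl (cone_cpx V W f)"
    unfolding scl_cone by (rule vector_space_pair[OF cc_vector_space[OF W] cc_vector_space[OF V]])
  obtain S where S: "S \<subseteq> piece V (n + 1)" "S \<lesssim> (UNIV :: 'b set)" "piece V (n + 1) \<subseteq> V.span S"
    using sV unfolding small_dim_def by blast
  obtain T where T: "T \<subseteq> piece W n" "T \<lesssim> (UNIV :: 'b set)" "piece W n \<subseteq> W.span T"
    using sW unfolding small_dim_def by blast
  let ?i = "\<lambda>w. (w, 0)" and ?j = "\<lambda>v. (0, v)"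
  let ?S = "?i ` T \<union> ?j ` S"
  have "(w, 0) \<in> P.span ?S" if "w \<in> W.span T" for w
    using that
  proof (induction rule: W.span_induct_alt)
    case base show ?case by (simp only: zero_prod_def[symmetric] P.span_zero)
  next
    case (step c x y)
    have "(x, 0) \<in> P.span ?S" by (rule P.span_base) (use step(1) in blast)
    then have "scl (cone_cpx V W f) c (x, 0) + (y, 0) \<in> P.span ?S"
      using step(2) by (intro P.span_add P.span_scale)
    moreover have "scl (cone_cpx V W f) c (x, 0) + (y, 0) = (scl W c x + y, 0)" by simp
    ultimately show ?case by metis
  qed
  moreover have "(0, v) \<in> P.span ?S" if "v \<in> V.span S" for v
    using that
  proof (induction rule: V.span_induct_alt)
    case base show ?case by (simp only: zero_prod_def[symmetric] P.span_zero)
  next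
    case (step c x y)
    have "(0, x) \<in> P.span ?S" by (rule P.span_base) (use step(1) in blast)
    then have "scl (cone_cpx V W f) c (0, x) + (0, y) \<in> P.span ?S"
      using step(2) by (intro P.span_add P.span_scale)
    moreover have "scl (cone_cpx V W f) c (0, x) + (0, y) = (0, scl V c x + y)" by simp
    ultimately show ?case by metis
  qed
  ultimately have "(w, v) \<in> P.span ?S" if "w \<in> piece W n" "v \<in> piece V (n + 1)" for w v
    using that S(3) T(3) P.span_add[of "(w, 0)" ?S "(0, v)"] by auto
  moreover have "?S \<lesssim> (UNIV :: 'b set)"
  proof -
    have "(\<Union>b\<in>{True, False}. if b then ?i ` T else ?j ` S) \<lesssim> (UNIV :: 'b set)"
      by (rule lepoll_UNIV_UN[OF inf lepoll_UNIV_finite[OF inf]]) (auto intro: lepoll_image S T)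
    then show ?thesis by (simp add: Un_commute)
  qed
  moreover have "?S \<subseteq> piece (cone_cpx V W f) n"
    using S(1) T(1) cc_zero[OF V] cc_zero[OF W] by auto
  moreover have "piece (cone_cpx V W f) n \<subseteq> P.span ?S"
    using calculation(1) by (auto simp only: cone_cpx_simps)
  ultimately show "\<exists>S\<subseteq>piece (cone_cpx V W f) n. S \<lesssim> (UNIV :: 'b set) \<and>
      piece (cone_cpx V W f) n \<subseteq> P.span S"
    by blast
qed

text \<open>Pure tensors of generators generate. In degree n they are indexed by i, by the degree p
  of the left factor (the right one has degree n - p), and by two small sets, all absorbed by the
  infinite type.\<close>

lemma (in tensor_data) small_dim_T:
  assumes inf: "infinite (UNIV :: 'z set)" and I: "I \<lesssim> (UNIV :: 'z set)"
    and sV: "\<And>i. i \<in> I \<Longrightarrow> small_dim TYPE('z) (V i)" and sW: "\<And>i. i \<in> I \<Longrightarrow> small_dim TYPE('z) (W i)"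
  shows "small_dim TYPE('z) T"
  unfolding small_dim_def scl_T
proof
  fix n
  interpret fs: vector_space "fscale :: 'k \<Rightarrow> ('i, 'v, 'w, 'k) formal \<Rightarrow> _" by (rule vector_space_fscale)
  have "\<exists>S. i \<in> I \<longrightarrow> S \<subseteq> piece (V i) p \<and> S \<lesssim> (UNIV :: 'z set) \<and> piece (V i) p \<subseteq> module.span (scl (V i)) S" for i p
    using sV unfolding small_dim_def by blast
  then obtain S where S: "\<And>i p. i \<in> I \<Longrightarrow> S i p \<subseteq> piece (V i) p" "\<And>i p. i \<in> I \<Longrightarrow> S i p \<lesssim> (UNIV :: 'z set)"
    "\<And>i p. i \<in> I \<Longrightarrow> piece (V i) p \<subseteq> module.span (scl (V i)) (S i p)" by metis
  have "\<exists>S. i \<in> I \<longrightarrow> S \<subseteq> piece (W i) p \<and> S \<lesssim> (UNIV :: 'z set) \<and> piece (W i) p \<subseteq> module.span (scl (W i)) S" for i p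
    using sW unfolding small_dim_def by blast
  then obtain S' where S': "\<And>i p. i \<in> I \<Longrightarrow> S' i p \<subseteq> piece (W i) p" "\<And>i p. i \<in> I \<Longrightarrow> S' i p \<lesssim> (UNIV :: 'z set)"
    "\<And>i p. i \<in> I \<Longrightarrow> piece (W i) p \<subseteq> module.span (scl (W i)) (S' i p)" by metis
  let ?X = "\<Union>i\<in>I. \<Union>p. (\<lambda>(v, w). tn i p (n - p) v w) ` (S i p \<times> S' i (n - p))"
  have sp: "tn i p (n - p) v w \<in> fs.span ?X"
    if i: "i \<in> I" and v: "v \<in> piece (V i) p" and w: "w \<in> piece (W i) (n - p)" for i p v w
  proof -
    interpret V: vector_space "scl (V i)" by (rule cc_vector_space[OF V[OF i]])
    interpret W: vector_space "scl (W i)" by (rule cc_vector_space[OF W[OF i]])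
    have VS: "V.span (S i p) \<subseteq> piece (V i) p" by (rule V.span_minimal[OF S(1)[OF i] cc_subspace[OF V[OF i]]])
    have WS: "W.span (S' i (n - p)) \<subseteq> piece (W i) (n - p)" by (rule W.span_minimal[OF S'(1)[OF i] cc_subspace[OF W[OF i]]])
    have "w \<in> W.span (S' i (n - p))" using S'(3) i w by blast
    then have base: "tn i p (n - p) s w \<in> fs.span ?X \<and> w \<in> W.span (S' i (n - p))" if s: "s \<in> S i p" for s
    proof (induction rule: W.span_induct_alt)
      case base
      have "s \<in> piece (V i) p" using s S(1)[OF i] by blast
      then show ?case using i by (simp add: ten_rules fs.span_zero W.span_zero)
    next
      case (step c x y)
      have "x \<in> piece (W i) (n - p)" "s \<in> piece (V i) p" "y \<in> piece (W i) (n - p)" "scl (W i) c x \<in> piece (W i) (n - p)"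
        using step s S S' i WS cc_scl[OF W[OF i]] by blast+
      moreover have "tn i p (n - p) s x \<in> fs.span ?X"
        using step(1) s i by (intro fs.span_base) blast
      ultimately show ?case using step i
        by (simp add: ten_rules fs.span_add fs.span_scale W.span_add W.span_scale W.span_base)
    qed
    have "v \<in> V.span (S i p)" using S(3) i v by blast
    then have "tn i p (n - p) v w \<in> fs.span ?X \<and> v \<in> V.span (S i p)"
    proof (induction rule: V.span_induct_alt)
      case base
      show ?case using w i by (simp add: ten_rules fs.span_zero V.span_zero)
    next
      case (step c x y)
      have "x \<in> piece (V i) p" "y \<in> piece (V i) p" "scl (V i) c x \<in> piece (V i) p"
        using step S i VS cc_scl[OF V[OF i]] by blast+
      moreover have "tn i p (n - p) x w \<in> fs.span ?X" using base step(1) by blast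
      ultimately show ?case using step i w
        by (simp add: ten_rules fs.span_add fs.span_scale V.span_add V.span_scale V.span_base)
    qed
    then show ?thesis ..
  qed
  have "tn i p q v w \<in> fs.span ?X"
    if "i \<in> I" "p + q = n" "v \<in> piece (V i) p" "w \<in> piece (W i) q" for i p q v w
  proof -
    have "q = n - p" using that(2) by simp
    then show ?thesis using sp[OF that(1,3)] that(4) by simp
  qed
  then have "piece T n \<subseteq> fs.span ?X"
    unfolding piece_eq by (intro fs.span_minimal fs.subspace_span) blast
  moreover have "?X \<subseteq> piece T n"
  proof (clarify)
    fix i p v w assume "i \<in> I" "v \<in> S i p" "w \<in> S' i (n - p)"
    then show "tn i p (n - p) v w \<in> piece T n"
      using S(1)[of i p] S'(1)[of i "n - p"] by (intro ten_in) auto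
  qed
  moreover have "?X \<lesssim> (UNIV :: 'z set)"
    by (intro lepoll_UNIV_UN[OF inf I] lepoll_UNIV_UN[OF inf] lepoll_UNIV_int[OF inf] lepoll_image
        lepoll_UNIV_times[OF inf] S S')
  ultimately show "\<exists>S\<subseteq>piece T n. S \<lesssim> (UNIV :: 'z set) \<and> piece T n \<subseteq> fs.span S" by blast
qed

lemma small_dim_tensor:
  assumes "infinite (UNIV :: 'b set)" "cochain_complex V" "cochain_complex W" "small_dim TYPE('b) V" "small_dim TYPE('b) W"
  shows "small_dim TYPE('b) (tensor_cpx V W)"
proof -
  interpret tensor_complex "UNIV :: unit set" "\<lambda>_. V" "\<lambda>_. W" "{}"
    by unfold_locales (simp_all add: assms)
  show ?thesis
    by (rule small_dim_T[OF assms(1) lepoll_UNIV_finite[OF assms(1)]]) (simp_all add: assms(4,5))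
qed

text \<open>The index type is \<open>'b\<close> itself, so the union of the generating sets, each
  placed in its own coordinate, stays small.\<close>

lemma small_dim_dsum:
  assumes inf: "infinite (UNIV :: 'b set)" and V: "\<And>j :: 'b. cochain_complex (V j)" and s: "\<And>j. small_dim TYPE('b) (V j)"
  shows "small_dim TYPE('b) (dsum_cpx V)"
  unfolding small_dim_def
proof
  fix n
  interpret P: vector_space "scl (dsum_cpx V)"
    unfolding scl_dsum by (rule vector_space_fun[OF cc_vector_space[OF V]])
  obtain S where S: "\<And>j. S j \<subseteq> piece (V j) n" "\<And>j. S j \<lesssim> (UNIV :: 'b set)" "\<And>j. piece (V j) n \<subseteq> module.span (scl (V j)) (S j)"
  proof -
    have "\<exists>S. S \<subseteq> piece (V j) n \<and> S \<lesssim> (UNIV :: 'b set) \<and> piece (V j) n \<subseteq> module.span (scl (V j)) S" for j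
      using s unfolding small_dim_def by blast
    then have "\<forall>j. \<exists>S. S \<subseteq> piece (V j) n \<and> S \<lesssim> (UNIV :: 'b set) \<and> piece (V j) n \<subseteq> module.span (scl (V j)) S"
      by blast
    from choice[OF this] show ?thesis using that by blast
  qed
  let ?e = "\<lambda>j v. (\<lambda>_. 0)(j := v)"
  let ?X = "\<Union>j. ?e j ` S j"
  have e: "?e j v \<in> P.span ?X" if v: "v \<in> piece (V j) n" for j v
  proof -
    interpret V: vector_space "scl (V j)" by (rule cc_vector_space[OF V])
    have z: "scl (V i) c 0 = 0" for i c using scl_add[OF V, of i c 0 0] by simp
    have "v \<in> V.span (S j)" using S(3) v by blast
    then show ?thesis
    proof (induction rule: V.span_induct_alt)
      case base
      have e: "?e j 0 = 0" by (simp add: fun_eq_iff)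
      show ?case unfolding e by (rule P.span_zero)
    next
      case (step c x y)
      have e: "?e j (scl (V j) c x + y) = scl (dsum_cpx V) c (?e j x) + ?e j y"
        by (simp add: fun_eq_iff z)
      have "?e j x \<in> P.span ?X" by (rule P.span_base) (use step(1) in blast)
      then show ?case unfolding e using step(2) by (intro P.span_add P.span_scale)
    qed
  qed
  have "t \<in> P.span ?X" if t: "\<And>j. t j \<in> piece (V j) n" "finite {j. t j \<noteq> 0}" for t
  proof -
    have "(\<Sum>j\<in>{j. t j \<noteq> 0}. ?e j (t j)) \<in> P.span ?X"
      by (intro P.span_sum e t)
    moreover have "(\<Sum>j\<in>{j. t j \<noteq> 0}. ?e j (t j)) = t"
    proof
      fix i
      have "(\<Sum>j\<in>{j. t j \<noteq> 0}. ?e j (t j)) i = (\<Sum>j\<in>{j. t j \<noteq> 0}. ?e j (t j) i)"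
        by (induction rule: infinite_finite_induct) simp_all
      also have "\<dots> = (\<Sum>j\<in>{j. t j \<noteq> 0}. if j = i then t j else 0)"
        by (rule sum.cong) auto
      also have "\<dots> = t i" using t(2) by (simp add: sum.delta)
      finally show "(\<Sum>j\<in>{j. t j \<noteq> 0}. ?e j (t j)) i = t i" .
    qed
    ultimately show ?thesis by metis
  qed
  moreover have "?X \<lesssim> (UNIV :: 'b set)"
    by (intro lepoll_UNIV_UN[OF inf lepoll_refl] lepoll_image S)
  moreover have "?X \<subseteq> piece (dsum_cpx V) n"
    using subsetD[OF S(1)] by (auto simp: cc_zero[OF V])
  moreover have "piece (dsum_cpx V) n \<subseteq> P.span ?X"
    using calculation(1) by (auto simp only: dsum_cpx_simps)
  ultimately show "\<exists>S\<subseteq>piece (dsum_cpx V) n. S \<lesssim> (UNIV :: 'b set) \<and> piece (dsum_cpx V) n \<subseteq> P.span S"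
    by blast
qed

section \<open>Functoriality of exterior products\<close>

lemma fst_gl: "cochain_complex W \<Longrightarrow> cochain_complex V \<Longrightarrow> graded_linear (cone_cpx V W f) W 0 (\<lambda>n. fst)"
  by (rule graded_linearI) auto

lemma snd_gl: "cochain_complex W \<Longrightarrow> cochain_complex V \<Longrightarrow> graded_linear (cone_cpx V W f) V 1 (\<lambda>n. snd)"
  by (rule graded_linearI) auto

lemma scl_zero_right: "cochain_complex V \<Longrightarrow> scl V c 0 = 0"
  using scl_add[of V c 0 0] by simp

lemma fst_inclusion_gl: "cochain_complex W \<Longrightarrow> cochain_complex V \<Longrightarrow> graded_linear W (cone_cpx V W f) 0 (\<lambda>n w. (w, 0))"
  by (rule graded_linearI) (auto simp: cc_rules scl_zero_right)

lemma snd_inclusion_gl: "cochain_complex W \<Longrightarrow> cochain_complex V \<Longrightarrow> graded_linear V (cone_cpx V W f) (-1) (\<lambda>n v. (0, v))"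
  by (rule graded_linearI) (auto simp: cc_rules scl_zero_right)

text \<open>A criterion for being a cone. The projections \<open>q\<close>, \<open>r\<close> and the
  sections \<open>i\<close>, \<open>s\<close> split Z into Y and X[1] as a graded object, and
  \<open>dq\<close>, \<open>dr\<close> say that its differential is the triangular one. The sections
  need only take values in the right pieces, because \<open>dg_isoI\<close> supplies their other
  properties.\<close>

lemma cone_isoI:
  assumes X: "dg_module C X" and Y: "dg_module C Y" and Z: "dg_module C Z" and C: "hom_complexes C"
    and f: "closed_morphism C X Y f"
    and q: "graded_map C Z Y 0 q" and r: "graded_map C Z X 1 r"
    and i: "\<And>x n w. x \<in> Obj C \<Longrightarrow> w \<in> piece (sp Y x) n \<Longrightarrow> i x n w \<in> piece (sp Z x) n"
    and s: "\<And>x n m v. x \<in> Obj C \<Longrightarrow> v \<in> piece (sp X x) n \<Longrightarrow> m = n - 1 \<Longrightarrow> s x n v \<in> piece (sp Z x) m"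
    and dq: "\<And>x n z. x \<in> Obj C \<Longrightarrow> z \<in> piece (sp Z x) n \<Longrightarrow>
        q x (n + 1) (dif (sp Z x) n z) = dif (sp Y x) n (q x n z) + f x (n + 1) (r x n z)"
    and dr: "\<And>x n z. x \<in> Obj C \<Longrightarrow> z \<in> piece (sp Z x) n \<Longrightarrow>
        r x (n + 1) (dif (sp Z x) n z) = - dif (sp X x) (n + 1) (r x n z)"
    and id: "\<And>x n z. x \<in> Obj C \<Longrightarrow> z \<in> piece (sp Z x) n \<Longrightarrow> i x n (q x n z) + s x (n + 1) (r x n z) = z"
    and qi: "\<And>x n w. x \<in> Obj C \<Longrightarrow> w \<in> piece (sp Y x) n \<Longrightarrow> q x n (i x n w) = w"
    and qs: "\<And>x n m v. x \<in> Obj C \<Longrightarrow> v \<in> piece (sp X x) n \<Longrightarrow> m = n - 1 \<Longrightarrow> q x m (s x n v) = 0"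
    and ri: "\<And>x n w. x \<in> Obj C \<Longrightarrow> w \<in> piece (sp Y x) n \<Longrightarrow> r x n (i x n w) = 0"
    and rs: "\<And>x n m v. x \<in> Obj C \<Longrightarrow> v \<in> piece (sp X x) n \<Longrightarrow> m = n - 1 \<Longrightarrow> r x m (s x n v) = v"
  shows "dg_iso C Z (cone X Y f) (\<lambda>x n z. (q x n z, r x n z)) (\<lambda>x n u. i x n (fst u) + s x (n + 1) (snd u))"
proof (rule dg_isoI[OF Z dg_module_cone[OF X Y f C]], goal_cases)
  case 1
  show ?case
  proof (rule closed_morphismI, rule graded_mapI, rule graded_linearI, goal_cases)
    case (4 x y m n v a)
    then show ?case using gm_act[OF q 4(1-4) refl] gm_act[OF r 4(1-4) refl] by (simp add: algebra_simps)
  qed (simp_all add: gm_in[OF q] gm_in[OF r] gm_add[OF q] gm_add[OF r] gm_scl[OF q] gm_scl[OF r] dq dr)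
next
  case (2 x n u)
  then show ?case by (auto intro!: mod_cc_rules(2)[OF Z] i s)
next
  case (3 x n z)
  then show ?case by (simp add: id)
next
  case (4 x n u)
  then obtain w v where u: "u = (w, v)" "w \<in> piece (sp Y x) n" "v \<in> piece (sp X x) (n + 1)" by auto
  have "i x n w \<in> piece (sp Z x) n" "s x (n + 1) v \<in> piece (sp Z x) n"
    using 4 u by (simp_all add: i s)
  then show ?case using 4 u
    by (simp add: gm_add[OF q] gm_add[OF r] qi qs ri rs)
qed

text \<open>The sign is that of moving the right map, of degree b, past the left element, of degree
  p.\<close>

definition ext_map ::
  "('o, 'k::field, 'h, 'm'::ab_group_add) dgmod \<Rightarrow> ('p, 'k, 'i, 'n'::ab_group_add) dgmod \<Rightarrow> int \<Rightarrow> int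
   \<Rightarrow> ('o \<Rightarrow> int \<Rightarrow> 'm \<Rightarrow> 'm') \<Rightarrow> ('p \<Rightarrow> int \<Rightarrow> 'n \<Rightarrow> 'n')
   \<Rightarrow> 'o \<times> 'p \<Rightarrow> int \<Rightarrow> (unit, 'm::ab_group_add, 'n, 'k) formal \<Rightarrow> (unit, 'm', 'n', 'k) formal" where
  "ext_map M' N' a b \<phi> \<psi> = (\<lambda>x n. tensor_map (sp M' (fst x)) (sp N' (snd x)) a b
     (\<lambda>p v. koszul (b * p) (\<phi> (fst x) p v)) (\<psi> (snd x)))"

lemma ext_prod_map_eq: "ext_prod_map M' N' \<phi> \<psi> = ext_map M' N' 0 0 \<phi> \<psi>"
  by (simp add: ext_prod_map_def ext_map_def tensor_map_def fun_eq_iff case_prod_beta')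

lemma koszul_gl:
  assumes f: "graded_linear V W a f" and V: "cochain_complex V" and W: "cochain_complex W"
  shows "graded_linear V W a (\<lambda>p v. koszul (b * p) (f p v))"
  by (rule graded_linearI)
    (simp_all add: gl_in[OF f] cc_rules[OF W] gl_rules[OF f] koszul_add koszul_scl[OF cc_vector_space[OF W]])

context
  fixes A :: "('o, 'k::field, 'h::ab_group_add) dgcat" and B :: "('p, 'k, 'i::ab_group_add) dgcat"
    and M :: "('o, 'k, 'h, 'm::ab_group_add) dgmod" and N :: "('p, 'k, 'i, 'n::ab_group_add) dgmod"
    and M' :: "('o, 'k, 'h, 'm'::ab_group_add) dgmod" and N' :: "('p, 'k, 'i, 'n'::ab_group_add) dgmod"
    and a b :: int and \<phi> \<psi>
  assumes A: "dg_category A" and B: "dg_category B" and M: "dg_module A M" and N: "dg_module B N"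
    and M': "dg_module A M'" and N': "dg_module B N'"
    and \<phi>: "graded_map A M M' a \<phi>" and \<psi>: "graded_map B N N' b \<psi>"
begin

lemma ext_map_tns:
  assumes "x \<in> Obj A" "y \<in> Obj B" "v \<in> piece (sp M x) p" "w \<in> piece (sp N y) q"
  shows "ext_map M' N' a b \<phi> \<psi> (x, y) n (tns (sp M x) (sp N y) p q v w)
    = koszul (b * p) (tns (sp M' x) (sp N' y) (p + a) (q + b) (\<phi> x p v) (\<psi> y q w))"
  unfolding ext_map_def fst_conv snd_conv using assms
  by (simp add: tensor_map_tns mod_cc[OF M] mod_cc[OF M'] mod_cc[OF N] mod_cc[OF N'] koszul_gl gm_gl[OF \<phi>] gm_gl[OF \<psi>]
      gm_in[OF \<phi>] gm_in[OF \<psi>] tns_rules)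

lemma ext_map_gl:
  assumes "x \<in> Obj A" "y \<in> Obj B"
  shows "graded_linear (tensor_cpx (sp M x) (sp N y)) (tensor_cpx (sp M' x) (sp N' y)) (a + b) (ext_map M' N' a b \<phi> \<psi> (x, y))"
  unfolding ext_map_def fst_conv snd_conv using assms
  by (simp add: tensor_map_gl mod_cc[OF M] mod_cc[OF M'] mod_cc[OF N] mod_cc[OF N'] koszul_gl gm_gl[OF \<phi>] gm_gl[OF \<psi>])

lemma ext_map_graded: "c = a + b \<Longrightarrow>
    graded_map (tensor_cat A B) (ext_prod M N) (ext_prod M' N') c (ext_map M' N' a b \<phi> \<psi>)"
proof (rule graded_mapI, goal_cases)
  case (1 x)
  then show ?case using ext_map_gl[of "fst x" "snd x"] by auto
next
  case (2 x y m n v h)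
  obtain x1 x2 y1 y2 where xy: "x = (x1, x2)" "y = (y1, y2)" by (metis surj_pair)
  note HA = hom_cc[OF dg_category_hom_complexes[OF A]] and HB = hom_cc[OF dg_category_hom_complexes[OF B]]
  have o: "x1 \<in> Obj A" "x2 \<in> Obj B" "y1 \<in> Obj A" "y2 \<in> Obj B" using 2 xy by auto
  have v: "v \<in> piece (tensor_cpx (sp M y1) (sp N y2)) m" and h: "h \<in> piece (tensor_cpx (Hom A x1 y1) (Hom B x2 y2)) n"
    using 2 xy by auto
  note cc = mod_cc[OF M o(3)] mod_cc[OF N o(4)] HA[OF o(1,3)] HB[OF o(2,4)]
  have add: "ext_map M' N' a b \<phi> \<psi> z k (s + t) = ext_map M' N' a b \<phi> \<psi> z k s + ext_map M' N' a b \<phi> \<psi> z k t"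
    "ext_map M' N' a b \<phi> \<psi> z k 0 = 0" "ext_map M' N' a b \<phi> \<psi> z k (koszul j t) = koszul j (ext_map M' N' a b \<phi> \<psi> z k t)" for z k s t j
    by (simp_all add: ext_map_def tensor_map_rules)
  from cc(1,2) v show ?case unfolding xy
  proof (induction rule: tensor_induct)
    case v: (ten p q v w)
    from cc(3,4) h show ?case
    proof (induction rule: tensor_induct)
      case h: (ten r s f g)
      note t = tensor_pair_tns[OF mod_cc[OF M'] mod_cc[OF N'] HA HB mod_cc[OF M'] mod_cc[OF N'] act_pairing[OF M'] act_pairing[OF N']]
        tensor_pair_tns[OF mod_cc[OF M] mod_cc[OF N] HA HB mod_cc[OF M] mod_cc[OF N] act_pairing[OF M] act_pairing[OF N]]
      have e: "b * (p + r) + q * r = (b + q) * r + b * p" by (simp add: algebra_simps)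
      show ?case using o v h
        by (simp add: t ext_map_tns add tensor_pair_rules act_in[OF M] act_in[OF N] gm_act[OF \<phi>] gm_act[OF \<psi>] gm_in[OF \<phi>] gm_in[OF \<psi>]
            koszul_koszul algebra_simps)
    qed (simp_all add: tensor_pair_rules add)
  qed (simp_all add: tensor_pair_rules add)
qed

end

lemma ext_map_rules:
  "ext_map M' N' a b \<phi> \<psi> z k (s + t) = ext_map M' N' a b \<phi> \<psi> z k s + ext_map M' N' a b \<phi> \<psi> z k t"
  "ext_map M' N' a b \<phi> \<psi> z k 0 = 0"
  "ext_map M' N' a b \<phi> \<psi> z k (koszul j t) = koszul j (ext_map M' N' a b \<phi> \<psi> z k t)"
  "ext_map M' N' a b \<phi> \<psi> z k (- t) = - ext_map M' N' a b \<phi> \<psi> z k t"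
  "ext_map M' N' a b \<phi> \<psi> z k (s - t) = ext_map M' N' a b \<phi> \<psi> z k s - ext_map M' N' a b \<phi> \<psi> z k t"
  by (simp_all add: ext_map_def tensor_map_rules)

lemma ext_map_closed:
  fixes A :: "('o, 'k::field, 'h::ab_group_add) dgcat" and B :: "('p, 'k, 'i::ab_group_add) dgcat"
    and M :: "('o, 'k, 'h, 'm::ab_group_add) dgmod" and N :: "('p, 'k, 'i, 'n::ab_group_add) dgmod"
    and M' :: "('o, 'k, 'h, 'm'::ab_group_add) dgmod" and N' :: "('p, 'k, 'i, 'n'::ab_group_add) dgmod"
  assumes A: "dg_category A" and B: "dg_category B" and M: "dg_module A M" and N: "dg_module B N"
    and M': "dg_module A M'" and N': "dg_module B N'"
    and \<phi>: "closed_morphism A M M' \<phi>" and \<psi>: "closed_morphism B N N' \<psi>"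
  shows "closed_morphism (tensor_cat A B) (ext_prod M N) (ext_prod M' N') (ext_map M' N' 0 0 \<phi> \<psi>)"
proof (rule closed_morphismI)
  note g = A B M N M' N' closed_graded[OF \<phi>] closed_graded[OF \<psi>]
  show "graded_map (tensor_cat A B) (ext_prod M N) (ext_prod M' N') 0 (ext_map M' N' 0 0 \<phi> \<psi>)"
    using ext_map_graded[OF g] by simp
  fix x n v assume "x \<in> Obj (tensor_cat A B)" "v \<in> piece (sp (ext_prod M N) x) n"
  then obtain x1 x2 where x: "x = (x1, x2)" "x1 \<in> Obj A" "x2 \<in> Obj B" and v: "v \<in> piece (tensor_cpx (sp M x1) (sp N x2)) n"
    by auto
  note cc = mod_cc[OF M x(2)] mod_cc[OF N x(3)] mod_cc[OF M' x(2)] mod_cc[OF N' x(3)]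
  from cc(1,2) v show "ext_map M' N' 0 0 \<phi> \<psi> x (n + 1) (dif (sp (ext_prod M N) x) n v) =
      dif (sp (ext_prod M' N') x) n (ext_map M' N' 0 0 \<phi> \<psi> x n v)"
    unfolding x(1)
  proof (induction rule: tensor_induct)
    case (ten p q v w)
    then show ?case using x cc
      by (simp add: ext_map_tns[OF g] ext_map_rules tns_dif tns_rules cc_rules closed_in[OF \<phi>] closed_in[OF \<psi>]
          closed_dif[OF \<phi>] closed_dif[OF \<psi>])
  qed (simp_all add: ext_map_rules tensor_dif_rules cc)
qed

context
  fixes A :: "('o, 'k::field, 'h::ab_group_add) dgcat" and B :: "('p, 'k, 'i::ab_group_add) dgcat"
  assumes A: "dg_category A" and B: "dg_category B"
begin

text \<open>The homotopy is h \<otimes> 1: the two occurrences of hv \<otimes> dw carry the signs of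
  p - 1 and p and cancel, leaving (dh + hd)v \<otimes> w.\<close>

lemma ext_prod_retract_left:
  assumes ret: "homotopy_retract A Z M" and N: "dg_module B N"
  shows "homotopy_retract (tensor_cat A B) (ext_prod Z N) (ext_prod M N)"
proof -
  from ret obtain i p h where Z: "dg_module A Z" and M: "dg_module A M"
    and i: "closed_morphism A Z M i" and p: "closed_morphism A M Z p" and h: "graded_map A Z Z (-1) h"
    and hh: "\<And>x n v. x \<in> Obj A \<Longrightarrow> v \<in> piece (sp Z x) n \<Longrightarrow>
      p x n (i x n v) - v = dif (sp Z x) (n - 1) (h x n v) + h x (n + 1) (dif (sp Z x) n v)"
    unfolding homotopy_retract_def homotopic_def by metis
  note id = closed_id[of B N]
  note gi = A B Z N M N closed_graded[OF i] closed_graded[OF id]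
    and gp = A B M N Z N closed_graded[OF p] closed_graded[OF id]
    and gh = A B Z N Z N h closed_graded[OF id]
  show ?thesis
  proof (rule homotopy_retractI[OF dg_module_ext_prod[OF A B Z N] dg_module_ext_prod[OF A B M N]
        ext_map_closed[OF A B Z N M N i id] ext_map_closed[OF A B M N Z N p id]], rule homotopicI)
    show "graded_map (tensor_cat A B) (ext_prod Z N) (ext_prod Z N) (- 1) (ext_map Z N (-1) 0 h (\<lambda>x n v. v))"
      by (rule ext_map_graded[OF gh]) simp
    fix x n t assume "x \<in> Obj (tensor_cat A B)" "t \<in> piece (sp (ext_prod Z N) x) n"
    then obtain x1 x2 where x: "x = (x1, x2)" "x1 \<in> Obj A" "x2 \<in> Obj B" and t: "t \<in> piece (tensor_cpx (sp Z x1) (sp N x2)) n"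
      by auto
    note cc = mod_cc[OF Z x(2)] mod_cc[OF N x(3)]
    from cc t show "ext_map Z N 0 0 p (\<lambda>x n v. v) x n (ext_map M N 0 0 i (\<lambda>x n v. v) x n t) - t =
      dif (sp (ext_prod Z N) x) (n - 1) (ext_map Z N (-1) 0 h (\<lambda>x n v. v) x n t) +
      ext_map Z N (-1) 0 h (\<lambda>x n v. v) x (n + 1) (dif (sp (ext_prod Z N) x) n t)"
      unfolding x(1)
    proof (induction rule: tensor_induct)
      case (ten r q v w)
      have hv: "h x1 r v \<in> piece (sp Z x1) (r - 1)" "h x1 (r + 1) (dif (sp Z x1) r v) \<in> piece (sp Z x1) r"
        using x(2) ten by (auto intro!: gm_in[OF h] cc_rules[OF cc(1)])
      have "tns (sp Z x1) (sp N x2) r q (p x1 r (i x1 r v)) w - tns (sp Z x1) (sp N x2) r q v w =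
        tns (sp Z x1) (sp N x2) r q (p x1 r (i x1 r v) - v) w"
        using x ten cc by (simp add: tns_rules closed_in[OF p] closed_in[OF i])
      also have "\<dots> = tns (sp Z x1) (sp N x2) r q (dif (sp Z x1) (r - 1) (h x1 r v)) w
          + tns (sp Z x1) (sp N x2) r q (h x1 (r + 1) (dif (sp Z x1) r v)) w"
        using x ten cc hh[OF x(2) ten(2)] hv by (simp add: tns_rules cc_rules)
      finally show ?case using x ten cc hv
        by (simp add: ext_map_tns[OF gi] ext_map_tns[OF gp] ext_map_tns[OF gh] ext_map_rules tns_dif cc_rules closed_in[OF i])
          (simp add: koszul_def)
    qed (simp_all add: ext_map_rules tensor_dif_rules cc algebra_simps)
  qed
qed

text \<open>The homotopy is 1 \<otimes> h with its Koszul sign (-1)^p, which makes the two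
  occurrences of dv \<otimes> hw cancel.\<close>

lemma ext_prod_retract_right:
  assumes M: "dg_module A M" and ret: "homotopy_retract B Z N"
  shows "homotopy_retract (tensor_cat A B) (ext_prod M Z) (ext_prod M N)"
proof -
  from ret obtain i p h where Z: "dg_module B Z" and N: "dg_module B N"
    and i: "closed_morphism B Z N i" and p: "closed_morphism B N Z p" and h: "graded_map B Z Z (-1) h"
    and hh: "\<And>x n v. x \<in> Obj B \<Longrightarrow> v \<in> piece (sp Z x) n \<Longrightarrow>
      p x n (i x n v) - v = dif (sp Z x) (n - 1) (h x n v) + h x (n + 1) (dif (sp Z x) n v)"
    unfolding homotopy_retract_def homotopic_def by metis
  note id = closed_id[of A M]
  note gi = A B M Z M N closed_graded[OF id] closed_graded[OF i]
    and gp = A B M N M Z closed_graded[OF id] closed_graded[OF p]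
    and gh = A B M Z M Z closed_graded[OF id] h
  show ?thesis
  proof (rule homotopy_retractI[OF dg_module_ext_prod[OF A B M Z] dg_module_ext_prod[OF A B M N]
        ext_map_closed[OF A B M Z M N id i] ext_map_closed[OF A B M N M Z id p]], rule homotopicI)
    show "graded_map (tensor_cat A B) (ext_prod M Z) (ext_prod M Z) (- 1) (ext_map M Z 0 (-1) (\<lambda>x n v. v) h)"
      by (rule ext_map_graded[OF gh]) simp
    fix x n t assume "x \<in> Obj (tensor_cat A B)" "t \<in> piece (sp (ext_prod M Z) x) n"
    then obtain x1 x2 where x: "x = (x1, x2)" "x1 \<in> Obj A" "x2 \<in> Obj B" and t: "t \<in> piece (tensor_cpx (sp M x1) (sp Z x2)) n"
      by auto
    note cc = mod_cc[OF M x(2)] mod_cc[OF Z x(3)]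
    from cc t show "ext_map M Z 0 0 (\<lambda>x n v. v) p x n (ext_map M N 0 0 (\<lambda>x n v. v) i x n t) - t =
      dif (sp (ext_prod M Z) x) (n - 1) (ext_map M Z 0 (-1) (\<lambda>x n v. v) h x n t) +
      ext_map M Z 0 (-1) (\<lambda>x n v. v) h x (n + 1) (dif (sp (ext_prod M Z) x) n t)"
      unfolding x(1)
    proof (induction rule: tensor_induct)
      case (ten r q v w)
      have hv: "h x2 q w \<in> piece (sp Z x2) (q - 1)" "h x2 (q + 1) (dif (sp Z x2) q w) \<in> piece (sp Z x2) q"
        using x(3) ten by (auto intro!: gm_in[OF h] cc_rules[OF cc(2)])
      have "tns (sp M x1) (sp Z x2) r q v (p x2 q (i x2 q w)) - tns (sp M x1) (sp Z x2) r q v w =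
        tns (sp M x1) (sp Z x2) r q v (p x2 q (i x2 q w) - w)"
        using x ten cc by (simp add: tns_rules closed_in[OF p] closed_in[OF i])
      also have "\<dots> = tns (sp M x1) (sp Z x2) r q v (dif (sp Z x2) (q - 1) (h x2 q w))
          + tns (sp M x1) (sp Z x2) r q v (h x2 (q + 1) (dif (sp Z x2) q w))"
        using x ten cc hh[OF x(3) ten(3)] hv by (simp add: tns_rules cc_rules)
      finally show ?case using x ten cc hv
        by (cases "even r")
          (simp_all add: ext_map_tns[OF gi] ext_map_tns[OF gp] ext_map_tns[OF gh] ext_map_rules tensor_dif_rules tns_dif cc_rules closed_in[OF i]
            koszul_def)
    qed (simp_all add: ext_map_rules tensor_dif_rules cc algebra_simps)
  qed
qed

end

section \<open>Exterior products of shifts and cones\<close>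

lemma graded_map_shift: "graded_map C M N k f \<Longrightarrow> graded_map C M (shift_mod k N) 0 f"
  unfolding graded_map_def by simp

lemma shift_graded_id: "graded_map C (shift_mod k M) M k (\<lambda>x n v. v)"
  by (rule graded_mapI, rule graded_linearI) simp_all

lemma graded_id_shift: "graded_map C M (shift_mod k M) (- k) (\<lambda>x n v. v)"
  by (rule graded_mapI, rule graded_linearI) simp_all

context
  fixes A :: "('o, 'k::field, 'h::ab_group_add) dgcat" and B :: "('p, 'k, 'i::ab_group_add) dgcat"
  assumes A: "dg_category A" and B: "dg_category B"
begin

text \<open>The identity of elements, read as a map of degree k on the left factor, already commutes
  with the differentials: the change of the left degree by k accounts for the sign of the shift on
  the terms v \<otimes> dw.\<close>

lemma ext_prod_shift_left:
  assumes M: "dg_module A M" and N: "dg_module B N"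
  obtains f g where "dg_iso (tensor_cat A B) (ext_prod (shift_mod k M) N) (shift_mod k (ext_prod M N)) f g"
proof -
  note HA = dg_category_hom_complexes[OF A] and HB = dg_category_hom_complexes[OF B]
  note S = dg_module_shift[OF M HA, of k]
  note g1 = A B S N M N shift_graded_id[of A k M] closed_graded[OF closed_id[of B N]]
    and g2 = A B M N S N graded_id_shift[of A M k] closed_graded[OF closed_id[of B N]]
  let ?f = "ext_map M N k 0 (\<lambda>x n v. v) (\<lambda>x n v. v)"
  let ?g = "\<lambda>x n. ext_map (shift_mod k M) N (- k) 0 (\<lambda>x n v. v) (\<lambda>x n v. v) x (n + k)"
  have "dg_iso (tensor_cat A B) (ext_prod (shift_mod k M) N) (shift_mod k (ext_prod M N)) ?f ?g"
  proof (rule dg_isoI[OF dg_module_ext_prod[OF A B S N] dg_module_shift[OF dg_module_ext_prod[OF A B M N] hom_complexes_tensor[OF HA HB]]],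
      goal_cases)
    case 1
    show ?case
    proof (rule closed_morphismI)
      show "graded_map (tensor_cat A B) (ext_prod (shift_mod k M) N) (shift_mod k (ext_prod M N)) 0 ?f"
        by (rule graded_map_shift, rule ext_map_graded[OF g1]) simp
      fix x n t assume "x \<in> Obj (tensor_cat A B)" "t \<in> piece (sp (ext_prod (shift_mod k M) N) x) n"
      then obtain x1 x2 where x: "x = (x1, x2)" "x1 \<in> Obj A" "x2 \<in> Obj B"
        and t: "t \<in> piece (tensor_cpx (sp (shift_mod k M) x1) (sp N x2)) n" by auto
      note cc = mod_cc[OF S x(2)] mod_cc[OF N x(3)] mod_cc[OF M x(2)]
      from cc(1,2) t show "?f x (n + 1) (dif (sp (ext_prod (shift_mod k M) N) x) n t) = dif (sp (shift_mod k (ext_prod M N)) x) n (?f x n t)"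
        unfolding x(1)
      proof (induction rule: tensor_induct)
        case (ten p q v w)
        have [simp]: "p + 1 + k = p + k + 1" by simp
        have "koszul k (dif (sp M x1) (p + k) v) \<in> piece (sp M x1) (p + k + 1)"
          using ten by (simp add: cc_rules[OF cc(3)])
        then show ?case using ten x
          by (cases "even k"; cases "even p")
            (simp_all add: ext_map_tns[OF g1, simplified] ext_map_rules tns_dif[OF cc(1,2), simplified] tns_dif[OF cc(3,2)] 
              cc_rules[OF cc(3)] cc_rules[OF cc(2)] tns_rules[OF cc(3,2)] koszul_def)
      qed (simp_all add: ext_map_rules tensor_dif_rules[OF cc(1,2), simplified] tensor_dif_rules[OF cc(3,2)] koszul_add)
    qed
  next
    case (2 x n w)
    then obtain x1 x2 where x: "x = (x1, x2)" "x1 \<in> Obj A" "x2 \<in> Obj B" by auto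
    show ?case using 2 x gl_in[OF ext_map_gl[OF g2 x(2,3)], of w "n + k" n] by simp
  next
    case (3 x n t)
    then obtain x1 x2 where x: "x = (x1, x2)" "x1 \<in> Obj A" "x2 \<in> Obj B"
        and t: "t \<in> piece (tensor_cpx (sp (shift_mod k M) x1) (sp N x2)) n" by auto
    note cc = mod_cc[OF S x(2)] mod_cc[OF N x(3)]
    from cc t show ?case unfolding x(1)
    proof (induction rule: tensor_induct)
      case (ten p q v w)
      then show ?case using x by (simp add: ext_map_tns[OF g1, simplified] ext_map_tns[OF g2, simplified])
    qed (simp_all add: ext_map_rules)
  next
    case (4 x n t)
    then obtain x1 x2 where x: "x = (x1, x2)" "x1 \<in> Obj A" "x2 \<in> Obj B"
        and t: "t \<in> piece (tensor_cpx (sp M x1) (sp N x2)) (n + k)" by auto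
    note cc = mod_cc[OF M x(2)] mod_cc[OF N x(3)]
    from cc t show ?case unfolding x(1)
    proof (induction rule: tensor_induct)
      case (ten p q v w)
      then show ?case using x by (simp add: ext_map_tns[OF g1, simplified] ext_map_tns[OF g2, simplified])
    qed (simp_all add: ext_map_rules)
  qed
  then show ?thesis by (rule that)
qed

end

lemma fst_graded:
  assumes "dg_module C M" "dg_module C N"
  shows "graded_map C (cone M N f) N 0 (\<lambda>x n. fst)"
  by (rule graded_mapI) (simp_all add: fst_gl mod_cc[OF assms(1)] mod_cc[OF assms(2)])

lemma snd_graded:
  assumes "dg_module C M" "dg_module C N"
  shows "graded_map C (cone M N f) M 1 (\<lambda>x n. snd)"
  by (rule graded_mapI) (simp_all add: snd_gl mod_cc[OF assms(1)] mod_cc[OF assms(2)])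

lemma fst_inclusion_graded:
  assumes "dg_module C M" "dg_module C N"
  shows "graded_map C N (cone M N f) 0 (\<lambda>x n w. (w, 0))"
  by (rule graded_mapI)
    (simp_all add: fst_inclusion_gl mod_cc[OF assms(1)] mod_cc[OF assms(2)] act_left_rules[OF assms(1)])

lemma snd_inclusion_graded:
  assumes "dg_module C M" "dg_module C N"
  shows "graded_map C M (cone M N f) (-1) (\<lambda>x n v. (0, v))"
  by (rule graded_mapI)
    (simp_all add: snd_inclusion_gl mod_cc[OF assms(1)] mod_cc[OF assms(2)] act_left_rules[OF assms(2)])

context
  fixes A :: "('o, 'k::field, 'h::ab_group_add) dgcat" and B :: "('p, 'k, 'i::ab_group_add) dgcat"
  assumes A: "dg_category A" and B: "dg_category B"
begin

text \<open>Here the identity has degree k on the right factor, and its Koszul sign (-1)^(kp) is the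
  one needed for a chain map.\<close>

lemma ext_prod_shift_right:
  assumes M: "dg_module A M" and N: "dg_module B N"
  obtains f g where "dg_iso (tensor_cat A B) (ext_prod M (shift_mod k N)) (shift_mod k (ext_prod M N)) f g"
proof -
  note HA = dg_category_hom_complexes[OF A] and HB = dg_category_hom_complexes[OF B]
  note S = dg_module_shift[OF N HB, of k]
  note g1 = A B M S M N closed_graded[OF closed_id[of A M]] shift_graded_id[of B k N]
    and g2 = A B M N M S closed_graded[OF closed_id[of A M]] graded_id_shift[of B N k]
  let ?f = "ext_map M N 0 k (\<lambda>x n v. v) (\<lambda>x n v. v)"
  let ?g = "\<lambda>x n. ext_map M (shift_mod k N) 0 (- k) (\<lambda>x n v. v) (\<lambda>x n v. v) x (n + k)"
  have "dg_iso (tensor_cat A B) (ext_prod M (shift_mod k N)) (shift_mod k (ext_prod M N)) ?f ?g"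
  proof (rule dg_isoI[OF dg_module_ext_prod[OF A B M S] dg_module_shift[OF dg_module_ext_prod[OF A B M N] hom_complexes_tensor[OF HA HB]]],
      goal_cases)
    case 1
    show ?case
    proof (rule closed_morphismI)
      show "graded_map (tensor_cat A B) (ext_prod M (shift_mod k N)) (shift_mod k (ext_prod M N)) 0 ?f"
        by (rule graded_map_shift, rule ext_map_graded[OF g1]) simp
      fix x n t assume "x \<in> Obj (tensor_cat A B)" "t \<in> piece (sp (ext_prod M (shift_mod k N)) x) n"
      then obtain x1 x2 where x: "x = (x1, x2)" "x1 \<in> Obj A" "x2 \<in> Obj B"
        and t: "t \<in> piece (tensor_cpx (sp M x1) (sp (shift_mod k N) x2)) n" by auto
      note cc = mod_cc[OF M x(2)] mod_cc[OF S x(3)] mod_cc[OF N x(3)]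
      from cc(1,2) t show "?f x (n + 1) (dif (sp (ext_prod M (shift_mod k N)) x) n t) = dif (sp (shift_mod k (ext_prod M N)) x) n (?f x n t)"
        unfolding x(1)
      proof (induction rule: tensor_induct)
        case (ten p q v w)
        have [simp]: "q + 1 + k = q + k + 1" by simp
        have "koszul k (dif (sp N x2) (q + k) w) \<in> piece (sp N x2) (q + k + 1)"
          using ten by (simp add: cc_rules[OF cc(3)])
        then show ?case using ten x
          by (cases "even k"; cases "even p")
            (simp_all add: ext_map_tns[OF g1, simplified] ext_map_rules tns_dif[OF cc(1,2), simplified] tns_dif[OF cc(1,3)] 
              cc_rules[OF cc(1)] cc_rules[OF cc(3)] tns_rules[OF cc(1,3)] tensor_dif_rules[OF cc(1,3)] koszul_def)
      qed (simp_all add: ext_map_rules tensor_dif_rules[OF cc(1,2), simplified] tensor_dif_rules[OF cc(1,3)] koszul_add)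
    qed
  next
    case (2 x n w)
    then obtain x1 x2 where x: "x = (x1, x2)" "x1 \<in> Obj A" "x2 \<in> Obj B" by auto
    show ?case using 2 x gl_in[OF ext_map_gl[OF g2 x(2,3)], of w "n + k" n] by simp
  next
    case (3 x n t)
    then obtain x1 x2 where x: "x = (x1, x2)" "x1 \<in> Obj A" "x2 \<in> Obj B"
        and t: "t \<in> piece (tensor_cpx (sp M x1) (sp (shift_mod k N) x2)) n" by auto
    note cc = mod_cc[OF M x(2)] mod_cc[OF S x(3)]
    from cc t show ?case unfolding x(1)
    proof (induction rule: tensor_induct)
      case (ten p q v w)
      then show ?case using x by (simp add: ext_map_tns[OF g1, simplified] ext_map_tns[OF g2, simplified] ext_map_rules koszul_koszul)
    qed (simp_all add: ext_map_rules)
  next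
    case (4 x n t)
    then obtain x1 x2 where x: "x = (x1, x2)" "x1 \<in> Obj A" "x2 \<in> Obj B"
        and t: "t \<in> piece (tensor_cpx (sp M x1) (sp N x2)) (n + k)" by auto
    note cc = mod_cc[OF M x(2)] mod_cc[OF N x(3)]
    from cc t show ?case unfolding x(1)
    proof (induction rule: tensor_induct)
      case (ten p q v w)
      then show ?case using x by (simp add: ext_map_tns[OF g1, simplified] ext_map_tns[OF g2, simplified] ext_map_rules koszul_koszul)
    qed (simp_all add: ext_map_rules)
  qed
  then show ?thesis by (rule that)
qed


text \<open>The projections and inclusions of the cone are tensored with the identity of
  \<open>N\<close>; they have degrees 0, 1, 0, -1 and fit the criterion
  \<open>cone_isoI\<close>.\<close>

lemma ext_prod_cone_left:
  assumes M: "dg_module A M" and M': "dg_module A M'" and N: "dg_module B N" and f: "closed_morphism A M M' f"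
  obtains u v where "dg_iso (tensor_cat A B) (ext_prod (cone M M' f) N)
    (cone (ext_prod M N) (ext_prod M' N) (ext_map M' N 0 0 f (\<lambda>x n v. v))) u v"
proof -
  note HA = dg_category_hom_complexes[OF A] and HB = dg_category_hom_complexes[OF B]
  let ?Z = "cone M M' f"
  note Z = dg_module_cone[OF M M' f HA] and id = closed_id[of B N]
  note gq = A B Z N M' N fst_graded[OF M M'] closed_graded[OF id]
    and gr = A B Z N M N snd_graded[OF M M'] closed_graded[OF id]
    and gi = A B M' N Z N fst_inclusion_graded[OF M M'] closed_graded[OF id]
    and gs = A B M N Z N snd_inclusion_graded[OF M M'] closed_graded[OF id]
    and gf = A B M N M' N closed_graded[OF f] closed_graded[OF id]
  note tns = ext_map_tns[OF gq, simplified] ext_map_tns[OF gr, simplified] ext_map_tns[OF gi, simplified]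
    ext_map_tns[OF gs, simplified] ext_map_tns[OF gf, simplified]
  have o: "\<exists>x1 x2. x = (x1, x2) \<and> x1 \<in> Obj A \<and> x2 \<in> Obj B" if "x \<in> Obj (tensor_cat A B)" for x
    using that by auto
  show ?thesis
  proof (rule that, rule cone_isoI[where i = "ext_map ?Z N 0 0 (\<lambda>x n w. (w, 0)) (\<lambda>x n v. v)"
        and s = "ext_map ?Z N (-1) 0 (\<lambda>x n v. (0, v)) (\<lambda>x n v. v)", OF dg_module_ext_prod[OF A B M N] dg_module_ext_prod[OF A B M' N] dg_module_ext_prod[OF A B Z N]
        hom_complexes_tensor[OF HA HB] ext_map_closed[OF A B M N M' N f id] ext_map_graded[OF gq] ext_map_graded[OF gr]], goal_cases)
    case (3 x n w)
    then show ?case using gl_in[OF ext_map_gl[OF gi], of "fst x" "snd x" w n n] by auto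
  next
    case (4 x n m v)
    then show ?case using gl_in[OF ext_map_gl[OF gs], of "fst x" "snd x" v n m] by auto
  next
    case (5 x n z)
    then obtain x1 x2 where x: "x = (x1, x2)" "x1 \<in> Obj A" "x2 \<in> Obj B"
        and t: "z \<in> piece (tensor_cpx (sp ?Z x1) (sp N x2)) n" by auto
    note cc = mod_cc[OF Z x(2)] mod_cc[OF N x(3)] mod_cc[OF M x(2)] mod_cc[OF M' x(2)]
    from cc(1,2) t show ?case unfolding x(1)
    proof (induction rule: tensor_induct)
      case (ten p q v w)
      then show ?case using x cc(2-)
        by (auto simp: tns ext_map_rules tns_dif[OF cc(1,2), simplified] tns_dif[OF cc(4,2)] tns_rules cc_rules closed_in[OF f] koszul_add)
    qed (simp_all add: ext_map_rules tensor_dif_rules[OF cc(1,2), simplified] tensor_dif_rules[OF cc(4,2)])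
  next
    case (6 x n z)
    then obtain x1 x2 where x: "x = (x1, x2)" "x1 \<in> Obj A" "x2 \<in> Obj B"
        and t: "z \<in> piece (tensor_cpx (sp ?Z x1) (sp N x2)) n" by auto
    note cc = mod_cc[OF Z x(2)] mod_cc[OF N x(3)] mod_cc[OF M x(2)] mod_cc[OF M' x(2)]
    from cc(1,2) t show ?case unfolding x(1)
    proof (induction rule: tensor_induct)
      case (ten p q v w)
      then show ?case using x cc(2-)
        by (auto simp: tns ext_map_rules tns_dif[OF cc(1,2), simplified] tns_dif[OF cc(3,2)] tns_rules cc_rules closed_in[OF f] koszul_def)
    qed (simp_all add: ext_map_rules tensor_dif_rules[OF cc(1,2), simplified] tensor_dif_rules[OF cc(3,2)])
  next
    case (7 x n z)
    then obtain x1 x2 where x: "x = (x1, x2)" "x1 \<in> Obj A" "x2 \<in> Obj B"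
        and t: "z \<in> piece (tensor_cpx (sp ?Z x1) (sp N x2)) n" by auto
    note cc = mod_cc[OF Z x(2)] mod_cc[OF N x(3)]
    from cc t show ?case unfolding x(1)
    proof (induction rule: tensor_induct)
      case (ten p q v w)
      have m: "(fst v, 0) \<in> piece (sp ?Z x1) p" "(0, snd v) \<in> piece (sp ?Z x1) p"
        using ten by (simp_all add: mem_Times_iff cc_zero[OF mod_cc[OF M x(2)]] cc_zero[OF mod_cc[OF M' x(2)]])
      have "tns (sp ?Z x1) (sp N x2) p q (fst v, 0) w + tns (sp ?Z x1) (sp N x2) p q (0, snd v) w = tns (sp ?Z x1) (sp N x2) p q v w"
        using tns_rules(1)[OF cc m ten(3)] by simp
      with ten x show ?case by (auto simp: tns)
    qed (simp_all add: ext_map_rules algebra_simps)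
  next
    case (8 x n w)
    then obtain x1 x2 where x: "x = (x1, x2)" "x1 \<in> Obj A" "x2 \<in> Obj B"
        and t: "w \<in> piece (tensor_cpx (sp M' x1) (sp N x2)) n" by auto
    from mod_cc[OF M' x(2)] mod_cc[OF N x(3)] t show ?case unfolding x(1)
    proof (induction rule: tensor_induct)
      case (ten p q v w)
      then show ?case using x by (simp add: tns cc_zero[OF mod_cc[OF M]])
    qed (simp_all add: ext_map_rules)
  next
    case (9 x n m w)
    then obtain x1 x2 where x: "x = (x1, x2)" "x1 \<in> Obj A" "x2 \<in> Obj B"
        and t: "w \<in> piece (tensor_cpx (sp M x1) (sp N x2)) n" by auto
    from mod_cc[OF M x(2)] mod_cc[OF N x(3)] t show ?case unfolding x(1)
    proof (induction rule: tensor_induct)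
      case (ten p q v w)
      then show ?case using x 
        by (simp add: tns cc_zero[OF mod_cc[OF M']] tns_rules[OF mod_cc[OF M'] mod_cc[OF N]])
    qed (simp_all add: ext_map_rules)
  next
    case (10 x n w)
    then obtain x1 x2 where x: "x = (x1, x2)" "x1 \<in> Obj A" "x2 \<in> Obj B"
        and t: "w \<in> piece (tensor_cpx (sp M' x1) (sp N x2)) n" by auto
    from mod_cc[OF M' x(2)] mod_cc[OF N x(3)] t show ?case unfolding x(1)
    proof (induction rule: tensor_induct)
      case (ten p q v w)
      then show ?case using x 
        by (simp add: tns cc_zero[OF mod_cc[OF M]] tns_rules[OF mod_cc[OF M] mod_cc[OF N]])
    qed (simp_all add: ext_map_rules)
  next
    case (11 x n m w)
    then obtain x1 x2 where x: "x = (x1, x2)" "x1 \<in> Obj A" "x2 \<in> Obj B"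
        and t: "w \<in> piece (tensor_cpx (sp M x1) (sp N x2)) n" by auto
    from mod_cc[OF M x(2)] mod_cc[OF N x(3)] t show ?case unfolding x(1)
    proof (induction rule: tensor_induct)
      case (ten p q v w)
      then show ?case using x 
        by (simp add: tns cc_zero[OF mod_cc[OF M']])
    qed (simp_all add: ext_map_rules)
  qed simp_all
qed

text \<open>As on the left, but the maps of degree 1 and -1 now sit on the right factor and carry
  the sign (-1)^p. It cancels in their composites and matches the negated differential of the
  cone.\<close>

lemma ext_prod_cone_right:
  assumes M: "dg_module A M" and N: "dg_module B N" and N': "dg_module B N'" and f: "closed_morphism B N N' f"
  obtains u v where "dg_iso (tensor_cat A B) (ext_prod M (cone N N' f))
    (cone (ext_prod M N) (ext_prod M N') (ext_map M N' 0 0 (\<lambda>x n v. v) f)) u v"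
proof -
  note HA = dg_category_hom_complexes[OF A] and HB = dg_category_hom_complexes[OF B]
  let ?Z = "cone N N' f"
  note Z = dg_module_cone[OF N N' f HB] and id = closed_id[of A M]
  note gq = A B M Z M N' closed_graded[OF id] fst_graded[OF N N']
    and gr = A B M Z M N closed_graded[OF id] snd_graded[OF N N']
    and gi = A B M N' M Z closed_graded[OF id] fst_inclusion_graded[OF N N']
    and gs = A B M N M Z closed_graded[OF id] snd_inclusion_graded[OF N N']
    and gf = A B M N M N' closed_graded[OF id] closed_graded[OF f]
  note tns = ext_map_tns[OF gq, simplified] ext_map_tns[OF gr, simplified] ext_map_tns[OF gi, simplified]
    ext_map_tns[OF gs, simplified] ext_map_tns[OF gf, simplified]
  have o: "\<exists>x1 x2. x = (x1, x2) \<and> x1 \<in> Obj A \<and> x2 \<in> Obj B" if "x \<in> Obj (tensor_cat A B)" for x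
    using that by auto
  show ?thesis
  proof (rule that, rule cone_isoI[where i = "ext_map M ?Z 0 0 (\<lambda>x n v. v) (\<lambda>x n w. (w, 0))"
        and s = "ext_map M ?Z 0 (-1) (\<lambda>x n v. v) (\<lambda>x n v. (0, v))", OF dg_module_ext_prod[OF A B M N] dg_module_ext_prod[OF A B M N'] dg_module_ext_prod[OF A B M Z]
        hom_complexes_tensor[OF HA HB] ext_map_closed[OF A B M N M N' id f] ext_map_graded[OF gq] ext_map_graded[OF gr]], goal_cases)
    case (3 x n w)
    then show ?case using gl_in[OF ext_map_gl[OF gi], of "fst x" "snd x" w n n] by auto
  next
    case (4 x n m v)
    then show ?case using gl_in[OF ext_map_gl[OF gs], of "fst x" "snd x" v n m] by auto
  next
    case (5 x n z)
    then obtain x1 x2 where x: "x = (x1, x2)" "x1 \<in> Obj A" "x2 \<in> Obj B"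
        and t: "z \<in> piece (tensor_cpx (sp M x1) (sp ?Z x2)) n" by auto
    note cc = mod_cc[OF M x(2)] mod_cc[OF Z x(3)] mod_cc[OF N x(3)] mod_cc[OF N' x(3)]
    from cc(1,2) t show ?case unfolding x(1)
    proof (induction rule: tensor_induct)
      case (ten p q v w)
      then show ?case using x cc(1,3-)
        by (auto simp: tns ext_map_rules tns_dif[OF cc(1,2), simplified] tns_dif[OF cc(1,4)] tns_rules cc_rules closed_in[OF f] koszul_add)
    qed (simp_all add: ext_map_rules tensor_dif_rules[OF cc(1,2), simplified] tensor_dif_rules[OF cc(1,4)])
  next
    case (6 x n z)
    then obtain x1 x2 where x: "x = (x1, x2)" "x1 \<in> Obj A" "x2 \<in> Obj B"
        and t: "z \<in> piece (tensor_cpx (sp M x1) (sp ?Z x2)) n" by auto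
    note cc = mod_cc[OF M x(2)] mod_cc[OF Z x(3)] mod_cc[OF N x(3)] mod_cc[OF N' x(3)]
    from cc(1,2) t show ?case unfolding x(1)
    proof (induction rule: tensor_induct)
      case (ten p q v w)
      then show ?case using x cc(1,3-)
        by (auto simp: tns ext_map_rules tns_dif[OF cc(1,2), simplified] tns_dif[OF cc(1,3)] tns_rules cc_rules closed_in[OF f] tensor_dif_rules[OF cc(1,3)] koszul_def)
    qed (simp_all add: ext_map_rules tensor_dif_rules[OF cc(1,2), simplified] tensor_dif_rules[OF cc(1,3)])
  next
    case (7 x n z)
    then obtain x1 x2 where x: "x = (x1, x2)" "x1 \<in> Obj A" "x2 \<in> Obj B"
        and t: "z \<in> piece (tensor_cpx (sp M x1) (sp ?Z x2)) n" by auto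
    note cc = mod_cc[OF M x(2)] mod_cc[OF Z x(3)]
    from cc t show ?case unfolding x(1)
    proof (induction rule: tensor_induct)
      case (ten p q v w)
      have m: "(fst w, 0) \<in> piece (sp ?Z x2) q" "(0, snd w) \<in> piece (sp ?Z x2) q"
        using ten by (simp_all add: mem_Times_iff cc_zero[OF mod_cc[OF N x(3)]] cc_zero[OF mod_cc[OF N' x(3)]])
      have "tns (sp M x1) (sp ?Z x2) p q v (fst w, 0) + tns (sp M x1) (sp ?Z x2) p q v (0, snd w) = tns (sp M x1) (sp ?Z x2) p q v w"
        using tns_rules(2)[OF cc ten(2) m] by simp
      with ten x show ?case by (auto simp: tns ext_map_rules koszul_koszul)
    qed (simp_all add: ext_map_rules algebra_simps)
  next
    case (8 x n w)
    then obtain x1 x2 where x: "x = (x1, x2)" "x1 \<in> Obj A" "x2 \<in> Obj B"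
        and t: "w \<in> piece (tensor_cpx (sp M x1) (sp N' x2)) n" by auto
    from mod_cc[OF M x(2)] mod_cc[OF N' x(3)] t show ?case unfolding x(1)
    proof (induction rule: tensor_induct)
      case (ten p q v w)
      then show ?case using x by (simp add: tns cc_zero[OF mod_cc[OF N]])
    qed (simp_all add: ext_map_rules)
  next
    case (9 x n m w)
    then obtain x1 x2 where x: "x = (x1, x2)" "x1 \<in> Obj A" "x2 \<in> Obj B"
        and t: "w \<in> piece (tensor_cpx (sp M x1) (sp N x2)) n" by auto
    from mod_cc[OF M x(2)] mod_cc[OF N x(3)] t show ?case unfolding x(1)
    proof (induction rule: tensor_induct)
      case (ten p q v w)
      then show ?case using x 
        by (simp add: tns cc_zero[OF mod_cc[OF N']] tns_rules[OF mod_cc[OF M] mod_cc[OF N']] ext_map_rules)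
    qed (simp_all add: ext_map_rules)
  next
    case (10 x n w)
    then obtain x1 x2 where x: "x = (x1, x2)" "x1 \<in> Obj A" "x2 \<in> Obj B"
        and t: "w \<in> piece (tensor_cpx (sp M x1) (sp N' x2)) n" by auto
    from mod_cc[OF M x(2)] mod_cc[OF N' x(3)] t show ?case unfolding x(1)
    proof (induction rule: tensor_induct)
      case (ten p q v w)
      then show ?case using x 
        by (simp add: tns cc_zero[OF mod_cc[OF N]] tns_rules[OF mod_cc[OF M] mod_cc[OF N]])
    qed (simp_all add: ext_map_rules)
  next
    case (11 x n m w)
    then obtain x1 x2 where x: "x = (x1, x2)" "x1 \<in> Obj A" "x2 \<in> Obj B"
        and t: "w \<in> piece (tensor_cpx (sp M x1) (sp N x2)) n" by auto
    from mod_cc[OF M x(2)] mod_cc[OF N x(3)] t show ?case unfolding x(1)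
    proof (induction rule: tensor_induct)
      case (ten p q v w)
      then show ?case using x 
        by (simp add: tns ext_map_rules koszul_koszul cc_zero[OF mod_cc[OF N']])
    qed (simp_all add: ext_map_rules)
  qed simp_all
qed

end

section \<open>Perfect modules up to isomorphism\<close>

lemma small_moduleD: "small_module C M \<Longrightarrow> dg_module C M"
  by (simp add: small_module_def)

lemma perf_small: "M \<in> perf C \<Longrightarrow> hom_complexes C \<Longrightarrow> small_module C M"
  by (induction rule: perf.induct) (auto simp: small_module_def dg_module_shift)

lemma perf_module: "M \<in> perf C \<Longrightarrow> hom_complexes C \<Longrightarrow> dg_module C M"
  using perf_small small_moduleD by blast

text \<open>Perfection for modules of arbitrary carrier type: \<open>perf\<close> itself fixes the
  carrier, so a construction can only be isomorphic to one of its members.\<close>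

definition eperf ::
  "'b itself \<Rightarrow> ('o, 'k::field, 'h::ab_group_add) dgcat \<Rightarrow> ('o, 'k, 'h, 'm::ab_group_add) dgmod \<Rightarrow> bool" where
  "eperf U C M \<longleftrightarrow> (\<exists>P :: ('o, 'k, 'h, 'b \<Rightarrow>\<^sub>0 'k) dgmod. P \<in> perf C \<and> (\<exists>f g. dg_iso C P M f g))"

context
  fixes C :: "('o, 'k::field, 'h::ab_group_add) dgcat"
  assumes C: "hom_complexes C"
begin

lemma eperf_iso: "eperf TYPE('b) C M \<Longrightarrow> dg_iso C N M f g \<Longrightarrow> eperf TYPE('b) C N"
  unfolding eperf_def using dg_iso_trans dg_iso_sym by blast

lemma dg_iso_refl: "dg_module C M \<Longrightarrow> dg_iso C M M (\<lambda>x n v. v) (\<lambda>x n v. v)"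
  by (simp add: dg_iso_def closed_id)

lemma eperf_perf: "P \<in> perf C \<Longrightarrow> eperf TYPE('b) C (P :: ('o, 'k, 'h, 'b \<Rightarrow>\<^sub>0 'k) dgmod)"
  unfolding eperf_def using dg_iso_refl perf_module[OF _ C] by blast

text \<open>The bound on dimensions is what gives the retract a small model. The model is then a
  homotopy retract of a genuine member of \<open>perf\<close>.\<close>

lemma eperf_retract:
  assumes M: "eperf TYPE('b) C M" and ret: "homotopy_retract C N M" and s: "\<And>x. x \<in> Obj C \<Longrightarrow> small_dim TYPE('b) (sp N x)"
  shows "eperf TYPE('b) C N"
proof -
  obtain P :: "('o, 'k, 'h, 'b \<Rightarrow>\<^sub>0 'k) dgmod" and f g where P: "P \<in> perf C" "dg_iso C P M f g"
    using M unfolding eperf_def by blast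
  have N: "dg_module C N" using ret by (simp add: homotopy_retract_def)
  obtain N' :: "('o, 'k, 'h, 'b \<Rightarrow>\<^sub>0 'k) dgmod" and f' g' where N': "small_module C N'" "dg_iso C N' N f' g'"
    using small_model[OF N C s] by blast
  have "homotopy_retract C N' P"
    by (rule retract_trans[OF retract_trans[OF iso_retract[OF C N'(2)] ret] iso_retract[OF C dg_iso_sym[OF P(2)]]])
  then have "N' \<in> perf C" using perf.retract[OF P(1) N'(1)] by blast
  then show ?thesis unfolding eperf_def using N' by blast
qed

lemma eperf_zero:
  assumes M: "dg_module C M" and z: "\<And>x n. x \<in> Obj C \<Longrightarrow> piece (sp M x) n = {0}"
  shows "eperf TYPE('b) C M"
proof -
  have "small_dim TYPE('b) (sp M x)" if x: "x \<in> Obj C" for x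
  proof -
    interpret vector_space "scl (sp M x)" by (rule cc_vector_space[OF mod_cc[OF M x]])
    show ?thesis unfolding small_dim_def using z[OF x] by (intro allI exI[of _ "{}"]) simp
  qed
  then obtain N :: "('o, 'k, 'h, 'b \<Rightarrow>\<^sub>0 'k) dgmod" and f g where N: "small_module C N" "dg_iso C N M f g"
    using small_model[OF M C] by blast
  have "piece (sp N x) n = {0}" if x: "x \<in> Obj C" for x n
  proof -
    have "v = 0" if v: "v \<in> piece (sp N x) n" for v
      using dg_isoD(5)[OF N(2) x v] closed_in[OF dg_isoD(3)[OF N(2)] x v] z[OF x]
        gl_zero[OF closed_gl[OF dg_isoD(4)[OF N(2)] x] mod_cc[OF M x], of n] by simp
    then show ?thesis using cc_zero[OF mod_cc[OF dg_isoD(1)[OF N(2)] x], of n] by blast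
  qed
  then show ?thesis unfolding eperf_def using N perf.zero by blast
qed

lemma eperf_shift:
  assumes "eperf TYPE('b) C M"
  shows "eperf TYPE('b) C (shift_mod k M)"
proof -
  obtain P :: "('o, 'k, 'h, 'b \<Rightarrow>\<^sub>0 'k) dgmod" and f g where P: "P \<in> perf C" "dg_iso C P M f g"
    using assms unfolding eperf_def by blast
  note i = dg_isoD[OF P(2)]
  have "dg_iso C (shift_mod k P) (shift_mod k M) (\<lambda>x n. f x (n + k)) (\<lambda>x n. g x (n + k))"
  proof (rule dg_isoI[OF dg_module_shift[OF i(1) C] dg_module_shift[OF i(2) C]])
    show "closed_morphism C (shift_mod k P) (shift_mod k M) (\<lambda>x n. f x (n + k))"
    proof (rule closed_morphismI, rule graded_mapI, rule graded_linearI, goal_cases)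
      case (5 x n v)
      then have "dif (sp P x) (n + k) v \<in> piece (sp P x) (n + 1 + k)" by (simp add: mod_cc_rules[OF i(1)])
      with 5 show ?case
        using gl_koszul[OF closed_gl[OF i(3) 5(1)] mod_cc[OF i(1) 5(1)], of "dif (sp P x) (n + k) v" "n + 1 + k" k]
        by (simp add: closed_dif[OF i(3)] mod_cc_rules[OF i(1)])
    qed (simp_all add: closed_in[OF i(3)] closed_add[OF i(3)] closed_scl[OF i(3)] closed_act[OF i(3)] algebra_simps)
  qed (simp_all add: i closed_in[OF i(4)])
  then show ?thesis unfolding eperf_def using perf.shift[OF P(1)] by blast
qed

lemma dg_iso_cone:
  assumes P: "dg_iso C P M a b" and Q: "dg_iso C Q N c d" and f: "closed_morphism C M N f"
  shows "dg_iso C (cone P Q (\<lambda>x n v. d x n (f x n (a x n v)))) (cone M N f)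
    (\<lambda>x n u. (c x n (fst u), a x (n + 1) (snd u))) (\<lambda>x n u. (d x n (fst u), b x (n + 1) (snd u)))"
proof -
  note p = dg_isoD[OF P] and q = dg_isoD[OF Q]
  note g = closed_comp[OF closed_comp[OF p(3) f] q(4)]
  show ?thesis
  proof (rule dg_isoI[OF dg_module_cone[OF p(1) q(1) g C] dg_module_cone[OF p(2) q(2) f C]])
    show "closed_morphism C (cone P Q (\<lambda>x n v. d x n (f x n (a x n v)))) (cone M N f) (\<lambda>x n u. (c x n (fst u), a x (n + 1) (snd u)))"
    proof (rule closed_morphismI, rule graded_mapI, rule graded_linearI, goal_cases)
      case (5 x n v)
      then obtain w u where v: "v = (w, u)" "w \<in> piece (sp Q x) n" "u \<in> piece (sp P x) (n + 1)" by auto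
      note m = closed_in[OF p(3) \<open>x \<in> Obj C\<close>] closed_in[OF f \<open>x \<in> Obj C\<close>] closed_in[OF q(4) \<open>x \<in> Obj C\<close>]
      show ?case
        using 5 v m gl_neg[OF closed_gl[OF p(3) 5(1)] mod_cc[OF p(1) 5(1)], of "dif (sp P x) (n + 1) u" "n + 1 + 1"]
        by (simp add: closed_dif[OF p(3)] closed_dif[OF q(3)] closed_add[OF q(3)] mod_cc_rules[OF p(1)] mod_cc_rules[OF q(1)] q(6))
    next
      case (4 x y m n v e)
      then show ?case using closed_act[OF p(3) 4(1,2), of "snd v" "m + 1" e n "m + 1 + n"]
        by (auto simp add: closed_act[OF q(3)] algebra_simps)
    qed (auto simp: closed_in[OF p(3)] closed_add[OF p(3)] closed_scl[OF p(3)] closed_in[OF q(3)] closed_add[OF q(3)] closed_scl[OF q(3)])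
  qed (auto simp: p(5,6) q(5,6) closed_in[OF p(4)] closed_in[OF q(4)])
qed

text \<open>The map is conjugated to one between perfect models; the cone of that map is isomorphic
  to the given one and small enough to have a model of its own.\<close>

lemma eperf_cone:
  assumes inf: "infinite (UNIV :: 'b set)" and M: "eperf TYPE('b) C M" and N: "eperf TYPE('b) C N" and f: "closed_morphism C M N f"
  shows "eperf TYPE('b) C (cone M N f)"
proof -
  obtain P :: "('o, 'k, 'h, 'b \<Rightarrow>\<^sub>0 'k) dgmod" and a b where P: "P \<in> perf C" "dg_iso C P M a b"
    using M unfolding eperf_def by blast
  obtain Q :: "('o, 'k, 'h, 'b \<Rightarrow>\<^sub>0 'k) dgmod" and c d where Q: "Q \<in> perf C" "dg_iso C Q N c d"
    using N unfolding eperf_def by blast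
  let ?g = "\<lambda>x n v. d x n (f x n (a x n v))"
  note p = dg_isoD[OF P(2)] and q = dg_isoD[OF Q(2)]
  have g: "closed_morphism C P Q ?g" by (rule closed_comp[OF closed_comp[OF p(3) f] q(4)])
  note i = dg_iso_cone[OF P(2) Q(2) f]
  have "small_dim TYPE('b) (sp (cone P Q ?g) x)" if x: "x \<in> Obj C" for x
    using small_dim_cone[OF inf mod_cc[OF p(1) x] mod_cc[OF q(1) x] small_module_dim[OF inf perf_small[OF P(1) C] x]
      small_module_dim[OF inf perf_small[OF Q(1) C] x]] by simp
  then obtain Z :: "('o, 'k, 'h, 'b \<Rightarrow>\<^sub>0 'k) dgmod" and u v where Z: "small_module C Z" "dg_iso C Z (cone P Q ?g) u v"
    using small_model[OF dg_isoD(1)[OF i] C] by blast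
  have "Z \<in> perf C"
    by (rule perf.cone[OF P(1) Q(1) g Z(1) iso_equivalent[OF C Z(2)]])
  then show ?thesis unfolding eperf_def using dg_iso_trans[OF Z(2) i] by blast
qed

end

section \<open>Perfection of exterior products\<close>

lemma tensor_zero_piece:
  assumes "cochain_complex V" "cochain_complex W" "(\<forall>p. piece V p = {0}) \<or> (\<forall>p. piece W p = {0})"
  shows "piece (tensor_cpx V W) n = {0}"
proof -
  have "t = 0" if "t \<in> piece (tensor_cpx V W) n" for t
    using assms(1,2) that
  proof (induction rule: tensor_induct)
    case (ten p q v w)
    then show ?case using assms(3) by (auto simp: tns_rules[OF assms(1,2)])
  qed simp_all
  then show ?thesis using cc_zero[OF cochain_complex_tensor[OF assms(1,2)], of n] by blast
qed

context
  fixes A :: "('o, 'k::field, 'h::ab_group_add) dgcat" and B :: "('p, 'k, 'i::ab_group_add) dgcat"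
  assumes A: "dg_category A" and B: "dg_category B"
begin

text \<open>The exterior product with a fixed \<open>N\<close> preserves zero modules, shifts, cones
  and homotopy retracts, so the modules whose product with \<open>N\<close> is perfect are closed
  under the rules generating \<open>perf\<close>; only representables are left as a
  hypothesis.\<close>

lemma eperf_ext_left:
  fixes N :: "('p, 'k, 'i, 'n::ab_group_add) dgmod"
  assumes inf: "infinite (UNIV :: 'b set)" and N: "dg_module B N"
    and sN: "\<And>y. y \<in> Obj B \<Longrightarrow> small_dim TYPE('b) (sp N y)"
    and base: "\<And>x. x \<in> Obj A \<Longrightarrow> eperf TYPE('b) (tensor_cat A B) (ext_prod (representable A x) N)"
    and M: "(M :: ('o, 'k, 'h, 'b \<Rightarrow>\<^sub>0 'k) dgmod) \<in> perf A"
  shows "eperf TYPE('b) (tensor_cat A B) (ext_prod M N)"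
proof -
  note HA = dg_category_hom_complexes[OF A] and HB = dg_category_hom_complexes[OF B]
  note HT = hom_complexes_tensor[OF HA HB]
  have sd: "small_dim TYPE('b) (sp (ext_prod M N) x)"
    if "small_module A M" "x \<in> Obj (tensor_cat A B)" for M :: "('o, 'k, 'h, 'b \<Rightarrow>\<^sub>0 'k) dgmod" and x
    using that by (auto intro!: small_dim_tensor[OF inf] sN mod_cc[OF N] mod_cc[OF small_moduleD] small_module_dim[OF inf])
  from M show ?thesis
  proof (induction rule: perf.induct)
    case (zero M)
    have "piece (sp (ext_prod M N) x) n = {0}" if "x \<in> Obj (tensor_cat A B)" for x n
      using that zero(2) by (auto simp: tensor_zero_piece mod_cc[OF N] mod_cc[OF small_moduleD[OF zero(1)]])
    then show ?case
      by (rule eperf_zero[OF HT dg_module_ext_prod[OF A B small_moduleD[OF zero(1)] N]])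
  next
    case (repr x M)
    show ?case
      by (rule eperf_retract[OF HT base[OF repr(1)] ext_prod_retract_left[OF A B equivalent_retract[OF repr(3)] N] sd[OF repr(2)]])
  next
    case (shift M k)
    obtain f g where "dg_iso (tensor_cat A B) (ext_prod (shift_mod k M) N) (shift_mod k (ext_prod M N)) f g"
      using ext_prod_shift_left[OF A B perf_module[OF shift(1) HA] N] by blast
    then show ?case by (rule eperf_iso[OF HT eperf_shift[OF HT shift(2)]])
  next
    case (cone M M' f Z)
    note m = perf_module[OF cone(1) HA] perf_module[OF cone(2) HA]
    obtain u v where i: "dg_iso (tensor_cat A B) (ext_prod (cone M M' f) N)
        (cone (ext_prod M N) (ext_prod M' N) (ext_map M' N 0 0 f (\<lambda>x n v. v))) u v"
      using ext_prod_cone_left[OF A B m N cone(3)] by blast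
    have "eperf TYPE('b) (tensor_cat A B) (ext_prod (cone M M' f) N)"
      by (rule eperf_iso[OF HT eperf_cone[OF HT inf cone(6,7) ext_map_closed[OF A B m(1) N m(2) N cone(3) closed_id]] i])
    then show ?case
      by (rule eperf_retract[OF HT _ ext_prod_retract_left[OF A B equivalent_retract[OF cone(5)] N] sd[OF cone(4)]])
  next
    case (retract M Z)
    show ?case
      by (rule eperf_retract[OF HT retract(4) ext_prod_retract_left[OF A B retract(3) N] sd[OF retract(2)]])
  qed
qed

lemma eperf_ext_right:
  fixes M :: "('o, 'k, 'h, 'm::ab_group_add) dgmod"
  assumes inf: "infinite (UNIV :: 'b set)" and M: "dg_module A M"
    and sM: "\<And>x. x \<in> Obj A \<Longrightarrow> small_dim TYPE('b) (sp M x)"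
    and base: "\<And>y. y \<in> Obj B \<Longrightarrow> eperf TYPE('b) (tensor_cat A B) (ext_prod M (representable B y))"
    and N: "(N :: ('p, 'k, 'i, 'b \<Rightarrow>\<^sub>0 'k) dgmod) \<in> perf B"
  shows "eperf TYPE('b) (tensor_cat A B) (ext_prod M N)"
proof -
  note HA = dg_category_hom_complexes[OF A] and HB = dg_category_hom_complexes[OF B]
  note HT = hom_complexes_tensor[OF HA HB]
  have sd: "small_dim TYPE('b) (sp (ext_prod M N) x)"
    if "small_module B N" "x \<in> Obj (tensor_cat A B)" for N :: "('p, 'k, 'i, 'b \<Rightarrow>\<^sub>0 'k) dgmod" and x
    using that by (auto intro!: small_dim_tensor[OF inf] sM mod_cc[OF M] mod_cc[OF small_moduleD] small_module_dim[OF inf])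
  from N show ?thesis
  proof (induction rule: perf.induct)
    case (zero N)
    have "piece (sp (ext_prod M N) x) n = {0}" if "x \<in> Obj (tensor_cat A B)" for x n
      using that zero(2) by (auto simp: tensor_zero_piece mod_cc[OF M] mod_cc[OF small_moduleD[OF zero(1)]])
    then show ?case
      by (rule eperf_zero[OF HT dg_module_ext_prod[OF A B M small_moduleD[OF zero(1)]]])
  next
    case (repr x N)
    show ?case
      by (rule eperf_retract[OF HT base[OF repr(1)] ext_prod_retract_right[OF A B M equivalent_retract[OF repr(3)]] sd[OF repr(2)]])
  next
    case (shift N k)
    obtain f g where "dg_iso (tensor_cat A B) (ext_prod M (shift_mod k N)) (shift_mod k (ext_prod M N)) f g"
      using ext_prod_shift_right[OF A B M perf_module[OF shift(1) HB]] by blast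
    then show ?case by (rule eperf_iso[OF HT eperf_shift[OF HT shift(2)]])
  next
    case (cone N N' f Z)
    note m = perf_module[OF cone(1) HB] perf_module[OF cone(2) HB]
    obtain u v where i: "dg_iso (tensor_cat A B) (ext_prod M (cone N N' f))
        (cone (ext_prod M N) (ext_prod M N') (ext_map M N' 0 0 (\<lambda>x n v. v) f)) u v"
      using ext_prod_cone_right[OF A B M m cone(3)] by blast
    have "eperf TYPE('b) (tensor_cat A B) (ext_prod M (cone N N' f))"
      by (rule eperf_iso[OF HT eperf_cone[OF HT inf cone(6,7) ext_map_closed[OF A B M m(1) M m(2) closed_id cone(3)]] i])
    then show ?case
      by (rule eperf_retract[OF HT _ ext_prod_retract_right[OF A B M equivalent_retract[OF cone(5)]] sd[OF cone(4)]])
  next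
    case (retract N Z)
    show ?case
      by (rule eperf_retract[OF HT retract(4) ext_prod_retract_right[OF A B M retract(3)] sd[OF retract(2)]])
  qed
qed

lemma representable_simps [simp]:
  "sp (representable A z) x = Hom A x z" "act (representable A z) x y = cmp A x y z"
  by (simp_all add: representable_def)

end

lemma dg_module_representable:
  assumes C: "dg_category C" and z: "z \<in> Obj C"
  shows "dg_module C (representable C z)"
  by (rule dg_moduleI)
    (simp_all add: representable_def z hom_cc[OF dg_category_hom_complexes[OF C]] cmp_pairing[OF C] cmp_assoc[OF C] cmp_idt_right[OF C])

context
  fixes A :: "('o, 'k::field, 'h::ab_group_add) dgcat" and B :: "('p, 'k, 'i::ab_group_add) dgcat"
  assumes A: "dg_category A" and B: "dg_category B"
begin

lemma representable_tensor: "representable (tensor_cat A B) (x, y) = ext_prod (representable A x) (representable B y)"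
  by (simp add: representable_def tensor_cat_def ext_prod_def fun_eq_iff split: prod.split)

text \<open>Two inductions, one for each factor. Both start from the product of two representables,
  which is representable over the tensor product.\<close>

lemma eperf_ext_prod:
  fixes M :: "('o, 'k, 'h, 'b \<Rightarrow>\<^sub>0 'k) dgmod" and N :: "('p, 'k, 'i, 'b \<Rightarrow>\<^sub>0 'k) dgmod"
  assumes inf: "infinite (UNIV :: 'b set)"
    and sA: "\<And>x y. x \<in> Obj A \<Longrightarrow> y \<in> Obj A \<Longrightarrow> small_dim TYPE('b) (Hom A x y)"
    and sB: "\<And>x y. x \<in> Obj B \<Longrightarrow> y \<in> Obj B \<Longrightarrow> small_dim TYPE('b) (Hom B x y)"
    and M: "M \<in> perf A" and N: "N \<in> perf B"
  shows "eperf TYPE('b) (tensor_cat A B) (ext_prod M N)"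
proof -
  note HA = dg_category_hom_complexes[OF A] and HB = dg_category_hom_complexes[OF B]
  note HT = hom_complexes_tensor[OF HA HB]
  have base: "eperf TYPE('b) (tensor_cat A B) (ext_prod (representable A x) (representable B y))"
    if x: "x \<in> Obj A" and y: "y \<in> Obj B" for x y
  proof -
    note m = dg_module_ext_prod[OF A B dg_module_representable[OF A x] dg_module_representable[OF B y]]
    have "small_dim TYPE('b) (sp (ext_prod (representable A x) (representable B y)) z)" if "z \<in> Obj (tensor_cat A B)" for z
      using that x y by (auto simp: representable_def intro!: small_dim_tensor[OF inf] sA sB hom_cc[OF HA] hom_cc[OF HB])
    then obtain P :: "('o \<times> 'p, 'k, (unit, 'h, 'i, 'k) formal, 'b \<Rightarrow>\<^sub>0 'k) dgmod" and f g where
      P: "small_module (tensor_cat A B) P" "dg_iso (tensor_cat A B) P (ext_prod (representable A x) (representable B y)) f g"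
      using small_model[OF m HT] by blast
    have "P \<in> perf (tensor_cat A B)"
      by (rule perf.repr[of "(x, y)"]) (use P x y iso_equivalent[OF HT P(2)] in \<open>simp_all add: representable_tensor\<close>)
    then show ?thesis unfolding eperf_def using P by blast
  qed
  have base': "eperf TYPE('b) (tensor_cat A B) (ext_prod M (representable B y))" if y: "y \<in> Obj B" for y
    by (rule eperf_ext_left[OF A B inf dg_module_representable[OF B y] _ base[OF _ y] M])
      (simp_all add: representable_def sB y)
  show ?thesis
    by (rule eperf_ext_right[OF A B inf perf_module[OF M HA] small_module_dim[OF inf perf_small[OF M HA]] base' N])
qed

end

section \<open>H-projectivity\<close>

text \<open>The lifting property of \<open>derived_object\<close>, separated from smallness so that
  it can be asked of cones and direct sums, whose carriers are not those of small modules. The test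
  modules remain small.\<close>

definition hproj ::
  "'b itself \<Rightarrow> ('o, 'k::field, 'h::ab_group_add) dgcat \<Rightarrow> ('o, 'k, 'h, 'm::ab_group_add) dgmod \<Rightarrow> bool" where
  "hproj U C P \<longleftrightarrow> (\<forall>N :: ('o, 'k, 'h, 'b \<Rightarrow>\<^sub>0 'k) dgmod. small_module C N \<and> acyclic_module C N \<longrightarrow>
     (\<forall>f. closed_morphism C P N f \<longrightarrow> homotopic C P N f (\<lambda>x n v. 0)))"

lemma derived_object_iff: "derived_object C P \<longleftrightarrow> small_module C P \<and> hproj TYPE('b) C P"
  for P :: "('o, 'k::field, 'h::ab_group_add, 'b \<Rightarrow>\<^sub>0 'k) dgmod"
  by (simp add: derived_object_def hproj_def)

lemma hprojI:
  assumes "\<And>(N :: ('o, 'k, 'h, 'b \<Rightarrow>\<^sub>0 'k) dgmod) f. small_module C N \<Longrightarrow> dg_module C N \<Longrightarrow> acyclic_module C N \<Longrightarrow>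
     closed_morphism C P N f \<Longrightarrow> \<exists>h. graded_map C P N (-1) h \<and> (\<forall>x\<in>Obj C. \<forall>n. \<forall>v\<in>piece (sp P x) n.
        f x n v = dif (sp N x) (n - 1) (h x n v) + h x (n + 1) (dif (sp P x) n v))"
  shows "hproj TYPE('b) (C :: ('o, 'k::field, 'h::ab_group_add) dgcat) P"
  using assms small_moduleD unfolding hproj_def homotopic_def by (metis diff_zero)

lemma hprojD:
  fixes N :: "('o, 'k::field, 'h::ab_group_add, 'b \<Rightarrow>\<^sub>0 'k) dgmod"
  assumes "hproj TYPE('b) C P" "small_module C N" "acyclic_module C N" "closed_morphism C P N f"
  obtains h where "graded_map C P N (-1) h"
    "\<And>x n v. x \<in> Obj C \<Longrightarrow> v \<in> piece (sp P x) n \<Longrightarrow>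
        dif (sp N x) (n - 1) (h x n v) + h x (n + 1) (dif (sp P x) n v) = f x n v"
  using assms unfolding hproj_def homotopic_def by (metis diff_zero)

lemma graded_neg:
  assumes N: "dg_module C N" and f: "graded_map C M N p f"
  shows "graded_map C M N p (\<lambda>x n v. - f x n v)"
  by (rule graded_mapI, rule graded_linearI)
    (simp_all add: gm_in[OF f] gm_add[OF f] gm_scl[OF f] gm_act[OF f] mod_cc_rules[OF N] act_left_rules[OF N] scl_neg[OF mod_cc[OF N]])

lemma hproj_retract:
  fixes C :: "('o, 'k::field, 'h::ab_group_add) dgcat"
  assumes ret: "homotopy_retract C M P" and P: "hproj TYPE('b) C P"
  shows "hproj TYPE('b) C M"
proof (rule hprojI)
  from ret obtain i p k where M: "dg_module C M"
    and i: "closed_morphism C M P i" and p: "closed_morphism C P M p" and k: "graded_map C M M (-1) k"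
    and kk: "\<And>x n v. x \<in> Obj C \<Longrightarrow> v \<in> piece (sp M x) n \<Longrightarrow>
      p x n (i x n v) - v = dif (sp M x) (n - 1) (k x n v) + k x (n + 1) (dif (sp M x) n v)"
    unfolding homotopy_retract_def homotopic_def by metis
  fix N :: "('o, 'k, 'h, 'b \<Rightarrow>\<^sub>0 'k) dgmod" and f
  assume sN: "small_module C N" and N: "dg_module C N" and aN: "acyclic_module C N" and f: "closed_morphism C M N f"
  obtain h where h: "graded_map C P N (-1) h"
    and hh: "\<And>x n v. x \<in> Obj C \<Longrightarrow> v \<in> piece (sp P x) n \<Longrightarrow>
        dif (sp N x) (n - 1) (h x n v) + h x (n + 1) (dif (sp P x) n v) = f x n (p x n v)"
    by (rule hprojD[OF P sN aN closed_comp[OF p f]]) blast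
  \<comment> \<open>Write f = f p i - f (p i - 1): the first term is the boundary of h i, the second
    that of f k.\<close>
  let ?a = "\<lambda>x n v. h x n (i x n v)" and ?b = "\<lambda>x n v. - f x (n - 1) (k x n v)"
  have a: "graded_map C M N (-1) ?a" using graded_map_comp[OF closed_graded[OF i] h] by simp
  have b: "graded_map C M N (-1) ?b" using graded_neg[OF N graded_map_comp[OF k closed_graded[OF f]]] by simp
  show "\<exists>h. graded_map C M N (-1) h \<and> (\<forall>x\<in>Obj C. \<forall>n. \<forall>v\<in>piece (sp M x) n.
        f x n v = dif (sp N x) (n - 1) (h x n v) + h x (n + 1) (dif (sp M x) n v))"
  proof (rule exI, intro conjI ballI allI)
    show "graded_map C M N (-1) (\<lambda>x n v. ?a x n v + ?b x n v)" by (rule graded_add[OF N a b])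
    fix x n v assume x: "x \<in> Obj C" and v: "v \<in> piece (sp M x) n"
    have 1: "k x n v \<in> piece (sp M x) (n - 1)" "dif (sp M x) n v \<in> piece (sp M x) (n + 1)"
      "k x (n + 1) (dif (sp M x) n v) \<in> piece (sp M x) n"
      using gm_in[OF k x v] gm_in[OF k x, of "dif (sp M x) n v" "n + 1" n] mod_cc_rules(7)[OF M x v] by simp_all
    have "f x n (p x n (i x n v)) - f x n v = f x n (p x n (i x n v) - v)"
      using x v by (simp add: gl_diff[OF closed_gl[OF f x] mod_cc[OF M x]] closed_in[OF p] closed_in[OF i])
    also have "\<dots> = dif (sp N x) (n - 1) (f x (n - 1) (k x n v)) + f x n (k x (n + 1) (dif (sp M x) n v))"
      using x 1 kk[OF x v] closed_dif[OF f x 1(1), of n] by (simp add: closed_add[OF f] mod_cc_rules[OF M])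
    finally show "f x n v = dif (sp N x) (n - 1) (?a x n v + ?b x n v) + (?a x (n + 1) (dif (sp M x) n v) + ?b x (n + 1) (dif (sp M x) n v))"
      using hh[OF x closed_in[OF i x v]] x v 1 gm_in[OF h x closed_in[OF i x v], of "n - 1"] closed_in[OF f x 1(1)]
      by (simp add: mod_dif_rules[OF N] mod_cc_rules[OF N] closed_dif[OF i] algebra_simps)
  qed
qed

text \<open>A morphism from M[k] to N is a morphism from M to N[-k], and shifting keeps test modules
  small and acyclic.\<close>

lemma hproj_shift:
  fixes C :: "('o, 'k::field, 'h::ab_group_add) dgcat"
  assumes C: "hom_complexes C" and M: "dg_module C M" and P: "hproj TYPE('b) C M"
  shows "hproj TYPE('b) C (shift_mod k M)"
proof (rule hprojI)
  fix N :: "('o, 'k, 'h, 'b \<Rightarrow>\<^sub>0 'k) dgmod" and f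
  assume sN: "small_module C N" and N: "dg_module C N" and aN: "acyclic_module C N" and f: "closed_morphism C (shift_mod k M) N f"
  let ?N = "shift_mod (- k) N" and ?f = "\<lambda>x n. f x (n - k)"
  have sN': "small_module C ?N" using sN dg_module_shift[OF N C] by (simp add: small_module_def)
  have aN': "acyclic_module C ?N"
    unfolding acyclic_module_def
  proof (intro ballI allI impI)
    fix x n v assume x: "x \<in> Obj C" and v: "v \<in> piece (sp ?N x) n" and 0: "dif (sp ?N x) n v = 0"
    have "dif (sp N x) (n - k) v = 0" using 0 by (auto simp: koszul_def split: if_splits)
    then obtain u where u: "u \<in> piece (sp N x) (n - k - 1)" "dif (sp N x) (n - k - 1) u = v"
      using aN x v unfolding acyclic_module_def by fastforce
    then show "\<exists>u\<in>piece (sp ?N x) (n - 1). dif (sp ?N x) (n - 1) u = v"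
      using x by (intro bexI[of _ "koszul k u"])
        (auto simp: mod_dif_rules[OF N] mod_cc_rules[OF N] koszul_koszul algebra_simps)
  qed
  have f': "closed_morphism C M ?N ?f"
  proof (rule closed_morphismI, rule graded_mapI, rule graded_linearI, goal_cases)
    case (1 x n v) then show ?case using closed_in[OF f, of x v "n - k"] by simp
  next
    case (2 x n v w) then show ?case using closed_add[OF f, of x v "n - k" w] by simp
  next
    case (3 x n v c) then show ?case using closed_scl[OF f, of x v "n - k" c] by simp
  next
    case (4 x y m n v a) then show ?case using closed_act[OF f 4(1,2), of v "m - k" a n "m - k + n"] by (simp add: algebra_simps)
  next
    case (5 x n v)
    have "f x (n - k + 1) (koszul k (dif (sp M x) n v)) = dif (sp N x) (n - k) (f x (n - k) v)"
      using closed_dif[OF f, of x v "n - k"] 5 by simp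
    moreover have "f x (n - k + 1) (koszul k (dif (sp M x) n v)) = koszul k (f x (n - k + 1) (dif (sp M x) n v))"
      using 5 gl_koszul[OF closed_gl[OF f 5(1)] mod_cc[OF dg_module_shift[OF M C] 5(1)], of "dif (sp M x) n v" "n - k + 1" k]
      by (simp add: mod_cc_rules[OF M])
    ultimately have "koszul (- k) (koszul k (f x (n - k + 1) (dif (sp M x) n v))) = koszul (- k) (dif (sp N x) (n - k) (f x (n - k) v))"
      by simp
    moreover have e: "n + 1 - k = n - k + 1" by simp
    ultimately show ?case unfolding e by (simp add: koszul_koszul)
  qed
  obtain h where h: "graded_map C M ?N (-1) h"
    and hh: "\<And>x n v. x \<in> Obj C \<Longrightarrow> v \<in> piece (sp M x) n \<Longrightarrow>
        dif (sp ?N x) (n - 1) (h x n v) + h x (n + 1) (dif (sp M x) n v) = f x (n - k) v"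
    by (rule hprojD[OF P sN' aN' f']) blast
  show "\<exists>h. graded_map C (shift_mod k M) N (-1) h \<and> (\<forall>x\<in>Obj C. \<forall>n. \<forall>v\<in>piece (sp (shift_mod k M) x) n.
        f x n v = dif (sp N x) (n - 1) (h x n v) + h x (n + 1) (dif (sp (shift_mod k M) x) n v))"
  proof (rule exI, intro conjI ballI allI)
    \<comment> \<open>The factor (-1)^k undoes the sign of the differential of N[-k] on one term and
      cancels that of M[k] on the other.\<close>
    show "graded_map C (shift_mod k M) N (-1) (\<lambda>x n v. koszul k (h x (n + k) v))"
    proof (rule graded_mapI, rule graded_linearI, goal_cases)
      case (1 x n v) then show ?case using gm_in[OF h, of x v "n + k" "n + k - 1"] by (simp add: mod_cc_rules[OF N])
    next
      case (2 x n v w) then show ?case by (simp add: gm_add[OF h] koszul_add)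
    next
      case (3 x n v c) then show ?case by (simp add: gm_scl[OF h] koszul_scl[OF cc_vector_space[OF mod_cc[OF N]]])
    next
      case (4 x y m n v a)
      then show ?case using gm_act[OF h 4(1,2), of v "m + k" a n "m + k + n"] gm_in[OF h, of y v "m + k" "m + k - 1"]
        by (simp add: algebra_simps act_left_rules[OF N])
    qed
    fix x n v assume x: "x \<in> Obj C" and "v \<in> piece (sp (shift_mod k M) x) n"
    then have v: "v \<in> piece (sp M x) (n + k)" by simp
    have 1: "h x (n + k) v \<in> piece (sp N x) (n - 1)" using gm_in[OF h x v, of "n + k - 1"] by simp
    have 2: "h x (n + k + 1) (koszul k (dif (sp M x) (n + k) v)) = koszul k (h x (n + k + 1) (dif (sp M x) (n + k) v))"
      using gl_koszul[OF gm_gl[OF h x] mod_cc[OF M x]] x v by (simp add: mod_cc_rules[OF M])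
    have 3: "koszul (- k) w = koszul k w" "koszul k (koszul k w) = w" for w :: "'b \<Rightarrow>\<^sub>0 'k"
      by (simp_all add: koszul_def)
    have e: "n + 1 + k = n + k + 1" by simp
    show "f x n v = dif (sp N x) (n - 1) (koszul k (h x (n + k) v)) + koszul k (h x (n + 1 + k) (dif (sp (shift_mod k M) x) n v))"
      unfolding e using hh[OF x v] x v 1 2 3 by (simp add: mod_dif_rules[OF N] koszul_add[symmetric])
  qed
qed

text \<open>On the subobject N the map g is null by some h. On M, the map g(0, -) has degree -1 and
  fails to be closed by the term g(f -, 0), the boundary of h after f. Subtracting h f gives a
  closed map to T[-1], which is null by some k.\<close>

lemma hproj_cone:
  fixes C :: "('o, 'k::field, 'h::ab_group_add) dgcat"
  assumes C: "hom_complexes C" and M: "dg_module C M" and N: "dg_module C N" and f: "closed_morphism C M N f"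
    and pM: "hproj TYPE('b) C M" and pN: "hproj TYPE('b) C N"
  shows "hproj TYPE('b) C (cone M N f)"
proof (rule hprojI)
  fix T :: "('o, 'k, 'h, 'b \<Rightarrow>\<^sub>0 'k) dgmod" and g
  assume sT: "small_module C T" and T: "dg_module C T" and aT: "acyclic_module C T" and g: "closed_morphism C (cone M N f) T g"
  note Z = dg_module_cone[OF M N f C]
  have aT': "acyclic_module C (shift_mod (-1) T)"
    unfolding acyclic_module_def
  proof (intro ballI allI impI)
    fix x n v assume x: "x \<in> Obj C" and v: "v \<in> piece (sp (shift_mod (-1) T) x) n" and 0: "dif (sp (shift_mod (-1) T) x) n v = 0"
    have "dif (sp T x) (n - 1) v = 0" using 0 by (simp add: koszul_def)
    then obtain u where u: "u \<in> piece (sp T x) (n - 1 - 1)" "dif (sp T x) (n - 1 - 1) u = v"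
      using aT x v unfolding acyclic_module_def by fastforce
    then show "\<exists>u\<in>piece (sp (shift_mod (-1) T) x) (n - 1). dif (sp (shift_mod (-1) T) x) (n - 1) u = v"
      using x by (intro bexI[of _ "- u"]) (auto simp: mod_dif_rules[OF T] mod_cc_rules[OF T] koszul_def)
  qed
  have sT': "small_module C (shift_mod (-1) T)" using sT dg_module_shift[OF T C] by (simp add: small_module_def)
  have i: "closed_morphism C N (cone M N f) (\<lambda>x n w. (w, 0))"
    by (rule closed_morphismI[OF fst_inclusion_graded[OF M N]])
      (simp add: mod_dif_rules[OF M] gl_zero[OF closed_gl[OF f] mod_cc[OF M]])
  obtain h where h: "graded_map C N T (-1) h"
    and hh: "\<And>x n v. x \<in> Obj C \<Longrightarrow> v \<in> piece (sp N x) n \<Longrightarrow>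
        dif (sp T x) (n - 1) (h x n v) + h x (n + 1) (dif (sp N x) n v) = g x n (v, 0)"
    by (rule hprojD[OF pN sT aT closed_comp[OF i g]]) blast
  let ?u = "\<lambda>x n v. g x (n - 1) (0, v) + - h x n (f x n v)"
  have gu: "graded_map C M T (-1) ?u"
    using graded_add[OF T graded_map_comp[OF snd_inclusion_graded[OF M N] closed_graded[OF g], of "-1"]
        graded_neg[OF T graded_map_comp[OF closed_graded[OF f] h, of "-1"]]] by simp
  have u: "closed_morphism C M (shift_mod (-1) T) ?u"
  proof (rule closed_morphismI[OF graded_map_shift[OF gu]])
    fix x n v assume x: "x \<in> Obj C" and v: "v \<in> piece (sp M x) n"
    have 1: "f x n v \<in> piece (sp N x) n" using closed_in[OF f x v] .
    have 2: "(0, v) \<in> piece (sp (cone M N f) x) (n - 1)" using v x by (simp add: mod_cc_rules[OF N])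
    have 3: "(f x n v, 0) \<in> piece (sp (cone M N f) x) n" "(0, - dif (sp M x) n v) \<in> piece (sp (cone M N f) x) n"
      using v x 1 by (simp_all add: mod_cc_rules[OF N] mod_cc_rules[OF M])
    have 4: "(0, dif (sp M x) n v) \<in> piece (sp (cone M N f) x) n"
      using v x by (simp_all add: mod_cc_rules[OF N] mod_cc_rules[OF M])
    have "dif (sp T x) (n - 1) (g x (n - 1) (0, v)) = g x n (f x n v, - dif (sp M x) n v)"
      using closed_dif[OF g x 2, of n] x by (simp add: mod_dif_rules[OF N])
    also have "\<dots> = g x n (f x n v, 0) - g x n (0, dif (sp M x) n v)"
      using closed_add[OF g x 3] gl_neg[OF closed_gl[OF g x] mod_cc[OF Z x] 4] by simp
    finally show "?u x (n + 1) (dif (sp M x) n v) = dif (sp (shift_mod (-1) T) x) n (?u x n v)"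
      using hh[OF x 1] x v 1 closed_in[OF g x 2] gm_in[OF h x 1]
      by (simp add: koszul_def mod_dif_rules[OF T] mod_cc_rules[OF T] closed_dif[OF f] algebra_simps)
  qed
  obtain k where k: "graded_map C M (shift_mod (-1) T) (-1) k"
    and kk: "\<And>x n v. x \<in> Obj C \<Longrightarrow> v \<in> piece (sp M x) n \<Longrightarrow>
        dif (sp (shift_mod (-1) T) x) (n - 1) (k x n v) + k x (n + 1) (dif (sp M x) n v) = ?u x n v"
    by (rule hprojD[OF pM sT' aT' u]) blast
  have k2: "graded_map C M T (-2) k"
    using k unfolding graded_map_def by simp
  \<comment> \<open>The sign of k reflects that T[-1] carries the negated differential of T.\<close>
  let ?a = "\<lambda>x n z. h x n (fst z)" and ?b = "\<lambda>x n z. - k x (n + 1) (snd z)"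
  have a: "graded_map C (cone M N f) T (-1) ?a" 
    using graded_map_comp[OF fst_graded[OF M N] h, of "-1"] by simp
  have b: "graded_map C (cone M N f) T (-1) ?b" 
    using graded_neg[OF T graded_map_comp[OF snd_graded[OF M N] k2, of "-1"]] by simp
  show "\<exists>h. graded_map C (cone M N f) T (-1) h \<and> (\<forall>x\<in>Obj C. \<forall>n. \<forall>v\<in>piece (sp (cone M N f) x) n.
        g x n v = dif (sp T x) (n - 1) (h x n v) + h x (n + 1) (dif (sp (cone M N f) x) n v))"
  proof (rule exI, intro conjI ballI allI)
    show "graded_map C (cone M N f) T (-1) (\<lambda>x n v. ?a x n v + ?b x n v)" by (rule graded_add[OF T a b])
    fix x n z assume x: "x \<in> Obj C" and "z \<in> piece (sp (cone M N f) x) n"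
    then obtain w v where z: "z = (w, v)" and w: "w \<in> piece (sp N x) n" and v: "v \<in> piece (sp M x) (n + 1)" by auto
    have 1: "f x (n + 1) v \<in> piece (sp N x) (n + 1)" "h x n w \<in> piece (sp T x) (n - 1)" "k x (n + 1) v \<in> piece (sp T x) (n - 1)"
      "dif (sp N x) n w \<in> piece (sp N x) (n + 1)"
      "dif (sp M x) (n + 1) v \<in> piece (sp M x) (n + 1 + 1)"
      using closed_in[OF f x v] gm_in[OF h x w] gm_in[OF k2 x v] w v x by (simp_all add: mod_cc_rules[OF N] mod_cc_rules[OF M])
    have 2: "(w, 0) \<in> piece (sp (cone M N f) x) n" "(0, v) \<in> piece (sp (cone M N f) x) n"
      using w v x by (simp_all add: mod_cc_rules[OF N] mod_cc_rules[OF M])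
    have "g x n z = g x n (w, 0) + g x n (0, v)" using closed_add[OF g x 2] z by simp
    moreover have "k x (n + 1 + 1) (- dif (sp M x) (n + 1) v) = - k x (n + 1 + 1) (dif (sp M x) (n + 1) v)"
      by (rule gl_neg[OF gm_gl[OF k2 x] mod_cc[OF M x] 1(5)])
    ultimately show "g x n z = dif (sp T x) (n - 1) (?a x n z + ?b x n z)
        + (?a x (n + 1) (dif (sp (cone M N f) x) n z) + ?b x (n + 1) (dif (sp (cone M N f) x) n z))"
      using hh[OF x w] kk[OF x v] x 1 z
      by (simp add: mod_dif_rules[OF T] mod_cc_rules[OF T] gm_add[OF h] koszul_def algebra_simps)
  qed
qed

text \<open>The Yoneda argument: f is determined by the cycle f(id), which is the boundary of some u
  by acyclicity, and a \<mapsto> u a is then a null-homotopy.\<close>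

lemma hproj_representable:
  fixes C :: "('o, 'k::field, 'h::ab_group_add) dgcat"
  assumes C: "dg_category C" and z: "z \<in> Obj C"
  shows "hproj TYPE('b) C (representable C z)"
proof (rule hprojI)
  note HC = dg_category_hom_complexes[OF C]
  fix N :: "('o, 'k, 'h, 'b \<Rightarrow>\<^sub>0 'k) dgmod" and f
  assume sN: "small_module C N" and N: "dg_module C N" and aN: "acyclic_module C N" and f: "closed_morphism C (representable C z) N f"
  have id: "idt C z \<in> piece (sp (representable C z) z) 0" "dif (sp (representable C z) z) 0 (idt C z) = 0"
    using idt_in[OF C z] dif_idt[OF C z] by (simp_all add: representable_def)
  have m: "dg_module C (representable C z)" by (rule dg_module_representable[OF C z])
  have "dif (sp N z) 0 (f z 0 (idt C z)) = 0"
    using closed_dif[OF f z id(1), of 1] id(2) gl_zero[OF closed_gl[OF f z] mod_cc[OF m z], of 1] by simp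
  then obtain u where u: "u \<in> piece (sp N z) (-1)" "dif (sp N z) (-1) u = f z 0 (idt C z)"
    using aN z closed_in[OF f z id(1)] unfolding acyclic_module_def by fastforce
  show "\<exists>h. graded_map C (representable C z) N (-1) h \<and> (\<forall>x\<in>Obj C. \<forall>n. \<forall>v\<in>piece (sp (representable C z) x) n.
        f x n v = dif (sp N x) (n - 1) (h x n v) + h x (n + 1) (dif (sp (representable C z) x) n v))"
  proof (rule exI, intro conjI ballI allI)
    show "graded_map C (representable C z) N (-1) (\<lambda>x n a. act N x z (-1) n u a)"
      by (rule graded_mapI, rule graded_linearI)
        (use z u in \<open>simp_all add: representable_def act_in[OF N] act_right_rules[OF N HC] act_act[OF N] algebra_simps\<close>)
    fix x n v assume x: "x \<in> Obj C" and "v \<in> piece (sp (representable C z) x) n"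
    then have v: "v \<in> piece (Hom C x z) n" by (simp add: representable_def)
    have "f x n v = f x (0 + n) (act (representable C z) x z 0 n (idt C z) v)"
      using cmp_idt_left[OF C x z v] by (simp add: representable_def)
    also have "\<dots> = act N x z 0 n (f z 0 (idt C z)) v"
      by (rule closed_act[OF f x z id(1) v]) simp
    finally show "f x n v = dif (sp N x) (n - 1) (act N x z (-1) n u v) + act N x z (-1) (n + 1) u (dif (sp (representable C z) x) n v)"
      using act_dif[OF N x z u(1) v, of "n - 1"] u(2) by (simp add: koszul_def representable_def)
  qed
qed

text \<open>Makes perfect modules objects of the derived category, which the base rule of
  \<open>ads\<close> demands of its generator.\<close>

lemma perf_hproj:
  assumes C: "dg_category C" and M: "M \<in> perf C"
  shows "hproj TYPE('b) C (M :: ('o, 'k::field, 'h::ab_group_add, 'b \<Rightarrow>\<^sub>0 'k) dgmod)"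
  using M
proof (induction rule: perf.induct)
  note HC = dg_category_hom_complexes[OF C]
  {
    case (zero M)
    show ?case
    proof (rule hprojI)
      fix N :: "('o, 'k, 'h, 'b \<Rightarrow>\<^sub>0 'k) dgmod" and f
      assume N: "dg_module C N" and f: "closed_morphism C M N f"
      show "\<exists>h. graded_map C M N (-1) h \<and> (\<forall>x\<in>Obj C. \<forall>n. \<forall>v\<in>piece (sp M x) n.
          f x n v = dif (sp N x) (n - 1) (h x n v) + h x (n + 1) (dif (sp M x) n v))"
        by (rule exI[of _ "\<lambda>x n v. 0"])
          (use zero gl_zero[OF closed_gl[OF f] mod_cc[OF small_moduleD[OF zero(1)]]] in
            \<open>auto simp: graded_zero[OF N HC] mod_dif_rules[OF N]\<close>)
    qed
  next
    case (repr x M)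
    then show ?case using hproj_retract[OF equivalent_retract] hproj_representable[OF C] by blast
  next
    case (shift M k)
    then show ?case using hproj_shift[OF HC perf_module[OF _ HC]] by blast
  next
    case (cone M N f Z)
    then show ?case using hproj_retract[OF equivalent_retract hproj_cone[OF HC perf_module[OF _ HC] perf_module[OF _ HC]]] by blast
  next
    case (retract M N)
    then show ?case using hproj_retract by blast
  }
qed

section \<open>Maps out of direct sums\<close>

lemma sum_piece:
  assumes T: "dg_module C T" and x: "x \<in> Obj C" and t: "\<And>j. j \<in> J \<Longrightarrow> t j \<in> piece (sp T x) n"
  shows "(\<Sum>j\<in>J. t j) \<in> piece (sp T x) n"
  using t by (induction J rule: infinite_finite_induct) (auto simp: mod_cc_rules[OF T] x)

lemma sum_dif:
  assumes T: "dg_module C T" and x: "x \<in> Obj C" and t: "\<And>j. j \<in> J \<Longrightarrow> t j \<in> piece (sp T x) n"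
  shows "dif (sp T x) n (\<Sum>j\<in>J. t j) = (\<Sum>j\<in>J. dif (sp T x) n (t j))"
  using t by (induction J rule: infinite_finite_induct) (auto simp: mod_dif_rules[OF T] sum_piece[OF T] x)

lemma sum_act:
  assumes T: "dg_module C T" and o: "x \<in> Obj C" "y \<in> Obj C" "a \<in> piece (Hom C x y) n" and t: "\<And>j. j \<in> J \<Longrightarrow> t j \<in> piece (sp T y) m"
  shows "act T x y m n (\<Sum>j\<in>J. t j) a = (\<Sum>j\<in>J. act T x y m n (t j) a)"
  using t by (induction J rule: infinite_finite_induct) (auto simp: act_left_rules[OF T] sum_piece[OF T] o)

lemma sum_scl:
  assumes V: "cochain_complex V"
  shows "scl V c (\<Sum>j\<in>J. t j) = (\<Sum>j\<in>J. scl V c (t j))"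
  by (induction J rule: infinite_finite_induct) (auto simp: scl_add[OF V] scl_zero_right[OF V])

definition dsum_map :: "('j \<Rightarrow> 'o \<Rightarrow> int \<Rightarrow> 'm::ab_group_add \<Rightarrow> 'n::ab_group_add) \<Rightarrow> 'o \<Rightarrow> int \<Rightarrow> ('j \<Rightarrow> 'm) \<Rightarrow> 'n" where
  "dsum_map h x n s = (\<Sum>j | s j \<noteq> 0. h j x n (s j))"

context
  fixes C :: "('o, 'k::field, 'h::ab_group_add) dgcat" and M :: "'j \<Rightarrow> ('o, 'k, 'h, 'm::ab_group_add) dgmod"
    and T :: "('o, 'k, 'h, 'n::ab_group_add) dgmod" and h p
  assumes C: "hom_complexes C" and M: "\<And>j. dg_module C (M j)" and T: "dg_module C T"
    and h: "\<And>j. graded_map C (M j) T p (h j)"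
begin

text \<open>Enlarging the index set adds only zeros. Additivity needs this, since two elements have
  to be summed over a common finite set containing both supports.\<close>

lemma dsum_map_superset:
  assumes x: "x \<in> Obj C" and J: "finite J" "\<And>j. j \<notin> J \<Longrightarrow> s j = 0"
  shows "dsum_map h x n s = (\<Sum>j\<in>J. h j x n (s j))"
  unfolding dsum_map_def
  by (rule sum.mono_neutral_left[OF J(1)]) (use J(2) gl_zero[OF gm_gl[OF h x] mod_cc[OF M x]] in auto)

lemma dsum_map_graded: "graded_map C (dsum_mod M) T p (dsum_map h)"
proof (rule graded_mapI, rule graded_linearI, goal_cases)
  case (1 x n s)
  then show ?case unfolding dsum_map_def by (auto intro!: sum_piece[OF T] gm_in[OF h])
next
  case (2 x n s t)
  let ?J = "{j. s j \<noteq> 0} \<union> {j. t j \<noteq> 0}"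
  have J: "finite ?J" using 2 by simp
  have "dsum_map h x n (s + t) = (\<Sum>j\<in>?J. h j x n ((s + t) j))" by (rule dsum_map_superset[OF 2(1) J]) simp
  also have "\<dots> = (\<Sum>j\<in>?J. h j x n (s j)) + (\<Sum>j\<in>?J. h j x n (t j))"
    unfolding sum.distrib[symmetric] by (rule sum.cong) (use 2 in \<open>simp_all add: gm_add[OF h]\<close>)
  also have "(\<Sum>j\<in>?J. h j x n (s j)) = dsum_map h x n s" by (rule dsum_map_superset[OF 2(1) J, symmetric]) simp
  also have "(\<Sum>j\<in>?J. h j x n (t j)) = dsum_map h x n t" by (rule dsum_map_superset[OF 2(1) J, symmetric]) simp
  finally show ?case .
next
  case (3 x n s c)
  have J: "finite {j. s j \<noteq> 0}" using 3 by simp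
  have "dsum_map h x n (\<lambda>j. scl (sp (M j) x) c (s j)) = (\<Sum>j | s j \<noteq> 0. h j x n (scl (sp (M j) x) c (s j)))"
    by (rule dsum_map_superset[OF 3(1) J]) (use scl_zero_right[OF mod_cc[OF M 3(1)]] in simp)
  also have "\<dots> = (\<Sum>j | s j \<noteq> 0. scl (sp T x) c (h j x n (s j)))"
    by (rule sum.cong) (use 3 in \<open>simp_all add: gm_scl[OF h]\<close>)
  also have "\<dots> = scl (sp T x) c (dsum_map h x n s)"
    unfolding dsum_map_def by (rule sum_scl[OF mod_cc[OF T 3(1)], symmetric])
  finally show ?case by simp
next
  case (4 x y m n s a)
  have J: "finite {j. s j \<noteq> 0}" and sj: "\<And>j. s j \<in> piece (sp (M j) y) m" using 4 by auto
  have z: "act (M j) x y m n 0 a = 0" for j using 4 by (simp add: act_left_rules[OF M])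
  have "dsum_map h x (m + n) (\<lambda>j. act (M j) x y m n (s j) a) = (\<Sum>j | s j \<noteq> 0. h j x (m + n) (act (M j) x y m n (s j) a))"
    by (rule dsum_map_superset[OF 4(1) J]) (use z in simp)
  also have "\<dots> = (\<Sum>j | s j \<noteq> 0. act T x y (m + p) n (h j y m (s j)) a)"
    by (rule sum.cong) (use 4 sj in \<open>simp_all add: gm_act[OF h]\<close>)
  also have "\<dots> = act T x y (m + p) n (dsum_map h y m s) a"
    unfolding dsum_map_def by (rule sum_act[OF T 4(1,2,4), symmetric]) (use gm_in[OF h 4(2) sj] in simp)
  finally show ?case by simp
qed

lemma dsum_map_dif:
  assumes x: "x \<in> Obj C" and s: "s \<in> piece (sp (dsum_mod M) x) n"
  shows "dsum_map h x m (dif (sp (dsum_mod M) x) n s) = (\<Sum>j | s j \<noteq> 0. h j x m (dif (sp (M j) x) n (s j)))"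
proof -
  have "dsum_map h x m (\<lambda>j. dif (sp (M j) x) n (s j)) = (\<Sum>j | s j \<noteq> 0. h j x m (dif (sp (M j) x) n (s j)))"
    by (rule dsum_map_superset[OF x]) (use s x in \<open>auto simp: mod_dif_rules[OF M]\<close>)
  then show ?thesis by simp
qed

lemma dif_dsum_map:
  assumes x: "x \<in> Obj C" and s: "s \<in> piece (sp (dsum_mod M) x) n" and "m = n + p"
  shows "dif (sp T x) m (dsum_map h x n s) = (\<Sum>j | s j \<noteq> 0. dif (sp T x) m (h j x n (s j)))"
  unfolding dsum_map_def
  by (rule sum_dif[OF T x]) (use s gm_in[OF h x _ assms(3)] in simp)

end

lemma dsum_map_closed:
  assumes C: "hom_complexes C" and M: "\<And>j. dg_module C (M j)" and T: "dg_module C T"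
    and h: "\<And>j. closed_morphism C (M j) T (h j)"
  shows "closed_morphism C (dsum_mod M) T (dsum_map h)"
proof (rule closed_morphismI[OF dsum_map_graded[OF C M T closed_graded[OF h]]])
  fix x n s assume x: "x \<in> Obj C" and s: "s \<in> piece (sp (dsum_mod M) x) n"
  show "dsum_map h x (n + 1) (dif (sp (dsum_mod M) x) n s) = dif (sp T x) n (dsum_map h x n s)"
    unfolding dsum_map_dif[OF C M T closed_graded[OF h] x s] dif_dsum_map[OF C M T closed_graded[OF h] x s add_0_right[symmetric]]
    by (rule sum.cong) (use s x in \<open>simp_all add: closed_dif[OF h]\<close>)
qed

text \<open>Null-homotopies chosen on the individual summands add up: on each element the sum is
  finite, and the element is the sum of its components.\<close>

lemma hproj_dsum:
  fixes C :: "('o, 'k::field, 'h::ab_group_add) dgcat"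
  assumes C: "hom_complexes C" and M: "\<And>j. dg_module C (M j)" and P: "\<And>j. hproj TYPE('b) C (M j)"
  shows "hproj TYPE('b) C (dsum_mod M)"
proof (rule hprojI)
  fix T :: "('o, 'k, 'h, 'b \<Rightarrow>\<^sub>0 'k) dgmod" and g
  assume sT: "small_module C T" and T: "dg_module C T" and aT: "acyclic_module C T" and g: "closed_morphism C (dsum_mod M) T g"
  let ?e = "\<lambda>j v. (\<lambda>_. 0)(j := v)"
  note S = dg_module_dsum[of C M, OF M C]
  have e_in: "?e j v \<in> piece (sp (dsum_mod M) x) n" if "x \<in> Obj C" "v \<in> piece (sp (M j) x) n" for x n j v
    using that by (simp add: mod_cc_rules[OF M])
  have i: "closed_morphism C (M j) (dsum_mod M) (\<lambda>x n. ?e j)" for j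
    by (rule closed_morphismI, rule graded_mapI, rule graded_linearI)
      (auto simp: mod_cc_rules[OF M] mod_dif_rules[OF M] act_left_rules[OF M] fun_eq_iff scl_zero_right[OF mod_cc[OF M]])
  have "\<exists>h. graded_map C (M j) T (-1) h \<and> (\<forall>x n v. x \<in> Obj C \<longrightarrow> v \<in> piece (sp (M j) x) n \<longrightarrow>
        dif (sp T x) (n - 1) (h x n v) + h x (n + 1) (dif (sp (M j) x) n v) = g x n (?e j v))" for j
    by (rule hprojD[OF P sT aT closed_comp[OF i g], of j]) blast
  then obtain h where h: "\<And>j. graded_map C (M j) T (-1) (h j)"
    and hh: "\<And>j x n v. x \<in> Obj C \<Longrightarrow> v \<in> piece (sp (M j) x) n \<Longrightarrow>
        dif (sp T x) (n - 1) (h j x n v) + h j x (n + 1) (dif (sp (M j) x) n v) = g x n (?e j v)"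
    by metis
  have s_sum: "g x n s = (\<Sum>j | s j \<noteq> 0. g x n (?e j (s j)))" if x: "x \<in> Obj C" and s: "s \<in> piece (sp (dsum_mod M) x) n" for x n s
  proof -
    have fin: "finite {j. s j \<noteq> 0}" and sj: "\<And>j. s j \<in> piece (sp (M j) x) n" using s by auto
    \<comment> \<open>Induction over finite truncations of s. Membership is proved together with the
      formula because g is additive only on the pieces.\<close>
    have "(\<lambda>j. if j \<in> J then s j else 0) \<in> piece (sp (dsum_mod M) x) n \<and>
      g x n (\<lambda>j. if j \<in> J then s j else 0) = (\<Sum>j\<in>J. g x n (?e j (s j)))" if "finite J" for J
      using that
    proof (induction J rule: finite_induct)
      case empty
      have e: "(\<lambda>j. if j \<in> {} then s j else 0) = 0" by (simp add: fun_eq_iff)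
      show ?case unfolding e
        using gl_zero[OF closed_gl[OF g x] mod_cc[OF S x]] cc_zero[OF mod_cc[OF S x]] by simp
    next
      case (insert i J)
      have e: "(\<lambda>j. if j \<in> insert i J then s j else 0) = ?e i (s i) + (\<lambda>j. if j \<in> J then s j else 0)"
        using insert(2) by (auto simp: fun_eq_iff)
      have m: "?e i (s i) \<in> piece (sp (dsum_mod M) x) n" by (rule e_in[OF x sj])
      have r: "(\<lambda>j. if j \<in> J then s j else 0) \<in> piece (sp (dsum_mod M) x) n" using insert(3) by blast
      show ?case
        unfolding e sum.insert[OF insert(1,2)] closed_add[OF g x m r]
        using insert(3) cc_add[OF mod_cc[OF S x] m r] by (simp only: simp_thms)
    qed
    moreover have e: "(\<lambda>j. if j \<in> {j. s j \<noteq> 0} then s j else 0) = s" by (simp add: fun_eq_iff)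
    ultimately show ?thesis using fin e by metis
  qed
  show "\<exists>h. graded_map C (dsum_mod M) T (-1) h \<and> (\<forall>x\<in>Obj C. \<forall>n. \<forall>v\<in>piece (sp (dsum_mod M) x) n.
        g x n v = dif (sp T x) (n - 1) (h x n v) + h x (n + 1) (dif (sp (dsum_mod M) x) n v))"
  proof (rule exI, intro conjI ballI allI)
    show "graded_map C (dsum_mod M) T (-1) (dsum_map h)" by (rule dsum_map_graded[OF C M T h])
    fix x n s assume x: "x \<in> Obj C" and s: "s \<in> piece (sp (dsum_mod M) x) n"
    have sj: "\<And>j. s j \<in> piece (sp (M j) x) n" using s by auto
    have m: "n - 1 = n + -1" by simp
    show "g x n s = dif (sp T x) (n - 1) (dsum_map h x n s) + dsum_map h x (n + 1) (dif (sp (dsum_mod M) x) n s)"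
      unfolding dsum_map_dif[OF C M T h x s] dif_dsum_map[OF C M T h x s m] sum.distrib[symmetric] s_sum[OF x s]
      by (rule sum.cong) (simp_all add: hh[OF x sj])
  qed
qed

section \<open>Tensoring a module with a complex\<close>

text \<open>The module (V \<otimes> N)(x) = V \<otimes> N(x). The action involves the right factor
  only, from the right, hence without sign.\<close>

definition vtens ::
  "('k::field, 'v::ab_group_add) cpx \<Rightarrow> ('o, 'k, 'h, 'n::ab_group_add) dgmod \<Rightarrow> ('o, 'k, 'h, (unit, 'v, 'n, 'k) formal) dgmod" where
  "vtens V N = \<lparr>sp = (\<lambda>x. tensor_cpx V (sp N x)),
     act = (\<lambda>x y m n t a. tensor_map V (sp N x) 0 n (\<lambda>p v. v) (\<lambda>q w. act N x y q n w a) t)\<rparr>"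

lemma vtens_simps [simp]:
  "sp (vtens V N) x = tensor_cpx V (sp N x)"
  "act (vtens V N) x y m n t a = tensor_map V (sp N x) 0 n (\<lambda>p v. v) (\<lambda>q w. act N x y q n w a) t"
  by (simp_all add: vtens_def)

lemma id_gl: "graded_linear V V 0 (\<lambda>p v. v)"
  by (rule graded_linearI) simp_all

lemma act_gl:
  assumes "dg_module C N" "x \<in> Obj C" "y \<in> Obj C" "a \<in> piece (Hom C x y) n"
  shows "graded_linear (sp N y) (sp N x) n (\<lambda>q w. act N x y q n w a)"
  by (rule graded_linearI) (use assms in \<open>simp_all add: act_in[OF assms(1)] act_left_rules[OF assms(1)]\<close>)

text \<open>Same sign convention as \<open>ext_map\<close>, with a plain complex as left
  factor.\<close>

definition vmap ::
  "('k::field, 'v'::ab_group_add) cpx \<Rightarrow> ('o, 'k, 'h, 'n'::ab_group_add) dgmod \<Rightarrow> int \<Rightarrow> int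
   \<Rightarrow> (int \<Rightarrow> 'v \<Rightarrow> 'v') \<Rightarrow> ('o \<Rightarrow> int \<Rightarrow> 'n \<Rightarrow> 'n')
   \<Rightarrow> 'o \<Rightarrow> int \<Rightarrow> (unit, 'v::ab_group_add, 'n, 'k) formal \<Rightarrow> (unit, 'v', 'n', 'k) formal" where
  "vmap V' N' a b \<gamma> \<psi> = (\<lambda>x n. tensor_map V' (sp N' x) a b (\<lambda>p v. koszul (b * p) (\<gamma> p v)) (\<psi> x))"

lemma vmap_rules:
  "vmap V' N' a b \<gamma> \<psi> x k (s + t) = vmap V' N' a b \<gamma> \<psi> x k s + vmap V' N' a b \<gamma> \<psi> x k t"
  "vmap V' N' a b \<gamma> \<psi> x k 0 = 0"
  "vmap V' N' a b \<gamma> \<psi> x k (koszul j t) = koszul j (vmap V' N' a b \<gamma> \<psi> x k t)"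
  "vmap V' N' a b \<gamma> \<psi> x k (- t) = - vmap V' N' a b \<gamma> \<psi> x k t"
  "vmap V' N' a b \<gamma> \<psi> x k (s - t) = vmap V' N' a b \<gamma> \<psi> x k s - vmap V' N' a b \<gamma> \<psi> x k t"
  by (simp_all add: vmap_def tensor_map_rules)

context
  fixes C :: "('o, 'k::field, 'h::ab_group_add) dgcat" and V :: "('k, 'v::ab_group_add) cpx"
    and N :: "('o, 'k, 'h, 'n::ab_group_add) dgmod"
  assumes C: "hom_complexes C" and V: "cochain_complex V" and N: "dg_module C N"
begin

lemma vtens_act_tns:
  assumes "x \<in> Obj C" "y \<in> Obj C" "a \<in> piece (Hom C x y) n" "v \<in> piece V p" "w \<in> piece (sp N y) q"
  shows "tensor_map V (sp N x) 0 n (\<lambda>p v. v) (\<lambda>q w. act N x y q n w a) (tns V (sp N y) p q v w)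
    = tns V (sp N x) p (q + n) v (act N x y q n w a)"
  using tensor_map_tns[OF V mod_cc[OF N assms(2)] V mod_cc[OF N assms(1)] id_gl act_gl[OF N assms(1-3)] assms(4,5)] by simp

lemma dg_module_vtens: "dg_module C (vtens V N)"
proof (rule dg_moduleI, goal_cases)
  case (1 x)
  then show ?case by (simp add: cochain_complex_tensor V mod_cc[OF N])
next
  case (2 x y)
  note cx = mod_cc[OF N 2(1)] and cy = mod_cc[OF N 2(2)] and ch = hom_cc[OF C 2]
  note cz = cochain_complex_tensor[OF V cx]
  note at = vtens_act_tns[OF 2]
  show ?case
  proof (rule bilinear_pairingI, goal_cases)
    case (1 m n u a)
    then show ?case
      using tensor_map_in[OF V cy V cx id_gl act_gl[OF N 2 1(2)], of u m "m + n"] by simp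
  next
    case (3 m n u a a')
    from 3(1) have "u \<in> piece (tensor_cpx V (sp N y)) m" by simp
    from V cy this show ?case
    proof (induction rule: tensor_induct)
      case (ten p q v w)
      then show ?case using 2 3
        by (simp add: at act_right_rules[OF N C] tns_rules[OF V cx] act_in[OF N] cc_rules[OF ch])
    qed (simp_all add: tensor_map_rules algebra_simps)
  next
    case (5 m n u a c)
    from 5(1) have "u \<in> piece (tensor_cpx V (sp N y)) m" by simp
    from V cy this show ?case
    proof (induction rule: tensor_induct)
      case (ten p q v w)
      then show ?case using 2 5
        by (simp add: at act_right_rules[OF N C] tns_rules[OF V cx] act_in[OF N] cc_rules[OF ch])
    qed (simp_all add: tensor_map_rules scl_zero_right[OF cz, simplified] scl_add[OF cz, simplified] algebra_simps)
  next
    case (6 m n u a)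
    from 6(1) have "u \<in> piece (tensor_cpx V (sp N y)) m" by simp
    from V cy this show ?case
    proof (induction rule: tensor_induct)
      case (ten p q v w)
      then show ?case using 2 6
        by (cases "even p"; cases "even q")
          (simp_all add: at act_right_rules[OF N C] tns_rules[OF V cx] act_in[OF N] cc_rules[OF ch] cc_rules[OF cx] cc_rules[OF cy] cc_rules[OF V]
            tns_dif[OF V cx] tns_dif[OF V cy] tensor_map_rules act_dif[OF N] koszul_def algebra_simps)
    qed (simp_all add: tensor_map_rules tensor_dif_rules[OF V cx] tensor_dif_rules[OF V cy] koszul_add algebra_simps)
  qed (simp_all add: tensor_map_rules tensor_map_scl)
next
  case (3 x y z l m n v g f)
  then have "v \<in> piece (tensor_cpx V (sp N z)) l" by simp
  from V mod_cc[OF N 3(3)] this show ?case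
  proof (induction rule: tensor_induct)
    case (ten p q v w)
    have [simp]: "q + (m + n) = q + m + n" by simp
    have "graded_linear (sp N z) (sp N x) (m + n) (\<lambda>q w. act N x z q (m + n) w (cmp C x y z m n g f))"
      by (rule graded_linearI)
        (use 3 in \<open>simp_all add: act_act[OF N, symmetric] act_in[OF N] act_left_rules[OF N] mod_cc_rules[OF N]\<close>)
    from tensor_map_tns[OF V mod_cc[OF N 3(3)] V mod_cc[OF N 3(1)] id_gl this ten(2,3)]
    show ?case using 3 ten
      by (simp add: vtens_act_tns act_act[OF N] act_in[OF N])
  qed (simp_all add: tensor_map_rules)
next
  case (4 x n v)
  then have "v \<in> piece (tensor_cpx V (sp N x)) n" by simp
  from V mod_cc[OF N 4(1)] this show ?case
  proof (induction rule: tensor_induct)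
    case (ten p q v w)
    have "graded_linear (sp N x) (sp N x) 0 (\<lambda>q w. act N x x q 0 w (idt C x))"
      by (rule graded_linearI) (use 4(1) in \<open>simp_all add: act_idt[OF N] mod_cc_rules[OF N]\<close>)
    from tensor_map_tns[OF V mod_cc[OF N 4(1)] V mod_cc[OF N 4(1)] id_gl this ten(2,3)]
    show ?case using 4(1) ten by (simp add: act_idt[OF N])
  qed (simp_all add: tensor_map_rules)
qed

context
  fixes V' :: "('k, 'v'::ab_group_add) cpx" and N' :: "('o, 'k, 'h, 'n'::ab_group_add) dgmod" and a b \<gamma> \<psi>
  assumes V': "cochain_complex V'" and N': "dg_module C N'"
    and \<gamma>: "graded_linear V V' a \<gamma>" and \<psi>: "graded_map C N N' b \<psi>"
begin

lemma vmap_tns: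
  assumes "x \<in> Obj C" "v \<in> piece V p" "w \<in> piece (sp N x) q"
  shows "vmap V' N' a b \<gamma> \<psi> x n (tns V (sp N x) p q v w)
    = koszul (b * p) (tns V' (sp N' x) (p + a) (q + b) (\<gamma> p v) (\<psi> x q w))"
  unfolding vmap_def using assms
  by (simp add: tensor_map_tns V V' mod_cc[OF N] mod_cc[OF N'] koszul_gl[OF \<gamma> V V'] gm_gl[OF \<psi>]
      gl_in[OF \<gamma>] gm_in[OF \<psi>] tns_rules)

lemma vmap_graded: "c = a + b \<Longrightarrow> graded_map C (vtens V N) (vtens V' N') c (vmap V' N' a b \<gamma> \<psi>)"
proof (rule graded_mapI, goal_cases)
  case (1 x)
  then show ?case
    unfolding vmap_def vtens_simps
    by (simp add: tensor_map_gl V V' mod_cc[OF N] mod_cc[OF N'] koszul_gl[OF \<gamma> V V'] gm_gl[OF \<psi>])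
next
  case (2 x y m n v h)
  have at': "tensor_map V' (sp N' x) 0 n (\<lambda>p v. v) (\<lambda>q w. act N' x y q n w h) (tns V' (sp N' y) p q v w)
    = tns V' (sp N' x) p (q + n) v (act N' x y q n w h)"
    if "v \<in> piece V' p" "w \<in> piece (sp N' y) q" for p q v w
    using tensor_map_tns[OF V' mod_cc[OF N' 2(3)] V' mod_cc[OF N' 2(2)] id_gl act_gl[OF N' 2(2,3,5)] that] by simp
  from 2 have "v \<in> piece (tensor_cpx V (sp N y)) m" by simp
  from V mod_cc[OF N 2(3)] this show ?case
  proof (induction rule: tensor_induct)
    case (ten p q v w)
    then show ?case using 2
      by (simp add: vtens_act_tns at' vmap_tns tensor_map_rules act_in[OF N] gm_act[OF \<psi>] gm_in[OF \<psi>] gl_in[OF \<gamma>] algebra_simps)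
  qed (simp_all add: tensor_map_rules vmap_rules)
qed

end

end

lemma vmap_closed:
  assumes g: "hom_complexes C" "cochain_complex V" "dg_module C H" "cochain_complex V'" "dg_module C H'"
    "graded_linear V V' 0 \<gamma>" and \<psi>: "closed_morphism C H H' \<psi>"
    and \<gamma>d: "\<And>n m v. v \<in> piece V n \<Longrightarrow> m = n + 1 \<Longrightarrow> \<gamma> m (dif V n v) = dif V' n (\<gamma> n v)"
  shows "closed_morphism C (vtens V H) (vtens V' H') (vmap V' H' 0 0 \<gamma> \<psi>)"
proof (rule closed_morphismI)
  note g = g closed_graded[OF \<psi>]
  show "graded_map C (vtens V H) (vtens V' H') 0 (vmap V' H' 0 0 \<gamma> \<psi>)"
    by (rule vmap_graded[OF g]) simp
  fix y n t assume y: "y \<in> Obj C" and "t \<in> piece (sp (vtens V H) y) n"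
  then have t: "t \<in> piece (tensor_cpx V (sp H y)) n" by simp
  note cc = g(2) mod_cc[OF g(3) y] g(4) mod_cc[OF g(5) y]
  from cc(1,2) t
  show "vmap V' H' 0 0 \<gamma> \<psi> y (n + 1) (dif (sp (vtens V H) y) n t) = dif (sp (vtens V' H') y) n (vmap V' H' 0 0 \<gamma> \<psi> y n t)"
  proof (induction rule: tensor_induct)
    case (ten p q v w)
    then show ?case using y
      by (simp add: vmap_tns[OF g] vmap_rules tns_dif[OF cc(1,2)] tns_dif[OF cc(3,4)] cc_rules[OF cc(1)] cc_rules[OF cc(2)]
          gl_in[OF g(6)] closed_in[OF \<psi>] closed_dif[OF \<psi>] \<gamma>d)
  qed (simp_all add: vmap_rules tensor_dif_rules[OF cc(1,2)] tensor_dif_rules[OF cc(3,4)])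
qed

section \<open>Balanced tensor products\<close>

text \<open>The balanced relations for an arbitrary family of complexes with a pairing \<rho>. Two
  instances occur: a bimodule with its left variable, which gives the convolution, and a module over
  the opposite category, which gives G \<otimes> F over C.\<close>

definition brels ::
  "('o, 'k::field, 'h::ab_group_add) dgcat \<Rightarrow> ('o \<Rightarrow> int \<Rightarrow> 'm set) \<Rightarrow> ('o \<Rightarrow> 'o \<Rightarrow> int \<Rightarrow> int \<Rightarrow> 'm::ab_group_add \<Rightarrow> 'h \<Rightarrow> 'm)
   \<Rightarrow> ('o, 'k, 'h, 'n::ab_group_add) dgmod \<Rightarrow> ('o, 'm, 'n, 'k) formal set" where
  "brels C L \<rho> F = {gen x p (q + s) k (act F x x' q s f a) - koszul (s * q) (gen x' (p + s) q (\<rho> x x' p s k a) f)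
      | x x' p q s k f a. x \<in> Obj C \<and> x' \<in> Obj C \<and>
          k \<in> L x p \<and> f \<in> piece (sp F x') q \<and> a \<in> piece (Hom C x x') s}"

locale balanced =
  fixes C :: "('o, 'k::field, 'h::ab_group_add) dgcat" and L :: "'o \<Rightarrow> ('k, 'm::ab_group_add) cpx"
    and \<rho> :: "'o \<Rightarrow> 'o \<Rightarrow> int \<Rightarrow> int \<Rightarrow> 'm \<Rightarrow> 'h \<Rightarrow> 'm" and F :: "('o, 'k, 'h, 'n::ab_group_add) dgmod"
    and E :: "('o, 'm, 'n, 'k) formal set"
  assumes C: "hom_complexes C" and F: "dg_module C F" and L: "\<And>x. x \<in> Obj C \<Longrightarrow> cochain_complex (L x)"
    and \<rho>: "\<And>x x'. x \<in> Obj C \<Longrightarrow> x' \<in> Obj C \<Longrightarrow> bilinear_pairing (L x) (Hom C x x') (L x') (\<rho> x x')"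
    and E: "E = brels C (\<lambda>x. piece (L x)) \<rho> F"
begin

sublocale tensor_data "Obj C" L "sp F" E
  by unfold_locales (simp_all add: L mod_cc[OF F])

lemma ten_balanced:
  assumes "x \<in> Obj C" "x' \<in> Obj C" "k \<in> piece (L x) p" "f \<in> piece (sp F x') q" "a \<in> piece (Hom C x x') s" "r = q + s"
  shows "tn x p r k (act F x x' q s f a) = koszul (s * q) (tn x' (p + s) q (\<rho> x x' p s k a) f)"
proof -
  have "pr (gen x p (q + s) k (act F x x' q s f a) - koszul (s * q) (gen x' (p + s) q (\<rho> x x' p s k a) f)) = 0"
    by (rule pr_rel, rule UnI2) (use assms in \<open>unfold E brels_def, blast\<close>)
  then show ?thesis using assms(6) by (simp add: ten_def pr_simps)
qed

text \<open>By the Leibniz rules for both actions, the differential of a balanced relation is a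
  combination of the relations obtained by differentiating k, f and a.\<close>

sublocale tensor_complex "Obj C" L "sp F" E
proof
  fix e assume "e \<in> E"
  then obtain x x' p q s k f a where e: "e = gen x p (q + s) k (act F x x' q s f a) - koszul (s * q) (gen x' (p + s) q (\<rho> x x' p s k a) f)"
    and o: "x \<in> Obj C" "x' \<in> Obj C" and m: "k \<in> piece (L x) p" "f \<in> piece (sp F x') q" "a \<in> piece (Hom C x x') s"
    unfolding E brels_def by blast
  have lin: "pr (tensor_dif L (sp F) (s - koszul j t)) = pr (tensor_dif L (sp F) s) - koszul j (pr (tensor_dif L (sp F) t))" for s t j
    by (simp add: tensor_dif_def lext_eq_lin_ext lin_ext_rules[OF vector_space_fscale] pr_simps)
  note cL = cc_rules[OF L] and dF = act_dif[OF F] and d\<rho> = bp_dif[OF \<rho>]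
  show "pr (tensor_dif L (sp F) e) = 0"
    unfolding e lin proj_tensor_dif_ten using o m
    by (cases "even p"; cases "even q"; cases "even s")
      (simp_all add: dF d\<rho> act_in[OF F] bp_in[OF \<rho>] cL mod_cc_rules[OF F] cc_rules[OF hom_cc[OF C]] ten_rules ten_balanced koszul_def algebra_simps)
qed

lemma balanced_lift:
  assumes s: "vector_space s" and b: "bilinear_on (Obj C) L (sp F) s b"
    and bal: "\<And>x x' p q r k f a. x \<in> Obj C \<Longrightarrow> x' \<in> Obj C \<Longrightarrow> k \<in> piece (L x) p \<Longrightarrow> f \<in> piece (sp F x') q \<Longrightarrow>
       a \<in> piece (Hom C x x') r \<Longrightarrow>
       b x p (q + r) k (act F x x' q r f a) = koszul (r * q) (b x' (p + r) q (\<rho> x x' p r k a) f)"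
  shows "lin_ext s (\<lambda>(i, p, q, v, w). b i p q v w) (tn x p q k f) = b x p q k f"
proof (rule lift_ten[OF s b])
  fix e assume "e \<in> E"
  then show "lin_ext s (\<lambda>(i, p, q, v, w). b i p q v w) e = 0"
    unfolding E brels_def by (auto simp: lin_ext_rules[OF s] lin_ext_gen[OF s] bal)
qed

end

section \<open>Convolution\<close>

abbreviation lunit where
  "lunit C x x' y s a \<equiv> tns (Hom C x x') (Hom C y y) s 0 a (idt C y)"

abbreviation runit where
  "runit C x z y r b \<equiv> tns (Hom C x x) (Hom C z y) 0 r (idt C x) b"

definition lact ::
  "('o, 'k::field, 'h::ab_group_add) dgcat \<Rightarrow> ('o, 'k, 'h, 'm::ab_group_add) dgbimod \<Rightarrow> 'o
   \<Rightarrow> 'o \<Rightarrow> 'o \<Rightarrow> int \<Rightarrow> int \<Rightarrow> 'm \<Rightarrow> 'h \<Rightarrow> 'm" where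
  "lact C K y x x' p s k a = act K (x', y) (x, y) p s k (lunit C x x' y s a)"

definition ract ::
  "('o, 'k::field, 'h::ab_group_add) dgcat \<Rightarrow> ('o, 'k, 'h, 'm::ab_group_add) dgbimod \<Rightarrow> 'o
   \<Rightarrow> 'o \<Rightarrow> 'o \<Rightarrow> int \<Rightarrow> int \<Rightarrow> 'm \<Rightarrow> 'h \<Rightarrow> 'm" where
  "ract C K x z y p r k b = act K (x, z) (x, y) p r k (runit C x z y r b)"

lemma balanced_rels_eq: "balanced_rels C K F y = brels C (\<lambda>x. piece (sp K (x, y))) (lact C K y) F"
  by (simp add: balanced_rels_def brels_def lact_def tproj_gen)

abbreviation ctn where
  "ctn C K F y x p q k f \<equiv> ten (Obj C) (\<lambda>x. sp K (x, y)) (sp F) (balanced_rels C K F y) x p q k f"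

lemma convolution_sp: "sp (convolution C K F) y = tensor_family (Obj C) (\<lambda>x. sp K (x, y)) (sp F) (balanced_rels C K F y)"
  by (simp add: convolution_def)

context
  fixes C :: "('o, 'k::field, 'h::ab_group_add) dgcat"
  assumes C: "dg_category C"
begin

lemma env_objects: "x \<in> Obj C \<Longrightarrow> y \<in> Obj C \<Longrightarrow> (x, y) \<in> Obj (env_cat C)"
  by simp

lemma dg_category_env_hom: "hom_complexes (env_cat C)"
  by (rule hom_complexes_tensor[OF dg_category_hom_complexes[OF dg_category_op[OF C]] dg_category_hom_complexes[OF C]])

lemma lunit_in: "x \<in> Obj C \<Longrightarrow> x' \<in> Obj C \<Longrightarrow> y \<in> Obj C \<Longrightarrow> a \<in> piece (Hom C x x') s \<Longrightarrow>
    lunit C x x' y s a \<in> piece (Hom (env_cat C) (x', y) (x, y)) s"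
  by (simp add: tns_in hom_cc[OF dg_category_hom_complexes[OF C]] idt_in[OF C])

lemma runit_in: "x \<in> Obj C \<Longrightarrow> z \<in> Obj C \<Longrightarrow> y \<in> Obj C \<Longrightarrow> b \<in> piece (Hom C z y) r \<Longrightarrow>
    runit C x z y r b \<in> piece (Hom (env_cat C) (x, z) (x, y)) r"
  by (simp add: tns_in hom_cc[OF dg_category_hom_complexes[OF C]] idt_in[OF C])

context
  fixes K :: "('o, 'k, 'h, 'm::ab_group_add) dgbimod"
  assumes K: "dg_module (env_cat C) K"
begin

lemma bimod_cc: "x \<in> Obj C \<Longrightarrow> y \<in> Obj C \<Longrightarrow> cochain_complex (sp K (x, y))"
  using mod_cc[OF K env_objects] .

text \<open>The identity is a cycle of degree 0, so a \<mapsto> a \<otimes> id is a chain map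
  without signs and the axioms are those of the bimodule action.\<close>

lemma lact_pairing:
  assumes x: "x \<in> Obj C" and x': "x' \<in> Obj C" and y: "y \<in> Obj C"
  shows "bilinear_pairing (sp K (x, y)) (Hom C x x') (sp K (x', y)) (lact C K y x x')"
proof -
  note h = hom_cc[OF dg_category_hom_complexes[OF C]]
  note b = act_pairing[OF K env_objects[OF x' y] env_objects[OF x y]]
  note l = lunit_in[OF x x' y]
  note t = tns_rules[OF h[OF x x'] h[OF y y]] and i = idt_in[OF C y]
  note hh = hom_cc[OF dg_category_env_hom env_objects[OF x' y] env_objects[OF x y]]
  show ?thesis
  proof (rule bilinear_pairingI, goal_cases)
    case (1 m n u v)
    then show ?case unfolding lact_def using bp_in[OF b 1(1) l[OF 1(2)]] by simp
  next
    case (2 m n u u' v)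
    then show ?case unfolding lact_def using bp_add_left[OF b 2(1,2) l[OF 2(3)]] by simp
  next
    case (3 m n u v v')
    then show ?case unfolding lact_def using bp_add_right[OF b 3(1) l[OF 3(2)] l[OF 3(3)]] by (simp add: t i)
  next
    case (4 m n u v c)
    then show ?case unfolding lact_def using bp_scl_left[OF b 4(1) l[OF 4(2)]] by simp
  next
    case (5 m n u v c)
    then show ?case unfolding lact_def using bp_scl_right[OF b 5(1) l[OF 5(2)]] by (simp add: t i)
  next
    case (6 m n u v)
    have "dif (Hom (env_cat C) (x', y) (x, y)) n (lunit C x x' y n v) = lunit C x x' y (n + 1) (dif (Hom C x x') n v)"
      using 6 by (simp add: tns_dif[OF h[OF x x'] h[OF y y]] i dif_idt[OF C y] t)
    then show ?case unfolding lact_def using bp_dif[OF b 6(1) l[OF 6(2)] refl] by simp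
  qed
qed

lemma ract_pairing:
  assumes x: "x \<in> Obj C" and z: "z \<in> Obj C" and y: "y \<in> Obj C"
  shows "bilinear_pairing (sp K (x, y)) (Hom C z y) (sp K (x, z)) (ract C K x z y)"
proof -
  note h = hom_cc[OF dg_category_hom_complexes[OF C]]
  note b = act_pairing[OF K env_objects[OF x z] env_objects[OF x y]]
  note l = runit_in[OF x z y]
  note t = tns_rules[OF h[OF x x] h[OF z y]] and i = idt_in[OF C x]
  note hh = hom_cc[OF dg_category_env_hom env_objects[OF x z] env_objects[OF x y]]
  show ?thesis
  proof (rule bilinear_pairingI, goal_cases)
    case (1 m n u v)
    then show ?case unfolding ract_def using bp_in[OF b 1(1) l[OF 1(2)]] by simp
  next
    case (2 m n u u' v)
    then show ?case unfolding ract_def using bp_add_left[OF b 2(1,2) l[OF 2(3)]] by simp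
  next
    case (3 m n u v v')
    then show ?case unfolding ract_def using bp_add_right[OF b 3(1) l[OF 3(2)] l[OF 3(3)]] by (simp add: t i)
  next
    case (4 m n u v c)
    then show ?case unfolding ract_def using bp_scl_left[OF b 4(1) l[OF 4(2)]] by simp
  next
    case (5 m n u v c)
    then show ?case unfolding ract_def using bp_scl_right[OF b 5(1) l[OF 5(2)]] by (simp add: t i)
  next
    case (6 m n u v)
    have "dif (Hom (env_cat C) (x, z) (x, y)) n (runit C x z y n v) = runit C x z y (n + 1) (dif (Hom C z y) n v)"
      using 6 by (simp add: tns_dif[OF h[OF x x] h[OF z y]] i dif_idt[OF C x] t)
    then show ?case unfolding ract_def using bp_dif[OF b 6(1) l[OF 6(2)] refl] by simp
  qed
qed

text \<open>The sign of qr comes from moving a' past b in the tensor product, that of pr from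
  reversing a and b in the opposite category.\<close>

lemma env_cmp:
  assumes "x1 \<in> Obj C" "x2 \<in> Obj C" "x3 \<in> Obj C" "y1 \<in> Obj C" "y2 \<in> Obj C" "y3 \<in> Obj C"
    and "a \<in> piece (Hom C x3 x2) p" "a' \<in> piece (Hom C y2 y3) q" "b \<in> piece (Hom C x2 x1) r" "b' \<in> piece (Hom C y1 y2) s"
  shows "cmp (env_cat C) (x1, y1) (x2, y2) (x3, y3) m n (tns (Hom C x3 x2) (Hom C y2 y3) p q a a') (tns (Hom C x2 x1) (Hom C y1 y2) r s b b')
    = koszul (q * r + p * r) (tns (Hom C x3 x1) (Hom C y1 y3) (p + r) (q + s) (cmp C x3 x2 x1 r p b a) (cmp C y1 y2 y3 q s a' b'))"
proof -
  note h = hom_cc[OF dg_category_hom_complexes[OF C]]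
  have e: "cmp (op_cat C) x1 x2 x3 = (\<lambda>m n g f. koszul (m * n) (cmp C x3 x2 x1 n m f g))"
    by (simp add: fun_eq_iff)
  have b: "bilinear_pairing (Hom C x3 x2) (Hom C x2 x1) (Hom C x3 x1) (cmp (op_cat C) x1 x2 x3)"
    using cmp_pairing[OF dg_category_op[OF C], of x1 x2 x3] assms by simp
  show ?thesis
    using tensor_pair_tns[OF h h h h h h b cmp_pairing[OF C]] assms
    by (simp add: h tns_rules bp_in[OF cmp_pairing[OF C]] koszul_koszul add.commute[of r p])
qed

text \<open>In the enveloping category a \<otimes> b is the composite of a \<otimes> id and id
  \<otimes> b in one order, and up to the sign of rs in the other. So the two actions commute up to
  that sign.\<close>

lemma lact_ract:
  assumes x: "x \<in> Obj C" and x': "x' \<in> Obj C" and y: "y \<in> Obj C" and z: "z \<in> Obj C"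
    and k: "k \<in> piece (sp K (x, y)) p" and a: "a \<in> piece (Hom C x x') s" and b: "b \<in> piece (Hom C z y) r"
    and e: "n = p + r" "m = p + s"
  shows "lact C K z x x' n s (ract C K x z y p r k b) a = koszul (r * s) (ract C K x' z y m r (lact C K y x x' p s k a) b)"
proof -
  note h = hom_cc[OF dg_category_hom_complexes[OF C]]
  note i = idt_in[OF C x] idt_in[OF C x'] idt_in[OF C y] idt_in[OF C z]
  note ab = env_objects[OF x' z] env_objects[OF x z] env_objects[OF x' y] env_objects[OF x y]
  let ?t = "tns (Hom C x x') (Hom C z y) s r a b"
  have t: "?t \<in> piece (Hom (env_cat C) (x', z) (x, y)) (r + s)"
    using x x' y z a b by (simp add: tns_in h)
  have 1: "cmp (env_cat C) (x', z) (x, z) (x, y) r s (runit C x z y r b) (lunit C x x' z s a) = koszul (r * s) ?t"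
    using env_cmp[OF x' x x z z y i(1) b a i(4)] cmp_idt_right[OF C x x' a] cmp_idt_right[OF C z y b] by simp
  have 2: "cmp (env_cat C) (x', z) (x', y) (x, y) s r (lunit C x x' y s a) (runit C x' z y r b) = ?t"
    using env_cmp[OF x' x' x z y y a i(3) i(2) b] cmp_idt_left[OF C x x' a] cmp_idt_left[OF C z y b] by simp
  show ?thesis
    unfolding lact_def ract_def
    using act_act[OF K ab(1,2,4) k runit_in[OF x z y b] lunit_in[OF x x' z a] e(1)] 
      act_act[OF K ab(1,3,4) k lunit_in[OF x x' y a] runit_in[OF x' z y b] e(2)]
      bp_koszul_right[OF act_pairing[OF K ab(1,4)] hom_cc[OF dg_category_env_hom ab(1,4)] k t]
    by (simp only: 1 2 add.commute[of s r])
qed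

context
  fixes F :: "('o, 'k, 'h, 'n::ab_group_add) dgmod"
  assumes F: "dg_module C F"
begin

lemma convolution_balanced: "y \<in> Obj C \<Longrightarrow> balanced C (\<lambda>x. sp K (x, y)) (lact C K y) F (balanced_rels C K F y)"
  by unfold_locales
    (simp_all add: dg_category_hom_complexes[OF C] F bimod_cc lact_pairing balanced_rels_eq)

lemma convolution_tensor: "y \<in> Obj C \<Longrightarrow> tensor_complex (Obj C) (\<lambda>x. sp K (x, y)) (sp F) (balanced_rels C K F y)"
proof -
  assume "y \<in> Obj C"
  then interpret balanced C "\<lambda>x. sp K (x, y)" "lact C K y" F "balanced_rels C K F y"
    by (rule convolution_balanced)
  show ?thesis by unfold_locales
qed

lemma convolution_data: "y \<in> Obj C \<Longrightarrow> tensor_data (Obj C) (\<lambda>x. sp K (x, y)) (sp F)"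
  using convolution_tensor tensor_complex_def by blast

lemmas ctn_rules = tensor_data.ten_rules[OF convolution_data]
lemma ctn_in: "y \<in> Obj C \<Longrightarrow> x \<in> Obj C \<Longrightarrow> k \<in> piece (sp K (x, y)) p \<Longrightarrow> f \<in> piece (sp F x) q \<Longrightarrow> n = p + q \<Longrightarrow>
    ctn C K F y x p q k f \<in> piece (sp (convolution C K F) y) n"
  unfolding convolution_sp by (rule tensor_data.ten_in[OF convolution_data])

lemmas ctn_dif = tensor_complex.dif_ten[OF convolution_tensor, folded convolution_sp]
lemmas convolution_cc = tensor_complex.cochain_complex_T[OF convolution_tensor, folded convolution_sp]
lemmas ctn_balanced = balanced.ten_balanced[OF convolution_balanced]
lemmas ctn_lift = balanced.balanced_lift[OF convolution_balanced]

lemma convolution_dif_rules: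
  assumes "y \<in> Obj C"
  shows "dif (sp (convolution C K F) y) n (s + t) = dif (sp (convolution C K F) y) n s + dif (sp (convolution C K F) y) n t"
    "dif (sp (convolution C K F) y) n 0 = 0"
    "dif (sp (convolution C K F) y) n (- s) = - dif (sp (convolution C K F) y) n s"
    "dif (sp (convolution C K F) y) n (s - t) = dif (sp (convolution C K F) y) n s - dif (sp (convolution C K F) y) n t"
proof -
  interpret l: Vector_Spaces.linear fscale fscale "dif (sp (convolution C K F) y) n"
    unfolding convolution_sp by (rule tensor_data.linear_dif[OF convolution_data[OF assms]])
  show "dif (sp (convolution C K F) y) n (s + t) = dif (sp (convolution C K F) y) n s + dif (sp (convolution C K F) y) n t"
    "dif (sp (convolution C K F) y) n 0 = 0"
    "dif (sp (convolution C K F) y) n (- s) = - dif (sp (convolution C K F) y) n s"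
    "dif (sp (convolution C K F) y) n (s - t) = dif (sp (convolution C K F) y) n s - dif (sp (convolution C K F) y) n t"
    by (simp_all add: l.add l.zero l.neg l.diff)
qed

lemma convolution_scl [simp]: "scl (sp (convolution C K F) y) = fscale"
  by (simp add: convolution_sp)

lemma convolution_act:
  assumes "z \<in> Obj C"
  shows "act (convolution C K F) z y n r t b = lin_ext fscale
    (\<lambda>(x, p, q, k, f). koszul (q * r) (ctn C K F z x (p + r) q (ract C K x z y p r k b) f)) t"
proof -
  interpret Z: balanced C "\<lambda>x. sp K (x, z)" "lact C K z" F "balanced_rels C K F z"
    by (rule convolution_balanced[OF assms])
  show ?thesis
    by (simp add: convolution_def lext_eq_lin_ext linear_comp_lin_ext[OF vector_space_fscale Z.linear_pr]
        case_prod_unfold Z.pr_simps ten_def[symmetric] ract_def)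
qed

lemma convolution_act_rules:
  assumes "z \<in> Obj C"
  shows "act (convolution C K F) z y n r (s + t) b = act (convolution C K F) z y n r s b + act (convolution C K F) z y n r t b"
    "act (convolution C K F) z y n r 0 b = 0"
    "act (convolution C K F) z y n r (- s) b = - act (convolution C K F) z y n r s b"
    "act (convolution C K F) z y n r (s - t) b = act (convolution C K F) z y n r s b - act (convolution C K F) z y n r t b"
    "act (convolution C K F) z y n r (koszul j s) b = koszul j (act (convolution C K F) z y n r s b)"
    "act (convolution C K F) z y n r (fscale c s) b = fscale c (act (convolution C K F) z y n r s b)"
  by (simp_all add: convolution_act[OF assms] lin_ext_rules[OF vector_space_fscale])

text \<open>The formula has to respect the balanced relations, and this is where commutation of the
  left with the right action enters.\<close>

lemma convolution_act_ten:
  assumes z: "z \<in> Obj C" and y: "y \<in> Obj C" and x: "x \<in> Obj C" and k: "k \<in> piece (sp K (x, y)) p"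
    and f: "f \<in> piece (sp F x) q" and b: "b \<in> piece (Hom C z y) r"
  shows "act (convolution C K F) z y n r (ctn C K F y x p q k f) b
    = koszul (q * r) (ctn C K F z x (p + r) q (ract C K x z y p r k b) f)"
  unfolding convolution_act[OF z]
proof (rule ctn_lift[OF y vector_space_fscale])
  note cr = ctn_rules[OF z]
  note rp = ract_pairing[OF _ z y]
  show "bilinear_on (Obj C) (\<lambda>x. sp K (x, y)) (sp F) fscale
     (\<lambda>x p q k f. koszul (q * r) (ctn C K F z x (p + r) q (ract C K x z y p r k b) f))"
    by (rule bilinear_onI)
      (use b in \<open>simp_all add: cr bp_in[OF rp] bp_left_rules[OF rp] koszul_add fscale_koszul\<close>)
next
  fix x x' p q s k f a
  assume *: "x \<in> Obj C" "x' \<in> Obj C" "k \<in> piece (sp K (x, y)) p" "f \<in> piece (sp F x') q" "a \<in> piece (Hom C x x') s"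
  have m: "ract C K x z y p r k b \<in> piece (sp K (x, z)) (p + r)" "lact C K y x x' p s k a \<in> piece (sp K (x', y)) (p + s)"
    using bp_in[OF ract_pairing[OF *(1) z y] *(3) b] bp_in[OF lact_pairing[OF *(1,2) y] *(3,5)] by simp_all
  have m': "ract C K x' z y (p + s) r (lact C K y x x' p s k a) b \<in> piece (sp K (x', z)) (p + s + r)"
    using bp_in[OF ract_pairing[OF *(2) z y] m(2) b] by simp
  have e: "p + r + s = p + s + r" by simp
  show "koszul ((q + s) * r) (ctn C K F z x (p + r) (q + s) (ract C K x z y p r k b) (act F x x' q s f a)) =
     koszul (s * q) (koszul (q * r) (ctn C K F z x' (p + s + r) q (ract C K x' z y (p + s) r (lact C K y x x' p s k a) b) f))"
    unfolding ctn_balanced[OF z *(1,2) m(1) *(4,5) refl] lact_ract[OF *(1,2) y z *(3,5) b refl refl]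
      tensor_data.ten_koszul_left[OF convolution_data[OF z] *(2) m'[folded e] *(4)] koszul_koszul
    by (cases "even q"; cases "even r"; cases "even s") (simp_all add: koszul_def e)
qed

lemma convolution_induct [consumes 2, case_names ten zero add]:
  assumes y: "y \<in> Obj C" and t: "t \<in> piece (sp (convolution C K F) y) n"
    and ten: "\<And>x p q k f. x \<in> Obj C \<Longrightarrow> n = p + q \<Longrightarrow> k \<in> piece (sp K (x, y)) p \<Longrightarrow> f \<in> piece (sp F x) q \<Longrightarrow>
      P (ctn C K F y x p q k f)"
    and zero: "P 0"
    and add: "\<And>s t. s \<in> piece (sp (convolution C K F) y) n \<Longrightarrow> t \<in> piece (sp (convolution C K F) y) n \<Longrightarrow> P s \<Longrightarrow> P t \<Longrightarrow> P (s + t)"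
  shows "P t"
  by (rule tensor_data.piece_induct[OF convolution_data[OF y] t[unfolded convolution_sp]])
    (use ten zero add in \<open>auto simp: convolution_sp\<close>)

end

end

end

lemma convolution_module_induct [consumes 5, case_names ten zero add]:
  assumes "dg_category C" "dg_module (env_cat C) K" "dg_module C F" "y \<in> Obj C" "t \<in> piece (sp (convolution C K F) y) n"
    and "\<And>x p q k f. x \<in> Obj C \<Longrightarrow> n = p + q \<Longrightarrow> k \<in> piece (sp K (x, y)) p \<Longrightarrow> f \<in> piece (sp F x) q \<Longrightarrow>
      P (ctn C K F y x p q k f)"
    and "P 0"
    and "\<And>s t. s \<in> piece (sp (convolution C K F) y) n \<Longrightarrow> t \<in> piece (sp (convolution C K F) y) n \<Longrightarrow> P s \<Longrightarrow> P t \<Longrightarrow> P (s + t)"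
  shows "P t"
  using assms by (rule convolution_induct)

context
  fixes C :: "('o, 'k::field, 'h::ab_group_add) dgcat" and K :: "('o, 'k, 'h, 'm::ab_group_add) dgbimod"
    and F :: "('o, 'k, 'h, 'n::ab_group_add) dgmod"
  assumes C: "dg_category C" and K: "dg_module (env_cat C) K" and F: "dg_module C F"
begin

lemma ract_ract:
  assumes x: "x \<in> Obj C" and y: "y \<in> Obj C" and z: "z \<in> Obj C" and w: "w \<in> Obj C"
    and k: "k \<in> piece (sp K (x, y)) p" and b: "b \<in> piece (Hom C z y) r" and a: "a \<in> piece (Hom C w z) s"
    and n: "n = p + r"
  shows "ract C K x w z n s (ract C K x z y p r k b) a = ract C K x w y p (r + s) k (cmp C w z y r s b a)"
proof -
  have "cmp (env_cat C) (x, w) (x, z) (x, y) r s (runit C x z y r b) (runit C x w z s a) = runit C x w y (r + s) (cmp C w z y r s b a)"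
    using env_cmp[OF C K x x x w z y idt_in[OF C x] b idt_in[OF C x] a] cmp_idt_left[OF C x x idt_in[OF C x]] by simp
  then show ?thesis
    unfolding ract_def
    using act_act[OF K env_objects[OF C x w] env_objects[OF C x z] env_objects[OF C x y] k runit_in[OF C x z y b] runit_in[OF C x w z a] n]
    by simp
qed

lemma ract_idt: "x \<in> Obj C \<Longrightarrow> y \<in> Obj C \<Longrightarrow> k \<in> piece (sp K (x, y)) p \<Longrightarrow> ract C K x y y p 0 k (idt C y) = k"
  using act_idt[OF K env_objects[OF C]] by (simp add: ract_def)

lemma dg_module_convolution: "dg_module C (convolution C K F)"
proof (rule dg_moduleI, goal_cases)
  case (1 y)
  then show ?case by (rule convolution_cc[OF C K F])
next
  case (2 z y)
  note cz = convolution_cc[OF C K F 2(1)] and cy = convolution_cc[OF C K F 2(2)]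
  note rz = ctn_rules[OF C K F 2(1)] and az = convolution_act_rules[OF C K F 2(1)]
  note at = convolution_act_ten[OF C K F 2]
  note rp = ract_pairing[OF C K _ 2]
  note hzy = hom_cc[OF dg_category_hom_complexes[OF C] 2]
  have in': "act (convolution C K F) z y m n u b \<in> piece (sp (convolution C K F) z) (m + n)"
    if "u \<in> piece (sp (convolution C K F) y) m" "b \<in> piece (Hom C z y) n" for m n u b
    using C K F 2(2) that(1)
  proof (induction rule: convolution_module_induct)
    case (ten x p q k f)
    then show ?case using that(2) 2
      by (simp add: at cc_rules[OF cz] ctn_in[OF C K F 2(1)] bp_in[OF rp])
  qed (simp_all add: az cc_rules[OF cz])
  show ?case
  proof (rule bilinear_pairingI, goal_cases)
    case (1 m n u b)
    then show ?case by (rule in')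
  next
    case (3 m n u a a')
    from C K F 2(2) 3(1) show ?case
    proof (induction rule: convolution_module_induct)
      case (ten x p q k f)
      then show ?case using 3(2,3)
        by (simp add: at bp_right_rules[OF rp] bp_in[OF rp] rz cc_rules[OF hzy] koszul_add)
    qed (simp_all add: az algebra_simps)
  next
    case (5 m n u a c)
    from C K F 2(2) 5(1) show ?case
    proof (induction rule: convolution_module_induct)
      case (ten x p q k f)
      then show ?case using 5(2)
        by (simp add: at bp_right_rules[OF rp] bp_in[OF rp] rz cc_rules[OF hzy] convolution_scl[OF C K F] fscale_koszul)
    qed (simp_all add: az convolution_scl[OF C K F] fscale_add scl_zero_right[OF cz, unfolded convolution_scl[OF C K F]])
  next
    case (6 m n u a)
    from C K F 2(2) 6(1) show ?case
    proof (induction rule: convolution_module_induct)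
      case (ten x p q k f)
      then show ?case using 6(2)
        by (cases "even p"; cases "even q"; cases "even n")
          (simp_all add: at az bp_right_rules[OF rp] bp_in[OF rp] bp_dif[OF rp] rz cc_rules[OF hzy] cc_rules[OF bimod_cc[OF C K]]
            mod_cc_rules[OF F] ctn_dif[OF C K F 2(1)] ctn_dif[OF C K F 2(2)]
            convolution_dif_rules[OF C K F 2(1)] koszul_def 2 algebra_simps)
    qed (simp_all add: az convolution_dif_rules[OF C K F 2(1)] convolution_dif_rules[OF C K F 2(2)] koszul_add algebra_simps)
  qed (simp_all add: az convolution_scl[OF C K F])
next
  case (3 w z y l m n v g f)
  note ar = convolution_act_rules[OF C K F 3(1)] convolution_act_rules[OF C K F 3(2)]
  from C K F 3(3,4) show ?case
  proof (induction rule: convolution_module_induct)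
    case (ten x p q k f')
    then show ?case using 3
      by (simp add: ar convolution_act_ten[OF C K F] bp_in[OF ract_pairing[OF C K]] bp_in[OF cmp_pairing[OF C]]
        ract_ract koszul_koszul algebra_simps)
  qed (simp_all add: ar)
next
  case (4 y n v)
  from C K F 4 show ?case
  proof (induction rule: convolution_module_induct)
    case (ten x p q k f)
    then show ?case using 4(1)
      by (simp add: convolution_act_ten[OF C K F] idt_in[OF C] ract_idt)
  qed (simp_all add: convolution_act_rules[OF C K F 4(1)])
qed

end

section \<open>Functoriality of convolution in the bimodule\<close>

definition conv_map ::
  "('o, 'k::field, 'h::ab_group_add) dgcat \<Rightarrow> ('o, 'k, 'h, 'm'::ab_group_add) dgbimod
   \<Rightarrow> ('o, 'k, 'h, 'n::ab_group_add) dgmod \<Rightarrow> int \<Rightarrow> ('o \<times> 'o \<Rightarrow> int \<Rightarrow> 'm \<Rightarrow> 'm')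
   \<Rightarrow> 'o \<Rightarrow> int \<Rightarrow> ('o, 'm, 'n, 'k) formal \<Rightarrow> ('o, 'm', 'n, 'k) formal" where
  "conv_map C K' F a \<phi> = (\<lambda>y n. lin_ext fscale (\<lambda>(x, p, q, k, f). ctn C K' F y x (p + a) q (\<phi> (x, y) p k) f))"

lemma conv_map_rules:
  "conv_map C K' F a \<phi> y n (s + t) = conv_map C K' F a \<phi> y n s + conv_map C K' F a \<phi> y n t"
  "conv_map C K' F a \<phi> y n 0 = 0"
  "conv_map C K' F a \<phi> y n (- t) = - conv_map C K' F a \<phi> y n t"
  "conv_map C K' F a \<phi> y n (koszul j t) = koszul j (conv_map C K' F a \<phi> y n t)"
  "conv_map C K' F a \<phi> y n (fscale c t) = fscale c (conv_map C K' F a \<phi> y n t)"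
  by (simp_all add: conv_map_def lin_ext_rules[OF vector_space_fscale])

context
  fixes C :: "('o, 'k::field, 'h::ab_group_add) dgcat" and K :: "('o, 'k, 'h, 'm::ab_group_add) dgbimod"
    and K' :: "('o, 'k, 'h, 'm'::ab_group_add) dgbimod" and F :: "('o, 'k, 'h, 'n::ab_group_add) dgmod" and a \<phi>
  assumes C: "dg_category C" and K: "dg_module (env_cat C) K" and K': "dg_module (env_cat C) K'" and F: "dg_module C F"
    and \<phi>: "graded_map (env_cat C) K K' a \<phi>"
begin

text \<open>Well defined on balanced tensors because \<phi> commutes with the bimodule action; it
  acts on the left factor, so that no sign arises for any degree of \<phi>.\<close>

lemma conv_map_ten:
  assumes y: "y \<in> Obj C" and x: "x \<in> Obj C" and k: "k \<in> piece (sp K (x, y)) p" and f: "f \<in> piece (sp F x) q"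
  shows "conv_map C K' F a \<phi> y n (ctn C K F y x p q k f) = ctn C K' F y x (p + a) q (\<phi> (x, y) p k) f"
  unfolding conv_map_def
proof (rule ctn_lift[OF C K F y vector_space_fscale])
  note cr = ctn_rules[OF C K' F y]
  note g = gm_gl[OF \<phi> env_objects[OF C _ y]]
  show "bilinear_on (Obj C) (\<lambda>x. sp K (x, y)) (sp F) fscale (\<lambda>x p q k f. ctn C K' F y x (p + a) q (\<phi> (x, y) p k) f)"
    by (rule bilinear_onI) (simp_all add: cr gl_in[OF g] gl_add[OF g] gl_scl[OF g])
next
  fix x x' p q s k f c
  assume *: "x \<in> Obj C" "x' \<in> Obj C" "k \<in> piece (sp K (x, y)) p" "f \<in> piece (sp F x') q" "c \<in> piece (Hom C x x') s"
  have "\<phi> (x', y) (p + s) (lact C K y x x' p s k c) = lact C K' y x x' (p + a) s (\<phi> (x, y) p k) c"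
    unfolding lact_def by (rule gm_act[OF \<phi> env_objects[OF C *(2) y] env_objects[OF C *(1) y] *(3) lunit_in[OF C *(1,2) y *(5)] refl])
  then show "ctn C K' F y x (p + a) (q + s) (\<phi> (x, y) p k) (act F x x' q s f c) =
      koszul (s * q) (ctn C K' F y x' (p + s + a) q (\<phi> (x', y) (p + s) (lact C K y x x' p s k c)) f)"
    using ctn_balanced[OF C K' F y *(1,2) gm_in[OF \<phi> env_objects[OF C *(1) y] *(3) refl] *(4,5) refl]
    by (simp add: ac_simps)
qed

lemma conv_map_graded: "graded_map C (convolution C K F) (convolution C K' F) a (conv_map C K' F a \<phi>)"
proof (rule graded_mapI, rule graded_linearI, goal_cases)
  case (1 y n v)
  from C K F 1 show ?case
  proof (induction rule: convolution_module_induct)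
    case (ten x p q k f)
    then show ?case using 1(1)
      by (simp add: conv_map_ten ctn_in[OF C K' F] gm_in[OF \<phi> env_objects[OF C]])
  qed (simp_all add: conv_map_rules cc_rules[OF convolution_cc[OF C K' F 1(1)]])
next
  case (4 z y m n v b)
  from C K F 4(2,3) show ?case
  proof (induction rule: convolution_module_induct)
    case (ten x p q k f)
    have "\<phi> (x, z) (p + n) (ract C K x z y p n k b) = ract C K' x z y (p + a) n (\<phi> (x, y) p k) b"
      unfolding ract_def using 4 ten
      by (intro gm_act[OF \<phi> env_objects[OF C] env_objects[OF C] _ runit_in[OF C]]) simp_all
    with ten show ?case using 4
      by (simp add: conv_map_ten conv_map_rules convolution_act_ten[OF C K F] convolution_act_ten[OF C K' F] bp_in[OF ract_pairing[OF C K]]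
         gm_in[OF \<phi> env_objects[OF C]] ac_simps)
  qed (simp_all add: conv_map_rules convolution_act_rules[OF C K F 4(1)] convolution_act_rules[OF C K' F 4(1)])
qed (simp_all add: conv_map_rules convolution_scl[OF C K F] convolution_scl[OF C K' F])

end

section \<open>Convolution with a product bimodule\<close>

definition bal_rels ::
  "('o, 'k::field, 'h::ab_group_add) dgcat \<Rightarrow> ('o, 'k, 'h, 'm::ab_group_add) dgmod
   \<Rightarrow> ('o, 'k, 'h, 'n::ab_group_add) dgmod \<Rightarrow> ('o, 'm, 'n, 'k) formal set" where
  "bal_rels C G F = brels C (\<lambda>x. piece (sp G x)) (\<lambda>x x'. act G x' x) F"

text \<open>The complex \<open>G \<otimes>\<^sub>C F\<close>, for \<open>G\<close> a module over the opposite category.\<close>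

definition btens ::
  "('o, 'k::field, 'h::ab_group_add) dgcat \<Rightarrow> ('o, 'k, 'h, 'm::ab_group_add) dgmod
   \<Rightarrow> ('o, 'k, 'h, 'n::ab_group_add) dgmod \<Rightarrow> ('k, ('o, 'm, 'n, 'k) formal) cpx" where
  "btens C G F = tensor_family (Obj C) (sp G) (sp F) (bal_rels C G F)"

abbreviation btn where
  "btn C G F x p q v f \<equiv> ten (Obj C) (sp G) (sp F) (bal_rels C G F) x p q v f"

text \<open>The exchange (v \<otimes> w) \<otimes> f \<mapsto> (-1)^(|w||f|) (v \<otimes> f)
  \<otimes> w for a fixed f. The left factor of the convolution is itself a tensor, so a map out of
  it is built by lifting twice; this is the inner lift.\<close>

definition split0 ::
  "('o, 'k::field, 'h::ab_group_add) dgcat \<Rightarrow> ('o, 'k, 'h, 'm::ab_group_add) dgmod \<Rightarrow> ('o, 'k, 'h, 'l::ab_group_add) dgmod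
   \<Rightarrow> ('o, 'k, 'h, 'n::ab_group_add) dgmod \<Rightarrow> 'o \<Rightarrow> 'o \<Rightarrow> int \<Rightarrow> 'n \<Rightarrow> (unit, 'm, 'l, 'k) formal
   \<Rightarrow> (unit, ('o, 'm, 'n, 'k) formal, 'l, 'k) formal" where
  "split0 C G H F y x q f = lin_ext fscale (\<lambda>(_, a, b, v, w).
     koszul (b * q) (tns (btens C G F) (sp H y) (a + q) b (btn C G F x a q v f) w))"

definition split_map ::
  "('o, 'k::field, 'h::ab_group_add) dgcat \<Rightarrow> ('o, 'k, 'h, 'm::ab_group_add) dgmod \<Rightarrow> ('o, 'k, 'h, 'l::ab_group_add) dgmod
   \<Rightarrow> ('o, 'k, 'h, 'n::ab_group_add) dgmod \<Rightarrow> 'o \<Rightarrow> int \<Rightarrow> ('o, (unit, 'm, 'l, 'k) formal, 'n, 'k) formal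
   \<Rightarrow> (unit, ('o, 'm, 'n, 'k) formal, 'l, 'k) formal" where
  "split_map C G H F = (\<lambda>y n. lin_ext fscale (\<lambda>(x, p, q, k, f). split0 C G H F y x q f k))"

text \<open>The inner lift of the inverse exchange (v \<otimes> f) \<otimes> w \<mapsto>
  (-1)^(|w||f|) (v \<otimes> w) \<otimes> f, for a fixed w.\<close>

definition merge0 ::
  "('o, 'k::field, 'h::ab_group_add) dgcat \<Rightarrow> ('o, 'k, 'h, 'm::ab_group_add) dgmod \<Rightarrow> ('o, 'k, 'h, 'l::ab_group_add) dgmod
   \<Rightarrow> ('o, 'k, 'h, 'n::ab_group_add) dgmod \<Rightarrow> 'o \<Rightarrow> int \<Rightarrow> 'l \<Rightarrow> ('o, 'm, 'n, 'k) formal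
   \<Rightarrow> ('o, (unit, 'm, 'l, 'k) formal, 'n, 'k) formal" where
  "merge0 C G H F y b w = lin_ext fscale (\<lambda>(x, a, q, v, f).
     koszul (b * q) (ctn C (ext_prod G H) F y x (a + b) q (tns (sp G x) (sp H y) a b v w) f))"

definition merge_map ::
  "('o, 'k::field, 'h::ab_group_add) dgcat \<Rightarrow> ('o, 'k, 'h, 'm::ab_group_add) dgmod \<Rightarrow> ('o, 'k, 'h, 'l::ab_group_add) dgmod
   \<Rightarrow> ('o, 'k, 'h, 'n::ab_group_add) dgmod \<Rightarrow> 'o \<Rightarrow> int \<Rightarrow> (unit, ('o, 'm, 'n, 'k) formal, 'l, 'k) formal
   \<Rightarrow> ('o, (unit, 'm, 'l, 'k) formal, 'n, 'k) formal" where
  "merge_map C G H F = (\<lambda>y n. lin_ext fscale (\<lambda>(_, c, b, u, w). merge0 C G H F y b w u))"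

lemma split0_rules:
  "split0 C G H F y x q f (s + t) = split0 C G H F y x q f s + split0 C G H F y x q f t"
  "split0 C G H F y x q f 0 = 0"
  "split0 C G H F y x q f (- t) = - split0 C G H F y x q f t"
  "split0 C G H F y x q f (koszul j t) = koszul j (split0 C G H F y x q f t)"
  "split0 C G H F y x q f (fscale c t) = fscale c (split0 C G H F y x q f t)"
  by (simp_all add: split0_def lin_ext_rules[OF vector_space_fscale])

lemma split_map_rules:
  "split_map C G H F y n (s + t) = split_map C G H F y n s + split_map C G H F y n t"
  "split_map C G H F y n (s - t) = split_map C G H F y n s - split_map C G H F y n t"
  "split_map C G H F y n 0 = 0"
  "split_map C G H F y n (- t) = - split_map C G H F y n t"
  "split_map C G H F y n (koszul j t) = koszul j (split_map C G H F y n t)"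
  "split_map C G H F y n (fscale c t) = fscale c (split_map C G H F y n t)"
  by (simp_all add: split_map_def lin_ext_rules[OF vector_space_fscale])

lemma merge0_rules:
  "merge0 C G H F y b w (s + t) = merge0 C G H F y b w s + merge0 C G H F y b w t"
  "merge0 C G H F y b w 0 = 0"
  "merge0 C G H F y b w (fscale c t) = fscale c (merge0 C G H F y b w t)"
  by (simp_all add: merge0_def lin_ext_rules[OF vector_space_fscale])

lemma merge_map_rules:
  "merge_map C G H F y n (s + t) = merge_map C G H F y n s + merge_map C G H F y n t"
  "merge_map C G H F y n 0 = 0"
  "merge_map C G H F y n (- t) = - merge_map C G H F y n t"
  "merge_map C G H F y n (koszul j t) = koszul j (merge_map C G H F y n t)"
  by (simp_all add: merge_map_def lin_ext_rules[OF vector_space_fscale])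

lemmas split_rules = split0_rules split_map_rules
lemmas merge_rules = merge0_rules merge_map_rules

lemma fscale_zero: "fscale c 0 = 0"
  using fscale_add[of c 0 0] by simp

context
  fixes C :: "('o, 'k::field, 'h::ab_group_add) dgcat" and G :: "('o, 'k, 'h, 'm::ab_group_add) dgmod"
    and F :: "('o, 'k, 'h, 'n::ab_group_add) dgmod"
  assumes C: "dg_category C" and G: "dg_module (op_cat C) G" and F: "dg_module C F"
begin

lemma op_mod_cc: "x \<in> Obj C \<Longrightarrow> cochain_complex (sp G x)"
  using mod_cc[OF G] by simp

lemma op_act_pairing: "x \<in> Obj C \<Longrightarrow> x' \<in> Obj C \<Longrightarrow> bilinear_pairing (sp G x) (Hom C x x') (sp G x') (act G x' x)"
  using act_pairing[OF G, of x' x] by simp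

lemma btens_balanced: "balanced C (sp G) (\<lambda>x x'. act G x' x) F (bal_rels C G F)"
  by unfold_locales (simp_all add: dg_category_hom_complexes[OF C] F op_mod_cc op_act_pairing bal_rels_def)

lemma btens_data: "tensor_data (Obj C) (sp G) (sp F)"
  and btens_complex: "tensor_complex (Obj C) (sp G) (sp F) (bal_rels C G F)"
proof -
  interpret balanced C "sp G" "\<lambda>x x'. act G x' x" F "bal_rels C G F" by (rule btens_balanced)
  show "tensor_data (Obj C) (sp G) (sp F)" "tensor_complex (Obj C) (sp G) (sp F) (bal_rels C G F)" by unfold_locales
qed

lemmas btn_rules = tensor_data.ten_rules[OF btens_data]
lemmas btn_dif = tensor_complex.dif_ten[OF btens_complex, folded btens_def]
lemmas btens_cc = tensor_complex.cochain_complex_T[OF btens_complex, folded btens_def]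
lemmas btn_balanced = balanced.ten_balanced[OF btens_balanced]
lemmas btn_lift = balanced.balanced_lift[OF btens_balanced]

lemma btn_in: "x \<in> Obj C \<Longrightarrow> v \<in> piece (sp G x) p \<Longrightarrow> f \<in> piece (sp F x) q \<Longrightarrow> n = p + q \<Longrightarrow>
    btn C G F x p q v f \<in> piece (btens C G F) n"
  unfolding btens_def by (rule tensor_data.ten_in[OF btens_data])

lemma scl_btens [simp]: "scl (btens C G F) = fscale"
  by (simp add: btens_def)

end

lemma btens_induct [consumes 4, case_names ten zero add]:
  assumes C: "dg_category C" and G: "dg_module (op_cat C) G" and F: "dg_module C F" and t: "t \<in> piece (btens C G F) n"
    and ten: "\<And>x p q k f. x \<in> Obj C \<Longrightarrow> n = p + q \<Longrightarrow> k \<in> piece (sp G x) p \<Longrightarrow> f \<in> piece (sp F x) q \<Longrightarrow> P (btn C G F x p q k f)"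
    and zero: "P 0"
    and add: "\<And>s t. s \<in> piece (btens C G F) n \<Longrightarrow> t \<in> piece (btens C G F) n \<Longrightarrow> P s \<Longrightarrow> P t \<Longrightarrow> P (s + t)"
  shows "P t"
  by (rule tensor_data.piece_induct[OF btens_data[OF C G F] t[unfolded btens_def]])
    (use ten zero add in \<open>auto simp: btens_def\<close>)

context
  fixes C :: "('o, 'k::field, 'h::ab_group_add) dgcat" and G :: "('o, 'k, 'h, 'm::ab_group_add) dgmod"
    and H :: "('o, 'k, 'h, 'l::ab_group_add) dgmod" and F :: "('o, 'k, 'h, 'n::ab_group_add) dgmod"
  assumes C: "dg_category C" and G: "dg_module (op_cat C) G" and H: "dg_module C H" and F: "dg_module C F"
begin

private abbreviation (input) "E \<equiv> ext_prod G H"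
private abbreviation (input) "V \<equiv> btens C G F"

lemma dg_module_E: "dg_module (env_cat C) E"
  by (rule dg_module_ext_prod[OF dg_category_op[OF C] C G H])

lemma lact_ext:
  assumes "x \<in> Obj C" "x' \<in> Obj C" "y \<in> Obj C" "v \<in> piece (sp G x) a" "w \<in> piece (sp H y) b" "c \<in> piece (Hom C x x') s"
  shows "lact C E y x x' p s (tns (sp G x) (sp H y) a b v w) c
    = koszul (b * s) (tns (sp G x') (sp H y) (a + s) b (act G x' x a s v c) w)"
  using ext_prod_act_tns[OF dg_category_op[OF C] C G H, of x' x y y v a w b c s "idt C y" 0 p s] assms
  by (simp add: lact_def idt_in[OF C] act_idt[OF H])

lemma ract_ext:
  assumes "x \<in> Obj C" "z \<in> Obj C" "y \<in> Obj C" "v \<in> piece (sp G x) a" "w \<in> piece (sp H y) b" "c \<in> piece (Hom C z y) s"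
  shows "ract C E x z y p s (tns (sp G x) (sp H y) a b v w) c
    = tns (sp G x) (sp H z) a (b + s) v (act H z y b s w c)"
  using ext_prod_act_tns[OF dg_category_op[OF C] C G H, of x x z y v a w b "idt C x" 0 c s p s] assms act_idt[OF G, of x v a]
  by (simp add: ract_def idt_in[OF C])

text \<open>Nested tensors are broken up twice, first into k \<otimes> f and then k into v \<otimes>
  w, so that maps on the convolution can be compared on triples.\<close>

lemma conv_ext_induct [consumes 2, case_names ten zero add]:
  assumes y: "y \<in> Obj C" and t: "t \<in> piece (sp (convolution C E F) y) n"
    and ten: "\<And>x a b q v w f. x \<in> Obj C \<Longrightarrow> n = a + b + q \<Longrightarrow> v \<in> piece (sp G x) a \<Longrightarrow> w \<in> piece (sp H y) b \<Longrightarrow>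
      f \<in> piece (sp F x) q \<Longrightarrow> P (ctn C E F y x (a + b) q (tns (sp G x) (sp H y) a b v w) f)"
    and zero: "P 0"
    and add: "\<And>s t. s \<in> piece (sp (convolution C E F) y) n \<Longrightarrow> t \<in> piece (sp (convolution C E F) y) n \<Longrightarrow> P s \<Longrightarrow> P t \<Longrightarrow> P (s + t)"
  shows "P t"
  using C dg_module_E F y t
proof (induction rule: convolution_module_induct)
  case (ten x p q k f)
  have k: "k \<in> piece (tensor_cpx (sp G x) (sp H y)) p" using ten by simp
  note r = ctn_rules[OF C dg_module_E F y ten(1)]
  from op_mod_cc[OF C G F ten(1)] mod_cc[OF H y] k show ?case
  proof (induction rule: tensor_induct)
    case (ten a b v w)
    then show ?case using assms(3) \<open>x \<in> Obj C\<close> \<open>n = p + q\<close> \<open>f \<in> piece (sp F x) q\<close> by simp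
  next
    case (add s t)
    have "ctn C E F y x p q (s + t) f = ctn C E F y x p q s f + ctn C E F y x p q t f"
      using r(1) add(1,2) ten by simp
    moreover have "ctn C E F y x p q s f \<in> piece (sp (convolution C E F) y) n" "ctn C E F y x p q t f \<in> piece (sp (convolution C E F) y) n"
      using add(1,2) ten y by (simp_all add: ctn_in[OF C dg_module_E F, simplified])
    ultimately show ?case using assms(5) add(3,4) by simp
  qed (use r ten assms(4) in simp)
qed (use assms in blast)+

lemma vtens_btens_induct [consumes 2, case_names ten zero add]:
  assumes y: "y \<in> Obj C" and t: "t \<in> piece (tensor_cpx V (sp H y)) n"
    and ten: "\<And>x a b q v w f. x \<in> Obj C \<Longrightarrow> n = a + q + b \<Longrightarrow> v \<in> piece (sp G x) a \<Longrightarrow> w \<in> piece (sp H y) b \<Longrightarrow>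
      f \<in> piece (sp F x) q \<Longrightarrow> P (tns V (sp H y) (a + q) b (btn C G F x a q v f) w)"
    and zero: "P 0"
    and add: "\<And>s t. s \<in> piece (tensor_cpx V (sp H y)) n \<Longrightarrow> t \<in> piece (tensor_cpx V (sp H y)) n \<Longrightarrow> P s \<Longrightarrow> P t \<Longrightarrow> P (s + t)"
  shows "P t"
  using btens_cc[OF C G F] mod_cc[OF H y] t
proof (induction rule: tensor_induct)
  case (ten c b u w)
  note r = tns_rules[OF btens_cc[OF C G F] mod_cc[OF H y]]
  from C G F ten(2) show ?case
  proof (induction rule: btens_induct)
    case (ten x a q v f)
    then show ?case using assms(3) \<open>n = c + b\<close> \<open>w \<in> piece (sp H y) b\<close> by simp
  next
    case (add s t)
    have "tns V (sp H y) c b (s + t) w = tns V (sp H y) c b s w + tns V (sp H y) c b t w"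
      using r(1) add(1,2) ten by simp
    moreover have "tns V (sp H y) c b s w \<in> piece (tensor_cpx V (sp H y)) n" "tns V (sp H y) c b t w \<in> piece (tensor_cpx V (sp H y)) n"
      using add(1,2) ten by (simp_all add: tns_in[OF btens_cc[OF C G F] mod_cc[OF H y]])
    ultimately show ?case using assms(5) add(3,4) by simp
  qed (use r ten assms(4) in simp)
qed (use assms in blast)+

lemma split0_tns:
  assumes "x \<in> Obj C" "y \<in> Obj C" "v \<in> piece (sp G x) a" "w \<in> piece (sp H y) b" "f \<in> piece (sp F x) q"
  shows "split0 C G H F y x q f (tns (sp G x) (sp H y) a b v w)
    = koszul (b * q) (tns V (sp H y) (a + q) b (btn C G F x a q v f) w)"
  unfolding split0_def
  by (rule tns_lift[OF op_mod_cc[OF C G F assms(1)] mod_cc[OF H assms(2)] vector_space_fscale], rule bilinear_onI)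
    (use assms in \<open>simp_all add: btn_rules[OF C G F] btn_in[OF C G F] tns_rules[OF btens_cc[OF C G F] mod_cc[OF H]]
      tns_rules(3)[OF btens_cc[OF C G F] mod_cc[OF H], unfolded scl_btens[OF C G F]] koszul_add fscale_koszul\<close>)

text \<open>The left action on the exterior product moves only v, up to the sign of passing w. So
  the balanced relations of the convolution turn into those of the tensor product of G and
  F.\<close>

lemma split_map_ten0:
  assumes y: "y \<in> Obj C" and x: "x \<in> Obj C" and k: "k \<in> piece (tensor_cpx (sp G x) (sp H y)) p" and f: "f \<in> piece (sp F x) q"
  shows "split_map C G H F y n (ctn C E F y x p q k f) = split0 C G H F y x q f k"
  unfolding split_map_def
proof (rule ctn_lift[OF C dg_module_E F y vector_space_fscale])
  have right: "split0 C G H F y x q (f + f') k = split0 C G H F y x q f k + split0 C G H F y x q f' k \<and>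
      split0 C G H F y x q (scl (sp F x) c f) k = fscale c (split0 C G H F y x q f k)"
    if x: "x \<in> Obj C" and k: "k \<in> piece (tensor_cpx (sp G x) (sp H y)) p" and f: "f \<in> piece (sp F x) q" "f' \<in> piece (sp F x) q"
    for x p q k f f' c
    using op_mod_cc[OF C G F x] mod_cc[OF H y] k
  proof (induction rule: tensor_induct)
    case (ten a b v w)
    then show ?case using x y f
      by (simp add: split0_tns mod_cc_rules[OF F] btn_rules[OF C G F] btn_in[OF C G F] tns_rules[OF btens_cc[OF C G F] mod_cc[OF H]]
        tns_rules(3)[OF btens_cc[OF C G F] mod_cc[OF H], unfolded scl_btens[OF C G F]] koszul_add fscale_koszul)
  next
    case (add s t)
    then show ?case by (simp add: split_rules fscale_add)
  next
    case zero
    show ?case by (simp add: split_rules fscale_zero)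
  qed
  show "bilinear_on (Obj C) (\<lambda>x. sp E (x, y)) (sp F) fscale (\<lambda>x p q k f. split0 C G H F y x q f k)"
    by (rule bilinear_onI) (simp_all add: split_rules right)
next
  fix x x' p q s k f c
  assume *: "x \<in> Obj C" "x' \<in> Obj C" "k \<in> piece (sp E (x, y)) p" "f \<in> piece (sp F x') q" "c \<in> piece (Hom C x x') s"
  note lp = lact_pairing[OF C dg_module_E *(1,2) y]
  have k: "k \<in> piece (tensor_cpx (sp G x) (sp H y)) p" using * by simp
  from op_mod_cc[OF C G F *(1)] mod_cc[OF H y] k 
  show "split0 C G H F y x (q + s) (act F x x' q s f c) k = koszul (s * q) (split0 C G H F y x' q f (lact C E y x x' p s k c))"
  proof (induction rule: tensor_induct)
    case (ten a b v w)
    have va: "act G x' x a s v c \<in> piece (sp G x') (a + s)" using bp_in[OF op_act_pairing[OF C G F *(1,2)] ten(2) *(5)] by simp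
    have "btn C G F x' (a + s) q (act G x' x a s v c) f \<in> piece V (a + s + q)"
      by (rule btn_in[OF C G F *(2) va *(4) refl])
    moreover have [simp]: "a + (q + s) = a + s + q" by simp
    ultimately show ?case using * ten y va
      by (cases "even b"; cases "even q"; cases "even s")
        (simp_all add: split0_tns lact_ext act_in[OF F] split_rules btn_balanced[OF C G F] tns_rules[OF btens_cc[OF C G F] mod_cc[OF H y]] koszul_def)
  next
    case zero
    show ?case
      by (simp add: split_rules bp_zero_left[OF lp bimod_cc[OF C dg_module_E *(1) y] *(5)])
  next
    case (add s' t)
    then show ?case using * by (simp add: split_rules bp_left_rules[OF lp] koszul_add)
  qed
qed

lemma split_map_ten':
  assumes "y \<in> Obj C" "x \<in> Obj C" "v \<in> piece (sp G x) a" "w \<in> piece (sp H y) b" "f \<in> piece (sp F x) q" "p = a + b"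
  shows "split_map C G H F y n (ctn C E F y x p q (tns (sp G x) (sp H y) a b v w) f)
    = koszul (b * q) (tns V (sp H y) (a + q) b (btn C G F x a q v f) w)"
  using split_map_ten0[OF assms(1,2) _ assms(5), of "tns (sp G x) (sp H y) a b v w" p n] assms
  by (simp add: tns_in[OF op_mod_cc[OF C G F] mod_cc[OF H]] split0_tns)

lemmas split_map_ten = split_map_ten'[unfolded ext_prod_simps fst_conv snd_conv]
lemmas ctn_rules_E = ctn_rules[OF C dg_module_E F, simplified]
lemmas ctn_in_E = ctn_in[OF C dg_module_E F, unfolded ext_prod_simps fst_conv snd_conv]
lemmas tns_rules_V = tns_rules[OF btens_cc[OF C G F] mod_cc[OF H]]
lemmas tns_rules_E = tns_rules[OF op_mod_cc[OF C G F] mod_cc[OF H]]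
lemmas tns_in_E = tns_in[OF op_mod_cc[OF C G F] mod_cc[OF H]]

lemma merge0_btn:
  assumes x: "x \<in> Obj C" and y: "y \<in> Obj C" and v: "v \<in> piece (sp G x) a" and w: "w \<in> piece (sp H y) b" and f: "f \<in> piece (sp F x) q"
  shows "merge0 C G H F y b w (btn C G F x a q v f)
    = koszul (b * q) (ctn C E F y x (a + b) q (tns (sp G x) (sp H y) a b v w) f)"
  unfolding merge0_def
proof (rule btn_lift[OF C G F vector_space_fscale])
  show "bilinear_on (Obj C) (sp G) (sp F) fscale
     (\<lambda>x a q v f. koszul (b * q) (ctn C E F y x (a + b) q (tns (sp G x) (sp H y) a b v w) f))"
    by (rule bilinear_onI) (use y w in \<open>simp_all add: ctn_rules_E tns_rules_E tns_in_E
      ctn_rules[OF C dg_module_E F, unfolded ext_prod_simps scl_tensor, simplified] koszul_add fscale_koszul\<close>)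
next
  fix x x' p q r k f c
  assume *: "x \<in> Obj C" "x' \<in> Obj C" "k \<in> piece (sp G x) p" "f \<in> piece (sp F x') q" "c \<in> piece (Hom C x x') r"
  have kc: "act G x' x p r k c \<in> piece (sp G x') (p + r)" using bp_in[OF op_act_pairing[OF C G F *(1,2)] *(3,5)] by simp
  have [simp]: "p + b + r = p + r + b" by simp
  have t: "tns (sp G x) (sp H y) p b k w \<in> piece (sp E (x, y)) (p + b)" using * y w by (simp add: tns_in_E)
  have t': "tns (sp G x') (sp H y) (p + r) b (act G x' x p r k c) w \<in> piece (sp E (x', y)) (p + b + r)"
    using * y w kc by (simp add: tns_in_E)
  show "koszul (b * (q + r)) (ctn C E F y x (p + b) (q + r) (tns (sp G x) (sp H y) p b k w) (act F x x' q r f c)) =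
     koszul (r * q) (koszul (b * q) (ctn C E F y x' (p + r + b) q (tns (sp G x') (sp H y) (p + r) b (act G x' x p r k c) w) f))"
    unfolding ctn_balanced[OF C dg_module_E F y *(1,2) t *(4,5) refl] lact_ext[OF *(1,2) y *(3) w *(5)]
      tensor_data.ten_koszul_left[OF convolution_data[OF C dg_module_E F y] *(2) t' *(4)] koszul_koszul
    by (cases "even q"; cases "even r"; cases "even b") (simp_all add: koszul_def)
qed

lemma merge0_right:
  assumes y: "y \<in> Obj C" and w: "w \<in> piece (sp H y) b" "w' \<in> piece (sp H y) b" and u: "u \<in> piece V c"
  shows "merge0 C G H F y b (w + w') u = merge0 C G H F y b w u + merge0 C G H F y b w' u \<and>
      merge0 C G H F y b (scl (sp H y) d w) u = fscale d (merge0 C G H F y b w u)"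
  using C G F u
proof (induction rule: btens_induct)
  case (ten x p q k f)
  then show ?case using y w
    by (simp add: merge0_btn mod_cc_rules[OF H] tns_rules_E tns_in_E ctn_rules_E
      ctn_rules[OF C dg_module_E F, unfolded ext_prod_simps scl_tensor, simplified] koszul_add fscale_koszul)
next
  case zero
  show ?case by (simp add: merge_rules fscale_zero)
next
  case (add s t)
  then show ?case by (simp add: merge_rules fscale_add)
qed

lemma merge_map_tns0:
  assumes y: "y \<in> Obj C" and u: "u \<in> piece V c" and w: "w \<in> piece (sp H y) b"
  shows "merge_map C G H F y n (tns V (sp H y) c b u w) = merge0 C G H F y b w u"
  unfolding merge_map_def
  by (rule tns_lift[OF btens_cc[OF C G F] mod_cc[OF H y] vector_space_fscale], rule bilinear_onI)
    (use y in \<open>simp_all add: merge_rules merge0_right scl_btens[OF C G F]\<close>)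

lemma merge_map_tns:
  assumes "y \<in> Obj C" "x \<in> Obj C" "v \<in> piece (sp G x) a" "f \<in> piece (sp F x) q" "w \<in> piece (sp H y) b" "c = a + q"
  shows "merge_map C G H F y n (tns V (sp H y) c b (btn C G F x a q v f) w)
    = koszul (b * q) (ctn C E F y x (a + b) q (tns (sp G x) (sp H y) a b v w) f)"
  using assms by (simp add: merge_map_tns0 btn_in[OF C G F] merge0_btn)

text \<open>The formula for convolution with a product bimodule, at the level of complexes: the
  complex G \<otimes> F stands where its cohomology appears in the derived statement.\<close>

lemma dg_iso_split: "dg_iso C (convolution C E F) (vtens V H) (split_map C G H F) (merge_map C G H F)"
proof (rule dg_isoI[OF dg_module_convolution[OF C dg_module_E F]
      dg_module_vtens[OF dg_category_hom_complexes[OF C] btens_cc[OF C G F] H]], goal_cases)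
  case 1
  show ?case
  proof (rule closed_morphismI, rule graded_mapI, rule graded_linearI, goal_cases)
    case (1 y n v)
    from 1 show ?case
    proof (induction rule: conv_ext_induct)
      case (ten x a b q v w f)
      note cc = cochain_complex_tensor[OF btens_cc[OF C G F] mod_cc[OF H 1(1)]]
      show ?case using ten 1(1)
        by (simp add: split_map_ten cc_rules[OF cc] tns_in[OF btens_cc[OF C G F] mod_cc[OF H]] btn_in[OF C G F])
    qed (simp_all add: split_rules cc_rules[OF cochain_complex_tensor[OF btens_cc[OF C G F] mod_cc[OF H 1(1)]]])
  next
    case (4 z y m n v c)
    from 4(2,3) show ?case
    proof (induction rule: conv_ext_induct)
      case (ten x a b q v w f)
      have t: "tns (sp G x) (sp H y) a b v w \<in> piece (sp E (x, y)) (a + b)" using ten 4 by (simp add: tns_in_E)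
      show ?case
        unfolding convolution_act_ten[OF C dg_module_E F 4(1,2) ten(1) t ten(5) 4(4)] ract_ext[OF ten(1) 4(1,2) ten(3,4) 4(4)]
        using ten 4
        by (cases "even b"; cases "even q"; cases "even n")
         (simp_all add: split_map_ten split_rules vtens_act_tns[OF dg_category_hom_complexes[OF C] btens_cc[OF C G F] H] btn_in[OF C G F] act_in[OF H]
            tensor_map_rules koszul_def)
    qed (simp_all add: split_rules convolution_act_rules[OF C dg_module_E F 4(1)] tensor_map_rules)
  next
    case (5 y n v)
    from 5 show ?case
    proof (induction rule: conv_ext_induct)
      case (ten x a b q v w f)
      have t: "tns (sp G x) (sp H y) a b v w \<in> piece (sp E (x, y)) (a + b)" using ten 5 by (simp add: tns_in_E)
      note cc = op_mod_cc[OF C G F ten(1)] mod_cc[OF H 5(1)] btens_cc[OF C G F]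
      have b: "btn C G F x a q v f \<in> piece V (a + q)" "btn C G F x (a + 1) q (dif (sp G x) a v) f \<in> piece V (a + q + 1)"
        "btn C G F x a (q + 1) v (dif (sp F x) q f) \<in> piece V (a + q + 1)"
        using ten by (simp_all add: btn_in[OF C G F] cc_rules[OF cc(1)] mod_cc_rules[OF F])
      have s: "a + b + 1 = a + 1 + b" "a + (b + 1) = a + 1 + b" "a + 1 + q = a + q + 1" "a + (q + 1) = a + q + 1" by simp_all
      show ?case
        unfolding ctn_dif[OF C dg_module_E F 5(1) ten(1) t ten(5)]
        using ten 5(1) b
        by (cases "even a"; cases "even b"; cases "even q")
          (simp_all add: s tns_dif[OF cc(1,2)] tns_dif[OF cc(3,2)] tensor_dif_rules[OF cc(3,2)] btn_dif[OF C G F] split_rules split_map_ten cc_rules[OF cc(1)] cc_rules[OF cc(2)]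
            mod_cc_rules[OF F] tns_in[OF cc(1,2)] tns_rules_V ctn_rules_E koszul_def)
    qed (simp_all add: split_rules convolution_dif_rules[OF C dg_module_E F 5(1)] tensor_dif_rules[OF btens_cc[OF C G F] mod_cc[OF H 5(1)]])
  qed (simp_all add: split_rules convolution_scl[OF C dg_module_E F])
next
  case (2 y n t)
  from 2 have "t \<in> piece (tensor_cpx V (sp H y)) n" by simp
  with 2(1) show ?case
  proof (induction rule: vtens_btens_induct)
    case (ten x a b q v w f)
    then show ?case using 2(1)
      by (simp add: merge_map_tns cc_rules[OF convolution_cc[OF C dg_module_E F]] ctn_in_E tns_in_E)
  qed (simp_all add: merge_rules cc_rules[OF convolution_cc[OF C dg_module_E F 2(1)]])
next
  case (3 y n t)
  from 3 show ?case
  proof (induction rule: conv_ext_induct)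
    case (ten x a b q v w f)
    then show ?case using 3(1)
      by (simp add: split_map_ten merge_rules merge_map_tns koszul_koszul)
        (simp add: koszul_def)
  qed (simp_all add: merge_rules split_rules)
next
  case (4 y n t)
  from 4 have "t \<in> piece (tensor_cpx V (sp H y)) n" by simp
  with 4(1) show ?case
  proof (induction rule: vtens_btens_induct)
    case (ten x a b q v w f)
    then show ?case using 4(1)
      by (simp add: merge_map_tns split_rules split_map_ten koszul_koszul)
        (simp add: koszul_def)
  qed (simp_all add: merge_rules split_rules)
qed

end

section \<open>Naturality, and convolution with the cone\<close>

definition btens_map ::
  "('o, 'k::field, 'h::ab_group_add) dgcat \<Rightarrow> ('o, 'k, 'h, 'm'::ab_group_add) dgmod
   \<Rightarrow> ('o, 'k, 'h, 'n::ab_group_add) dgmod \<Rightarrow> ('o \<Rightarrow> int \<Rightarrow> 'm \<Rightarrow> 'm')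
   \<Rightarrow> int \<Rightarrow> ('o, 'm, 'n, 'k) formal \<Rightarrow> ('o, 'm', 'n, 'k) formal" where
  "btens_map C G' F \<phi> = (\<lambda>n. lin_ext fscale (\<lambda>(x, p, q, v, f). btn C G' F x p q (\<phi> x p v) f))"

lemma btens_map_rules:
  "btens_map C G' F \<phi> n (s + t) = btens_map C G' F \<phi> n s + btens_map C G' F \<phi> n t"
  "btens_map C G' F \<phi> n 0 = 0"
  "btens_map C G' F \<phi> n (koszul j t) = koszul j (btens_map C G' F \<phi> n t)"
  "btens_map C G' F \<phi> n (fscale c t) = fscale c (btens_map C G' F \<phi> n t)"
  by (simp_all add: btens_map_def lin_ext_rules[OF vector_space_fscale])

context
  fixes C :: "('o, 'k::field, 'h::ab_group_add) dgcat" and G :: "('o, 'k, 'h, 'm::ab_group_add) dgmod"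
    and G' :: "('o, 'k, 'h, 'm'::ab_group_add) dgmod" and F :: "('o, 'k, 'h, 'n::ab_group_add) dgmod" and \<phi>
  assumes C: "dg_category C" and G: "dg_module (op_cat C) G" and G': "dg_module (op_cat C) G'" and F: "dg_module C F"
    and \<phi>: "closed_morphism (op_cat C) G G' \<phi>"
begin

lemma btens_map_btn:
  assumes x: "x \<in> Obj C" and v: "v \<in> piece (sp G x) p" and f: "f \<in> piece (sp F x) q"
  shows "btens_map C G' F \<phi> n (btn C G F x p q v f) = btn C G' F x p q (\<phi> x p v) f"
  unfolding btens_map_def
proof (rule btn_lift[OF C G F vector_space_fscale])
  note c = closed_in[OF \<phi>] closed_add[OF \<phi>] closed_scl[OF \<phi>]
  show "bilinear_on (Obj C) (sp G) (sp F) fscale (\<lambda>x p q v f. btn C G' F x p q (\<phi> x p v) f)"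
    by (rule bilinear_onI) (simp_all add: c btn_rules[OF C G' F])
next
  fix x x' p q r k f c
  assume *: "x \<in> Obj C" "x' \<in> Obj C" "k \<in> piece (sp G x) p" "f \<in> piece (sp F x') q" "c \<in> piece (Hom C x x') r"
  then show "btn C G' F x p (q + r) (\<phi> x p k) (act F x x' q r f c) = koszul (r * q) (btn C G' F x' (p + r) q (\<phi> x' (p + r) (act G x' x p r k c)) f)"
    by (simp add: closed_act[OF \<phi>] closed_in[OF \<phi>] btn_balanced[OF C G' F])
qed

lemma btens_map_gl: "graded_linear (btens C G F) (btens C G' F) 0 (btens_map C G' F \<phi>)"
proof (rule graded_linearI, goal_cases)
  case (1 n t)
  from C G F 1 show ?case
  proof (induction rule: btens_induct)
    case (ten x p q k f)
    then show ?case by (simp add: btens_map_btn btn_in[OF C G' F] closed_in[OF \<phi>])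
  qed (simp_all add: btens_map_rules cc_rules[OF btens_cc[OF C G' F]])
qed (simp_all add: btens_map_rules scl_btens[OF C G F] scl_btens[OF C G' F])

lemma btens_map_dif:
  assumes "t \<in> piece (btens C G F) n" "m = n + 1"
  shows "btens_map C G' F \<phi> m (dif (btens C G F) n t) = dif (btens C G' F) n (btens_map C G' F \<phi> n t)"
  using C G F assms(1)
proof (induction rule: btens_induct)
  case (ten x p q k f)
  then show ?case
    by (simp add: btens_map_btn btens_map_rules btn_dif[OF C G F] btn_dif[OF C G' F] closed_in[OF \<phi>] closed_dif[OF \<phi>]
      cc_rules[OF op_mod_cc[OF C G F]] mod_cc_rules[OF F])
next
  case zero
  then show ?case by (simp add: dif_zero[OF btens_cc[OF C G F]] dif_zero[OF btens_cc[OF C G' F]] btens_map_rules)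
next
  case (add s t)
  then show ?case
    by (simp add: btens_map_rules dif_rules[OF btens_cc[OF C G F]] dif_rules[OF btens_cc[OF C G' F]] gl_in[OF btens_map_gl])
qed

end

context
  fixes C :: "('o, 'k::field, 'h::ab_group_add) dgcat" and G :: "('o, 'k, 'h, 'm::ab_group_add) dgmod"
    and G' :: "('o, 'k, 'h, 'm'::ab_group_add) dgmod" and F :: "('o, 'k, 'h, 'n::ab_group_add) dgmod" and \<phi>
    and H :: "('o, 'k, 'h, 'l::ab_group_add) dgmod" and H' :: "('o, 'k, 'h, 'l'::ab_group_add) dgmod" and \<psi>
  assumes C: "dg_category C" and G: "dg_module (op_cat C) G" and G': "dg_module (op_cat C) G'" and F: "dg_module C F"
    and \<phi>: "closed_morphism (op_cat C) G G' \<phi>" and H: "dg_module C H" and H': "dg_module C H'"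
    and \<psi>: "closed_morphism C H H' \<psi>"
begin

private abbreviation (input) "E1 \<equiv> ext_prod G H"
private abbreviation (input) "E2 \<equiv> ext_prod G' H'"
private abbreviation (input) "\<Phi> \<equiv> ext_map G' H' 0 0 \<phi> \<psi>"

lemma ext_closed: "closed_morphism (env_cat C) E1 E2 \<Phi>"
  by (rule ext_map_closed[OF dg_category_op[OF C] C G H G' H' \<phi> \<psi>])

lemma vmap_btens_closed:
  "closed_morphism C (vtens (btens C G F) H) (vtens (btens C G' F) H') (vmap (btens C G' F) H' 0 0 (btens_map C G' F \<phi>) \<psi>)"
  by (rule vmap_closed[OF dg_category_hom_complexes[OF C] btens_cc[OF C G F] H btens_cc[OF C G' F] H' btens_map_gl[OF C G G' F \<phi>] \<psi>])
    (rule btens_map_dif[OF C G G' F \<phi>])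

text \<open>Both routes send (v \<otimes> w) \<otimes> f to (\<phi> v \<otimes> f) \<otimes> \<psi>
  w with the same sign, as \<phi> and \<psi> have degree 0.\<close>

lemma split_natural:
  assumes y: "y \<in> Obj C" and t: "t \<in> piece (sp (convolution C E1 F) y) n"
  shows "split_map C G' H' F y m (conv_map C E2 F 0 \<Phi> y n t)
    = vmap (btens C G' F) H' 0 0 (btens_map C G' F \<phi>) \<psi> y n (split_map C G H F y n t)"
  using C G H F y t
proof (induction rule: conv_ext_induct [consumes 6, case_names ten zero add])
  case (ten x a b q v w f)
  note HC = dg_category_hom_complexes[OF C]
  note g = HC btens_cc[OF C G F] H btens_cc[OF C G' F] H' btens_map_gl[OF C G G' F \<phi>] closed_graded[OF \<psi>]
  have t: "tns (sp G x) (sp H y) a b v w \<in> piece (sp E1 (x, y)) (a + b)"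
    using ten y by (simp add: tns_in[OF op_mod_cc[OF C G F] mod_cc[OF H]])
  have e: "\<Phi> (x, y) (a + b) (tns (sp G x) (sp H y) a b v w) = tns (sp G' x) (sp H' y) a b (\<phi> x a v) (\<psi> y b w)"
    using ext_map_tns[OF dg_category_op[OF C] C G H G' H' closed_graded[OF \<phi>] closed_graded[OF \<psi>], of x y v a w b "a + b"] ten y by simp
  show ?case
    unfolding conv_map_ten[OF C dg_module_E[OF C G H F] dg_module_E[OF C G' H' F] F closed_graded[OF ext_closed] y ten(1) t ten(5)] e
    using ten y
    by (simp add: split_map_ten[OF C G H F] split_map_ten[OF C G' H' F] closed_in[OF \<phi>] closed_in[OF \<psi>] vmap_rules vmap_tns[OF g]
        btn_in[OF C G F] btens_map_btn[OF C G G' F \<phi>])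
qed (simp_all add: conv_map_rules split_rules vmap_rules)

text \<open>\<open>P\<close> is the expected value of the composite. It is instantiated by the
  identity and by zero, for the projections and inclusions of a cone.\<close>

lemma conv_map_comp:
  assumes K1: "dg_module (env_cat C) K1" and K2: "dg_module (env_cat C) K2" and K3: "dg_module (env_cat C) K3"
    and \<alpha>: "graded_map (env_cat C) K1 K2 a \<alpha>" and \<beta>: "graded_map (env_cat C) K2 K3 b \<beta>"
    and y: "y \<in> Obj C" and t: "t \<in> piece (sp (convolution C K1 F) y) n"
    and ten: "\<And>x p q k f. x \<in> Obj C \<Longrightarrow> k \<in> piece (sp K1 (x, y)) p \<Longrightarrow> f \<in> piece (sp F x) q \<Longrightarrow>
      ctn C K3 F y x (p + a + b) q (\<beta> (x, y) (p + a) (\<alpha> (x, y) p k)) f = P (ctn C K1 F y x p q k f)"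
    and P: "P 0 = 0" "\<And>s t. P (s + t) = P s + P t"
  shows "conv_map C K3 F b \<beta> y m (conv_map C K2 F a \<alpha> y n t) = P t"
  using C K1 F y t
proof (induction rule: convolution_module_induct)
  case (ten x p q k f)
  then show ?case using y assms(8)
    by (simp add: conv_map_ten[OF C K1 K2 F \<alpha>] conv_map_ten[OF C K2 K3 F \<beta>] gm_in[OF \<alpha>])
qed (simp_all add: conv_map_rules P)

text \<open>The projections and inclusions of the cone of bimodules survive convolution. Composed
  with the exchange isomorphisms they exhibit the convolution as a cone by \<open>cone_isoI\<close>,
  and naturality identifies the connecting map.\<close>

lemma conv_cone_iso:
  obtains u v where "dg_iso C (convolution C (cone E1 E2 \<Phi>) F)
    (cone (vtens (btens C G F) H) (vtens (btens C G' F) H') (vmap (btens C G' F) H' 0 0 (btens_map C G' F \<phi>) \<psi>)) u v"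
proof -
  note HC = dg_category_hom_complexes[OF C] and HE = dg_category_env_hom[OF C]
  note E1 = dg_module_E[OF C G H F] and E2 = dg_module_E[OF C G' H' F]
  let ?K = "cone E1 E2 \<Phi>"
  note K = dg_module_cone[OF E1 E2 ext_closed HE]
  note fq = fst_graded[OF E1 E2, of \<Phi>] and fr = snd_graded[OF E1 E2, of \<Phi>]
    and fi = fst_inclusion_graded[OF E1 E2, of \<Phi>] and fs = snd_inclusion_graded[OF E1 E2, of \<Phi>]
  note iA = dg_isoD[OF dg_iso_split[OF C G H F]] and iA' = dg_isoD[OF dg_iso_split[OF C G' H' F]]
  note mq = conv_map_graded[OF C K E2 F fq] and mr = conv_map_graded[OF C K E1 F fr]
    and mi = conv_map_graded[OF C E2 K F fi] and ms = conv_map_graded[OF C E1 K F fs]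
  note tq = conv_map_ten[OF C K E2 F fq] and tr = conv_map_ten[OF C K E1 F fr]
    and ti = conv_map_ten[OF C E2 K F fi] and ts = conv_map_ten[OF C E1 K F fs]
    and tf = conv_map_ten[OF C E1 E2 F closed_graded[OF ext_closed]]
  let ?q = "\<lambda>y n t. split_map C G' H' F y n (conv_map C E2 F 0 (\<lambda>x n. fst) y n t)"
  let ?r = "\<lambda>y n t. split_map C G H F y (n + 1) (conv_map C E1 F 1 (\<lambda>x n. snd) y n t)"
  let ?i = "\<lambda>y n t. conv_map C ?K F 0 (\<lambda>x n w. (w, 0)) y n (merge_map C G' H' F y n t)"
  let ?s = "\<lambda>y n t. conv_map C ?K F (-1) (\<lambda>x n w. (0, w)) y n (merge_map C G H F y n t)"
  let ?f = "vmap (btens C G' F) H' 0 0 (btens_map C G' F \<phi>) \<psi>"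
  have q: "graded_map C (convolution C ?K F) (vtens (btens C G' F) H') 0 ?q"
    using graded_map_comp[OF mq closed_graded[OF iA'(3)], of 0] by simp
  have r: "graded_map C (convolution C ?K F) (vtens (btens C G F) H) 1 ?r"
    using graded_map_comp[OF mr closed_graded[OF iA(3)], of 1] by simp
  have z: "0 \<in> piece (sp E1 (x, y)) p" "0 \<in> piece (sp E2 (x, y)) p" if "x \<in> Obj C" "y \<in> Obj C" for x y p
    using cc_zero[OF bimod_cc[OF C E1 that]] cc_zero[OF bimod_cc[OF C E2 that]] .
  have qi: "conv_map C E2 F 0 (\<lambda>x n. fst) y m (conv_map C ?K F 0 (\<lambda>x n w. (w, 0)) y n t) = t"
    if "y \<in> Obj C" "t \<in> piece (sp (convolution C E2 F) y) n" for y n m t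
    by (rule conv_map_comp[OF E2 K E2 fi fq that]) simp_all
  have rs: "conv_map C E1 F 1 (\<lambda>x n. snd) y m (conv_map C ?K F (-1) (\<lambda>x n w. (0, w)) y n t) = t"
    if "y \<in> Obj C" "t \<in> piece (sp (convolution C E1 F) y) n" for y n m t
    by (rule conv_map_comp[OF E1 K E1 fs fr that]) simp_all
  have qs: "conv_map C E2 F 0 (\<lambda>x n. fst) y m (conv_map C ?K F (-1) (\<lambda>x n w. (0, w)) y n t) = 0"
    if "y \<in> Obj C" "t \<in> piece (sp (convolution C E1 F) y) n" for y n m t
    by (rule conv_map_comp[OF E1 K E2 fs fq that]) (use that in \<open>simp_all add: ctn_rules[OF C E2 F, unfolded ext_prod_simps fst_conv snd_conv]\<close>)
  have ri: "conv_map C E1 F 1 (\<lambda>x n. snd) y m (conv_map C ?K F 0 (\<lambda>x n w. (w, 0)) y n t) = 0"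
    if "y \<in> Obj C" "t \<in> piece (sp (convolution C E2 F) y) n" for y n m t
    by (rule conv_map_comp[OF E2 K E1 fi fr that]) (use that in \<open>simp_all add: ctn_rules[OF C E1 F, unfolded ext_prod_simps fst_conv snd_conv]\<close>)
  have dq: "conv_map C E2 F 0 (\<lambda>x n. fst) y (n + 1) (dif (sp (convolution C ?K F) y) n t) =
      dif (sp (convolution C E2 F) y) n (conv_map C E2 F 0 (\<lambda>x n. fst) y n t) +
      conv_map C E2 F 0 \<Phi> y (n + 1) (conv_map C E1 F 1 (\<lambda>x n. snd) y n t)"
    if y: "y \<in> Obj C" and t: "t \<in> piece (sp (convolution C ?K F) y) n" for y n t
    using C K F y t
  proof (induction rule: convolution_module_induct)
    case (ten x p q k f)
    have k: "fst k \<in> piece (sp E2 (x, y)) p" "snd k \<in> piece (sp E1 (x, y)) (p + 1)" using ten(3) by auto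
    have dk: "dif (sp ?K (x, y)) p k \<in> piece (sp ?K (x, y)) (p + 1)" by (rule cc_dif[OF bimod_cc[OF C K ten(1) y] ten(3) refl])
    have df: "dif (sp F x) q f \<in> piece (sp F x) (q + 1)" by (rule mod_cc_rules(7)[OF F ten(1,4) refl])
    have 1: "fst (dif (sp ?K (x, y)) p k) = dif (sp E2 (x, y)) p (fst k) + \<Phi> (x, y) (p + 1) (snd k)" 
      by (simp only: cone_simps cone_cpx_simps fst_conv)
    have m: "dif (sp E2 (x, y)) p (fst k) \<in> piece (sp E2 (x, y)) (p + 1)" "\<Phi> (x, y) (p + 1) (snd k) \<in> piece (sp E2 (x, y)) (p + 1)"
      using cc_dif[OF bimod_cc[OF C E2 ten(1) y] k(1) refl] closed_in[OF ext_closed env_objects[OF C ten(1) y] k(2)] by blast+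
    show ?case
      unfolding ctn_dif[OF C K F y ten(1,3,4)] conv_map_rules tq[OF y ten(1) dk ten(4)] tq[OF y ten(1) ten(3) df]
        tq[OF y ten(1,3,4)] tr[OF y ten(1,3,4)] tf[OF y ten(1) k(2) ten(4)] 1 add_0_right
        ctn_dif[OF C E2 F y ten(1) k(1) ten(4)] ctn_rules(1)[OF C E2 F y ten(1) m ten(4)]
      by (simp only: ac_simps)
  qed (simp_all add: conv_map_rules convolution_dif_rules[OF C K F y] convolution_dif_rules[OF C E2 F y])
  have dr: "conv_map C E1 F 1 (\<lambda>x n. snd) y (n + 1) (dif (sp (convolution C ?K F) y) n t) =
      - dif (sp (convolution C E1 F) y) (n + 1) (conv_map C E1 F 1 (\<lambda>x n. snd) y n t)"
    if y: "y \<in> Obj C" and t: "t \<in> piece (sp (convolution C ?K F) y) n" for y n t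
    using C K F y t
  proof (induction rule: convolution_module_induct)
    case (ten x p q k f)
    have k: "snd k \<in> piece (sp E1 (x, y)) (p + 1)" using ten(3) by auto
    have dk: "dif (sp ?K (x, y)) p k \<in> piece (sp ?K (x, y)) (p + 1)" by (rule cc_dif[OF bimod_cc[OF C K ten(1) y] ten(3) refl])
    have df: "dif (sp F x) q f \<in> piece (sp F x) (q + 1)" by (rule mod_cc_rules(7)[OF F ten(1,4) refl])
    have 1: "snd (dif (sp ?K (x, y)) p k) = - dif (sp E1 (x, y)) (p + 1) (snd k)" 
      by (simp only: cone_simps cone_cpx_simps snd_conv)
    have m: "dif (sp E1 (x, y)) (p + 1) (snd k) \<in> piece (sp E1 (x, y)) (p + 1 + 1)"
      by (rule cc_dif[OF bimod_cc[OF C E1 ten(1) y] k(1) refl])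
    have k1: "koszul (p + 1) w = - koszul p w" for w :: "('o, (unit, 'm, 'l, 'k) formal, 'n, 'k) formal"
      by (simp add: koszul_def)
    show ?case
      unfolding ctn_dif[OF C K F y ten(1,3,4)] conv_map_rules tr[OF y ten(1) dk ten(4)] tr[OF y ten(1) ten(3) df]
        tr[OF y ten(1,3,4)] 1
        ctn_dif[OF C E1 F y ten(1) k(1) ten(4)] tensor_data.ten_neg_left[OF convolution_data[OF C E1 F y] ten(1) m ten(4)] k1
      by simp
  qed (simp_all add: conv_map_rules convolution_dif_rules[OF C K F y] convolution_dif_rules[OF C E1 F y])
  have id: "conv_map C ?K F 0 (\<lambda>x n w. (w, 0)) y n (conv_map C E2 F 0 (\<lambda>x n. fst) y n t) +
      conv_map C ?K F (-1) (\<lambda>x n w. (0, w)) y (n + 1) (conv_map C E1 F 1 (\<lambda>x n. snd) y n t) = t"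
    if y: "y \<in> Obj C" and t: "t \<in> piece (sp (convolution C ?K F) y) n" for y n t
    using C K F y t
  proof (induction rule: convolution_module_induct)
    case (ten x p q k f)
    have k: "fst k \<in> piece (sp E2 (x, y)) p" "snd k \<in> piece (sp E1 (x, y)) (p + 1)" using ten(3) by auto
    have m: "(fst k, 0) \<in> piece (sp ?K (x, y)) p" "(0, snd k) \<in> piece (sp ?K (x, y)) p"
      using k z[OF ten(1) y] by simp_all
    show ?case
      unfolding tq[OF y ten(1,3,4)] tr[OF y ten(1,3,4)] add_0_right ti[OF y ten(1) k(1) ten(4)] ts[OF y ten(1) k(2) ten(4)]
      using ctn_rules(1)[OF C K F y ten(1) m ten(4)] by simp
  next
    case (add s t)
    then show ?case by (simp add: conv_map_rules algebra_simps)
  qed (simp add: conv_map_rules)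
  show ?thesis
  proof (rule that, rule cone_isoI[where i = ?i and s = ?s, OF dg_module_vtens[OF HC btens_cc[OF C G F] H] dg_module_vtens[OF HC btens_cc[OF C G' F] H']
        dg_module_convolution[OF C K F] HC vmap_btens_closed q r], goal_cases)
    case (1 x n w)
    then show ?case using gm_in[OF mi, of x "merge_map C G' H' F x n w" n n] closed_in[OF iA'(4)] by simp
  next
    case (2 x n m v)
    then show ?case using gm_in[OF ms, of x "merge_map C G H F x n v" n m] closed_in[OF iA(4)] by simp
  next
    case (3 x n t)
    have r: "conv_map C E1 F 1 (\<lambda>x n. snd) x n t \<in> piece (sp (convolution C E1 F) x) (n + 1)"
      "conv_map C E2 F 0 (\<lambda>x n. fst) x n t \<in> piece (sp (convolution C E2 F) x) n"
      using gm_in[OF mr 3 refl] gm_in[OF mq 3, of n] by simp_all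
    show ?case
      unfolding dq[OF 3] split_map_rules split_natural[OF 3(1) r(1)] closed_dif[OF iA'(3) 3(1) r(2) refl] ..
  next
    case (4 x n t)
    have r: "conv_map C E1 F 1 (\<lambda>x n. snd) x n t \<in> piece (sp (convolution C E1 F) x) (n + 1)"
      using gm_in[OF mr 4 refl] by simp
    show ?case
      unfolding dr[OF 4] split_map_rules closed_dif[OF iA(3) 4(1) r refl] ..
  next
    case (5 x n t)
    have r: "conv_map C E1 F 1 (\<lambda>x n. snd) x n t \<in> piece (sp (convolution C E1 F) x) (n + 1)"
      "conv_map C E2 F 0 (\<lambda>x n. fst) x n t \<in> piece (sp (convolution C E2 F) x) n"
      using gm_in[OF mr 5 refl] gm_in[OF mq 5, of n] by simp_all
    show ?case
      unfolding iA(5)[OF 5(1) r(1)] iA'(5)[OF 5(1) r(2)] by (rule id[OF 5])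
  next
    case (6 x n w)
    then show ?case by (simp only: qi[OF 6(1) closed_in[OF iA'(4) 6]] iA'(6))
  next
    case (7 x n m v)
    then show ?case by (simp only: qs[OF 7(1) closed_in[OF iA(4) 7(1,2)]] split_map_rules)
  next
    case (8 x n w)
    then show ?case by (simp only: ri[OF 8(1) closed_in[OF iA'(4) 8]] split_map_rules)
  next
    case (9 x n m v)
    have "split_map C G H F x (m + 1) (merge_map C G H F x n v) = v"
      using iA(6)[OF 9(1,2)] 9(3) by simp
    then show ?case by (simp only: rs[OF 9(1) closed_in[OF iA(4) 9(1,2)]])
  qed
qed

end

section \<open>Complexes of vector spaces split\<close>

text \<open>Pieces are subspaces of an ambient space, and maps are linear on them only; extension
  from a basis of S gives a map linear everywhere.\<close>

lemma linear_extension: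
  assumes s: "vector_space s" and t: "vector_space t" and S: "module.subspace s S"
    and add: "\<And>v w. v \<in> S \<Longrightarrow> w \<in> S \<Longrightarrow> f (v + w) = f v + f w" and scale: "\<And>c v. v \<in> S \<Longrightarrow> f (s c v) = t c (f v)"
  obtains g where "Vector_Spaces.linear s t g" "\<And>v. v \<in> S \<Longrightarrow> g v = f v"
proof -
  interpret s: vector_space s by fact
  interpret t: vector_space t by fact
  interpret p: vector_space_pair s t by unfold_locales
  obtain B where B: "B \<subseteq> S" "s.independent B" "S \<subseteq> s.span B" using s.maximal_independent_subset by blast
  let ?g = "p.construct B f"
  have lin: "Vector_Spaces.linear s t ?g" by (rule p.linear_construct[OF B(2)])
  interpret g: Vector_Spaces.linear s t ?g by (rule lin)
  have sub: "s.span B \<subseteq> S" using s.span_minimal[OF B(1) S] .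
  have f0: "f 0 = 0" using add[of 0 0] s.subspace_0[OF S] by simp
  have "?g v = f v" if "v \<in> S" for v
  proof -
    have "v \<in> s.span B" using that B(3) by blast
    then have "?g v = f v \<and> v \<in> s.span B"
    proof (induction rule: s.span_induct_alt)
      case base
      then show ?case by (simp add: g.zero f0 s.span_zero)
    next
      case (step c x y)
      have x: "x \<in> S" "y \<in> S" "s c x \<in> S" using step B(1) sub s.subspace_scale[OF S] by blast+
      have "?g x = f x" by (rule p.construct_basis[OF B(2) step(1)])
      then show ?case using step x
        by (simp add: g.add g.scale add scale s.span_add s.span_scale s.span_base)
    qed
    then show ?thesis ..
  qed
  with lin show ?thesis by (rule that)
qed

text \<open>\<open>p\<close> projects onto the kernel of f in S, and \<open>g\<close> inverts f on
  the complement of all v - p v. Both are defined on the whole ambient space with values in S, so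
  they land in the right piece for every argument.\<close>

lemma linear_splitting:
  assumes s: "vector_space s" and t: "vector_space t" and S: "module.subspace s S"
    and add: "\<And>v w. v \<in> S \<Longrightarrow> w \<in> S \<Longrightarrow> f (v + w) = f v + f w" and scale: "\<And>c v. v \<in> S \<Longrightarrow> f (s c v) = t c (f v)"
  obtains g p where "Vector_Spaces.linear t s g" "Vector_Spaces.linear s s p" "\<And>w. g w \<in> S" "\<And>v. p v \<in> S" "\<And>v. f (p v) = 0"
    "\<And>v. v \<in> S \<Longrightarrow> f v = 0 \<Longrightarrow> p v = v" "\<And>w. p (g w) = 0" "\<And>v. v \<in> S \<Longrightarrow> g (f v) = v - p v"
proof -
  interpret s: vector_space s by fact
  interpret t: vector_space t by fact
  obtain f' where lf: "Vector_Spaces.linear s t f'" and ff: "\<And>v. v \<in> S \<Longrightarrow> f' v = f v"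
    by (rule linear_extension[where f = f, OF s t S add scale]) blast+
  interpret f': Vector_Spaces.linear s t f' by (rule lf)
  let ?K = "S \<inter> {v. f' v = 0}"
  have K: "s.subspace ?K" by (rule s.subspace_inter[OF S f'.subspace_kernel])
  \<comment> \<open>A linear left inverse of the inclusion of K, with values in K, is a projection
    onto K.\<close>
  obtain p where p: "p ` UNIV \<subseteq> ?K" "Vector_Spaces.linear s s p" "\<forall>v\<in>?K. p v = v"
    using vector_space_pair.linear_exists_left_inverse_on[OF vector_space_pair.intro[OF s s] s.linear_ident K] by (auto simp: inj_on_def)
  interpret p: Vector_Spaces.linear s s p by (rule p(2))
  have pK': "p v \<in> ?K" for v using p(1) by blast
  have pK: "p v \<in> S" "f' (p v) = 0" "p (p v) = p v" for v using pK' p(3) by blast+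
  let ?C = "(\<lambda>v. v - p v) ` S"
  have lin: "Vector_Spaces.linear s s (\<lambda>v. v - p v)"
    by (unfold_locales) (simp_all add: p.add p.scale s.scale_right_diff_distrib algebra_simps)
  interpret c: Vector_Spaces.linear s s "\<lambda>v. v - p v" by (rule lin)
  have C: "s.subspace ?C" by (rule c.subspace_image[OF S])
  have CS: "?C \<subseteq> S" using s.subspace_diff[OF S] pK(1) by blast
  have pC: "p v = 0" if "v \<in> ?C" for v using that by (auto simp: p.diff pK)
  have "inj_on f' ?C"
  proof -
    have "v = 0" if "v \<in> ?C" "f' v = 0" for v
    proof -
      have "v \<in> ?K" using that CS by blast
      then have "p v = v" using p(3) by blast
      then show ?thesis using pC[OF that(1)] by simp
    qed
    then show ?thesis using f'.inj_on_iff_eq_0[OF C] by blast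
  qed
  then obtain g where g: "g ` UNIV \<subseteq> ?C" "Vector_Spaces.linear t s g" "\<forall>v\<in>?C. g (f' v) = v"
    using vector_space_pair.linear_exists_left_inverse_on[OF vector_space_pair.intro[OF s t] lf C] by blast
  show ?thesis
  proof (rule that[OF g(2) p(2)])
    show "g w \<in> S" for w using g(1) CS by blast
    show "p v \<in> S" for v by (rule pK)
    show "f (p v) = 0" for v using ff[OF pK(1)] pK(2) by simp
    show "p v = v" if "v \<in> S" "f v = 0" for v using p(3) that ff by simp
    show "p (g w) = 0" for w using g(1) by (intro pC) blast
    show "g (f v) = v - p v" if "v \<in> S" for v
    proof -
      have "g (f' (v - p v)) = v - p v" using g(3) that by blast
      moreover have "f' (v - p v) = f v" using that by (simp add: f'.diff pK ff)
      ultimately show ?thesis by simp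
    qed
  qed
qed

lemma graded_splitting:
  assumes V: "cochain_complex V" and W: "cochain_complex W" and f: "graded_linear V W a f"
  obtains g p where "graded_linear W V (- a) g" "graded_linear V V 0 p" "\<And>n v. f n (p n v) = 0"
    "\<And>n v. v \<in> piece V n \<Longrightarrow> f n v = 0 \<Longrightarrow> p n v = v" "\<And>n w. p n (g (n + a) w) = 0"
    "\<And>n m v. v \<in> piece V n \<Longrightarrow> m = n + a \<Longrightarrow> g m (f n v) = v - p n v"
proof -
  have "\<exists>g p. Vector_Spaces.linear (scl W) (scl V) g \<and> Vector_Spaces.linear (scl V) (scl V) p \<and> (\<forall>w. g w \<in> piece V n) \<and>
      (\<forall>v. p v \<in> piece V n) \<and> (\<forall>v. f n (p v) = 0) \<and> (\<forall>v. v \<in> piece V n \<longrightarrow> f n v = 0 \<longrightarrow> p v = v) \<and> (\<forall>w. p (g w) = 0) \<and>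
      (\<forall>v. v \<in> piece V n \<longrightarrow> g (f n v) = v - p v)" for n
    by (rule linear_splitting[OF cc_vector_space[OF V] cc_vector_space[OF W] cc_subspace[OF V, of n], of "f n"])
      (auto simp: gl_rules[OF f])
  then obtain g p where g: "\<And>n. Vector_Spaces.linear (scl W) (scl V) (g n)" and p: "\<And>n. Vector_Spaces.linear (scl V) (scl V) (p n)"
    and h: "\<And>n w. g n w \<in> piece V n" "\<And>n v. p n v \<in> piece V n" "\<And>n v. f n (p n v) = 0"
    "\<And>n v. v \<in> piece V n \<Longrightarrow> f n v = 0 \<Longrightarrow> p n v = v" "\<And>n w. p n (g n w) = 0"
    "\<And>n v. v \<in> piece V n \<Longrightarrow> g n (f n v) = v - p n v"
    by metis
  show ?thesis
  \<comment> \<open>The splitting was made for each source degree n of f; as a map out of W,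
    \<open>g\<close> is indexed by the degree n + a.\<close>
  proof (rule that[of "\<lambda>n. g (n - a)" p])
    show "graded_linear W V (- a) (\<lambda>n. g (n - a))"
    proof (rule graded_linearI)
      interpret g: Vector_Spaces.linear "scl W" "scl V" "g n" for n by (rule g)
      show "g (n - a) v \<in> piece V (n + - a)" for n v using h(1)[of "n - a" v] by simp
      show "g (n - a) (v + w) = g (n - a) v + g (n - a) w" "g (n - a) (scl W c v) = scl V c (g (n - a) v)" for n v w c
        by (simp_all add: g.add g.scale)
    qed
    show "graded_linear V V 0 p"
    proof (rule graded_linearI)
      interpret p: Vector_Spaces.linear "scl V" "scl V" "p n" for n by (rule p)
      show "p n v \<in> piece V (n + 0)" for n v using h(2) by simp
      show "p n (v + w) = p n v + p n w" "p n (scl V c v) = scl V c (p n v)" for n v w c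
        by (simp_all add: p.add p.scale)
    qed
  qed (use h in simp_all)
qed

text \<open>From g f v = v - p v and f p = 0.\<close>

lemma generalized_inverse:
  assumes V: "cochain_complex V" and W: "cochain_complex W" and f: "graded_linear V W 0 f"
  obtains g where "graded_linear W V 0 g" "\<And>n v. v \<in> piece V n \<Longrightarrow> f n (g n (f n v)) = f n v"
proof -
  obtain g p where g: "graded_linear W V (- 0) g" and p: "graded_linear V V 0 p" and h: "\<And>n v. f n (p n v) = 0"
    "\<And>n m v. v \<in> piece V n \<Longrightarrow> m = n + 0 \<Longrightarrow> g m (f n v) = v - p n v"
    by (rule graded_splitting[OF V W f]) blast
  show ?thesis
  proof (rule that[of g])
    fix n v assume v: "v \<in> piece V n"
    have "g n (f n v) = v - p n v" using h(2)[OF v] by simp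
    then show "f n (g n (f n v)) = f n v"
      using v by (simp add: gl_diff[OF f V] gl_in[OF p] h(1))
  qed (use g in simp)
qed

text \<open>Take s = g p, with g a partial inverse of the differential and p the projection onto
  cycles. Applying p before g is what forces s s = 0, because p g = 0.\<close>

lemma contraction:
  assumes V: "cochain_complex V"
  obtains s where "graded_linear V V (-1) s"
    "\<And>n m v. v \<in> piece V n \<Longrightarrow> m = n + 1 \<Longrightarrow> dif V n (s m (dif V n v)) = dif V n v"
    "\<And>n m v. v \<in> piece V n \<Longrightarrow> m = n - 1 \<Longrightarrow> s n (dif V m (s n v)) = s n v"
    "\<And>n m v. v \<in> piece V n \<Longrightarrow> m = n - 1 \<Longrightarrow> s m (s n v) = 0"
proof -
  obtain g p where g: "graded_linear V V (- 1) g" and p: "graded_linear V V 0 p" and dp: "\<And>n v. dif V n (p n v) = 0"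
    and pz: "\<And>n v. v \<in> piece V n \<Longrightarrow> dif V n v = 0 \<Longrightarrow> p n v = v" and pg: "\<And>n w. p n (g (n + 1) w) = 0"
    and gd: "\<And>n m v. v \<in> piece V n \<Longrightarrow> m = n + 1 \<Longrightarrow> g m (dif V n v) = v - p n v"
    by (rule graded_splitting[OF V V gl_dif[OF V]]) blast
  \<comment> \<open>A boundary is a cycle, hence fixed by p, so s d v = v - p v.\<close>
  have sd: "g m (p m (dif V n v)) = v - p n v" if "v \<in> piece V n" "m = n + 1" for n m v
    using that pz[of "dif V n v" m] gd[OF that] by (simp add: cc_dif[OF V] dif_dif[OF V])
  show ?thesis
  proof (rule that[of "\<lambda>n v. g n (p n v)"])
    show "graded_linear V V (- 1) (\<lambda>n v. g n (p n v))"
      by (rule graded_linearI) (simp_all add: gl_in[OF g] gl_in[OF p] gl_rules[OF g] gl_rules[OF p])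
    show "dif V n (g m (p m (dif V n v))) = dif V n v" if "v \<in> piece V n" "m = n + 1" for n m v
      using that by (simp add: sd dif_rules[OF V] gl_in[OF p] dp)
    show "g n (p n (dif V m (g n (p n v)))) = g n (p n v)" if "v \<in> piece V n" "m = n - 1" for n m v
    proof -
      have "g n (p n v) \<in> piece V m" using that by (intro gl_in[OF g] gl_in[OF p]) simp_all
      from sd[OF this, of n] that pg[of m "p n v"] show ?thesis by simp
    qed
    show "g m (p m (g n (p n v))) = 0" if "v \<in> piece V n" "m = n - 1" for n m v
      using pg[of m "p n v"] that gl_zero[OF g V] by simp
  qed
qed

text \<open>\<open>V\<close> with the zero differential; its pieces are not the cohomology, but they contain it as a retract.\<close>

definition zdif :: "('k, 'v::ab_group_add) cpx \<Rightarrow> ('k, 'v) cpx" where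
  "zdif V = V\<lparr>dif := \<lambda>n v. 0\<rparr>"

lemma zdif_simps [simp]: "piece (zdif V) = piece V" "scl (zdif V) = scl V" "dif (zdif V) n v = 0"
  by (simp_all add: zdif_def)

lemma cochain_complex_zdif: "cochain_complex V \<Longrightarrow> cochain_complex (zdif V)"
  by (rule cochain_complexI) (simp_all add: cc_vector_space cc_rules scl_zero_right)

section \<open>Maps between cones\<close>

lemma cone_map_graded:
  assumes X: "dg_module C X" and Y: "dg_module C Y" and Y': "dg_module C Y'"
    and a: "graded_map C Y Y' p a" and b: "graded_map C X X' p b" and c: "graded_map C X Y' (p - 1) c"
  shows "graded_map C (cone X Y f) (cone X' Y' f') p (\<lambda>x n u. (a x n (fst u) + c x (n + 1) (snd u), b x (n + 1) (snd u)))"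
proof (rule graded_mapI, rule graded_linearI, goal_cases)
  case (1 x n u)
  then obtain w v where u: "u = (w, v)" "w \<in> piece (sp Y x) n" "v \<in> piece (sp X x) (n + 1)" by auto
  then show ?case using 1 by (simp add: gm_in[OF a] gm_in[OF b] gm_in[OF c] mod_cc_rules[OF Y'])
next
  case (2 x n u u')
  then show ?case by (auto simp: gm_add[OF a] gm_add[OF b] gm_add[OF c])
next
  case (3 x n u k)
  then show ?case by (auto simp: gm_scl[OF a] gm_scl[OF b] gm_scl[OF c] scl_add[OF mod_cc[OF Y']])
next
  case (4 x y m n u k)
  then obtain w v where u: "u = (w, v)" "w \<in> piece (sp Y y) m" "v \<in> piece (sp X y) (m + 1)" by auto
  have e: "m + n + 1 = m + 1 + n" "m + 1 + p = m + p + 1" "m + 1 + (p - 1) = m + p" by simp_all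
  show ?case using 4 u gm_act[OF b 4(1,2) u(3) 4(4) e(1)] gm_act[OF c 4(1,2) u(3) 4(4) e(1)]
    by (simp add: gm_act[OF a] gm_in[OF a] gm_in[OF c] act_left_rules[OF Y'] e)
qed

text \<open>A square that commutes up to the homotopy c induces a triangular map of cones with
  diagonal a, b and off-diagonal entry c.\<close>

lemma cone_map_closed:
  assumes X: "dg_module C X" and Y: "dg_module C Y" and X': "dg_module C X'" and Y': "dg_module C Y'"
    and C: "hom_complexes C" and f: "closed_morphism C X Y f" and f': "closed_morphism C X' Y' f'"
    and a: "closed_morphism C Y Y' a" and b: "closed_morphism C X X' b" and c: "graded_map C X Y' (-1) c"
    and h: "\<And>x n v. x \<in> Obj C \<Longrightarrow> v \<in> piece (sp X x) n \<Longrightarrow>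
      a x n (f x n v) = dif (sp Y' x) (n - 1) (c x n v) + c x (n + 1) (dif (sp X x) n v) + f' x n (b x n v)"
  shows "closed_morphism C (cone X Y f) (cone X' Y' f') (\<lambda>x n u. (a x n (fst u) + c x (n + 1) (snd u), b x (n + 1) (snd u)))"
proof (rule closed_morphismI)
  show "graded_map C (cone X Y f) (cone X' Y' f') 0 (\<lambda>x n u. (a x n (fst u) + c x (n + 1) (snd u), b x (n + 1) (snd u)))"
    by (rule cone_map_graded[OF X Y Y' closed_graded[OF a] closed_graded[OF b]]) (use c in simp)
  fix x n u assume x: "x \<in> Obj C" and "u \<in> piece (sp (cone X Y f) x) n"
  then obtain w v where u: "u = (w, v)" "w \<in> piece (sp Y x) n" "v \<in> piece (sp X x) (n + 1)" by auto
  have m: "dif (sp X x) (n + 1) v \<in> piece (sp X x) (n + 1 + 1)" "f x (n + 1) v \<in> piece (sp Y x) (n + 1)"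
    "dif (sp Y x) n w \<in> piece (sp Y x) (n + 1)" "c x (n + 1) v \<in> piece (sp Y' x) n"
    using u x closed_in[OF f x u(3)] gm_in[OF c x u(3), of n] by (simp_all add: mod_cc_rules[OF X] mod_cc_rules[OF Y])
  have neg: "c x (n + 1 + 1) (- dif (sp X x) (n + 1) v) = - c x (n + 1 + 1) (dif (sp X x) (n + 1) v)"
    "b x (n + 1 + 1) (- dif (sp X x) (n + 1) v) = - b x (n + 1 + 1) (dif (sp X x) (n + 1) v)"
    using gl_neg[OF gm_gl[OF c x] mod_cc[OF X x] m(1)] gl_neg[OF closed_gl[OF b x] mod_cc[OF X x] m(1)] by simp_all
  show "(a x (n + 1) (fst (dif (sp (cone X Y f) x) n u)) + c x (n + 1 + 1) (snd (dif (sp (cone X Y f) x) n u)),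
       b x (n + 1 + 1) (snd (dif (sp (cone X Y f) x) n u))) =
      dif (sp (cone X' Y' f') x) n (a x n (fst u) + c x (n + 1) (snd u), b x (n + 1) (snd u))"
    using x u m h[OF x u(3)] neg
    by (simp add: closed_add[OF a] closed_dif[OF a] closed_dif[OF b] closed_in[OF a] mod_dif_rules[OF Y'])
qed

context
  fixes C :: "('o, 'k::field, 'h::ab_group_add) dgcat" and V :: "('k, 'v::ab_group_add) cpx" and V' :: "('k, 'v'::ab_group_add) cpx"
    and H :: "('o, 'k, 'h, 'm::ab_group_add) dgmod" and H' :: "('o, 'k, 'h, 'n::ab_group_add) dgmod" and \<alpha> \<psi>
  assumes C: "hom_complexes C" and V: "cochain_complex V" and V': "cochain_complex V'" and H: "dg_module C H" and H': "dg_module C H'"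
    and \<alpha>: "graded_linear V V' 0 \<alpha>" and \<psi>: "closed_morphism C H H' \<psi>"
    and \<alpha>d: "\<And>n m v. v \<in> piece V n \<Longrightarrow> m = n + 1 \<Longrightarrow> \<alpha> m (dif V n v) = dif V' n (\<alpha> n v)"
begin

text \<open>\<pi> = 1 - ds - sd is idempotent with \<pi>d = d\<pi> = 0, so it is a chain map from V
  to V with zero differential and also back, and the composite is homotopic to 1 through s. The
  contractions know nothing of \<alpha>, so with \<alpha>' = \<pi>'\<alpha>\<pi> the squares commute
  only up to homotopy and the retraction of cones needs a term of second order.\<close>

lemma cohomology_retract:
  obtains \<alpha>' where "graded_linear (zdif V) (zdif V') 0 \<alpha>'"
    "homotopy_retract C (cone (vtens V H) (vtens V' H') (vmap V' H' 0 0 \<alpha> \<psi>))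
      (cone (vtens (zdif V) H) (vtens (zdif V') H') (vmap (zdif V') H' 0 0 \<alpha>' \<psi>))"
proof -
  obtain s where s: "graded_linear V V (-1) s"
    and dsd: "\<And>n m v. v \<in> piece V n \<Longrightarrow> m = n + 1 \<Longrightarrow> dif V n (s m (dif V n v)) = dif V n v"
    and sds: "\<And>n m v. v \<in> piece V n \<Longrightarrow> m = n - 1 \<Longrightarrow> s n (dif V m (s n v)) = s n v"
    and ss: "\<And>n m v. v \<in> piece V n \<Longrightarrow> m = n - 1 \<Longrightarrow> s m (s n v) = 0"
    by (rule contraction[OF V]) blast
  obtain s' where s': "graded_linear V' V' (-1) s'"
    and dsd': "\<And>n m v. v \<in> piece V' n \<Longrightarrow> m = n + 1 \<Longrightarrow> dif V' n (s' m (dif V' n v)) = dif V' n v"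
    and sds': "\<And>n m v. v \<in> piece V' n \<Longrightarrow> m = n - 1 \<Longrightarrow> s' n (dif V' m (s' n v)) = s' n v"
    and ss': "\<And>n m v. v \<in> piece V' n \<Longrightarrow> m = n - 1 \<Longrightarrow> s' m (s' n v) = 0"
    by (rule contraction[OF V']) blast
  define \<pi> where "\<pi> n v = v - dif V (n - 1) (s n v) - s (n + 1) (dif V n v)" for n v
  define \<pi>' where "\<pi>' n v = v - dif V' (n - 1) (s' n v) - s' (n + 1) (dif V' n v)" for n v
  have sin: "s n v \<in> piece V m" if "v \<in> piece V n" "m = n - 1" for n m v using gl_in[OF s that(1)] that(2) by simp
  have sin': "s' n v \<in> piece V' m" if "v \<in> piece V' n" "m = n - 1" for n m v using gl_in[OF s' that(1)] that(2) by simp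
  have dsin: "dif V (n - 1) (s n v) \<in> piece V n" "s (n + 1) (dif V n v) \<in> piece V n" if "v \<in> piece V n" for n v
    using that by (auto intro!: cc_dif[OF V] sin)
  have dsin': "dif V' (n - 1) (s' n v) \<in> piece V' n" "s' (n + 1) (dif V' n v) \<in> piece V' n" if "v \<in> piece V' n" for n v
    using that by (auto intro!: cc_dif[OF V'] sin')
  have p: "graded_linear V V 0 \<pi>"
  proof (rule graded_linearI)
    fix n v w c assume v: "v \<in> piece V n"
    show "\<pi> n v \<in> piece V (n + 0)" using v dsin by (simp add: \<pi>_def cc_rules[OF V])
    show "\<pi> n (v + w) = \<pi> n v + \<pi> n w" if "w \<in> piece V n"
      using v that by (simp add: \<pi>_def gl_add[OF s] dif_rules[OF V] cc_rules[OF V] sin)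
    show "\<pi> n (scl V c v) = scl V c (\<pi> n v)"
    proof -
      interpret vector_space "scl V" by (rule cc_vector_space[OF V])
      show ?thesis using v by (simp add: \<pi>_def gl_scl[OF s] dif_rules[OF V] cc_rules[OF V] sin scale_right_diff_distrib)
    qed
  qed
  have p': "graded_linear V' V' 0 \<pi>'"
  proof (rule graded_linearI)
    fix n v w c assume v: "v \<in> piece V' n"
    show "\<pi>' n v \<in> piece V' (n + 0)" using v dsin' by (simp add: \<pi>'_def cc_rules[OF V'])
    show "\<pi>' n (v + w) = \<pi>' n v + \<pi>' n w" if "w \<in> piece V' n"
      using v that by (simp add: \<pi>'_def gl_add[OF s'] dif_rules[OF V'] cc_rules[OF V'] sin')
    show "\<pi>' n (scl V' c v) = scl V' c (\<pi>' n v)"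
    proof -
      interpret vector_space "scl V'" by (rule cc_vector_space[OF V'])
      show ?thesis using v by (simp add: \<pi>'_def gl_scl[OF s'] dif_rules[OF V'] cc_rules[OF V'] sin' scale_right_diff_distrib)
    qed
  qed
  have pin: "\<pi> n v \<in> piece V n" if "v \<in> piece V n" for n v using gl_in[OF p that] by simp
  have pin': "\<pi>' n v \<in> piece V' n" if "v \<in> piece V' n" for n v using gl_in[OF p' that] by simp
  have ain: "\<alpha> n v \<in> piece V' n" if "v \<in> piece V n" for n v using gl_in[OF \<alpha> that] by simp
  have pd: "\<pi> m (dif V n v) = 0" "dif V n (\<pi> n v) = 0" if "v \<in> piece V n" "m = n + 1" for n m v
    using that dsd[OF that] dsin[OF that(1)] by (simp_all add: \<pi>_def dif_dif[OF V] gl_zero[OF s V] dif_rules[OF V] cc_rules[OF V] sin)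
  have pd': "\<pi>' m (dif V' n v) = 0" "dif V' n (\<pi>' n v) = 0" if "v \<in> piece V' n" "m = n + 1" for n m v
    using that dsd'[OF that] dsin'[OF that(1)] by (simp_all add: \<pi>'_def dif_dif[OF V'] gl_zero[OF s' V'] dif_rules[OF V'] cc_rules[OF V'] sin')
  have ps: "\<pi> m (s n v) = 0" if "v \<in> piece V n" "m = n - 1" for n m v
    using that sds[OF that] ss[OF that] sin[OF that] by (simp add: \<pi>_def dif_zero[OF V])
  have ps': "\<pi>' m (s' n v) = 0" if "v \<in> piece V' n" "m = n - 1" for n m v
    using that sds'[OF that] ss'[OF that] sin'[OF that] by (simp add: \<pi>'_def dif_zero[OF V'])
  have pp: "\<pi> n (\<pi> n v) = \<pi> n v" if v: "v \<in> piece V n" for n v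
  proof -
    have "\<pi> n (v - dif V (n - 1) (s n v) - s (n + 1) (dif V n v)) = \<pi> n v"
      using v dsin[OF v] by (simp add: gl_diff[OF p V] cc_rules[OF V] pd ps sin)
    then show ?thesis by (simp only: \<pi>_def[of n v, symmetric])
  qed
  have pp': "\<pi>' n (\<pi>' n v) = \<pi>' n v" if v: "v \<in> piece V' n" for n v
  proof -
    have "\<pi>' n (v - dif V' (n - 1) (s' n v) - s' (n + 1) (dif V' n v)) = \<pi>' n v"
      using v dsin'[OF v] by (simp add: gl_diff[OF p' V'] cc_rules[OF V'] pd' ps' sin')
    then show ?thesis by (simp only: \<pi>'_def[of n v, symmetric])
  qed
  let ?W = "zdif V" and ?W' = "zdif V'"
  note W = cochain_complex_zdif[OF V] and W' = cochain_complex_zdif[OF V']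
  \<comment> \<open>c fills the square formed by \<alpha>, \<alpha>' and the projections, c' the
    square in the opposite direction, and e corrects the composite of the two.\<close>
  define \<alpha>' where "\<alpha>' n v = \<pi>' n (\<alpha> n (\<pi> n v))" for n v
  define c where "c n v = \<pi>' (n - 1) (\<alpha> (n - 1) (s n v))" for n v
  define c' where "c' n v = - s' n (\<alpha> n (\<pi> n v))" for n v
  define e where "e n v = - s' (n - 1) (\<alpha> (n - 1) (s n v))" for n v
  have gl0: "graded_linear X Y a f = graded_linear X' Y' a f" if "piece X = piece X'" "piece Y = piece Y'" "scl X = scl X'" "scl Y = scl Y'"
    for X X' :: "('k, 'x::ab_group_add) cpx" and Y Y' :: "('k, 'y::ab_group_add) cpx" and a f
    using that by (simp add: graded_linear_def)
  have a': "graded_linear ?W ?W' 0 \<alpha>'"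
    unfolding \<alpha>'_def
    by (rule graded_linearI) (simp_all add: pin pin' ain gl_add[OF p] gl_add[OF p'] gl_add[OF \<alpha>] gl_scl[OF p] gl_scl[OF p'] gl_scl[OF \<alpha>])
  have c: "graded_linear V ?W' (-1) c"
    unfolding c_def
    by (rule graded_linearI) (simp_all add: pin' ain sin gl_add[OF s] gl_add[OF p'] gl_add[OF \<alpha>] gl_scl[OF s] gl_scl[OF p'] gl_scl[OF \<alpha>])
  have c': "graded_linear ?W V' (-1) c'"
    unfolding c'_def
    by (rule graded_linearI) (simp_all add: pin ain sin' cc_rules[OF V'] gl_add[OF p] gl_add[OF s'] gl_add[OF \<alpha>] gl_scl[OF p] gl_scl[OF s'] gl_scl[OF \<alpha>] scl_neg[OF V'])
  have e: "graded_linear V V' (-2) e"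
    unfolding e_def
    by (rule graded_linearI) (simp_all add: sin ain sin' cc_rules[OF V'] gl_add[OF s] gl_add[OF s'] gl_add[OF \<alpha>] gl_scl[OF s] gl_scl[OF s'] gl_scl[OF \<alpha>] scl_neg[OF V'])
  have pi: "graded_linear V ?W 0 \<pi>" "graded_linear ?W V 0 \<pi>" "graded_linear V' ?W' 0 \<pi>'" "graded_linear ?W' V' 0 \<pi>'"
    using p p' by (simp_all add: graded_linear_def)
  note idH = closed_id[of C H] and idH' = closed_id[of C H']
  note X = dg_module_vtens[OF C V H] and Y = dg_module_vtens[OF C V' H'] and X0 = dg_module_vtens[OF C W H] and Y0 = dg_module_vtens[OF C W' H']
  let ?f = "vmap V' H' 0 0 \<alpha> \<psi>" and ?g = "vmap ?W' H' 0 0 \<alpha>' \<psi>"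
  have f: "closed_morphism C (vtens V H) (vtens V' H') ?f" by (rule vmap_closed[OF C V H V' H' \<alpha> \<psi> \<alpha>d])
  have f0: "closed_morphism C (vtens ?W H) (vtens ?W' H') ?g"
    by (rule vmap_closed[OF C W H W' H' a' \<psi>]) (simp add: gl_zero[OF a' W])
  have q1: "closed_morphism C (vtens V H) (vtens ?W H) (vmap ?W H 0 0 \<pi> (\<lambda>x n v. v))"
    by (rule vmap_closed[OF C V H W H pi(1) idH]) (simp add: pd)
  have q2: "closed_morphism C (vtens ?W H) (vtens V H) (vmap V H 0 0 \<pi> (\<lambda>x n v. v))"
    by (rule vmap_closed[OF C W H V H pi(2) idH]) (simp add: pd gl_zero[OF p V])
  have q1': "closed_morphism C (vtens V' H') (vtens ?W' H') (vmap ?W' H' 0 0 \<pi>' (\<lambda>x n v. v))"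
    by (rule vmap_closed[OF C V' H' W' H' pi(3) idH']) (simp add: pd')
  have q2': "closed_morphism C (vtens ?W' H') (vtens V' H') (vmap V' H' 0 0 \<pi>' (\<lambda>x n v. v))"
    by (rule vmap_closed[OF C W' H' V' H' pi(4) idH']) (simp add: pd' gl_zero[OF p' V'])
  note cg = closed_graded[OF \<psi>]
  have cm: "graded_map C (vtens V H) (vtens ?W' H') (-1) (vmap ?W' H' (-1) 0 c \<psi>)"
    by (rule vmap_graded[OF C V H W' H' c cg]) simp
  have cm': "graded_map C (vtens ?W H) (vtens V' H') (-1) (vmap V' H' (-1) 0 c' \<psi>)"
    by (rule vmap_graded[OF C W H V' H' c' cg]) simp
  have em: "graded_map C (vtens V H) (vtens V' H') (-2) (vmap V' H' (-2) 0 e \<psi>)"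
    by (rule vmap_graded[OF C V H V' H' e cg]) simp
  have sm: "graded_map C (vtens V H) (vtens V H) (-1) (vmap V H (-1) 0 s (\<lambda>x n v. v))"
    by (rule vmap_graded[OF C V H V H s closed_graded[OF idH]]) simp
  have sm': "graded_map C (vtens V' H') (vtens V' H') (-1) (vmap V' H' (-1) 0 s' (\<lambda>x n v. v))"
    by (rule vmap_graded[OF C V' H' V' H' s' closed_graded[OF idH']]) simp
  note t\<alpha> = vmap_tns[OF C V H V' H' \<alpha> cg] and t\<alpha>' = vmap_tns[OF C W H W' H' a' cg] and tc = vmap_tns[OF C V H W' H' c cg]
    and tc' = vmap_tns[OF C W H V' H' c' cg] and te = vmap_tns[OF C V H V' H' e cg]
    and ts = vmap_tns[OF C V H V H s closed_graded[OF idH]] and ts' = vmap_tns[OF C V' H' V' H' s' closed_graded[OF idH']]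
    and t1 = vmap_tns[OF C V H W H pi(1) closed_graded[OF idH]] and t2 = vmap_tns[OF C W H V H pi(2) closed_graded[OF idH]]
    and t1' = vmap_tns[OF C V' H' W' H' pi(3) closed_graded[OF idH']] and t2' = vmap_tns[OF C W' H' V' H' pi(4) closed_graded[OF idH']]
  have E1: "\<pi>' n (\<alpha> n v) = c (n + 1) (dif V n v) + \<alpha>' n (\<pi> n v)" if v: "v \<in> piece V n" for n v
  proof -
    have "\<alpha> n (\<pi> n v) = \<alpha> n v - dif V' (n - 1) (\<alpha> (n - 1) (s n v)) - \<alpha> n (s (n + 1) (dif V n v))"
      using v dsin[OF v] by (simp add: \<pi>_def gl_diff[OF \<alpha> V] cc_rules[OF V] \<alpha>d[of _ "n - 1"] sin)
    then have "\<pi>' n (\<alpha> n (\<pi> n v)) = \<pi>' n (\<alpha> n v) - \<pi>' n (\<alpha> n (s (n + 1) (dif V n v)))"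
      using v dsin[OF v] pd'(1)[of "\<alpha> (n - 1) (s n v)" "n - 1" n]
      by (simp add: gl_diff[OF p' V'] cc_rules[OF V'] ain sin)
    then show ?thesis using v by (simp add: c_def \<alpha>'_def pp)
  qed
  have E2: "\<pi>' n (\<alpha>' n v) = dif V' (n - 1) (c' n v) + \<alpha> n (\<pi> n v)" if v: "v \<in> piece V n" for n v
  proof -
    have "dif V' n (\<alpha> n (\<pi> n v)) = 0" using \<alpha>d[OF pin[OF v] refl] pd(2)[OF v refl] gl_zero[OF \<alpha> V] by simp
    then have "\<alpha>' n v = \<alpha> n (\<pi> n v) - dif V' (n - 1) (s' n (\<alpha> n (\<pi> n v)))"
      by (simp add: \<pi>'_def \<alpha>'_def gl_zero[OF s' V'])
    moreover have "\<pi>' n (\<alpha>' n v) = \<alpha>' n v"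
      unfolding \<alpha>'_def by (rule pp'[OF ain[OF pin[OF v]]])
    moreover have "dif V' (n - 1) (c' n v) = - dif V' (n - 1) (s' n (\<alpha> n (\<pi> n v)))"
      unfolding c'_def by (rule dif_neg[OF V']) (rule sin'[OF ain[OF pin[OF v]] refl])
    ultimately show ?thesis by simp
  qed
  \<comment> \<open>The left side is the off-diagonal entry of the composite of the two maps of
    cones, minus the identity; the right side is that entry of the boundary of the homotopy with
    entries -s', e, s.\<close>
  have E4: "\<pi>' (n - 1) (c n v) + c' n (\<pi> n v) = dif V' (n - 2) (e n v) + \<alpha> (n - 1) (s n v) - s' n (\<alpha> n v) - e (n + 1) (dif V n v)"
    if v: "v \<in> piece V n" for n v
  proof -
    have sv: "s n v \<in> piece V (n - 1)" "\<alpha> (n - 1) (s n v) \<in> piece V' (n - 1)" using v sin ain by simp_all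
    have 1: "\<pi>' (n - 1) (c n v) = \<pi>' (n - 1) (\<alpha> (n - 1) (s n v))"
      unfolding c_def by (rule pp'[OF sv(2)])
    have 2: "c' n (\<pi> n v) = - s' n (\<alpha> n (\<pi> n v))" unfolding c'_def pp[OF v] ..
    have "\<alpha> n (\<pi> n v) = \<alpha> n v - dif V' (n - 1) (\<alpha> (n - 1) (s n v)) - \<alpha> n (s (n + 1) (dif V n v))"
      using v dsin[OF v] by (simp add: \<pi>_def gl_diff[OF \<alpha> V] cc_rules[OF V] \<alpha>d[of _ "n - 1"] sin)
    then have 3: "s' n (\<alpha> n (\<pi> n v)) = s' n (\<alpha> n v) - s' n (dif V' (n - 1) (\<alpha> (n - 1) (s n v))) - s' n (\<alpha> n (s (n + 1) (dif V n v)))"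
      using v dsin[OF v] sv by (simp add: gl_diff[OF s' V'] cc_rules[OF V'] ain)
    have 4: "dif V' (n - 2) (e n v) = - dif V' (n - 2) (s' (n - 1) (\<alpha> (n - 1) (s n v)))"
      unfolding e_def by (rule dif_neg[OF V']) (rule sin'[OF sv(2)], simp)
    show ?thesis unfolding 1 2 3 4 by (simp add: \<pi>'_def e_def)
  qed
  \<comment> \<open>Relations and pieces involve only the underlying graded space, so tensors with V
    and with \<open>zdif V\<close> have the same elements; only the differentials differ.\<close>
  have tW: "tns ?W (sp H x) = tns V (sp H x)" "tns ?W' (sp H' x) = tns V' (sp H' x)" for x
    by (simp_all add: fun_eq_iff ten_def tensor_proj_def bilinear_rels_def)
  have pW: "piece (tensor_cpx ?W (sp H x)) = piece (tensor_cpx V (sp H x))" "piece (tensor_cpx ?W' (sp H' x)) = piece (tensor_cpx V' (sp H' x))" for x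
    by (simp_all add: fun_eq_iff tensor_family_def tensor_proj_def bilinear_rels_def)
  note t\<alpha>' = t\<alpha>'[unfolded zdif_simps tW] and tc = tc[unfolded zdif_simps tW] and tc' = tc'[unfolded zdif_simps tW]
    and t1 = t1[unfolded zdif_simps tW] and t2 = t2[unfolded zdif_simps tW] and t1' = t1'[unfolded zdif_simps tW] and t2' = t2'[unfolded zdif_simps tW]
  let ?I = "\<lambda>x n u. (vmap ?W' H' 0 0 \<pi>' (\<lambda>x n v. v) x n (fst u) + vmap ?W' H' (-1) 0 c \<psi> x (n + 1) (snd u), vmap ?W H 0 0 \<pi> (\<lambda>x n v. v) x (n + 1) (snd u))"
  let ?P = "\<lambda>x n u. (vmap V' H' 0 0 \<pi>' (\<lambda>x n v. v) x n (fst u) + vmap V' H' (-1) 0 c' \<psi> x (n + 1) (snd u), vmap V H 0 0 \<pi> (\<lambda>x n v. v) x (n + 1) (snd u))"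
  have I: "closed_morphism C (cone (vtens V H) (vtens V' H') ?f) (cone (vtens ?W H) (vtens ?W' H') ?g) ?I"
  proof (rule cone_map_closed[OF X Y X0 Y0 C f f0 q1' q1 cm])
    fix x n t assume x: "x \<in> Obj C" and "t \<in> piece (sp (vtens V H) x) n"
    then have t: "t \<in> piece (tensor_cpx V (sp H x)) n" by simp
    note cc = V mod_cc[OF H x] V' mod_cc[OF H' x]
    note d0 = tns_dif[OF W' cc(4), unfolded zdif_simps tW]
    from cc(1,2) t show "vmap ?W' H' 0 0 \<pi>' (\<lambda>x n v. v) x n (?f x n t) = dif (sp (vtens ?W' H') x) (n - 1) (vmap ?W' H' (-1) 0 c \<psi> x n t)
        + vmap ?W' H' (-1) 0 c \<psi> x (n + 1) (dif (sp (vtens V H) x) n t) + ?g x n (vmap ?W H 0 0 \<pi> (\<lambda>x n v. v) x n t)"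
    proof (induction rule: tensor_induct)
      case (ten p q v w)
      have m: "c p v \<in> piece V' (p - 1)" "c (p + 1) (dif V p v) \<in> piece V' p" "\<alpha>' p (\<pi> p v) \<in> piece V' p"
        using gl_in[OF c ten(2), of "p - 1"] gl_in[OF c cc_dif[OF V ten(2) refl], of p] gl_in[OF a', of "\<pi> p v" p p] pin[OF ten(2)] by simp_all
      note i = m ten x ain[OF ten(2)] closed_in[OF \<psi> x ten(3)] pin[OF ten(2)] cc_dif[OF V ten(2) refl] mod_cc_rules(7)[OF H x ten(3) refl]
        closed_in[OF \<psi> x mod_cc_rules(7)[OF H x ten(3) refl]]
      show ?case using i
        by (cases "even p") (simp_all add: tns_dif[OF cc(1,2)] d0 t\<alpha> t\<alpha>' t1' t1 tc vmap_rules E1[OF ten(2)] tns_rules[OF cc(3,4)]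
          closed_dif[OF \<psi>] koszul_def)
    qed (simp_all add: vmap_rules tensor_dif_rules[OF cc(1,2)] tensor_dif_rules[OF W' cc(4)])
  qed
  have P: "closed_morphism C (cone (vtens ?W H) (vtens ?W' H') ?g) (cone (vtens V H) (vtens V' H') ?f) ?P"
  proof (rule cone_map_closed[OF X0 Y0 X Y C f0 f q2' q2 cm'])
    fix x n t assume x: "x \<in> Obj C" and "t \<in> piece (sp (vtens ?W H) x) n"
    then have t: "t \<in> piece (tensor_cpx V (sp H x)) n" by (simp add: pW)
    note cc = V mod_cc[OF H x] V' mod_cc[OF H' x]
    note d0 = tns_dif[OF W cc(2), unfolded zdif_simps tW]
    from cc(1,2) t show "vmap V' H' 0 0 \<pi>' (\<lambda>x n v. v) x n (?g x n t) = dif (sp (vtens V' H') x) (n - 1) (vmap V' H' (-1) 0 c' \<psi> x n t)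
        + vmap V' H' (-1) 0 c' \<psi> x (n + 1) (dif (sp (vtens ?W H) x) n t) + ?f x n (vmap V H 0 0 \<pi> (\<lambda>x n v. v) x n t)"
    proof (induction rule: tensor_induct)
      case (ten p q v w)
      have m: "c' p v \<in> piece V' (p - 1)" "\<alpha>' p v \<in> piece V' p" "dif V' (p - 1) (c' p v) \<in> piece V' p" "\<alpha> p (\<pi> p v) \<in> piece V' p"
        using gl_in[OF c', of v p "p - 1"] gl_in[OF a', of v p p] ten(2) cc_dif[OF V', of "c' p v" "p - 1" p] pin ain by simp_all
      note i = m ten x closed_in[OF \<psi> x ten(3)] pin[OF ten(2)] mod_cc_rules(7)[OF H x ten(3) refl]
        closed_in[OF \<psi> x mod_cc_rules(7)[OF H x ten(3) refl]] mod_cc_rules(7)[OF H' x closed_in[OF \<psi> x ten(3)] refl]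
      show ?case using i
        by (cases "even p") (simp_all add: tns_dif[OF cc(3,4)] d0 t\<alpha> t\<alpha>' t2' t2 tc' vmap_rules E2[OF ten(2)] tns_rules[OF cc(3,4)] tns_rules[OF cc(1,2)]
          closed_dif[OF \<psi>] koszul_def)
    qed (simp_all add: vmap_rules tensor_dif_rules[OF W cc(2)] tensor_dif_rules[OF cc(3,4)])
  qed
  show ?thesis
  proof (rule that[OF a'], rule homotopy_retractI[OF dg_module_cone[OF X Y f C] dg_module_cone[OF X0 Y0 f0 C] I P])
    let ?sn = "\<lambda>x n t. - vmap V' H' (-1) 0 s' (\<lambda>x n v. v) x n t"
    \<comment> \<open>\<pi>' - 1 is the boundary of -s'. On the component of V the cone negates the
      differential, so there the sign of s is positive.\<close>
    let ?T = "\<lambda>x n u. (?sn x n (fst u) + vmap V' H' (-2) 0 e \<psi> x (n + 1) (snd u), vmap V H (-1) 0 s (\<lambda>x n v. v) x (n + 1) (snd u))"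
    have T: "graded_map C (cone (vtens V H) (vtens V' H') ?f) (cone (vtens V H) (vtens V' H') ?f) (-1) ?T"
      by (rule cone_map_graded[OF X Y Y graded_neg[OF Y sm'] sm]) (use em in simp)
    have H1: "vmap V' H' 0 0 \<pi>' (\<lambda>x n v. v) x n (vmap ?W' H' 0 0 \<pi>' (\<lambda>x n v. v) x n t) - t =
      - dif (tensor_cpx V' (sp H' x)) (n - 1) (vmap V' H' (-1) 0 s' (\<lambda>x n v. v) x n t) - vmap V' H' (-1) 0 s' (\<lambda>x n v. v) x (n + 1) (dif (tensor_cpx V' (sp H' x)) n t)"
      if x: "x \<in> Obj C" and t: "t \<in> piece (tensor_cpx V' (sp H' x)) n" for x n t
      using V' mod_cc[OF H' x] t
    proof (induction rule: tensor_eqI)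
      case (ten p q v w)
      note cc = V' mod_cc[OF H' x]
      have m: "s' p v \<in> piece V' (p - 1)" "s' (p + 1) (dif V' p v) \<in> piece V' p" "dif V' (p - 1) (s' p v) \<in> piece V' p"
        using sin'[OF ten(2)] dsin'[OF ten(2)] by simp_all
      have "tns V' (sp H' x) p q (\<pi>' p v) w = tns V' (sp H' x) p q v w - tns V' (sp H' x) p q (dif V' (p - 1) (s' p v)) w - tns V' (sp H' x) p q (s' (p + 1) (dif V' p v)) w"
        unfolding \<pi>'_def using m ten by (simp add: tns_rules[OF cc] cc_rules[OF V'])
      moreover have "vmap V' H' 0 0 \<pi>' (\<lambda>x n v. v) x n (vmap ?W' H' 0 0 \<pi>' (\<lambda>x n v. v) x n (tns V' (sp H' x) p q v w)) = tns V' (sp H' x) p q (\<pi>' p v) w"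
        using x ten pin'[OF ten(2)] pp'[OF ten(2)] by (simp add: t1' t2')
      ultimately show ?case using m ten x
        by (cases "even p") (simp_all add: ts' vmap_rules tns_dif[OF cc] cc_rules[OF V'] mod_cc_rules[OF H'] koszul_def)
    qed (simp_all add: vmap_rules tensor_dif_rules[OF V' mod_cc[OF H' x]] algebra_simps)
    have H3: "vmap V H 0 0 \<pi> (\<lambda>x n v. v) x n (vmap ?W H 0 0 \<pi> (\<lambda>x n v. v) x n t) - t =
      - dif (tensor_cpx V (sp H x)) (n - 1) (vmap V H (-1) 0 s (\<lambda>x n v. v) x n t) - vmap V H (-1) 0 s (\<lambda>x n v. v) x (n + 1) (dif (tensor_cpx V (sp H x)) n t)"
      if x: "x \<in> Obj C" and t: "t \<in> piece (tensor_cpx V (sp H x)) n" for x n t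
      using V mod_cc[OF H x] t
    proof (induction rule: tensor_eqI)
      case (ten p q v w)
      note cc = V mod_cc[OF H x]
      have m: "s p v \<in> piece V (p - 1)" "s (p + 1) (dif V p v) \<in> piece V p" "dif V (p - 1) (s p v) \<in> piece V p"
        using sin[OF ten(2)] dsin[OF ten(2)] by simp_all
      have "tns V (sp H x) p q (\<pi> p v) w = tns V (sp H x) p q v w - tns V (sp H x) p q (dif V (p - 1) (s p v)) w - tns V (sp H x) p q (s (p + 1) (dif V p v)) w"
        unfolding \<pi>_def using m ten by (simp add: tns_rules[OF cc] cc_rules[OF V])
      moreover have "vmap V H 0 0 \<pi> (\<lambda>x n v. v) x n (vmap ?W H 0 0 \<pi> (\<lambda>x n v. v) x n (tns V (sp H x) p q v w)) = tns V (sp H x) p q (\<pi> p v) w"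
        using x ten pin[OF ten(2)] pp[OF ten(2)] by (simp add: t1 t2)
      ultimately show ?case using m ten x
        by (cases "even p") (simp_all add: ts vmap_rules tns_dif[OF cc] cc_rules[OF V] mod_cc_rules[OF H] koszul_def)
    qed (simp_all add: vmap_rules tensor_dif_rules[OF V mod_cc[OF H x]] algebra_simps)
    have H2: "vmap V' H' 0 0 \<pi>' (\<lambda>x n v. v) x m (vmap ?W' H' (-1) 0 c \<psi> x n t) + vmap V' H' (-1) 0 c' \<psi> x n (vmap ?W H 0 0 \<pi> (\<lambda>x n v. v) x n t) =
      dif (tensor_cpx V' (sp H' x)) (n - 2) (vmap V' H' (-2) 0 e \<psi> x n t) + ?f x m (vmap V H (-1) 0 s (\<lambda>x n v. v) x n t)
        - vmap V' H' (-1) 0 s' (\<lambda>x n v. v) x n (?f x n t) - vmap V' H' (-2) 0 e \<psi> x (n + 1) (dif (tensor_cpx V (sp H x)) n t)"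
      if x: "x \<in> Obj C" and t: "t \<in> piece (tensor_cpx V (sp H x)) n" for x n m t
      using V mod_cc[OF H x] t
    proof (induction rule: tensor_eqI)
      case (ten p q v w)
      note cc = V mod_cc[OF H x] V' mod_cc[OF H' x]
      have m: "s p v \<in> piece V (p - 1)" "c p v \<in> piece V' (p - 1)" "c' p (\<pi> p v) \<in> piece V' (p - 1)" "e p v \<in> piece V' (p - 2)"
        "dif V' (p - 2) (e p v) \<in> piece V' (p - 1)" "\<alpha> (p - 1) (s p v) \<in> piece V' (p - 1)" "s' p (\<alpha> p v) \<in> piece V' (p - 1)"
        "e (p + 1) (dif V p v) \<in> piece V' (p - 1)" "\<pi>' (p - 1) (c p v) \<in> piece V' (p - 1)"
        using sin[OF ten(2)] gl_in[OF c, of v p "p - 1"] gl_in[OF c', of "\<pi> p v" p "p - 1"] pin[OF ten(2)] gl_in[OF e, of v p "p - 2"]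
          gl_in[OF e, of "dif V p v" "p + 1" "p - 1"] cc_dif[OF V', of "e p v" "p - 2" "p - 1"] ain sin'[OF ain[OF ten(2)]] ten(2)
        by (simp_all add: cc_rules[OF V] pin')
      have pw: "\<psi> x q w \<in> piece (sp H' x) q" by (rule closed_in[OF \<psi> x ten(3)])
      have "tns V' (sp H' x) (p - 1) q (\<pi>' (p - 1) (c p v)) (\<psi> x q w) + tns V' (sp H' x) (p - 1) q (c' p (\<pi> p v)) (\<psi> x q w)
          = tns V' (sp H' x) (p - 1) q (\<pi>' (p - 1) (c p v) + c' p (\<pi> p v)) (\<psi> x q w)"
        using m pw by (simp add: tns_rules[OF cc(3,4)])
      also have "\<dots> = tns V' (sp H' x) (p - 1) q (dif V' (p - 2) (e p v)) (\<psi> x q w) + tns V' (sp H' x) (p - 1) q (\<alpha> (p - 1) (s p v)) (\<psi> x q w)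
          - tns V' (sp H' x) (p - 1) q (s' p (\<alpha> p v)) (\<psi> x q w) - tns V' (sp H' x) (p - 1) q (e (p + 1) (dif V p v)) (\<psi> x q w)"
        unfolding E4[OF ten(2)] using m pw by (simp add: tns_rules[OF cc(3,4)] cc_rules[OF V'])
      finally show ?case using m pw ten x pin[OF ten(2)] ain[OF ten(2)]
        by (cases "even p") (simp_all add: t1 t2' tc tc' te t\<alpha> ts ts' vmap_rules tns_dif[OF cc(1,2)] tns_dif[OF cc(3,4)] cc_rules[OF V] mod_cc_rules[OF H]
          closed_dif[OF \<psi>] koszul_def)
    qed (simp_all add: vmap_rules tensor_dif_rules[OF V mod_cc[OF H x]] tensor_dif_rules[OF V' mod_cc[OF H' x]] algebra_simps)
    have solve_first: "a - s = - d - e \<Longrightarrow> a = s - d - e" "a + b = c + d - e - f \<Longrightarrow> a = c + d - e - f - b"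
      for a b c d e f s :: "'z::ab_group_add"
      by (simp_all add: algebra_simps)
    show "homotopic C (cone (vtens V H) (vtens V' H') ?f) (cone (vtens V H) (vtens V' H') ?f) (\<lambda>x n v. ?P x n (?I x n v)) (\<lambda>x n v. v)"
    proof (rule homotopicI[OF T])
      fix x n u assume x: "x \<in> Obj C" and "u \<in> piece (sp (cone (vtens V H) (vtens V' H') ?f) x) n"
      then obtain w v where u: "u = (w, v)" and w: "w \<in> piece (tensor_cpx V' (sp H' x)) n" and v: "v \<in> piece (tensor_cpx V (sp H x)) (n + 1)"
        by auto
      have n: "n + 1 - 2 = n - 1" "n + 1 - 1 = n" "n - 1 + 1 = n" by simp_all
      show "?P x n (?I x n u) - u = dif (sp (cone (vtens V H) (vtens V' H') ?f) x) (n - 1) (?T x n u) + ?T x (n + 1) (dif (sp (cone (vtens V H) (vtens V' H') ?f) x) n u)"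
        by (simp add: u vmap_rules tensor_dif_rules[OF V mod_cc[OF H x]] tensor_dif_rules[OF V' mod_cc[OF H' x]] n
            H1[OF x w, THEN solve_first(1)] H2[OF x v, of n, THEN solve_first(2)] H3[OF x v, THEN solve_first(1)])
    qed
  qed
qed

end

text \<open>A map out of the cone is a closed map A on Y with a null-homotopy A' of A f, and a map
  into it is a pair Q, R with triangular compatibility. The last four hypotheses say that the
  composite is the identity matrix.\<close>

lemma cone_strict_retract:
  assumes C: "hom_complexes C" and X: "dg_module C X" and Y: "dg_module C Y" and Z: "dg_module C Z" and f: "closed_morphism C X Y f"
    and A: "closed_morphism C Y Z A" and A': "graded_map C X Z (-1) A'" and Q: "graded_map C Z Y 0 Q" and R: "graded_map C Z X 1 R"
    and Ad: "\<And>x n v. x \<in> Obj C \<Longrightarrow> v \<in> piece (sp X x) n \<Longrightarrow>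
      A x n (f x n v) = dif (sp Z x) (n - 1) (A' x n v) + A' x (n + 1) (dif (sp X x) n v)"
    and Qd: "\<And>x n t. x \<in> Obj C \<Longrightarrow> t \<in> piece (sp Z x) n \<Longrightarrow>
      Q x (n + 1) (dif (sp Z x) n t) = dif (sp Y x) n (Q x n t) + f x (n + 1) (R x n t)"
    and Rd: "\<And>x n t. x \<in> Obj C \<Longrightarrow> t \<in> piece (sp Z x) n \<Longrightarrow> R x (n + 1) (dif (sp Z x) n t) = - dif (sp X x) (n + 1) (R x n t)"
    and QA: "\<And>x n w. x \<in> Obj C \<Longrightarrow> w \<in> piece (sp Y x) n \<Longrightarrow> Q x n (A x n w) = w"
    and RA: "\<And>x n w. x \<in> Obj C \<Longrightarrow> w \<in> piece (sp Y x) n \<Longrightarrow> R x n (A x n w) = 0"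
    and QA': "\<And>x n m v. x \<in> Obj C \<Longrightarrow> v \<in> piece (sp X x) n \<Longrightarrow> m = n - 1 \<Longrightarrow> Q x m (A' x n v) = 0"
    and RA': "\<And>x n m v. x \<in> Obj C \<Longrightarrow> v \<in> piece (sp X x) n \<Longrightarrow> m = n - 1 \<Longrightarrow> R x m (A' x n v) = v"
  shows "homotopy_retract C (cone X Y f) Z"
proof -
  let ?I = "\<lambda>x n u. A x n (fst u) + A' x (n + 1) (snd u)" and ?P = "\<lambda>x n t. (Q x n t, R x n t)"
  have in': "A' x n v \<in> piece (sp Z x) m" if "x \<in> Obj C" "v \<in> piece (sp X x) n" "m = n - 1" for x n m v
    using gm_in[OF A' that(1,2)] that(3) by simp
  have I: "closed_morphism C (cone X Y f) Z ?I"
  proof (rule closed_morphismI, rule graded_mapI, rule graded_linearI, goal_cases)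
    case (1 x n u)
    then show ?case by (auto simp: closed_in[OF A] in' mod_cc_rules[OF Z])
  next
    case (2 x n u u')
    then show ?case by (auto simp: closed_add[OF A] gm_add[OF A'])
  next
    case (3 x n u c)
    then show ?case by (auto simp: closed_scl[OF A] gm_scl[OF A'] scl_add[OF mod_cc[OF Z]])
  next
    case (4 x y m n u c)
    then obtain w v where u: "u = (w, v)" "w \<in> piece (sp Y y) m" "v \<in> piece (sp X y) (m + 1)" by auto
    have e: "m + n + 1 = m + 1 + n" "m + 1 + - 1 = m" by simp_all
    show ?case using 4 u gm_act[OF A' 4(1,2) u(3) 4(4) e(1)]
      by (simp add: closed_act[OF A] closed_in[OF A] in' act_left_rules[OF Z] e)
  next
    case (5 x n u)
    then obtain w v where u: "u = (w, v)" "w \<in> piece (sp Y x) n" "v \<in> piece (sp X x) (n + 1)" by auto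
    have m: "f x (n + 1) v \<in> piece (sp Y x) (n + 1)" "dif (sp Y x) n w \<in> piece (sp Y x) (n + 1)"
      "dif (sp X x) (n + 1) v \<in> piece (sp X x) (n + 1 + 1)"
      using 5 u closed_in[OF f 5(1) u(3)] by (simp_all add: mod_cc_rules[OF Y] mod_cc_rules[OF X])
    have "A' x (n + 1 + 1) (- dif (sp X x) (n + 1) v) = - A' x (n + 1 + 1) (dif (sp X x) (n + 1) v)"
      by (rule gl_neg[OF gm_gl[OF A' 5(1)] mod_cc[OF X 5(1)] m(3)])
    then show ?case using 5 u m
      by (simp add: closed_add[OF A] closed_dif[OF A] Ad closed_in[OF A] in' mod_dif_rules[OF Z])
  qed
  have P: "closed_morphism C Z (cone X Y f) ?P"
  proof (rule closed_morphismI, rule graded_mapI, rule graded_linearI, goal_cases)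
    case (4 x y m n t c)
    have e: "m + n + 1 = m + 1 + n" by simp
    show ?case using 4 by (simp add: gm_act[OF Q] gm_act[OF R])
  qed (simp_all add: gm_in[OF Q] gm_in[OF R] gm_add[OF Q] gm_add[OF R] gm_scl[OF Q] gm_scl[OF R] Qd Rd)
  show ?thesis
  proof (rule strict_retract[OF C dg_module_cone[OF X Y f C] Z I P])
    fix x n u assume x: "x \<in> Obj C" and "u \<in> piece (sp (cone X Y f) x) n"
    then obtain w v where u: "u = (w, v)" "w \<in> piece (sp Y x) n" "v \<in> piece (sp X x) (n + 1)" by auto
    show "?P x n (?I x n u) = u" using x u
      by (simp add: gm_add[OF Q] gm_add[OF R] closed_in[OF A] in' QA RA QA' RA')
  qed
qed

lemma scl_diff: "cochain_complex V \<Longrightarrow> scl V c (v - w) = scl V c v - scl V c w"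
  using scl_add[of V c v "- w"] scl_neg[of V c w] by simp

lemma closed_morphism_add:
  assumes N: "dg_module C N" and f: "closed_morphism C M N f" and g: "closed_morphism C M N g"
  shows "closed_morphism C M N (\<lambda>x n v. f x n v + g x n v)"
  by (rule closed_morphismI[OF graded_add[OF N closed_graded[OF f] closed_graded[OF g]]])
    (simp add: closed_dif[OF f] closed_dif[OF g] mod_dif_rules[OF N] closed_in[OF f] closed_in[OF g])

section \<open>A perfect module controlling all the cones\<close>

text \<open>
  After passing to the splitting of \<open>\<alpha>\<close>, the cone of \<open>\<alpha> \<otimes> \<psi>\<close> is a sum of copies of the cone of \<open>\<psi>\<close>,
  of the shift of \<open>H\<close>, and of \<open>H'\<close>. The locale describes a module \<open>G\<close> with these three as summands;
  \<open>a, b\<close> belong to the shift of \<open>H\<close>, \<open>a', b'\<close> to \<open>H'\<close>, and \<open>i, s, q, r\<close> to the cone of \<open>\<psi>\<close>.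
\<close>

locale cone_splitting =
  fixes C :: "('o, 'k::field, 'h::ab_group_add) dgcat" and H :: "('o, 'k, 'h, 'm::ab_group_add) dgmod"
    and H' :: "('o, 'k, 'h, 'n::ab_group_add) dgmod" and \<psi> and G :: "('o, 'k, 'h, 'g::ab_group_add) dgmod" and a b a' b' i s q r
  assumes C: "hom_complexes C" and H: "dg_module C H" and H': "dg_module C H'" and G: "dg_module C G" and \<psi>: "closed_morphism C H H' \<psi>"
    and maps: "graded_map C H G (-1) a" "graded_map C G H 1 b" "closed_morphism C H' G a'" "closed_morphism C G H' b'"
    "closed_morphism C H' G i" "graded_map C H G (-1) s" "graded_map C G H' 0 q" "graded_map C G H 1 r"
    and difs:
    "\<And>x n m w. x \<in> Obj C \<Longrightarrow> w \<in> piece (sp H x) n \<Longrightarrow> m = n - 1 \<Longrightarrow> dif (sp G x) m (a x n w) = - a x (n + 1) (dif (sp H x) n w)"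
    "\<And>x n g. x \<in> Obj C \<Longrightarrow> g \<in> piece (sp G x) n \<Longrightarrow> b x (n + 1) (dif (sp G x) n g) = - dif (sp H x) (n + 1) (b x n g)"
    "\<And>x n m w. x \<in> Obj C \<Longrightarrow> w \<in> piece (sp H x) n \<Longrightarrow> m = n - 1 \<Longrightarrow>
      dif (sp G x) m (s x n w) = i x n (\<psi> x n w) - s x (n + 1) (dif (sp H x) n w)"
    "\<And>x n g. x \<in> Obj C \<Longrightarrow> g \<in> piece (sp G x) n \<Longrightarrow> q x (n + 1) (dif (sp G x) n g) = dif (sp H' x) n (q x n g) + \<psi> x (n + 1) (r x n g)"
    "\<And>x n g. x \<in> Obj C \<Longrightarrow> g \<in> piece (sp G x) n \<Longrightarrow> r x (n + 1) (dif (sp G x) n g) = - dif (sp H x) (n + 1) (r x n g)"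
    and on_H: "\<And>x n m w. x \<in> Obj C \<Longrightarrow> w \<in> piece (sp H x) n \<Longrightarrow> m = n - 1 \<Longrightarrow>
      q x m (s x n w) = 0 \<and> q x m (a x n w) = 0 \<and> b x m (s x n w) = 0 \<and> b x m (a x n w) = w \<and> r x m (s x n w) = w \<and> r x m (a x n w) = 0"
    and on_H': "\<And>x n w. x \<in> Obj C \<Longrightarrow> w \<in> piece (sp H' x) n \<Longrightarrow>
      q x n (i x n w) = w \<and> b x n (i x n w) = 0 \<and> r x n (i x n w) = 0 \<and> b' x n (a' x n w) = w"
begin

text \<open>With \<alpha>\<beta>\<alpha> = \<alpha>, both \<beta>\<alpha> and \<alpha>\<beta> are
  idempotent: the former splits V into a part on which \<alpha> is injective and the kernel of
  \<alpha>, the latter V' into the image of \<alpha> and a complement. The part of V with the image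
  contributes copies of the cone of \<psi>, the kernel copies of H[1], and the complement copies of
  H'. All three are placed in (V' \<oplus> V) \<otimes> G.\<close>

lemma cone_retract:
  fixes V :: "('k, 'v::ab_group_add) cpx" and V' :: "('k, 'v'::ab_group_add) cpx"
  assumes V: "cochain_complex V" and V': "cochain_complex V'" and z: "\<And>n v. dif V n v = 0" and z': "\<And>n v. dif V' n v = 0"
    and \<alpha>: "graded_linear V V' 0 \<alpha>"
  shows "homotopy_retract C (cone (vtens V H) (vtens V' H') (vmap V' H' 0 0 \<alpha> \<psi>)) (vtens (cone_cpx (shift_cpx (-1) V) V' (\<lambda>n v. 0)) G)"
proof -
  \<comment> \<open>The cone of a zero map serves as the direct sum. It shifts its source by 1, so
    the source is shifted back first; in degree n this is V' \<times> V in the same degree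
    n.\<close>
  let ?U = "cone_cpx (shift_cpx (-1) V) V' (\<lambda>n v. 0)" and ?f = "vmap V' H' 0 0 \<alpha> \<psi>"
  obtain \<beta> where \<beta>: "graded_linear V' V 0 \<beta>" and \<alpha>\<beta>: "\<And>n v. v \<in> piece V n \<Longrightarrow> \<alpha> n (\<beta> n (\<alpha> n v)) = \<alpha> n v"
    by (rule generalized_inverse[OF V V' \<alpha>]) blast
  have U: "cochain_complex ?U"
  proof (rule cochain_complex_cone[OF cochain_complex_shift[OF V] V'])
    show "graded_linear (shift_cpx (- 1) V) V' 0 (\<lambda>n v. 0)"
      by (rule graded_linearI) (simp_all add: cc_rules[OF V'] scl_zero_right[OF V'])
  qed (simp add: z')
  have zU: "dif ?U n u = 0" for n u by (cases u) (simp add: z z' zero_prod_def)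
  have \<alpha>in: "\<alpha> n v \<in> piece V' n" if "v \<in> piece V n" for n v using gl_in[OF \<alpha> that] by simp
  have \<beta>in: "\<beta> n v \<in> piece V n" if "v \<in> piece V' n" for n v using gl_in[OF \<beta> that] by simp
  note lin = gl_zero[OF \<alpha> V] gl_diff[OF \<alpha> V] gl_add[OF \<alpha>] gl_scl[OF \<alpha>] gl_zero[OF \<beta> V'] gl_diff[OF \<beta> V'] gl_add[OF \<beta>] gl_scl[OF \<beta>] cc_rules[OF V] cc_rules[OF V'] \<alpha>in \<beta>in scl_zero_right[OF V] scl_zero_right[OF V']
    scl_add[OF V] scl_add[OF V'] scl_diff[OF V] scl_diff[OF V']
  have g1: "graded_linear V' ?U 0 (\<lambda>n v'. (0, \<beta> n v'))"
    and g2: "graded_linear V' ?U 0 (\<lambda>n v'. (v' - \<alpha> n (\<beta> n v'), 0))"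
    and g3: "graded_linear V ?U 0 (\<lambda>n v. (0, \<beta> n (\<alpha> n v)))"
    and g4: "graded_linear V ?U 0 (\<lambda>n v. (0, v - \<beta> n (\<alpha> n v)))"
    by (rule graded_linearI; simp add: lin)+
  have h1: "graded_linear ?U V' 0 (\<lambda>n u. \<alpha> n (snd u))"
    and h2: "graded_linear ?U V' 0 (\<lambda>n u. fst u)"
    and h3: "graded_linear ?U V 0 (\<lambda>n u. snd u - \<beta> n (\<alpha> n (snd u)))"
    and h4: "graded_linear ?U V 0 (\<lambda>n u. snd u)"
    by (rule graded_linearI; auto simp: lin)+
  note zp = zero_prod_def[symmetric]
  note a = maps(1) and b = maps(2) and a' = maps(3) and b' = maps(4) and i = maps(5) and s = maps(6) and q = maps(7) and r = maps(8)
  note X = dg_module_vtens[OF C V H] and Y = dg_module_vtens[OF C V' H'] and Z = dg_module_vtens[OF C U G]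
  have f: "closed_morphism C (vtens V H) (vtens V' H') ?f"
    by (rule vmap_closed[OF C V H V' H' \<alpha> \<psi>]) (simp add: z z' gl_zero[OF \<alpha> V])
  \<comment> \<open>On V' \<otimes> H' the image part enters through its preimage \<beta> v' in V
    and through i, the complementary part through a'. \<open>?A'\<close> does the same on V
    \<otimes> H, with s on the part \<beta>\<alpha> v and a on the kernel part.\<close>
  let ?A = "\<lambda>x n t. vmap ?U G 0 0 (\<lambda>n v'. (0, \<beta> n v')) i x n t + vmap ?U G 0 0 (\<lambda>n v'. (v' - \<alpha> n (\<beta> n v'), 0)) a' x n t"
  let ?A' = "\<lambda>x n t. vmap ?U G 0 (-1) (\<lambda>n v. (0, \<beta> n (\<alpha> n v))) s x n t + vmap ?U G 0 (-1) (\<lambda>n v. (0, v - \<beta> n (\<alpha> n v))) a x n t"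
  \<comment> \<open>In the other direction q and b' recover the two parts of V' \<otimes> H', while
    \<open>?R\<close> recovers the two parts of V \<otimes> H by r and b.\<close>
  let ?Q = "\<lambda>x n t. vmap V' H' 0 0 (\<lambda>n u. \<alpha> n (snd u)) q x n t + vmap V' H' 0 0 (\<lambda>n u. fst u) b' x n t"
  let ?R = "\<lambda>x n t. vmap V H 0 1 (\<lambda>n u. snd u - \<beta> n (\<alpha> n (snd u))) b x n t + vmap V H 0 1 (\<lambda>n u. snd u) r x n t"
  note tA = vmap_tns[OF C V' H' U G g1 closed_graded[OF i]] vmap_tns[OF C V' H' U G g2 closed_graded[OF a']]
  note tA' = vmap_tns[OF C V H U G g3 s] vmap_tns[OF C V H U G g4 a]
  note tQ = vmap_tns[OF C U G V' H' h1 q] vmap_tns[OF C U G V' H' h2 closed_graded[OF b']]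
  note tR = vmap_tns[OF C U G V H h3 b] vmap_tns[OF C U G V H h4 r]
  note tf = vmap_tns[OF C V H V' H' \<alpha> closed_graded[OF \<psi>]]
  have A: "closed_morphism C (vtens V' H') (vtens ?U G) ?A"
    by (rule closed_morphism_add[OF Z]; rule vmap_closed[OF C V' H' U G]) (use g1 g2 i a' in \<open>simp_all add: z z' zU gl_zero[OF \<beta> V'] gl_zero[OF \<alpha> V] zero_prod_def\<close>)
  have A': "graded_map C (vtens V H) (vtens ?U G) (-1) ?A'"
    by (rule graded_add[OF Z]; rule vmap_graded[OF C V H U G]) (use g3 g4 s a in simp_all)
  have Q: "graded_map C (vtens ?U G) (vtens V' H') 0 ?Q"
    by (rule graded_add[OF Y]; rule vmap_graded[OF C U G V' H']) (use h1 h2 q closed_graded[OF b'] in simp_all)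
  have R: "graded_map C (vtens ?U G) (vtens V H) 1 ?R"
    by (rule graded_add[OF X]; rule vmap_graded[OF C U G V H]) (use h3 h4 b r in simp_all)
  have sin: "s x n w \<in> piece (sp G x) m" "a x n w \<in> piece (sp G x) m" if "x \<in> Obj C" "w \<in> piece (sp H x) n" "m = n - 1" for x n m w
    using gm_in[OF s that(1,2)] gm_in[OF a that(1,2)] that(3) by simp_all
  have rin: "r x n g \<in> piece (sp H x) m" "b x n g \<in> piece (sp H x) m" "q x n g \<in> piece (sp H' x) n" if "x \<in> Obj C" "g \<in> piece (sp G x) n" "m = n + 1" for x n m g
    using gm_in[OF r that(1,2)] gm_in[OF b that(1,2)] gm_in[OF q that(1,2)] that(3) by simp_all
  show ?thesis
  proof (rule cone_strict_retract[OF C X Y Z f A A' Q R])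
    fix x n t assume x: "x \<in> Obj C" and "t \<in> piece (sp (vtens V H) x) n"
    then have t: "t \<in> piece (tensor_cpx V (sp H x)) n" by simp
    note cc = V mod_cc[OF H x] V' mod_cc[OF H' x] U mod_cc[OF G x]
    note tn = tns_rules[OF cc(1,2)] tns_rules[OF cc(5,6)]
    from cc(1,2) t show "?A x n (?f x n t) = dif (sp (vtens ?U G) x) (n - 1) (?A' x n t) + ?A' x (n + 1) (dif (sp (vtens V H) x) n t)"
    proof (induction rule: tensor_eqI)
      case (ten p q v w)
      note w = closed_in[OF \<psi> x ten(3)] mod_cc_rules(7)[OF H x ten(3) refl]
      show ?case using ten x w lin(1)
        by (cases "even p") (simp_all add: tf tA tA' vmap_rules tns_dif[OF cc(1,2)] tns_dif[OF cc(5,6)] zU z z' tn \<alpha>in \<beta>in \<alpha>\<beta> lin sin difs(1,3) koszul_def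
          mod_cc_rules[OF G] closed_in[OF i] closed_in[OF a'] zp tensor_dif_rules[OF cc(5,6)] tns_in[OF cc(5,6)])
    qed (simp_all add: vmap_rules tensor_dif_rules[OF cc(1,2)] tensor_dif_rules[OF cc(5,6)] algebra_simps)
  next
    fix x n t assume x: "x \<in> Obj C" and "t \<in> piece (sp (vtens ?U G) x) n"
    then have t: "t \<in> piece (tensor_cpx ?U (sp G x)) n" by simp
    note cc = V mod_cc[OF H x] V' mod_cc[OF H' x] U mod_cc[OF G x]
    note tn = tns_rules[OF cc(1,2)] tns_rules[OF cc(3,4)] tns_rules[OF cc(5,6)]
    from cc(5,6) t show "?Q x (n + 1) (dif (sp (vtens ?U G) x) n t) = dif (sp (vtens V' H') x) n (?Q x n t) + ?f x (n + 1) (?R x n t)"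
    proof (induction rule: tensor_eqI)
      case (ten p q u g)
      then obtain v' v where u: "u = (v', v)" "v' \<in> piece V' p" "v \<in> piece V p" by auto
      show ?case using ten x u rin[OF x ten(3)] closed_in[OF b' x ten(3)] mod_cc_rules(7)[OF G x ten(3) refl]
        by (cases "even p") (simp_all add: tf tQ tR vmap_rules tns_dif[OF cc(5,6)] tns_dif[OF cc(3,4)] zU z z' tn \<alpha>in \<beta>in \<alpha>\<beta> lin difs(2,4) koszul_def
          mod_cc_rules[OF H'] closed_in[OF \<psi>] closed_dif[OF b'] zp tensor_dif_rules[OF cc(3,4)] tns_in[OF cc(3,4)])
    qed (simp_all add: vmap_rules tensor_dif_rules[OF cc(5,6)] tensor_dif_rules[OF cc(3,4)] algebra_simps)
    from cc(5,6) t show "?R x (n + 1) (dif (sp (vtens ?U G) x) n t) = - dif (sp (vtens V H) x) (n + 1) (?R x n t)"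
    proof (induction rule: tensor_eqI)
      case (ten p q u g)
      then obtain v' v where u: "u = (v', v)" "v' \<in> piece V' p" "v \<in> piece V p" by auto
      show ?case using ten x u rin[OF x ten(3)] mod_cc_rules(7)[OF G x ten(3) refl]
        by (cases "even p") (simp_all add: tR vmap_rules tns_dif[OF cc(5,6)] tns_dif[OF cc(1,2)] zU z z' tn \<alpha>in \<beta>in \<alpha>\<beta> lin difs(2,5) koszul_def
          mod_cc_rules[OF H] zp tensor_dif_rules[OF cc(1,2)] tns_in[OF cc(1,2)])
    qed (simp_all add: vmap_rules tensor_dif_rules[OF cc(5,6)] tensor_dif_rules[OF cc(1,2)] algebra_simps)
  next
    fix x n t assume x: "x \<in> Obj C" and "t \<in> piece (sp (vtens V' H') x) n"
    then have t: "t \<in> piece (tensor_cpx V' (sp H' x)) n" by simp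
    note cc = V mod_cc[OF H x] V' mod_cc[OF H' x] U mod_cc[OF G x]
    note tn = tns_rules[OF cc(1,2)] tns_rules[OF cc(3,4)] tns_rules[OF cc(5,6)]
    from cc(3,4) t show "?Q x n (?A x n t) = t"
    proof (induction rule: tensor_eqI)
      case (ten p q v w)
      note w = closed_in[OF i x ten(3)] closed_in[OF a' x ten(3)] on_H'[OF x ten(3)]
      show ?case using ten x w rin[OF x w(1)] rin[OF x w(2)] closed_in[OF b' x w(1)]
        by (simp add: tA tQ vmap_rules tn \<alpha>in \<beta>in \<alpha>\<beta> lin zp)
    qed (simp_all add: vmap_rules algebra_simps)
    from cc(3,4) t show "?R x n (?A x n t) = 0"
    proof (induction rule: tensor_eqI)
      case (ten p q v w)
      note w = closed_in[OF i x ten(3)] closed_in[OF a' x ten(3)] on_H'[OF x ten(3)]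
      show ?case using ten x w rin[OF x w(1)] rin[OF x w(2)]
        by (simp add: tA tR vmap_rules tn \<alpha>in \<beta>in \<alpha>\<beta> lin zp)
    qed (simp_all add: vmap_rules algebra_simps)
  next
    fix x n m t assume x: "x \<in> Obj C" and "t \<in> piece (sp (vtens V H) x) n" and m: "m = n - 1"
    then have t: "t \<in> piece (tensor_cpx V (sp H x)) n" by simp
    note cc = V mod_cc[OF H x] V' mod_cc[OF H' x] U mod_cc[OF G x]
    note tn = tns_rules[OF cc(1,2)] tns_rules[OF cc(3,4)] tns_rules[OF cc(5,6)]
    from cc(1,2) t show "?Q x m (?A' x n t) = 0"
    proof (induction rule: tensor_eqI)
      case (ten p q v w)
      note w = sin[OF x ten(3)] on_H[OF x ten(3)]
      show ?case using ten x w rin[OF x w(1)[OF refl]] rin[OF x w(2)[OF refl]] closed_in[OF b' x w(1)[OF refl]] closed_in[OF b' x w(2)[OF refl]]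
        by (cases "even p") (simp_all add: tA' tQ vmap_rules tn \<alpha>in \<beta>in \<alpha>\<beta> lin koszul_def zp)
    qed (simp_all add: vmap_rules algebra_simps)
    from cc(1,2) t show "?R x m (?A' x n t) = t"
    proof (induction rule: tensor_eqI)
      case (ten p q v w)
      note w = sin[OF x ten(3)] on_H[OF x ten(3)]
      show ?case using ten x w rin[OF x w(1)[OF refl]] rin[OF x w(2)[OF refl]]
        by (cases "even p") (simp_all add: tA' tR vmap_rules tn \<alpha>in \<beta>in \<alpha>\<beta> lin koszul_def zp)
    qed (simp_all add: vmap_rules algebra_simps)
  qed
qed

end

lemma zero_closed:
  assumes "dg_module C N" "hom_complexes C"
  shows "closed_morphism C M N (\<lambda>x n v. 0)"
  by (rule closed_morphismI[OF graded_zero[OF assms]]) (simp add: mod_dif_rules[OF assms(1)])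

text \<open>Cones of zero maps play the part of direct sums, because \<open>perf\<close> is closed
  under cones. An element is a pair of pairs, the first from H' \<oplus> H[1], the second from the
  cone of \<psi>; the inner shift by -1 undoes the shift made by the outer cone.\<close>

lemma cone_splitting_cones:
  assumes C: "hom_complexes C" and H: "dg_module C H" and H': "dg_module C H'" and \<psi>: "closed_morphism C H H' \<psi>"
  shows "cone_splitting C H H' \<psi> (cone (shift_mod (-1) (cone H H' \<psi>)) (cone H H' (\<lambda>x n v. 0)) (\<lambda>x n v. 0))
    (\<lambda>x n w. ((0, w), 0)) (\<lambda>x n g. snd (fst g)) (\<lambda>x n w. ((w, 0), 0)) (\<lambda>x n g. fst (fst g))
    (\<lambda>x n w. (0, (w, 0))) (\<lambda>x n w. (0, (0, w))) (\<lambda>x n g. fst (snd g)) (\<lambda>x n g. snd (snd g))"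
proof (unfold_locales, goal_cases)
  let ?M = "shift_mod (-1) (cone H H' \<psi>)" and ?N = "cone H H' (\<lambda>x n v. 0)"
  note z = zero_closed[OF H' C]
  note N = dg_module_cone[OF H H' z C] and M = dg_module_shift[OF dg_module_cone[OF H H' \<psi> C] C]
  have X: "dg_module C (cone ?M ?N (\<lambda>x n v. 0))" by (rule dg_module_cone[OF M N zero_closed[OF N C] C])
  note rules = mod_cc_rules[OF H] mod_cc_rules[OF H'] mod_dif_rules[OF H] mod_dif_rules[OF H'] scl_zero_right[OF mod_cc[OF H]] scl_zero_right[OF mod_cc[OF H']]
    act_left_rules[OF H] act_left_rules[OF H'] zero_prod_def koszul_def gl_zero[OF closed_gl[OF \<psi>] mod_cc[OF H]]
  {
    case 4
    show ?case by (rule X)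
  next
    case 6
    show ?case by (rule graded_mapI; (rule graded_linearI)?; auto simp: rules)
  next
    case 7
    show ?case by (rule graded_mapI; (rule graded_linearI)?; auto simp: rules algebra_simps)
  next
    case 8
    show ?case by (rule closed_morphismI, rule graded_mapI; (rule graded_linearI)?; auto simp: rules)
  next
    case 9
    show ?case by (rule closed_morphismI, rule graded_mapI; (rule graded_linearI)?; auto simp: rules)
  next
    case 10
    show ?case by (rule closed_morphismI, rule graded_mapI; (rule graded_linearI)?; auto simp: rules)
  next
    case 11
    show ?case by (rule graded_mapI; (rule graded_linearI)?; auto simp: rules)
  next
    case 12
    show ?case by (rule graded_mapI; (rule graded_linearI)?; auto simp: rules)
  next
    case 13
    show ?case by (rule graded_mapI; (rule graded_linearI)?; auto simp: rules algebra_simps)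
  next
    case 14 then show ?case by (auto simp: rules)
  next
    case 15 then show ?case by (auto simp: rules)
  next
    case 16 then show ?case by (auto simp: rules)
  next
    case 17 then show ?case by (auto simp: rules)
  next
    case 18 then show ?case by (auto simp: rules)
  }
qed (use assms in auto)

text \<open>Moves the structure from the iterated cone to an isomorphic module whose carrier lies in
  the universe.\<close>

lemma cone_splitting_iso:
  assumes X: "cone_splitting C H H' \<psi> X a b a' b' i s q r" and iso: "dg_iso C G X f g"
  shows "cone_splitting C H H' \<psi> G (\<lambda>x n w. g x (n - 1) (a x n w)) (\<lambda>x n v. b x n (f x n v)) (\<lambda>x n w. g x n (a' x n w)) (\<lambda>x n v. b' x n (f x n v))
    (\<lambda>x n w. g x n (i x n w)) (\<lambda>x n w. g x (n - 1) (s x n w)) (\<lambda>x n v. q x n (f x n v)) (\<lambda>x n v. r x n (f x n v))"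
proof -
  interpret X: cone_splitting C H H' \<psi> X a b a' b' i s q r by (rule X)
  note d = dg_isoD[OF iso]
  have in1: "a x n w \<in> piece (sp X x) m" "s x n w \<in> piece (sp X x) m" if "x \<in> Obj C" "w \<in> piece (sp H x) n" "m = n - 1" for x n m w
    using gm_in[OF X.maps(1) that(1,2)] gm_in[OF X.maps(6) that(1,2)] that(3) by simp_all
  note rules = closed_in[OF d(3)] closed_in[OF d(4)] closed_dif[OF d(3), symmetric] closed_dif[OF d(4), symmetric] d(5,6) in1 closed_in[OF X.maps(3)] closed_in[OF X.maps(5)]
    closed_in[OF X.\<psi>] mod_cc_rules[OF X.H] mod_cc_rules[OF X.G]
  show ?thesis
  proof (unfold_locales, goal_cases)
    case 6
    show ?case using graded_map_comp[OF X.maps(1) closed_graded[OF d(4)], of "-1"] by simp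
  next
    case 7
    show ?case using graded_map_comp[OF closed_graded[OF d(3)] X.maps(2), of 1] by simp
  next
    case 8
    show ?case by (rule closed_comp[OF X.maps(3) d(4)])
  next
    case 9
    show ?case by (rule closed_comp[OF d(3) X.maps(4)])
  next
    case 10
    show ?case by (rule closed_comp[OF X.maps(5) d(4)])
  next
    case 11
    show ?case using graded_map_comp[OF X.maps(6) closed_graded[OF d(4)], of "-1"] by simp
  next
    case 12
    show ?case using graded_map_comp[OF closed_graded[OF d(3)] X.maps(7), of 0] by simp
  next
    case 13
    show ?case using graded_map_comp[OF closed_graded[OF d(3)] X.maps(8), of 1] by simp
  next
    case (14 x n m w)
    then show ?case using gl_neg[OF closed_gl[OF d(4) 14(1)] mod_cc[OF X.G 14(1)], of "a x (n + 1) (dif (sp H x) n w)" n]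
      by (simp add: rules X.difs)
  next
    case (16 x n m w)
    then show ?case using gl_diff[OF closed_gl[OF d(4) 16(1)] mod_cc[OF X.G 16(1)], of "i x n (\<psi> x n w)" n "s x (n + 1) (dif (sp H x) n w)"]
      by (simp add: rules X.difs)
  next
    case (19 x n m w)
    then show ?case using X.on_H[OF 19(1,2)] by (simp add: rules)
  next
    case (20 x n w)
    then show ?case using X.on_H'[OF 20(1,2)] by (simp add: rules)
  qed (use X.C X.H X.H' d(1) X.\<psi> in \<open>simp_all add: closed_dif[OF d(3)] X.difs closed_in[OF d(3)]\<close>)
qed

lemma perf_cone_splitting:
  fixes H H' :: "('o, 'k::field, 'h::ab_group_add, 'b \<Rightarrow>\<^sub>0 'k) dgmod"
  assumes inf: "infinite (UNIV :: 'b set)" and C: "hom_complexes C" and H: "H \<in> perf C" and H': "H' \<in> perf C" and \<psi>: "closed_morphism C H H' \<psi>"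
  obtains G :: "('o, 'k, 'h, 'b \<Rightarrow>\<^sub>0 'k) dgmod" and a b a' b' i s q r where "G \<in> perf C" "cone_splitting C H H' \<psi> G a b a' b' i s q r"
proof -
  note mH = perf_module[OF H C] and mH' = perf_module[OF H' C]
  note eH = eperf_perf[OF C H] and eH' = eperf_perf[OF C H']
  let ?M = "shift_mod (-1) (cone H H' \<psi>)" and ?N = "cone H H' (\<lambda>x n v. 0)"
  have "eperf TYPE('b) C (cone ?M ?N (\<lambda>x n v. 0))"
    by (rule eperf_cone[OF C inf eperf_shift[OF C eperf_cone[OF C inf eH eH' \<psi>]] eperf_cone[OF C inf eH eH' zero_closed[OF mH' C]]
        zero_closed[OF dg_module_cone[OF mH mH' zero_closed[OF mH' C] C] C]])
  then obtain G :: "('o, 'k, 'h, 'b \<Rightarrow>\<^sub>0 'k) dgmod" and f g where G: "G \<in> perf C" "dg_iso C G (cone ?M ?N (\<lambda>x n v. 0)) f g"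
    unfolding eperf_def by blast
  from G(1) cone_splitting_iso[OF cone_splitting_cones[OF C mH mH' \<psi>] G(2)] show ?thesis by (rule that)
qed

section \<open>Tensoring with a complex with zero differential\<close>

lemma dsum_tuple_closed:
  assumes h: "\<And>j. closed_morphism C M (N j) (h j)"
    and fin: "\<And>x n v. x \<in> Obj C \<Longrightarrow> v \<in> piece (sp M x) n \<Longrightarrow> finite {j. h j x n v \<noteq> 0}"
  shows "closed_morphism C M (dsum_mod N) (\<lambda>x n v j. h j x n v)"
  by (rule closed_morphismI, rule graded_mapI, rule graded_linearI)
    (simp_all add: fin closed_in[OF h] closed_add[OF h] closed_scl[OF h] closed_act[OF h] closed_dif[OF h] fun_eq_iff)

lemma tns_sum:
  assumes "cochain_complex V" "cochain_complex W" "w \<in> piece W q"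
  shows "finite S \<Longrightarrow> (\<And>b. b \<in> S \<Longrightarrow> f b \<in> piece V p) \<Longrightarrow>
    sum f S \<in> piece V p \<and> tns V W p q (sum f S) w = (\<Sum>b\<in>S. tns V W p q (f b) w)"
  by (induction S rule: finite_induct) (simp_all add: tns_rules[OF assms(1,2)] assms(3) cc_rules[OF assms(1)])

context
  fixes C :: "('o, 'k::field, 'h::ab_group_add) dgcat" and U :: "('k, 'u::ab_group_add) cpx" and G :: "('o, 'k, 'h, 'g::ab_group_add) dgmod"
  assumes C: "hom_complexes C" and U: "cochain_complex U" and z: "\<And>n u. dif U n u = 0" and G: "dg_module C G"
begin

text \<open>As u is a cycle, only u \<otimes> dg remains in the differential, with the sign (-1)^p;
  the shift by -p contributes the same sign.\<close>

lemma element_closed: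
  assumes u: "u \<in> piece U p"
  shows "closed_morphism C (shift_mod (- p) G) (vtens U G) (\<lambda>x n g. tns U (sp G x) p (n - p) u g)"
proof (rule closed_morphismI, rule graded_mapI, rule graded_linearI, goal_cases)
  case (4 x y m n g a)
  have e: "m + n - p = m - p + n" by simp
  show ?case using 4 u by (simp add: vtens_act_tns[OF C U G] e)
next
  case (5 x n g)
  note cc = U mod_cc[OF G 5(1)]
  have e: "n + 1 - p = n - p + 1" by simp
  show ?case using 5 u by (simp add: tns_dif[OF cc] z tns_rules[OF cc] mod_cc_rules[OF G] koszul_def e)
qed (use u in \<open>simp_all add: tns_in[OF U mod_cc[OF G]] tns_rules[OF U mod_cc[OF G]]\<close>)

text \<open>Contraction with a functional c on the piece of degree p, zero on the other degrees.
  Pieces may overlap, so the degree recorded in the generator decides.\<close>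

definition functional_map :: "int \<Rightarrow> ('u \<Rightarrow> 'k) \<Rightarrow> 'o \<Rightarrow> int \<Rightarrow> (unit, 'u, 'g, 'k) formal \<Rightarrow> 'g" where
  "functional_map p c x n = lin_ext (scl (sp G x)) (\<lambda>(_, r, q, u, g). if r = p then scl (sp G x) (c u) g else 0)"

lemma functional_map_rules:
  assumes x: "x \<in> Obj C"
  shows "functional_map p c x n (s + t) = functional_map p c x n s + functional_map p c x n t"
    "functional_map p c x n 0 = 0" "functional_map p c x n (fscale k t) = scl (sp G x) k (functional_map p c x n t)"
    "functional_map p c x n (koszul j t) = koszul j (functional_map p c x n t)"
  using lin_ext_rules[OF cc_vector_space[OF mod_cc[OF G x]]] by (simp_all add: functional_map_def)

context
  fixes p :: int and c
  assumes c_add: "\<And>u v. u \<in> piece U p \<Longrightarrow> v \<in> piece U p \<Longrightarrow> c (u + v) = c u + c v"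
    and c_scl: "\<And>k u. u \<in> piece U p \<Longrightarrow> c (scl U k u) = k * c u"
begin

lemma functional_map_tns:
  assumes x: "x \<in> Obj C" and "u \<in> piece U r" "g \<in> piece (sp G x) q"
  shows "functional_map p c x n (tns U (sp G x) r q u g) = (if r = p then scl (sp G x) (c u) g else 0)"
proof -
  interpret vector_space "scl (sp G x)" by (rule cc_vector_space[OF mod_cc[OF G x]])
  have "bilin U (sp G x) (scl (sp G x)) (\<lambda>r q u g. if r = p then scl (sp G x) (c u) g else 0)"
    by (rule bilinear_onI) (auto simp: c_add c_scl scale_left_distrib scale_right_distrib mult.commute)
  from tns_lift[OF U mod_cc[OF G x] vector_space_axioms this] assms show ?thesis
    by (simp add: functional_map_def)
qed

lemma functional_map_in:
  assumes x: "x \<in> Obj C" and t: "t \<in> piece (tensor_cpx U (sp G x)) n"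
  shows "functional_map p c x m t \<in> piece (sp G x) (n - p)"
  using U mod_cc[OF G x] t
proof (induction rule: tensor_induct)
  case (ten r q u g)
  then show ?case using x by (auto simp: functional_map_tns mod_cc_rules[OF G])
qed (use x in \<open>simp_all add: functional_map_rules mod_cc_rules[OF G]\<close>)

lemma functional_map_closed: "closed_morphism C (vtens U G) (shift_mod (- p) G) (functional_map p c)"
proof (rule closed_morphismI, rule graded_mapI, rule graded_linearI, goal_cases)
  case (4 x y m n t a)
  from 4 have t: "t \<in> piece (tensor_cpx U (sp G y)) m" by simp
  have "functional_map p c x (m + n) (tensor_map U (sp G x) 0 n (\<lambda>p v. v) (\<lambda>q w. act G x y q n w a) t)
    = act G x y (m - p) n (functional_map p c y m t) a"
    using U mod_cc[OF G 4(2)] t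
  proof (induction rule: tensor_induct)
    case (ten r q u g)
    then show ?case using 4
      by (auto simp: vtens_act_tns[OF C U G] functional_map_tns act_in[OF G] act_left_rules[OF G])
  next
    case (add s t)
    then show ?case using 4
      by (simp add: tensor_map_rules functional_map_rules functional_map_in act_left_rules[OF G])
  qed (use 4 in \<open>simp_all add: tensor_map_rules functional_map_rules act_left_rules[OF G]\<close>)
  then show ?case by simp
next
  case (5 x n t)
  note cc = U mod_cc[OF G 5(1)]
  from 5 have t: "t \<in> piece (tensor_cpx U (sp G x)) n" by simp
  have "functional_map p c x (n + 1) (dif (tensor_cpx U (sp G x)) n t) = koszul p (dif (sp G x) (n - p) (functional_map p c x n t))"
    using cc t
  proof (induction rule: tensor_induct)
    case (ten r q u g)
    then show ?case using 5
      by (simp add: tns_dif[OF cc] z tns_rules[OF cc] mod_cc_rules[OF G] functional_map_tns functional_map_rules mod_dif_rules[OF G])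
  next
    case (add s t)
    then show ?case using 5
      by (simp add: tensor_dif_rules[OF cc] functional_map_rules functional_map_in mod_dif_rules[OF G] koszul_add)
  qed (use 5 in \<open>simp_all add: tensor_dif_rules[OF cc] functional_map_rules mod_dif_rules[OF G]\<close>)
  then show ?case by (simp add: koszul_def)
qed (simp_all add: functional_map_in functional_map_rules)

end

lemma zero_dif_retract:
  assumes inf: "infinite (UNIV :: 'b set)" and s: "small_dim TYPE('b) U"
  obtains k :: "'b \<Rightarrow> int" where "homotopy_retract C (vtens U G) (dsum_mod (\<lambda>j. shift_mod (k j) G))"
proof -
  interpret u: vector_space "scl U" by (rule cc_vector_space[OF U])
  obtain B where B: "\<And>n. B n \<subseteq> piece U n" "\<And>n. u.independent (B n)" "\<And>n. u.span (B n) = piece U n" "\<And>n. B n \<lesssim> (UNIV :: 'b set)"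
    by (rule small_dim_basis[OF U s]) blast
  \<comment> \<open>The disjoint union of the bases of all degrees; tagging by the degree is needed
    as the pieces may overlap.\<close>
  let ?S = "\<Union>p\<in>UNIV. Pair p ` B p"
  have "?S \<lesssim> (UNIV :: 'b set)"
    by (rule lepoll_UNIV_UN[OF inf lepoll_UNIV_int[OF inf]]) (rule lepoll_image[OF B(4)])
  then obtain e :: "int \<times> 'u \<Rightarrow> 'b" where e: "inj_on e ?S" unfolding lepoll_def by blast
  define deg where "deg j = fst (inv_into ?S e j)" for j
  \<comment> \<open>An index that names no basis vector gets the element 0, the functional 0 and
    some unspecified degree.\<close>
  define el where "el j = (if j \<in> e ` ?S then snd (inv_into ?S e j) else 0)" for j
  define c where "c j u = (if j \<in> e ` ?S then u.representation (B (deg j)) u (el j) else 0)" for j u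
  have e_deg: "deg (e (p, b)) = p" "el (e (p, b)) = b" "e (p, b) \<in> e ` ?S" if "b \<in> B p" for p b
  proof -
    have m: "(p, b) \<in> ?S" using that by blast
    show "deg (e (p, b)) = p" "el (e (p, b)) = b" "e (p, b) \<in> e ` ?S"
      using inv_into_f_f[OF e m] m by (simp_all add: deg_def el_def)
  qed
  have el: "el j \<in> piece U (deg j)" for j
  proof (cases "j \<in> e ` ?S")
    case True
    then obtain p b where "b \<in> B p" "j = e (p, b)" by blast
    then show ?thesis using e_deg[of b p] subsetD[OF B(1), of b p] by simp
  qed (simp add: el_def cc_zero[OF U])
  have c_add: "c j (u + v) = c j u + c j v" if "u \<in> piece U (deg j)" "v \<in> piece U (deg j)" for j u v
    using that unfolding c_def by (simp add: u.representation_add[OF B(2)] B(3))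
  have c_scl: "c j (scl U k u) = k * c j u" if "u \<in> piece U (deg j)" for j k u
    using that unfolding c_def by (simp add: u.representation_scale[OF B(2)] B(3))
  \<comment> \<open>The indices of the basis vectors that occur in u; outside this finite set every
    component of u \<otimes> g vanishes.\<close>
  let ?J = "\<lambda>p u. (\<lambda>b. e (p, b)) ` {b. u.representation (B p) u b \<noteq> 0}"
  let ?M = "\<lambda>j. shift_mod (- deg j) G" and ?h = "\<lambda>j. functional_map (deg j) (c j)"
  let ?t = "\<lambda>j x n. tns U (sp G x) (deg j) (n - deg j) (el j)"
  have k: "closed_morphism C (vtens U G) (?M j) (?h j)" for j
    by (rule functional_map_closed[OF c_add c_scl])
  have ktns: "?h j x n (tns U (sp G x) r q u g) = (if r = deg j then scl (sp G x) (c j u) g else 0)"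
    if "x \<in> Obj C" "u \<in> piece U r" "g \<in> piece (sp G x) q" for j x n r q u g
    by (rule functional_map_tns[OF c_add c_scl that])
  have finJ: "finite (?J p u)" for p u by (rule finite_imageI[OF u.finite_representation])
  have outJ: "?h j x n (tns U (sp G x) p q u g) = 0" if "x \<in> Obj C" "u \<in> piece U p" "g \<in> piece (sp G x) q" "j \<notin> ?J p u" for j x n p q u g
  proof -
    interpret g: vector_space "scl (sp G x)" by (rule cc_vector_space[OF mod_cc[OF G that(1)]])
    have "c j u = 0" if "p = deg j"
    proof (rule ccontr)
      assume "c j u \<noteq> 0"
      then have j: "j \<in> e ` ?S" "u.representation (B p) u (el j) \<noteq> 0" by (auto simp: c_def that split: if_splits)
      then have "j = e (p, el j)" using u.representation_ne_zero[OF j(2)] e_deg by (auto simp: that)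
      then show False using j(2) \<open>j \<notin> ?J p u\<close> by blast
    qed
    then show ?thesis using that by (simp add: ktns)
  qed
  have fin: "finite {j. ?h j x n t \<noteq> 0}" if x: "x \<in> Obj C" and "t \<in> piece (sp (vtens U G) x) n" for x n t
  proof -
    from that have t: "t \<in> piece (tensor_cpx U (sp G x)) n" by simp
    from U mod_cc[OF G x] t show ?thesis
    proof (induction rule: tensor_induct)
      case (ten p q u g)
      show ?case by (rule finite_subset[OF _ finJ[of p u]]) (use outJ[OF x ten(2,3)] in blast)
    next
      case (add s t)
      then show ?case using finite_support_add by (simp add: functional_map_rules x)
    qed (simp add: functional_map_rules x)
  qed
  have I: "closed_morphism C (vtens U G) (dsum_mod ?M) (\<lambda>x n t j. ?h j x n t)" by (rule dsum_tuple_closed[OF k fin])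
  have mM: "dg_module C (?M j)" for j by (rule dg_module_shift[OF G C])
  note Z = dg_module_vtens[OF C U G]
  have tc: "closed_morphism C (?M j) (vtens U G) (?t j)" for j by (rule element_closed[OF el])
  have P: "closed_morphism C (dsum_mod ?M) (vtens U G) (dsum_map ?t)" by (rule dsum_map_closed[OF C mM Z tc])
  show ?thesis
  proof (rule that, rule strict_retract[OF C Z dg_module_dsum[OF mM C] I P])
    fix x n t assume x: "x \<in> Obj C" and "t \<in> piece (sp (vtens U G) x) n"
    then have t: "t \<in> piece (tensor_cpx U (sp G x)) n" by simp
    note cc = U mod_cc[OF G x]
    have Iin: "(\<lambda>j. ?h j x n t) \<in> piece (sp (dsum_mod ?M) x) n" if "t \<in> piece (tensor_cpx U (sp G x)) n" for t
      by (rule closed_in[OF I x]) (use that in simp)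
    from cc t show "dsum_map ?t x n (\<lambda>j. ?h j x n t) = t"
    proof (induction rule: tensor_eqI)
      case (ten p q u g)
      let ?R = "u.representation (B p) u"
      have inB: "b \<in> B p" if "?R b \<noteq> 0" for b using u.representation_ne_zero[OF that] .
      have su: "(\<Sum>b | ?R b \<noteq> 0. scl U (?R b) b) = u"
        by (rule u.sum_nonzero_representation_eq[OF B(2)]) (use ten B(3) in simp)
      have "dsum_map ?t x n (\<lambda>j. ?h j x n (tns U (sp G x) p q u g)) = (\<Sum>j\<in>?J p u. ?t j x n (?h j x n (tns U (sp G x) p q u g)))"
        by (rule dsum_map_superset[OF C mM Z closed_graded[OF tc] x finJ outJ[OF x ten(2,3)]])
      also have "\<dots> = (\<Sum>b | ?R b \<noteq> 0. ?t (e (p, b)) x n (?h (e (p, b)) x n (tns U (sp G x) p q u g)))"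
        by (rule sum.reindex[unfolded comp_def]) (rule inj_on_inverseI[where g = el], simp add: e_deg(2) inB)
      also have "\<dots> = (\<Sum>b | ?R b \<noteq> 0. tns U (sp G x) p q (scl U (?R b) b) g)"
      proof (rule sum.cong[OF refl], clarify)
        fix b assume "?R b \<noteq> 0"
        then have b: "b \<in> B p" by (rule inB)
        have "b \<in> piece U p" using b B(1) by blast
        then show "?t (e (p, b)) x n (?h (e (p, b)) x n (tns U (sp G x) p q u g)) = tns U (sp G x) p q (scl U (?R b) b) g"
          unfolding ktns[OF x ten(2,3)] using ten x e_deg[OF b] by (simp add: c_def tns_rules[OF cc])
      qed
      also have "\<dots> = tns U (sp G x) p q (\<Sum>b | ?R b \<noteq> 0. scl U (?R b) b) g"
        by (rule tns_sum[OF cc ten(3) u.finite_representation, THEN conjunct2, symmetric]) (use inB B(1) in \<open>auto intro!: cc_scl[OF U]\<close>)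
      finally show ?case unfolding su .
    next
      case (left s t)
      have "(\<lambda>j. ?h j x n (s + t)) = (\<lambda>j. ?h j x n s) + (\<lambda>j. ?h j x n t)" by (simp add: fun_eq_iff functional_map_rules x)
      then show ?case using closed_add[OF P x Iin[OF left(1)] Iin[OF left(2)]] by simp
    qed simp
  qed
qed

end

section \<open>The cone of a product morphism\<close>

lemma universe_small_dim:
  assumes "universe_for TYPE('b) C" "dg_category C" "x \<in> Obj C" "y \<in> Obj C"
  shows "small_dim TYPE('b) (Hom C x y)"
  unfolding small_dim_def
proof
  fix n
  interpret vector_space "scl (Hom C x y)" by (rule cc_vector_space[OF hom_cc[OF dg_category_hom_complexes[OF assms(2)] assms(3,4)]])
  show "\<exists>S\<subseteq>piece (Hom C x y) n. S \<lesssim> (UNIV :: 'b set) \<and> piece (Hom C x y) n \<subseteq> span S"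
    using assms span_superset unfolding universe_for_def by blast
qed

text \<open>Membership in \<open>ads\<close> under sums and summands requires derived objects. The
  sum of shifts is h-projective since G is perfect, and so is its retract N; a small model of the
  sum stands in for it, as \<open>ads\<close> has a fixed carrier.\<close>

lemma ads_dsum_shift:
  fixes G :: "('o, 'k::field, 'h::ab_group_add, 'b \<Rightarrow>\<^sub>0 'k) dgmod"
  assumes C: "dg_category C" and inf: "infinite (UNIV :: 'b set)" and G: "G \<in> perf C"
    and N: "small_module C N" and ret: "homotopy_retract C N (dsum_mod (\<lambda>j :: 'b. shift_mod (k j) G))"
  shows "N \<in> ads C G"
proof -
  note HC = dg_category_hom_complexes[OF C]
  note mG = perf_module[OF G HC] and sG = perf_small[OF G HC]
  let ?D = "dsum_mod (\<lambda>j :: 'b. shift_mod (k j) G)"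
  have mS: "dg_module C (shift_mod (k j) G)" for j by (rule dg_module_shift[OF mG HC])
  note mD = dg_module_dsum[of C "\<lambda>j. shift_mod (k j) G", OF mS HC]
  have "G \<in> ads C G" by (rule ads.self) (simp add: derived_object_iff sG perf_hproj[OF C G])
  then have S: "shift_mod (k j) G \<in> ads C G" for j by (rule ads.shift)
  have hD: "hproj TYPE('b) C ?D" by (rule hproj_dsum[OF HC mS hproj_shift[OF HC mG perf_hproj[OF C G]]])
  have "small_dim TYPE('b) (sp ?D x)" if x: "x \<in> Obj C" for x
    unfolding dsum_mod_simps
    by (rule small_dim_dsum[OF inf mod_cc[OF mS x]]) (use small_dim_shift[OF small_module_dim[OF inf sG x]] in simp)
  then obtain D' :: "('o, 'k, 'h, 'b \<Rightarrow>\<^sub>0 'k) dgmod" and f g where D': "small_module C D'" "dg_iso C D' ?D f g"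
    using small_model[OF mD HC] by blast
  have "derived_object C D'"
    using D'(1) hproj_retract[OF iso_retract[OF HC D'(2)] hD] by (simp add: derived_object_iff)
  then have "D' \<in> ads C G" by (rule ads.dsum[OF S _ iso_equivalent[OF HC D'(2)]])
  moreover have "derived_object C N" using N hproj_retract[OF ret hD] by (simp add: derived_object_iff)
  ultimately show ?thesis
    by (rule ads.summand[OF _ _ retract_trans[OF ret iso_retract[OF HC dg_iso_sym[OF D'(2)]]]])
qed

text \<open>Three reductions compose: to zero differentials, to a complex tensored with G, and by a
  basis to shifts of G. The shifts k depend on V and V', whereas G does not.\<close>

lemma (in cone_splitting) vtens_cone_retract:
  fixes V :: "('k, 'v::ab_group_add) cpx" and V' :: "('k, 'v'::ab_group_add) cpx"
  assumes inf: "infinite (UNIV :: 'b set)" and V: "cochain_complex V" and V': "cochain_complex V'"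
    and sV: "small_dim TYPE('b) V" and sV': "small_dim TYPE('b) V'"
    and \<alpha>: "graded_linear V V' 0 \<alpha>" and \<alpha>d: "\<And>n m v. v \<in> piece V n \<Longrightarrow> m = n + 1 \<Longrightarrow> \<alpha> m (dif V n v) = dif V' n (\<alpha> n v)"
  obtains k :: "'b \<Rightarrow> int" where
    "homotopy_retract C (cone (vtens V H) (vtens V' H') (vmap V' H' 0 0 \<alpha> \<psi>)) (dsum_mod (\<lambda>j. shift_mod (k j) G))"
proof -
  let ?W = "zdif V" and ?W' = "zdif V'"
  let ?U = "cone_cpx (shift_cpx (-1) ?W) ?W' (\<lambda>n v. 0)"
  note W = cochain_complex_zdif[OF V] and W' = cochain_complex_zdif[OF V']
  note Ws = cochain_complex_shift[OF W, of "-1"]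
  obtain \<alpha>' where \<alpha>': "graded_linear ?W ?W' 0 \<alpha>'"
    and ret: "homotopy_retract C (cone (vtens V H) (vtens V' H') (vmap V' H' 0 0 \<alpha> \<psi>)) (cone (vtens ?W H) (vtens ?W' H') (vmap ?W' H' 0 0 \<alpha>' \<psi>))"
    by (rule cohomology_retract[OF C V V' H H' \<alpha> \<psi> \<alpha>d])
  have "small_dim TYPE('b) ?W" "small_dim TYPE('b) ?W'" using sV sV' by (simp_all add: small_dim_def)
  then have sU: "small_dim TYPE('b) ?U" by (intro small_dim_cone[OF inf Ws W'] small_dim_shift)
  have U: "cochain_complex ?U"
    by (rule cochain_complex_cone[OF Ws W' graded_linearI]) (simp_all add: cc_zero[OF V'] scl_zero_right[OF V'])
  have zU: "dif ?U n u = 0" for n u by (cases u) (simp add: zero_prod_def)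
  obtain k :: "'b \<Rightarrow> int" where "homotopy_retract C (vtens ?U G) (dsum_mod (\<lambda>j. shift_mod (k j) G))"
    by (rule zero_dif_retract[OF C U zU G inf sU])
  from retract_trans[OF retract_trans[OF ret cone_retract[OF W W' zdif_simps(3) zdif_simps(3) \<alpha>']] this] show ?thesis by (rule that)
qed

theorem lemma3p4:
  fixes C :: "('o, 'k::field, 'h::ab_group_add) dgcat"
    and G1 G1' G2 G2' :: "('o, 'k, 'h, 'b \<Rightarrow>\<^sub>0 'k) dgmod"
    and \<phi>1 \<phi>2 :: "'o \<Rightarrow> int \<Rightarrow> ('b \<Rightarrow>\<^sub>0 'k) \<Rightarrow> ('b \<Rightarrow>\<^sub>0 'k)"
  assumes "dg_category C"
    and "universe_for TYPE('b) C"
    and "G1 \<in> perf (op_cat C)" and "G1' \<in> perf (op_cat C)"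
    and "G2 \<in> perf C" and "G2' \<in> perf C"
    and "closed_morphism (op_cat C) G1 G1' \<phi>1"
    and "closed_morphism C G2 G2' \<phi>2"
  shows "weakly_product_bimodule TYPE('b) C
           (cone (ext_prod G1 G2) (ext_prod G1' G2') (ext_prod_map G1' G2' \<phi>1 \<phi>2))"
proof -
  note C = assms(1) and univ = assms(2) and p1 = assms(3) and p1' = assms(4) and p2 = assms(5) and p2' = assms(6)
    and \<phi>1 = assms(7) and \<phi>2 = assms(8)
  note Cop = dg_category_op[OF C]
  note HC = dg_category_hom_complexes[OF C] and Hop = dg_category_hom_complexes[OF Cop] and HE = dg_category_env_hom[OF C]
  note m1 = perf_module[OF p1 Hop] and m1' = perf_module[OF p1' Hop] and m2 = perf_module[OF p2 HC] and m2' = perf_module[OF p2' HC]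
  have inf: "infinite (UNIV :: 'b set)" and obj: "Obj C \<lesssim> (UNIV :: 'b set)" using univ by (simp_all add: universe_for_def)
  note sH = universe_small_dim[OF univ C]
  have sHop: "small_dim TYPE('b) (Hom (op_cat C) x y)" if "x \<in> Obj (op_cat C)" "y \<in> Obj (op_cat C)" for x y
    using sH that by simp
  let ?\<Phi> = "ext_map G1' G2' 0 0 \<phi>1 \<phi>2"
  let ?K = "cone (ext_prod G1 G2) (ext_prod G1' G2') ?\<Phi>"
  note \<Phi> = ext_map_closed[OF Cop C m1 m2 m1' m2' \<phi>1 \<phi>2]
  have "eperf TYPE('b) (env_cat C) ?K"
    by (rule eperf_cone[OF HE inf eperf_ext_prod[OF Cop C inf sHop sH p1 p2] eperf_ext_prod[OF Cop C inf sHop sH p1' p2'] \<Phi>])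
  then obtain K' :: "('o, 'k, 'h, 'b \<Rightarrow>\<^sub>0 'k) dgbimod" and f g where K': "K' \<in> perf (env_cat C)" "dg_iso (env_cat C) K' ?K f g"
    unfolding eperf_def by blast
  \<comment> \<open>G is fixed before F appears: it depends only on \<phi>2, its source and its
    target.\<close>
  obtain G :: "('o, 'k, 'h, 'b \<Rightarrow>\<^sub>0 'k) dgmod" and a b a' b' i s q r where G: "G \<in> perf C"
    and split: "cone_splitting C G2 G2' \<phi>2 G a b a' b' i s q r"
    by (rule perf_cone_splitting[OF inf HC p2 p2' \<phi>2])
  have "\<exists>N\<in>ads C G. homotopy_equivalent C (convolution C ?K F) N" if F: "F \<in> perf C" for F :: "('o, 'k, 'h, 'b \<Rightarrow>\<^sub>0 'k) dgmod"
  proof -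
    note mF = perf_module[OF F HC] and mK = dg_module_cone[OF dg_module_ext_prod[OF Cop C m1 m2] dg_module_ext_prod[OF Cop C m1' m2'] \<Phi> HE]
    have s1: "small_dim TYPE('b) (sp M x)" if "M \<in> perf (op_cat C)" "x \<in> Obj C" for M :: "('o, 'k, 'h, 'b \<Rightarrow>\<^sub>0 'k) dgmod" and x
      using small_module_dim[OF inf perf_small[OF that(1) Hop]] that(2) by simp
    have s2: "small_dim TYPE('b) (sp M x)" if "M \<in> perf C" "x \<in> Obj C" for M :: "('o, 'k, 'h, 'b \<Rightarrow>\<^sub>0 'k) dgmod" and x
      using small_module_dim[OF inf perf_small[OF that(1) HC] that(2)] .
    have cc1: "cochain_complex (sp M x)" if "dg_module (op_cat C) M" "x \<in> Obj C" for M :: "('o, 'k, 'h, 'b \<Rightarrow>\<^sub>0 'k) dgmod" and x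
      using mod_cc[OF that(1)] that(2) by simp
    \<comment> \<open>Bounded dimension gives the convolution a model N with values in the universe,
      the form in which membership in \<open>ads\<close> can be stated.\<close>
    have "small_dim TYPE('b) (sp (convolution C ?K F) y)" if y: "y \<in> Obj C" for y
      unfolding convolution_sp
    proof (rule tensor_data.small_dim_T[OF convolution_data[OF C mK mF y] inf obj])
      fix x assume x: "x \<in> Obj C"
      show "small_dim TYPE('b) (sp F x)" by (rule s2[OF F x])
      have "small_dim TYPE('b) (cone_cpx (tensor_cpx (sp G1 x) (sp G2 y)) (tensor_cpx (sp G1' x) (sp G2' y)) (?\<Phi> (x, y)))"
        by (intro small_dim_cone[OF inf] cochain_complex_tensor small_dim_tensor[OF inf] cc1 mod_cc[OF m2] mod_cc[OF m2'] s1 s2 m1 m1' p1 p1' p2 p2' x y)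
      then show "small_dim TYPE('b) (sp ?K (x, y))" by simp
    qed
    then obtain N :: "('o, 'k, 'h, 'b \<Rightarrow>\<^sub>0 'k) dgmod" and f g where N: "small_module C N" "dg_iso C N (convolution C ?K F) f g"
      using small_model[OF dg_module_convolution[OF C mK mF] HC] by blast
    have sB: "small_dim TYPE('b) (btens C M F)" if "M \<in> perf (op_cat C)" for M :: "('o, 'k, 'h, 'b \<Rightarrow>\<^sub>0 'k) dgmod"
      unfolding btens_def
      by (rule tensor_data.small_dim_T[OF btens_data[OF C perf_module[OF that Hop] mF] inf obj s1[OF that] s2[OF F]])
    let ?V = "btens C G1 F" and ?V' = "btens C G1' F"
    obtain u v where uv: "dg_iso C (convolution C ?K F) (cone (vtens ?V G2) (vtens ?V' G2') (vmap ?V' G2' 0 0 (btens_map C G1' F \<phi>1) \<phi>2)) u v"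
      by (rule conv_cone_iso[OF C m1 m1' mF \<phi>1 m2 m2' \<phi>2])
    obtain k :: "'b \<Rightarrow> int" where k: "homotopy_retract C (cone (vtens ?V G2) (vtens ?V' G2') (vmap ?V' G2' 0 0 (btens_map C G1' F \<phi>1) \<phi>2))
        (dsum_mod (\<lambda>j. shift_mod (k j) G))"
      by (rule cone_splitting.vtens_cone_retract[OF split inf btens_cc[OF C m1 mF] btens_cc[OF C m1' mF] sB[OF p1] sB[OF p1']
          btens_map_gl[OF C m1 m1' mF \<phi>1] btens_map_dif[OF C m1 m1' mF \<phi>1]])
    have "N \<in> ads C G"
      by (rule ads_dsum_shift[OF C inf G N(1) retract_trans[OF iso_retract[OF HC dg_iso_trans[OF N(2) uv]] k]])
    then show ?thesis using iso_equivalent[OF HC dg_iso_sym[OF N(2)]] by blast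
  qed
  then show ?thesis
    unfolding weakly_product_bimodule_def ext_prod_map_eq using K'(1) iso_equivalent[OF HE dg_iso_sym[OF K'(2)]] G by blast
qed

end
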